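(* Let $m>1$, $p$, $\sigma_1$, $\sigma_2$ be such that $$-2<\sigma_2<\sigma_1,\qquad 1\le p<p_c(\sigma_1,\sigma_2):=m-\frac{(m-1)(\sigma_2+2)}{\sigma_1+2},$$ in dimension $N\ge2$, adding the restrictions $\sigma_1\ge0$, $\sigma_2>-1$ in dimension $N=1$. Let $L(\sigma_1,\sigma_2)=\sigma_2(m-1)+2(p-1)-\sigma_1(m-p)$. Then there exists a unique self-similar solution to $$|x|^{\sigma_1}\partial_tu=\Delta u^m+|x|^{\sigma_2}u^p$$ in forward form $u(x,t)=t^{\alpha}f(|x|t^{-\beta})$, $(x,t)\in\mathbb{R}^N\times(0,\infty)$, where $$\alpha=-\frac{\sigma_2+2}{L(\sigma_1,\sigma_2)},\qquad \beta=-\frac{m-p}{L(\sigma_1,\sigma_2)},$$ such that its profile $f(\xi)$, with $\xi=|x|(\theta^2t)^{-\beta}$, $\theta=(\sigma_1+2)/2$, has the following local behavior at the origin $$f(\xi)\sim\left[D-\frac{m-p}{m(N+\sigma_2)(2+\sigma_2)}\xi^{\sigma_2+2}\right]^{1/(m-p)},\qquad\text{as }\xi\to0,$$ where $D>0$ is a constant depending on $\sigma_1$ and $\sigma_2$, and is compactly supported at some $\xi_0\in(0,\infty)$ with $$f(\xi)>0\ \text{for}\ \xi\in(0,\xi_0),\qquad f(\xi_0)=0,\qquad (f^m)'(\xi_0)=0.$$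
   Context: The equation is posed in $\mathbb{R}^N\times(0,\infty)$. The function $f$ is the self-similar profile. The conditions on the exponents imply $L(\sigma_1,\sigma_2)<0$. *)

theory Defs
  imports "HOL-Analysis.Analysis" "HOL-Library.Landau_Symbols"
begin

subsection \<open>Exponents\<close>

definition p_crit :: "real \<Rightarrow> real \<Rightarrow> real \<Rightarrow> real" where
  "p_crit m \<sigma>1 \<sigma>2 = m - (m - 1) * (\<sigma>2 + 2) / (\<sigma>1 + 2)"

definition L_exp :: "real \<Rightarrow> real \<Rightarrow> real \<Rightarrow> real \<Rightarrow> real" where
  "L_exp m p \<sigma>1 \<sigma>2 = \<sigma>2 * (m - 1) + 2 * (p - 1) - \<sigma>1 * (m - p)"

definition alpha_exp :: "real \<Rightarrow> real \<Rightarrow> real \<Rightarrow> real \<Rightarrow> real" where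
  "alpha_exp m p \<sigma>1 \<sigma>2 = - (\<sigma>2 + 2) / L_exp m p \<sigma>1 \<sigma>2"

definition beta_exp :: "real \<Rightarrow> real \<Rightarrow> real \<Rightarrow> real \<Rightarrow> real" where
  "beta_exp m p \<sigma>1 \<sigma>2 = - (m - p) / L_exp m p \<sigma>1 \<sigma>2"

definition theta :: "real \<Rightarrow> real" where
  "theta \<sigma>1 = (\<sigma>1 + 2) / 2"

subsection \<open>Weak solutions\<close>

definition partial_deriv :: "'a::euclidean_space \<Rightarrow> ('a \<Rightarrow> real) \<Rightarrow> 'a \<Rightarrow> real" where
  "partial_deriv b g z = deriv (\<lambda>s. g (z + s *\<^sub>R b)) 0"

text \<open>Smoothness is expressed by existence and continuity of all iterated partial derivatives;
  the list \<open>bs\<close> is the sequence of coordinate directions in which one differentiates.\<close>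

definition C_infinity :: "('a::euclidean_space \<Rightarrow> real) \<Rightarrow> bool" where
  "C_infinity g \<longleftrightarrow>
     (\<forall>bs. set bs \<subseteq> Basis \<longrightarrow>
        continuous_on UNIV (fold partial_deriv bs g) \<and>
        (\<forall>b\<in>Basis. \<forall>z. (\<lambda>s. fold partial_deriv bs g (z + s *\<^sub>R b)) differentiable (at 0)))"

definition test_function :: "((real^'n) \<times> real \<Rightarrow> real) \<Rightarrow> bool" where
  "test_function \<phi> \<longleftrightarrow> C_infinity \<phi> \<and>
     (\<exists>K. compact K \<and> K \<subseteq> UNIV \<times> {0<..} \<and> (\<forall>z. z \<notin> K \<longrightarrow> \<phi> z = 0))"

definition time_deriv :: "((real^'n) \<times> real \<Rightarrow> real) \<Rightarrow> (real^'n) \<times> real \<Rightarrow> real" where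
  "time_deriv \<phi> = partial_deriv (0, 1) \<phi>"

definition space_laplacian :: "((real^'n) \<times> real \<Rightarrow> real) \<Rightarrow> (real^'n) \<times> real \<Rightarrow> real" where
  "space_laplacian \<phi> z =
     (\<Sum>i\<in>UNIV. partial_deriv (axis i 1, 0) (partial_deriv (axis i 1, 0) \<phi>) z)"

text \<open>Nonnegative continuous solutions, in the sense of distributions on
  \<open>\<real>\<^sup>N \<times> (0,\<infinity>)\<close>, of \<open>|x|\<^sup>\<sigma>\<^sup>1 \<partial>\<^sub>t u = \<Delta> (u\<^sup>m) + |x|\<^sup>\<sigma>\<^sup>2 u\<^sup>p\<close>. A classical notion is not available: the solutions
  of interest vanish on an open set with a free boundary across which they need not be
  differentiable, and the weights may be singular at \<open>x = 0\<close>. Test functions need not vanish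
  near \<open>x = 0\<close>, so the equation is also imposed across the origin. The values of \<open>u\<close> at
  nonpositive times are irrelevant.\<close>

definition weak_solution ::
    "real \<Rightarrow> real \<Rightarrow> real \<Rightarrow> real \<Rightarrow> (real^'n \<Rightarrow> real \<Rightarrow> real) \<Rightarrow> bool" where
  "weak_solution m p \<sigma>1 \<sigma>2 u \<longleftrightarrow>
     (\<forall>x. \<forall>t>0. 0 \<le> u x t) \<and>
     continuous_on (UNIV \<times> {0<..}) (\<lambda>(x, t). u x t) \<and>
     (\<forall>K. compact K \<and> K \<subseteq> UNIV \<times> {0<..} \<longrightarrow>
        set_integrable lborel K (\<lambda>(x, t). norm x powr \<sigma>1 * u x t) \<and>
        set_integrable lborel K (\<lambda>(x, t). u x t powr m) \<and>
        set_integrable lborel K (\<lambda>(x, t). norm x powr \<sigma>2 * u x t powr p)) \<and>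
     (\<forall>\<phi>. test_function \<phi> \<longrightarrow>
        set_lebesgue_integral lborel (UNIV \<times> {0<..})
          (\<lambda>(x, t). norm x powr \<sigma>1 * u x t * time_deriv \<phi> (x, t)
                   + u x t powr m * space_laplacian \<phi> (x, t)
                   + norm x powr \<sigma>2 * u x t powr p * \<phi> (x, t)) = 0)"

subsection \<open>Self-similar solutions and their profiles\<close>

text \<open>The forward self-similar form written with a time unit \<open>c > 0\<close>: for \<open>c = 1\<close> it is
  \<open>u(x,t) = t\<^sup>\<alpha> f(|x| t\<^sup>-\<^sup>\<beta>)\<close>, and for \<open>c = \<theta>\<^sup>2\<close> the profile is expressed in the variable
  \<open>\<xi> = |x| (\<theta>\<^sup>2 t)\<^sup>-\<^sup>\<beta>\<close>. The same \<open>u\<close> has the form for every \<open>c\<close>, with profiles related by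
  \<open>f\<^sub>c(\<xi>) = c powr (-\<alpha>) * f\<^sub>1(c powr \<beta> * \<xi>)\<close>; since \<open>\<alpha> (m - p) = \<beta> (\<sigma>2 + 2)\<close>, this
  changes the constant \<open>D\<close> but not the coefficient of \<open>\<xi>\<close> in the expansion at the origin.\<close>

definition forward_form ::
    "real \<Rightarrow> real \<Rightarrow> real \<Rightarrow> (real \<Rightarrow> real) \<Rightarrow> (real^'n \<Rightarrow> real \<Rightarrow> real) \<Rightarrow> bool" where
  "forward_form \<alpha> \<beta> c f u \<longleftrightarrow>
     (\<forall>x. \<forall>t>0. u x t = (c * t) powr \<alpha> * f (norm x * (c * t) powr (-\<beta>)))"

text \<open>The asymptotic relation is a two-term expansion, that is, the error is negligible with
  respect to the last displayed term \<open>\<xi>\<^sup>\<sigma>\<^sup>2\<^sup>+\<^sup>2\<close>. Since \<open>D > 0\<close>, it implies that the quotient of both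
  sides tends to 1, a statement which by itself would not see the second term.\<close>

definition origin_behavior ::
    "nat \<Rightarrow> real \<Rightarrow> real \<Rightarrow> real \<Rightarrow> real \<Rightarrow> (real \<Rightarrow> real) \<Rightarrow> bool" where
  "origin_behavior N m p \<sigma>2 D f \<longleftrightarrow>
     (\<lambda>\<xi>. f \<xi> - (D - (m - p) / (m * (real N + \<sigma>2) * (2 + \<sigma>2)) * \<xi> powr (\<sigma>2 + 2)) powr (1 / (m - p)))
       \<in> o[at_right 0](\<lambda>\<xi>. \<xi> powr (\<sigma>2 + 2))"

definition compactly_supported_at :: "real \<Rightarrow> real \<Rightarrow> (real \<Rightarrow> real) \<Rightarrow> bool" where
  "compactly_supported_at m \<xi>0 f \<longleftrightarrow>
     (\<forall>\<xi>. 0 < \<xi> \<and> \<xi> < \<xi>0 \<longrightarrow> f \<xi> > 0) \<and>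
     (\<forall>\<xi>\<ge>\<xi>0. f \<xi> = 0) \<and>
     ((\<lambda>\<xi>. f \<xi> powr m) has_real_derivative 0) (at \<xi>0)"

definition self_similar_solution ::
    "real \<Rightarrow> real \<Rightarrow> real \<Rightarrow> real \<Rightarrow> real \<Rightarrow> (real \<Rightarrow> real) \<Rightarrow> (real^'n \<Rightarrow> real \<Rightarrow> real) \<Rightarrow> bool" where
  "self_similar_solution m p \<sigma>1 \<sigma>2 c f u \<longleftrightarrow>
     weak_solution m p \<sigma>1 \<sigma>2 u \<and>
     forward_form (alpha_exp m p \<sigma>1 \<sigma>2) (beta_exp m p \<sigma>1 \<sigma>2) c f u"

end

theory Submission
  imports Defs "HOL-Real_Asymp.Real_Asymp"
begin

text \<open>With \<open>a = \<sigma>2 + 2\<close> and \<open>f(\<xi>) = F(\<xi>\<^sup>a)\<close> the profile equation becomes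
  \<open>E' = x\<^sup>\<nu>\<^sup>-\<^sup>1 (\<epsilon> B x\<^sup>\<kappa> F - \<mu> F\<^sup>p)\<close>, \<open>(F\<^sup>m)' = x\<^sup>-\<^sup>\<nu> (E - \<epsilon> x\<^sup>\<nu>\<^sup>+\<^sup>\<kappa> F)\<close>, \<open>E(0) = 0\<close>, and the scaling
  \<open>F \<mapsto> A F(\<Lambda> x)\<close> multiplies \<open>\<epsilon>\<close> and \<open>\<mu>\<close> by powers of \<open>A\<close> and \<open>\<Lambda>\<close>.

  Existence is by shooting in \<open>\<tau> \<in> [0,1]\<close> with \<open>\<epsilon> = 1 - \<tau>\<close>, \<open>\<mu> = \<tau>\<close>, \<open>F(0) = 1\<close>. The values of \<open>\<tau>\<close> whose
  solution enters an invariant region where it increases form an open set containing 0, those whose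
  solution reaches zero with negative flux form a disjoint open set containing 1; for a value in
  neither set the solution reaches zero with vanishing flux.

  For uniqueness, one of two profiles with the same coefficients is scaled so that \<open>\<epsilon>\<close> is kept and
  \<open>\<mu>\<close> increases, down to the first contact with the other one. Contact at the origin, in the interior
  and at a common interface are all impossible, the last one because the ratio of the two profiles
  tends to 1 there.

  The fluxes of a profile turn the weak formulation into the integral of a divergence. Conversely,
  test functions \<open>\<chi>(t) h(|x|\<^sup>2 t\<^sup>-\<^sup>2\<^sup>\<beta>)\<close> turn it into a one-dimensional identity for the profile, from which
  the equation follows by letting \<open>h'\<close> approach the indicator of an interval.\<close>

section \<open>Uniqueness of normalised profiles\<close>

text \<open>In dimension n the exponents are \<nu> = (n + \<sigma>2)/a and \<kappa> = (\<sigma>1 -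
  \<sigma>2)/a. The drift term of the similarity equation is absorbed into \<open>E\<close>, the
  diffusive flux plus \<epsilon> x^(\<nu>+\<kappa>) F. No derivative of \<open>F\<close> alone then
  occurs, so both equations make sense across the free boundary, where \<open>F\<close> need not be
  differentiable; E(0) = 0 expresses that the equation also holds across the origin. The condition p
  < p_c is p - 1 < \<kappa> (m - p). It acts three times: it makes the increasing region invariant,
  it decides that shrinking \<Lambda> at fixed \<epsilon> raises \<mu>, and it makes the passage
  from (A, \<Lambda>) to the factors of \<epsilon> and \<mu> invertible, so that one shooting
  solution serves all coefficients. The obstacle in the weak formulation is x = 0: for \<sigma>2 <
  -1 both the weight |x|^\<sigma>2 and the gradient of u^m may blow up there, while test functions
  need not vanish. It is overcome by the integrability of the weights and by the estimate |u^m -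
  u(0,t)^m| \<le> C r^(\<sigma>2+2), which is why the value at the origin is subtracted before
  cutting off.\<close>

lemma one_minus_powr_le:
  fixes m y :: real
  assumes "1 < m" "0 < y"
  shows "(m - 1) * (1 - y powr m) \<le> m * (1 - y powr (m - 1))"
proof -
  \<comment> \<open>Convexity trades the power m for m - 1. With y = 1/\<rho> this compares two flux
    gaps at a maximum \<rho> of the ratio of two profiles.\<close>
  have "(y powr m) powr ((m - 1) / m) * 1 powr (1 / m) \<le> (m - 1) / m * y powr m + 1 / m * 1"
    by (rule Youngs_inequality_0) (use assms in \<open>auto simp: field_simps\<close>)
  then have "y powr (m - 1) \<le> ((m - 1) * y powr m + 1) / m"
    using assms by (simp add: powr_powr add_divide_distrib)
  then have "m * y powr (m - 1) \<le> (m - 1) * y powr m + 1"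
    using assms by (simp add: pos_le_divide_eq mult.commute)
  then show ?thesis by (simp add: algebra_simps)
qed

lemma continuous_on_Icc_bound:
  fixes f :: "real \<Rightarrow> real"
  assumes "continuous_on {a..b} f"
  obtains K where "0 < K" "\<And>x. a \<le> x \<Longrightarrow> x \<le> b \<Longrightarrow> \<bar>f x\<bar> \<le> K"
proof -
  have "bounded (f ` {a..b})"
    by (intro compact_imp_bounded compact_continuous_image assms) auto
  then obtain K where "0 < K" "\<forall>y\<in>f ` {a..b}. norm y \<le> K" unfolding bounded_pos by blast
  then show thesis by (intro that[of K]) auto
qed

section \<open>Profiles with an interface and their scaling\<close>

locale profile_equation =
  fixes m p \<nu> \<kappa> :: real
  assumes m: "1 < m" and p: "1 \<le> p" "p < m" and \<nu>: "0 < \<nu>" and \<kappa>: "0 < \<kappa>"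
    and subcritical: "p - 1 < \<kappa> * (m - p)"
begin

definition q :: real where "q = 1 / (m - p)"

lemma q_pos: "0 < q"
  using p by (simp add: q_def)

text \<open>Forced by the similarity exponents: \<alpha> = \<beta> a q and n + \<sigma>1 = a (\<nu>
  + \<kappa>), so \<alpha> + \<beta> (n + \<sigma>1) = \<beta> a B. The summand \<nu> + \<kappa>
  comes from writing the drift term as a derivative.\<close>

definition B :: real where "B = q + \<nu> + \<kappa>"

lemma B_pos: "0 < B"
  using q_pos \<nu> \<kappa> by (simp add: B_def)

definition flux_deriv :: "real \<Rightarrow> real \<Rightarrow> (real \<Rightarrow> real) \<Rightarrow> real \<Rightarrow> real" where
  "flux_deriv \<epsilon> \<mu> F x = x powr (\<nu> - 1) * (\<epsilon> * B * x powr \<kappa> * F x - \<mu> * F x powr p)"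

definition slope :: "real \<Rightarrow> (real \<Rightarrow> real) \<Rightarrow> (real \<Rightarrow> real) \<Rightarrow> real \<Rightarrow> real" where
  "slope \<epsilon> F E x = x powr (- \<nu>) * (E x - \<epsilon> * x powr (\<nu> + \<kappa>) * F x)"

text \<open>Extending \<open>F\<close> by zero and demanding both equations for all x > 0, the
  interface included, encodes the vanishing of (F^m)' at x0. At 0, where the weights may be
  singular, only continuity and E 0 = 0 are imposed.\<close>

definition profile :: "real \<Rightarrow> real \<Rightarrow> real \<Rightarrow> (real \<Rightarrow> real) \<Rightarrow> (real \<Rightarrow> real) \<Rightarrow> bool" where
  "profile \<epsilon> \<mu> x0 F E \<longleftrightarrow> 0 < x0 \<and> continuous_on {0..} F \<and> continuous_on {0..} E \<and> E 0 = 0 \<and>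
     (\<forall>x. 0 \<le> x \<and> x < x0 \<longrightarrow> 0 < F x) \<and> (\<forall>x\<ge>x0. F x = 0) \<and>
     (\<forall>x>0. DERIV E x :> flux_deriv \<epsilon> \<mu> F x) \<and>
     (\<forall>x>0. DERIV (\<lambda>x. F x powr m) x :> slope \<epsilon> F E x)"

lemma profileD:
  assumes "profile \<epsilon> \<mu> x0 F E"
  shows "0 < x0" "continuous_on {0..} F" "continuous_on {0..} E" "E 0 = 0"
    "\<And>x. 0 \<le> x \<Longrightarrow> x < x0 \<Longrightarrow> 0 < F x" "\<And>x. x0 \<le> x \<Longrightarrow> F x = 0"
    "\<And>x. 0 < x \<Longrightarrow> DERIV E x :> flux_deriv \<epsilon> \<mu> F x"
    "\<And>x. 0 < x \<Longrightarrow> DERIV (\<lambda>x. F x powr m) x :> slope \<epsilon> F E x"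
    "\<And>x. 0 \<le> x \<Longrightarrow> 0 \<le> F x"
proof -
  show "0 < x0" "continuous_on {0..} F" "continuous_on {0..} E" "E 0 = 0"
    and pos: "\<And>x. 0 \<le> x \<Longrightarrow> x < x0 \<Longrightarrow> 0 < F x" and zero: "\<And>x. x0 \<le> x \<Longrightarrow> F x = 0"
    and "\<And>x. 0 < x \<Longrightarrow> DERIV E x :> flux_deriv \<epsilon> \<mu> F x"
    "\<And>x. 0 < x \<Longrightarrow> DERIV (\<lambda>x. F x powr m) x :> slope \<epsilon> F E x"
    using assms unfolding profile_def by blast+
  show "0 \<le> F x" if "0 \<le> x" for x
    using pos[OF that] zero[of x] by (cases "x < x0") auto
qed

lemma profile_isCont:
  assumes "profile \<epsilon> \<mu> x0 F E" "0 < x"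
  shows "isCont F x" "isCont E x"
  using profileD(2,3)[OF assms(1)] assms(2)
  by (auto intro!: continuous_on_interior)

text \<open>Beyond x0 the function F^m is locally zero, so the second equation with F = 0 forces E =
  0; continuity carries this to x0. This is the form in which the condition at the interface is
  used.\<close>

lemma profile_outside:
  assumes P: "profile \<epsilon> \<mu> x0 F E" and x: "x0 \<le> x"
  shows "E x = 0"
proof -
  note D = profileD[OF P]
  have *: "E y = 0" if y: "x0 < y" for y
  proof -
    have "DERIV (\<lambda>x. F x powr m) y :> 0"
    proof (rule has_field_derivative_transform_within_open[of "\<lambda>_. 0"])
      show "open {x0<..}" "y \<in> {x0<..}" using y by auto
    qed (use D(6) in auto)
    from DERIV_unique[OF this D(8)[of y]] y D(1) D(6)[of y] show ?thesis
      by (auto simp: slope_def)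
  qed
  show ?thesis
  proof (cases "x = x0")
    case True
    have "((\<lambda>y. E y) \<longlongrightarrow> E x0) (at_right x0)"
      using profile_isCont(2)[OF P D(1)] by (simp add: isCont_def filterlim_at_split)
    moreover have "((\<lambda>y. E y) \<longlongrightarrow> 0) (at_right x0)"
      by (rule tendsto_eventually) (use * in \<open>auto simp: eventually_at_filter\<close>)
    ultimately show ?thesis using True tendsto_unique[of "at_right x0"] by auto
  qed (use * x in auto)
qed

lemma profile_deriv:
  assumes P: "profile \<epsilon> \<mu> x0 F E" and x: "0 < x" "x < x0"
  shows "DERIV F x :> slope \<epsilon> F E x / (m * F x powr (m - 1))"
proof -
  note D = profileD[OF P]
  have Fx: "0 < F x" using D(5) x by simp
  have "((\<lambda>x. (F x powr m) powr (1 / m)) has_real_derivative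
      1 / m * (F x powr m) powr (1 / m - 1) * slope \<epsilon> F E x) (at x)"
    by (rule DERIV_chain2[where g="\<lambda>x. F x powr m", OF has_real_derivative_powr D(8)])
       (use Fx x in auto)
  then have "DERIV F x :> 1 / m * (F x powr m) powr (1 / m - 1) * slope \<epsilon> F E x"
  proof (rule has_field_derivative_transform_within_open)
    show "open {0<..<x0}" "x \<in> {0<..<x0}" using x by auto
    show "(F y powr m) powr (1 / m) = F y" if "y \<in> {0<..<x0}" for y
      using D(5)[of y] that m by (simp add: powr_powr)
  qed
  moreover have "1 / m * (F x powr m) powr (1 / m - 1) * slope \<epsilon> F E x =
      slope \<epsilon> F E x / (m * F x powr (m - 1))"
  proof -
    have "(F x powr m) powr (1 / m - 1) = F x powr (- (m - 1))"
      using m by (simp add: powr_powr right_diff_distrib)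
    then show ?thesis using powr_minus_divide[of "F x" "m - 1"] by simp
  qed
  ultimately show ?thesis by simp
qed

text \<open>The factor of \<open>E\<close> is dictated by the second equation, since F^m gains A^m
  and differentiation gains \<Lambda>. Matching the remaining terms then determines the factors of
  \<epsilon> and \<mu>.\<close>

lemma profile_scale:
  assumes P: "profile \<epsilon> \<mu> x0 F E" and pos: "0 < A" "0 < \<Lambda>"
  shows "profile (\<epsilon> * A powr (m - 1) * \<Lambda> powr (1 + \<kappa>)) (\<mu> * A powr (m - p) * \<Lambda>) (x0 / \<Lambda>)
    (\<lambda>x. A * F (\<Lambda> * x)) (\<lambda>x. A powr m * \<Lambda> powr (1 - \<nu>) * E (\<Lambda> * x))"
proof -
  note D = profileD[OF P]
  let ?\<epsilon> = "\<epsilon> * A powr (m - 1) * \<Lambda> powr (1 + \<kappa>)" and ?\<mu> = "\<mu> * A powr (m - p) * \<Lambda>"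
  let ?F = "\<lambda>x. A * F (\<Lambda> * x)" and ?E = "\<lambda>x. A powr m * \<Lambda> powr (1 - \<nu>) * E (\<Lambda> * x)"
  have Apow: "A powr m = A powr (m - 1) * A" "A powr m = A powr (m - p) * A powr p"
    using pos by (simp_all add: powr_diff)
  have cont: "continuous_on {0..} (\<lambda>x. g (\<Lambda> * x))" if "continuous_on {0..} g" for g :: "real \<Rightarrow> real"
    by (rule continuous_on_compose2[OF that]) (use pos in \<open>auto intro!: continuous_intros\<close>)
  have dE: "DERIV ?E x :> flux_deriv ?\<epsilon> ?\<mu> ?F x" if x: "0 < x" for x
  proof -
    have "DERIV ?E x :> A powr m * \<Lambda> powr (1 - \<nu>) * (flux_deriv \<epsilon> \<mu> F (\<Lambda> * x) * \<Lambda>)"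
      by (intro DERIV_cmult DERIV_chain2[OF D(7)])
         (use pos x in \<open>auto intro!: derivative_eq_intros\<close>)
    moreover have "A powr m * \<Lambda> powr (1 - \<nu>) * (flux_deriv \<epsilon> \<mu> F (\<Lambda> * x) * \<Lambda>) = flux_deriv ?\<epsilon> ?\<mu> ?F x"
    proof -
      have "0 \<le> F (\<Lambda> * x)" using D(9) pos x by simp
      then have e1: "flux_deriv ?\<epsilon> ?\<mu> ?F x = x powr (\<nu> - 1) *
         (\<epsilon> * A powr m * \<Lambda> powr (1 + \<kappa>) * B * x powr \<kappa> * F (\<Lambda> * x)
           - \<mu> * A powr m * \<Lambda> * F (\<Lambda> * x) powr p)"
        using pos Apow by (simp add: flux_deriv_def powr_mult algebra_simps)
      have e2: "flux_deriv \<epsilon> \<mu> F (\<Lambda> * x) = \<Lambda> powr (\<nu> - 1) * x powr (\<nu> - 1) *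
         (\<epsilon> * B * \<Lambda> powr \<kappa> * x powr \<kappa> * F (\<Lambda> * x) - \<mu> * F (\<Lambda> * x) powr p)"
        using pos x by (simp add: flux_deriv_def powr_mult)
      have e3: "\<Lambda> powr (1 - \<nu>) * \<Lambda> powr (\<nu> - 1) = 1" "\<Lambda> powr (1 + \<kappa>) = \<Lambda> * \<Lambda> powr \<kappa>"
        using pos by (simp flip: powr_add, simp add: powr_add)
      show ?thesis unfolding e1 e2 using e3 by algebra
    qed
    ultimately show ?thesis by simp
  qed
  have dG: "DERIV (\<lambda>x. ?F x powr m) x :> slope ?\<epsilon> ?F ?E x" if x: "0 < x" for x
  proof -
    have "DERIV (\<lambda>x. A powr m * F (\<Lambda> * x) powr m) x :> A powr m * (slope \<epsilon> F E (\<Lambda> * x) * \<Lambda>)"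
      by (intro DERIV_cmult DERIV_chain2[where f="\<lambda>x. F x powr m", OF D(8)])
         (use pos x in \<open>auto intro!: derivative_eq_intros\<close>)
    then have "DERIV (\<lambda>x. ?F x powr m) x :> A powr m * (slope \<epsilon> F E (\<Lambda> * x) * \<Lambda>)"
    proof (rule has_field_derivative_transform_within_open)
      show "open {0::real<..}" "x \<in> {0<..}" using x by auto
      show "A powr m * F (\<Lambda> * y) powr m = (A * F (\<Lambda> * y)) powr m" if "y \<in> {0<..}" for y
        using that pos D(9)[of "\<Lambda> * y"] by (simp add: powr_mult)
    qed
    moreover have "A powr m * (slope \<epsilon> F E (\<Lambda> * x) * \<Lambda>) = slope ?\<epsilon> ?F ?E x"
    proof -
      have e: "\<Lambda> powr (- \<nu>) * \<Lambda> = \<Lambda> powr (1 - \<nu>)" "\<Lambda> powr (- \<nu>) * \<Lambda> * \<Lambda> powr (\<nu> + \<kappa>) = \<Lambda> powr (1 + \<kappa>)"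
        using pos by (simp_all add: powr_add powr_diff powr_minus field_simps)
      have l: "slope \<epsilon> F E (\<Lambda> * x) = \<Lambda> powr (- \<nu>) * x powr (- \<nu>) *
          (E (\<Lambda> * x) - \<epsilon> * \<Lambda> powr (\<nu> + \<kappa>) * x powr (\<nu> + \<kappa>) * F (\<Lambda> * x))"
        using pos x by (simp add: slope_def powr_mult)
      show ?thesis unfolding l unfolding slope_def e(1)[symmetric] e(2)[symmetric] Apow(1) by algebra
    qed
    ultimately show ?thesis by simp
  qed
  show ?thesis unfolding profile_def
    using pos D dE dG cont[OF D(2)] cont[OF D(3)]
    by (auto simp: field_simps intro!: continuous_intros)
qed

section \<open>Contact of two ordered profiles with different source coefficients\<close>

lemma contact_interior:
  assumes PF: "profile \<epsilon> \<mu>' xF F EF" and Pf: "profile \<epsilon> \<mu> xf f Ef" and \<mu>: "\<mu> < \<mu>'"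
    and le: "\<And>x. 0 \<le> x \<Longrightarrow> f x \<le> F x" and y: "0 < y" "y < xf"
  shows "f y < F y"
proof (rule ccontr)
  assume "\<not> f y < F y"
  then have eq: "F y = f y" using le[of y] y by simp
  note DF = profileD[OF PF] and Df = profileD[OF Pf]
  have fy: "0 < f y" using Df(5) y by simp
  have yF: "y < xF" using DF(6)[of y] eq fy by force
  \<comment> \<open>H has its minimum 0 at y, which makes the difference D of the diffusive fluxes
    vanish there. In the derivative of D at y everything cancels except the sources, which differ by
    \<mu>' - \<mu>; so D, and with it H, becomes negative to the right of y.\<close>
  define H where "H x = F x powr m - f x powr m" for x
  define D where "D x = EF x - Ef x - \<epsilon> * x powr (\<nu> + \<kappa>) * (F x - f x)" for x
  have dH: "DERIV H x :> x powr (- \<nu>) * D x" if "0 < x" for x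
  proof -
    have "DERIV H x :> slope \<epsilon> F EF x - slope \<epsilon> f Ef x"
      unfolding H_def by (intro DERIV_diff DF(8) Df(8) that)
    then show ?thesis by (simp add: slope_def D_def algebra_simps)
  qed
  have "y powr (- \<nu>) * D y = 0"
  proof (rule DERIV_local_min[OF dH[OF y(1)] y(1)], intro allI impI)
    fix z assume "\<bar>y - z\<bar> < y"
    then have "0 \<le> z" by linarith
    then show "H y \<le> H z" using le[of z] Df(9)[of z] eq m by (auto simp: H_def intro!: powr_mono2)
  qed
  then have Dy: "D y = 0" using y by simp
  have slope_eq: "slope \<epsilon> F EF y = slope \<epsilon> f Ef y"
    using Dy eq by (simp add: slope_def D_def)
  let ?D' = "flux_deriv \<epsilon> \<mu>' F y - flux_deriv \<epsilon> \<mu> f y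
    - (\<epsilon> * y powr (\<nu> + \<kappa>) * (slope \<epsilon> F EF y / (m * F y powr (m - 1)) - slope \<epsilon> f Ef y / (m * f y powr (m - 1)))
       + \<epsilon> * ((\<nu> + \<kappa>) * y powr (\<nu> + \<kappa> - 1)) * (F y - f y))"
  have "DERIV D y :> ?D'"
    unfolding D_def
    by (intro DERIV_diff DERIV_mult' DERIV_cmult DF(7) Df(7) profile_deriv[OF PF] profile_deriv[OF Pf]
        has_real_derivative_powr y yF)
  moreover have "?D' = - ((\<mu>' - \<mu>) * f y powr p * y powr (\<nu> - 1))"
    unfolding slope_eq eq by (simp add: flux_deriv_def eq algebra_simps)
  moreover have "\<dots> < 0" using \<mu> fy y by simp
  ultimately obtain d where d: "0 < d" "\<And>h. 0 < h \<Longrightarrow> h < d \<Longrightarrow> D (y + h) < 0"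
    using DERIV_neg_dec_right[of D ?D' y] Dy by metis
  have "H (y + d / 2) < H y"
  proof (rule DERIV_neg_imp_decreasing_open[of y "y + d / 2" H])
    show "\<exists>z. DERIV H x :> z \<and> z < 0" if "y < x" "x < y + d / 2" for x
      using dH[of x] d(2)[of "x - y"] that y(1) d(1)
      by (intro exI[of _ "x powr (- \<nu>) * D x"]) (simp add: mult_pos_neg)
    show "continuous_on {y..y + d / 2} H"
      by (rule DERIV_continuous_on[where D="\<lambda>x. x powr (- \<nu>) * D x"])
         (rule DERIV_subset[OF dH], use y(1) in auto)
  qed (use d in auto)
  moreover have "H y = 0" using eq by (simp add: H_def)
  moreover have "0 \<le> H (y + d / 2)"
    using le[of "y + d / 2"] Df(9)[of "y + d/2"] y d m by (auto simp: H_def intro!: powr_mono2)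
  ultimately show False by simp
qed

lemma continuous_on_weighted_source:
  assumes "continuous_on S F" "\<And>x. x \<in> S \<Longrightarrow> 0 \<le> F x" "S \<subseteq> {0..}"
  shows "continuous_on S (\<lambda>x. \<epsilon> * B * x powr \<kappa> * F x - \<mu> * F x powr p)"
  using assms \<kappa> p by (intro continuous_intros continuous_on_powr') auto

text \<open>No derivative at 0 is available, so the first equation is integrated from E 0 = 0: the
  larger source coefficient makes the difference of the \<open>E\<close> negative near 0. The drift
  contributes with the same sign because f \<le> F, so F^m - f^m would decrease from 0.\<close>

lemma contact_origin:
  assumes PF: "profile \<epsilon> \<mu>' xF F EF" and Pf: "profile \<epsilon> \<mu> xf f Ef" and \<mu>: "\<mu> < \<mu>'" and \<epsilon>: "0 \<le> \<epsilon>"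
    and le: "\<And>x. 0 \<le> x \<Longrightarrow> f x \<le> F x"
  shows "f 0 < F 0"
proof (rule ccontr)
  assume "\<not> f 0 < F 0"
  then have eq: "F 0 = f 0" using le[of 0] by simp
  note DF = profileD[OF PF] and Df = profileD[OF Pf]
  have f0: "0 < f 0" using Df(1,5) by simp
  \<comment> \<open>The difference of the two right-hand sides without their singular weight, hence
    continuous up to 0.\<close>
  define k where "k x = (\<epsilon> * B * x powr \<kappa> * F x - \<mu>' * F x powr p) - (\<epsilon> * B * x powr \<kappa> * f x - \<mu> * f x powr p)" for x
  have "continuous_on {0..} k"
    unfolding k_def using DF Df by (intro continuous_on_diff continuous_on_weighted_source) auto
  moreover have "k 0 < 0"
    using f0 \<mu> \<kappa> p eq by (simp add: k_def)
  ultimately have "\<exists>d>0. \<forall>x\<in>{0..}. dist x 0 < d \<longrightarrow> dist (k x) (k 0) < - k 0"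
    unfolding continuous_on_iff by (elim ballE[of _ _ 0]) auto
  then obtain d where d: "0 < d" "\<forall>x\<in>{0..}. dist x 0 < d \<longrightarrow> dist (k x) (k 0) < - k 0"
    by blast
  have k_neg: "k x < 0" if "0 \<le> x" "x < d" for x
    using d(2)[rule_format, of x] that by (auto simp: dist_real_def)
  define H where "H x = F x powr m - f x powr m" for x
  have E: "EF x - Ef x < 0" if x: "0 < x" "x < d" for x
  proof -
    have "EF x - Ef x < EF 0 - Ef 0"
    proof (rule DERIV_neg_imp_decreasing_open[of 0 x "\<lambda>x. EF x - Ef x", OF x(1)])
      fix z assume z: "0 < z" "z < x"
      have "DERIV (\<lambda>x. EF x - Ef x) z :> z powr (\<nu> - 1) * k z"
        using DERIV_diff[OF DF(7) Df(7), OF z(1) z(1)] by (simp add: flux_deriv_def k_def algebra_simps)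
      moreover have "z powr (\<nu> - 1) * k z < 0" using k_neg[of z] z x by (simp add: mult_pos_neg)
      ultimately show "\<exists>y. DERIV (\<lambda>x. EF x - Ef x) z :> y \<and> y < 0" by blast
    next
      show "continuous_on {0..x} (\<lambda>x. EF x - Ef x)"
        by (intro continuous_on_diff continuous_on_subset[OF DF(3)] continuous_on_subset[OF Df(3)]) auto
    qed
    then show ?thesis using DF(4) Df(4) by simp
  qed
  have "H (d / 2) < H 0"
  proof (rule DERIV_neg_imp_decreasing_open[of 0 "d / 2" H])
    fix x assume x: "0 < x" "x < d / 2"
    have "DERIV H x :> slope \<epsilon> F EF x - slope \<epsilon> f Ef x"
      unfolding H_def by (intro DERIV_diff DF(8) Df(8) x)
    moreover have "slope \<epsilon> F EF x - slope \<epsilon> f Ef x = x powr (- \<nu>) * (EF x - Ef x - \<epsilon> * x powr (\<nu> + \<kappa>) * (F x - f x))"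
      by (simp add: slope_def algebra_simps)
    moreover have "EF x - Ef x - \<epsilon> * x powr (\<nu> + \<kappa>) * (F x - f x) < 0"
    proof -
      have "0 \<le> \<epsilon> * x powr (\<nu> + \<kappa>) * (F x - f x)" using le[of x] x \<epsilon> by simp
      then show ?thesis using E[of x] x d(1) by linarith
    qed
    ultimately show "\<exists>y. DERIV H x :> y \<and> y < 0"
      using x by (intro exI[of _ "slope \<epsilon> F EF x - slope \<epsilon> f Ef x"]) (simp add: mult_pos_neg)
  next
    show "continuous_on {0..d / 2} H"
      unfolding H_def using DF(9) Df(9) m
      by (intro continuous_on_diff continuous_on_powr' continuous_on_const
          continuous_on_subset[OF DF(2)] continuous_on_subset[OF Df(2)]) auto
  qed (use d in auto)
  moreover have "H 0 = 0" using eq by (simp add: H_def)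
  moreover have "0 \<le> H (d / 2)"
    using le[of "d / 2"] Df(9)[of "d / 2"] d m by (auto simp: H_def intro!: powr_mono2)
  ultimately show False by simp
qed

section \<open>Behaviour of a profile near its interface\<close>

lemma flux_deriv_bound:
  assumes P: "profile \<epsilon> \<mu> x0 F E" and \<epsilon>: "0 \<le> \<epsilon>" and \<mu>: "0 \<le> \<mu>"
  obtains C where "0 < C" "\<And>x. x0 / 2 \<le> x \<Longrightarrow> x \<le> x0 \<Longrightarrow> \<bar>flux_deriv \<epsilon> \<mu> F x\<bar> \<le> C * F x"
    "\<And>x. x0 / 2 \<le> x \<Longrightarrow> x \<le> x0 \<Longrightarrow> x powr (\<nu> - 1) * (\<mu> * F x powr p) \<le> C * F x"
proof -
  note D = profileD[OF P]
  have "continuous_on {x0 / 2..x0} F"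
    using D(1) by (intro continuous_on_subset[OF D(2)]) auto
  then obtain K where "\<And>x. x0 / 2 \<le> x \<Longrightarrow> x \<le> x0 \<Longrightarrow> \<bar>F x\<bar> \<le> K"
    by (rule continuous_on_Icc_bound) blast
  then have K: "\<And>x. x0 / 2 \<le> x \<Longrightarrow> x \<le> x0 \<Longrightarrow> F x \<le> K" by (meson abs_le_D1)
  have "continuous_on {x0 / 2..x0} (\<lambda>x. x powr (\<nu> - 1))"
    using D(1) by (intro continuous_intros) auto
  then obtain W where W0: "0 < W" and "\<And>x. x0 / 2 \<le> x \<Longrightarrow> x \<le> x0 \<Longrightarrow> \<bar>x powr (\<nu> - 1)\<bar> \<le> W"
    by (rule continuous_on_Icc_bound) blast
  then have W: "\<And>x. x0 / 2 \<le> x \<Longrightarrow> x \<le> x0 \<Longrightarrow> x powr (\<nu> - 1) \<le> W" by (meson abs_le_D1)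
  \<comment> \<open>Because p \<ge> 1, F^p is at most M F: near the interface the source is
    controlled linearly by F.\<close>
  define M where "M = max 1 K powr (p - 1)"
  have M0: "0 \<le> M" by (simp add: M_def)
  define C where "C = W * (\<epsilon> * B * x0 powr \<kappa> + \<mu> * M) + 1"
  have Fp: "F x powr p \<le> M * F x" if x: "x0 / 2 \<le> x" "x \<le> x0" for x
  proof (cases "F x = 0")
    case False
    then have F: "0 < F x" using D(9)[of x] x D(1) by simp
    then have "F x powr p = F x powr (p - 1) * F x" by (simp add: powr_diff)
    also have "\<dots> \<le> M * F x"
      unfolding M_def using F K[OF x] p by (intro mult_right_mono powr_mono2) auto
    finally show ?thesis .
  qed (use p in simp)
  have a1: "x powr (\<nu> - 1) * (\<mu> * F x powr p) \<le> W * (\<mu> * M) * F x" if x: "x0 / 2 \<le> x" "x \<le> x0" for x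
  proof -
    have "x powr (\<nu> - 1) * (\<mu> * F x powr p) \<le> W * (\<mu> * (M * F x))"
      using W[OF x] Fp[OF x] \<mu> W0 by (intro mult_mono) auto
    then show ?thesis by (simp add: algebra_simps)
  qed
  have a2: "x powr (\<nu> - 1) * (\<epsilon> * B * x powr \<kappa> * F x) \<le> W * (\<epsilon> * B * x0 powr \<kappa>) * F x" if x: "x0 / 2 \<le> x" "x \<le> x0" for x
  proof -
    have Fx: "0 \<le> F x" "0 \<le> x" using D(9)[of x] x D(1) by auto
    have "x powr \<kappa> \<le> x0 powr \<kappa>" using x Fx \<kappa> by (intro powr_mono2) auto
    then have "x powr (\<nu> - 1) * (\<epsilon> * B * x powr \<kappa> * F x) \<le> W * (\<epsilon> * B * x0 powr \<kappa> * F x)"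
      using W[OF x] \<epsilon> W0 B_pos Fx by (intro mult_mono mult_nonneg_nonneg) auto
    then show ?thesis by (simp add: algebra_simps)
  qed
  show thesis
  proof (rule that[of C])
    show "0 < C" unfolding C_def using W0 M0 \<epsilon> \<mu> B_pos by (intro add_nonneg_pos mult_nonneg_nonneg add_nonneg_nonneg) auto
    fix x assume x: "x0 / 2 \<le> x" "x \<le> x0"
    have Fx: "0 \<le> F x" using D(9)[of x] x D(1) by auto
    have nn: "0 \<le> W * (\<epsilon> * B * x0 powr \<kappa>) * F x" "0 \<le> W * (\<mu> * M) * F x"
      using W0 M0 \<epsilon> \<mu> B_pos Fx by auto
    have s: "W * (\<epsilon> * B * x0 powr \<kappa>) * F x + W * (\<mu> * M) * F x \<le> C * F x"
      using Fx by (simp add: C_def algebra_simps)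
    show "x powr (\<nu> - 1) * (\<mu> * F x powr p) \<le> C * F x"
      using a1[OF x] s nn by linarith
    have "0 \<le> x powr (\<nu> - 1) * (\<mu> * F x powr p)" "0 \<le> x powr (\<nu> - 1) * (\<epsilon> * B * x powr \<kappa> * F x)"
      using \<mu> \<epsilon> B_pos Fx by auto
    then show "\<bar>flux_deriv \<epsilon> \<mu> F x\<bar> \<le> C * F x"
      unfolding flux_deriv_def right_diff_distrib using a1[OF x] a2[OF x] s nn by linarith
  qed
qed

text \<open>E vanishes at x0 and its derivative is of the size of F, so the mean value theorem gains
  the factor x0 - x. \<open>S\<close> will be a maximum of F to the right of x, and later F x
  itself, once F is known to decrease.\<close>

lemma flux_le_near_interface:
  assumes P: "profile \<epsilon> \<mu> x0 F E"
    and C: "\<And>x. x0 / 2 \<le> x \<Longrightarrow> x \<le> x0 \<Longrightarrow> \<bar>flux_deriv \<epsilon> \<mu> F x\<bar> \<le> C * F x" and "0 < C"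
    and x: "x0 / 2 \<le> x" "x \<le> x0" and le: "\<And>s. x \<le> s \<Longrightarrow> s \<le> x0 \<Longrightarrow> F s \<le> S"
  shows "\<bar>E x\<bar> \<le> (x0 - x) * (C * S)"
proof (cases "x = x0")
  case True then show ?thesis using profile_outside[OF P] by simp
next
  case False
  note D = profileD[OF P]
  obtain z where z: "x < z" "z < x0" "E x0 - E x = (x0 - x) * flux_deriv \<epsilon> \<mu> F z"
    using MVT2[of x x0 E "flux_deriv \<epsilon> \<mu> F"] D(7) x D(1) False by fastforce
  have "\<bar>E x\<bar> = (x0 - x) * \<bar>flux_deriv \<epsilon> \<mu> F z\<bar>"
    using z profile_outside[OF P, of x0] x by (simp add: abs_mult flip: abs_minus_cancel[of "E x"])
  also have "\<dots> \<le> (x0 - x) * (C * S)"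
  proof (rule mult_left_mono)
    have "\<bar>flux_deriv \<epsilon> \<mu> F z\<bar> \<le> C * F z" using C[of z] z x by simp
    also have "\<dots> \<le> C * S" using le[of z] z \<open>0 < C\<close> by simp
    finally show "\<bar>flux_deriv \<epsilon> \<mu> F z\<bar> \<le> C * S" .
  qed (use x in simp)
  finally show ?thesis .
qed

lemma decreasing_near_interface:
  assumes P: "profile \<epsilon> \<mu> x0 F E" and \<epsilon>: "0 < \<epsilon>"
    and C: "\<And>x. x0 / 2 \<le> x \<Longrightarrow> x \<le> x0 \<Longrightarrow> \<bar>flux_deriv \<epsilon> \<mu> F x\<bar> \<le> C * F x" "0 < C"
    and x: "x0 / 2 \<le> x" "x \<le> s" "s \<le> x0"
    and small: "(x0 - x) * C < \<epsilon> * (x0 / 2) powr (\<nu> + \<kappa>)"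
  shows "F s \<le> F x"
proof (rule ccontr)
  assume nle: "\<not> F s \<le> F x"
  note D = profileD[OF P]
  have "\<exists>y\<in>{x..x0}. \<forall>z\<in>{x..x0}. F z \<le> F y"
    using x D(1) by (intro continuous_attains_sup continuous_on_subset[OF D(2)]) auto
  then obtain y where y: "x \<le> y" "y \<le> x0" "\<And>z. x \<le> z \<Longrightarrow> z \<le> x0 \<Longrightarrow> F z \<le> F y"
    by auto
  have yx: "F x < F y" using y(3)[of s] nle x by auto
  then have "x < y" using y(1) by (cases "x = y") auto
  have Fy: "0 < F y" using yx D(9)[of x] x D(1) by simp
  then have "y < x0" using D(6)[of y] by force
  have y0: "0 < y" using x D(1) y by simp
  \<comment> \<open>At an interior maximum the diffusive flux vanishes, so E y equals the drift
    \<epsilon> y^(\<nu>+\<kappa>) F y. But E y is at most C (x0 - y) F y, and close to x0 both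
    cannot hold.\<close>
  have "slope \<epsilon> F E y = 0"
  proof (rule DERIV_local_max[OF D(8)[OF y0]])
    show "0 < min (y - x) (x0 - y)" using \<open>x < y\<close> \<open>y < x0\<close> by simp
    show "\<forall>z. \<bar>y - z\<bar> < min (y - x) (x0 - y) \<longrightarrow> F z powr m \<le> F y powr m"
    proof (intro allI impI)
      fix z assume "\<bar>y - z\<bar> < min (y - x) (x0 - y)"
      then have z: "x \<le> z" "z \<le> x0" by auto
      then show "F z powr m \<le> F y powr m"
        using y(3)[of z] D(9)[of z] x D(1) m by (intro powr_mono2) auto
    qed
  qed
  then have "E y = \<epsilon> * y powr (\<nu> + \<kappa>) * F y" using y0 by (simp add: slope_def)
  moreover have "\<bar>E y\<bar> \<le> (x0 - y) * (C * F y)"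
    by (rule flux_le_near_interface[OF P C]) (use x y in auto)
  ultimately have "\<epsilon> * y powr (\<nu> + \<kappa>) * F y \<le> ((x0 - y) * C) * F y" by simp
  then have "\<epsilon> * y powr (\<nu> + \<kappa>) \<le> (x0 - y) * C" using Fy by simp
  also have "\<dots> \<le> (x0 - x) * C" using y C(2) by simp
  also have "\<dots> < \<epsilon> * (x0 / 2) powr (\<nu> + \<kappa>)" by (rule small)
  also have "\<dots> \<le> \<epsilon> * y powr (\<nu> + \<kappa>)"
    using \<epsilon> x y D(1) \<nu> \<kappa> by (intro mult_left_mono powr_mono2) auto
  finally show False by simp
qed

lemma profile_near_interface:
  assumes P: "profile \<epsilon> \<mu> x0 F E" and \<epsilon>: "0 < \<epsilon>" and \<mu>: "0 \<le> \<mu>"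
  obtains C d where "0 < C" "0 < d" "d \<le> x0 / 2"
    "\<And>x s. x0 - d < x \<Longrightarrow> x \<le> s \<Longrightarrow> s \<le> x0 \<Longrightarrow> F s \<le> F x"
    "\<And>x. x0 - d < x \<Longrightarrow> x \<le> x0 \<Longrightarrow> \<bar>E x\<bar> \<le> (x0 - x) * (C * F x)"
    "\<And>x. x0 / 2 \<le> x \<Longrightarrow> x \<le> x0 \<Longrightarrow> x powr (\<nu> - 1) * (\<mu> * F x powr p) \<le> C * F x"
proof -
  note D = profileD[OF P]
  obtain C where C: "0 < C" "\<And>x. x0 / 2 \<le> x \<Longrightarrow> x \<le> x0 \<Longrightarrow> \<bar>flux_deriv \<epsilon> \<mu> F x\<bar> \<le> C * F x"
    "\<And>x. x0 / 2 \<le> x \<Longrightarrow> x \<le> x0 \<Longrightarrow> x powr (\<nu> - 1) * (\<mu> * F x powr p) \<le> C * F x"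
    using flux_deriv_bound[OF P less_imp_le[OF \<epsilon>] \<mu>] by metis
  \<comment> \<open>Within this distance the bound C (x0 - x) on E / F stays below the drift
    coefficient.\<close>
  define d where "d = min (x0 / 2) (\<epsilon> * (x0 / 2) powr (\<nu> + \<kappa>) / C)"
  have d: "0 < d" "d \<le> x0 / 2" "d * C \<le> \<epsilon> * (x0 / 2) powr (\<nu> + \<kappa>)"
    using C(1) D(1) \<epsilon> by (auto simp: d_def min_def field_simps)
  have dec: "F s \<le> F x" if "x0 - d < x" "x \<le> s" "s \<le> x0" for x s
  proof (rule decreasing_near_interface[OF P \<epsilon> C(2,1)])
    have "(x0 - x) * C < d * C" using that C(1) by simp
    then show "(x0 - x) * C < \<epsilon> * (x0 / 2) powr (\<nu> + \<kappa>)" using d(3) by linarith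
  qed (use that d in auto)
  have flux: "\<bar>E x\<bar> \<le> (x0 - x) * (C * F x)" if "x0 - d < x" "x \<le> x0" for x
    by (rule flux_le_near_interface[OF P C(2,1)]) (use that d dec[of x] in auto)
  show thesis
    by (rule that[OF C(1) d(1,2) dec flux C(3)])
qed

text \<open>The pressure F^(m-1) is the quantity that vanishes linearly at the interface. As E / F
  tends to 0, its limiting slope -(m - 1)/m \<epsilon> x0^\<kappa> comes from the drift alone and
  does not see \<mu>.\<close>

lemma pressure_near_interface:
  assumes P: "profile \<epsilon> \<mu> x0 F E" and \<epsilon>: "0 < \<epsilon>" and \<mu>: "0 \<le> \<mu>"
  shows "((\<lambda>x. slope \<epsilon> F E x / F x) \<longlongrightarrow> - (\<epsilon> * x0 powr \<kappa>)) (at_left x0)"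
    and "0 < x \<Longrightarrow> x < x0 \<Longrightarrow>
      DERIV (\<lambda>x. F x powr (m - 1)) x :> (m - 1) / m * (slope \<epsilon> F E x / F x)"
    and "((\<lambda>x. F x powr (m - 1)) \<longlongrightarrow> 0) (at_left x0)"
proof -
  note D = profileD[OF P]
  obtain C d where C: "0 < C" "0 < d" "d \<le> x0 / 2"
    "\<And>x. x0 - d < x \<Longrightarrow> x \<le> x0 \<Longrightarrow> \<bar>E x\<bar> \<le> (x0 - x) * (C * F x)"
    using profile_near_interface[OF P \<epsilon> \<mu>] by metis
  have ev: "\<forall>\<^sub>F x in at_left x0. x0 - d < x \<and> x < x0"
    using C(2) by (auto simp: eventually_at_left[of "x0 - 1"] intro!: exI[of _ "x0 - d"])
  have "((\<lambda>x. E x / F x) \<longlongrightarrow> 0) (at_left x0)"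
  proof (rule Lim_null_comparison)
    show "\<forall>\<^sub>F x in at_left x0. norm (E x / F x) \<le> (x0 - x) * C"
      using ev
    proof eventually_elim
      case (elim x)
      then have "0 < F x" using D(5)[of x] C(3) D(1) by auto
      then show ?case using C(4)[of x] elim by (simp add: field_simps)
    qed
    show "((\<lambda>x. (x0 - x) * C) \<longlongrightarrow> 0) (at_left x0)"
      by (auto intro!: tendsto_eq_intros)
  qed
  then have l1: "((\<lambda>x. x powr (- \<nu>) * (E x / F x - \<epsilon> * x powr (\<nu> + \<kappa>))) \<longlongrightarrow>
      x0 powr (- \<nu>) * (0 - \<epsilon> * x0 powr (\<nu> + \<kappa>))) (at_left x0)"
    using D(1) by (intro tendsto_intros) auto
  have l2: "\<forall>\<^sub>F x in at_left x0. x powr (- \<nu>) * (E x / F x - \<epsilon> * x powr (\<nu> + \<kappa>)) = slope \<epsilon> F E x / F x"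
    using ev
  proof eventually_elim
    case (elim x)
    then have "0 < F x" using D(5)[of x] C(3) D(1) by auto
    then show ?case by (simp add: slope_def field_simps)
  qed
  have l3: "x0 powr (- \<nu>) * (0 - \<epsilon> * x0 powr (\<nu> + \<kappa>)) = - (\<epsilon> * x0 powr \<kappa>)"
    using D(1) by (simp add: powr_add powr_minus)
  show "((\<lambda>x. slope \<epsilon> F E x / F x) \<longlongrightarrow> - (\<epsilon> * x0 powr \<kappa>)) (at_left x0)"
    using l1 unfolding tendsto_cong[OF l2] l3 .
  show "DERIV (\<lambda>x. F x powr (m - 1)) x :> (m - 1) / m * (slope \<epsilon> F E x / F x)"
    if x: "0 < x" "x < x0"
  proof -
    have Fx: "0 < F x" using D(5) x by simp
    have "((\<lambda>x. F x powr (m - 1)) has_real_derivative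
        ((m - 1) * F x powr (m - 1 - 1)) * (slope \<epsilon> F E x / (m * F x powr (m - 1)))) (at x)"
      by (rule DERIV_chain2[OF has_real_derivative_powr profile_deriv[OF P x]]) (use Fx in auto)
    moreover have e: "F x powr (m - 1 - 1) = F x powr (m - 1) / F x"
      using Fx by (simp add: powr_diff power2_eq_square)
    have "((m - 1) * F x powr (m - 1 - 1)) * (slope \<epsilon> F E x / (m * F x powr (m - 1))) =
        (m - 1) / m * (slope \<epsilon> F E x / F x)"
      unfolding e using Fx by simp
    ultimately show ?thesis by simp
  qed
  have "((\<lambda>x. F x powr (m - 1)) \<longlongrightarrow> F x0 powr (m - 1)) (at_left x0)"
  proof (rule tendsto_powr')
    show "(F \<longlongrightarrow> F x0) (at_left x0)"
      using profile_isCont(1)[OF P D(1)] by (simp add: isCont_def filterlim_at_split)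
    have "\<forall>\<^sub>F x in at_left x0. 0 \<le> F x"
      using ev by eventually_elim (use D(1) C(3) D(9) in auto)
    then show "F x0 \<noteq> 0 \<or> 0 < m - 1 \<and> (\<forall>\<^sub>F x in at_left x0. 0 \<le> F x)" using m by simp
  qed auto
  then show "((\<lambda>x. F x powr (m - 1)) \<longlongrightarrow> 0) (at_left x0)" using D(6)[of x0] by simp
qed

text \<open>Both pressures vanish at x0 with the same nonzero limiting slope, which depends only on
  \<epsilon> and x0; hence l'Hopital's rule.\<close>

lemma pressure_ratio_tendsto_1:
  assumes PF: "profile \<epsilon> \<mu>' x0 F EF" and Pf: "profile \<epsilon> \<mu> x0 f Ef" and \<epsilon>: "0 < \<epsilon>" and \<mu>: "0 \<le> \<mu>" "0 \<le> \<mu>'"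
  shows "((\<lambda>x. F x powr (m - 1) / f x powr (m - 1)) \<longlongrightarrow> 1) (at_left x0)"
proof -
  note DF = profileD[OF PF] and Df = profileD[OF Pf]
  note QF = pressure_near_interface[OF PF \<epsilon> \<mu>(2)] and Qf = pressure_near_interface[OF Pf \<epsilon> \<mu>(1)]
  have nz: "- (\<epsilon> * x0 powr \<kappa>) < 0" using \<epsilon> DF(1) by simp
  have ev: "\<forall>\<^sub>F x in at_left x0. 0 < x \<and> x < x0"
    using DF(1) by (auto simp: eventually_at_left[of "x0 - 1"] intro!: exI[of _ 0])
  show ?thesis
  proof (rule lhopital_left[OF QF(3) Qf(3)])
    show "\<forall>\<^sub>F x in at_left x0. f x powr (m - 1) \<noteq> 0"
      using ev
    proof eventually_elim
      case (elim x)
      then have "0 < f x" using Df(5)[of x] by simp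
      then show ?case by simp
    qed
    show "\<forall>\<^sub>F x in at_left x0. (m - 1) / m * (slope \<epsilon> f Ef x / f x) \<noteq> 0"
      using order_tendstoD(2)[OF Qf(1) nz] by eventually_elim (use m in auto)
    show "\<forall>\<^sub>F x in at_left x0. DERIV (\<lambda>x. F x powr (m - 1)) x :> (m - 1) / m * (slope \<epsilon> F EF x / F x)"
      using ev by eventually_elim (use QF(2) in blast)
    show "\<forall>\<^sub>F x in at_left x0. DERIV (\<lambda>x. f x powr (m - 1)) x :> (m - 1) / m * (slope \<epsilon> f Ef x / f x)"
      using ev by eventually_elim (use Qf(2) in blast)
    have "((\<lambda>x. (m - 1) / m * (slope \<epsilon> F EF x / F x) / ((m - 1) / m * (slope \<epsilon> f Ef x / f x))) \<longlongrightarrow>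
        (m - 1) / m * - (\<epsilon> * x0 powr \<kappa>) / ((m - 1) / m * - (\<epsilon> * x0 powr \<kappa>))) (at_left x0)"
      by (intro tendsto_divide tendsto_mult_left QF(1) Qf(1)) (use m nz in auto)
    then show "((\<lambda>x. (m - 1) / m * (slope \<epsilon> F EF x / F x) / ((m - 1) / m * (slope \<epsilon> f Ef x / f x))) \<longlongrightarrow> 1) (at_left x0)"
      using m \<epsilon> DF(1) by simp
  qed
qed

text \<open>At a common interface the ratio of two ordered profiles tends to \<open>1\<close>, so it attains its maximum
  over a left neighbourhood of the interface unless it is constantly \<open>1\<close>. At such a maximum the
  logarithmic derivatives are ordered, which the flux balance contradicts.\<close>

lemma ratio_maximum_impossible:
  assumes PF: "profile \<epsilon> \<mu>' x0 F EF" and Pf: "profile \<epsilon> \<mu> x0 f Ef" and \<mu>: "\<mu> \<le> \<mu>'" "0 \<le> \<mu>" and \<epsilon>: "0 < \<epsilon>"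
    and le: "\<And>x. 0 \<le> x \<Longrightarrow> f x \<le> F x"
    and C: "0 < C" "\<And>x. x0 / 2 \<le> x \<Longrightarrow> x \<le> x0 \<Longrightarrow> x powr (\<nu> - 1) * (\<mu> * f x powr p) \<le> C * f x"
    and x: "x0 / 2 \<le> x" "x < x0" and dec: "\<And>s. x \<le> s \<Longrightarrow> s \<le> x0 \<Longrightarrow> f s \<le> f x"
    and \<rho>: "F x = \<rho> * f x" "1 < \<rho>" and max: "\<And>s. x \<le> s \<Longrightarrow> s \<le> x0 \<Longrightarrow> F s \<le> \<rho> * f s"
    and small: "(x0 - x) * C * m < (m - 1) * (\<epsilon> * (x0 / 2) powr (\<nu> + \<kappa>))"
  shows False
proof -
  note DF = profileD[OF PF] and Df = profileD[OF Pf]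
  have x0: "0 < x" "0 < x0" using x DF(1) by auto
  have fx: "0 < f x" using Df(5) x x0 by simp
  have Fx: "0 < F x" using DF(5) x x0 by simp
  \<comment> \<open>The quotient f^m / F^m at x. The combination r \<open>EF\<close> -
    \<open>Ef\<close> is studied: the maximum bounds it at x, and it vanishes at x0.\<close>
  define r where "r = \<rho> powr (- m)"
  have r: "0 < r" using \<rho> by (simp add: r_def)
  have r1: "\<rho> * r = \<rho> powr (1 - m)" using \<rho> by (simp add: r_def powr_diff powr_minus field_simps)
  have r_lt: "r \<le> 1" "\<rho> * r < 1"
    unfolding r1 using powr_less_mono[of "- m" 0 \<rho>] powr_less_mono[of "1 - m" 0 \<rho>] \<rho> m
    by (simp_all add: r_def)
  have young: "(m - 1) * (1 - r) \<le> m * (1 - \<rho> * r)"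
  proof -
    have "(1 / \<rho>) powr m = r" "(1 / \<rho>) powr (m - 1) = \<rho> * r"
      unfolding r1 using \<rho> by (simp_all add: r_def powr_divide powr_minus powr_diff field_simps)
    then show ?thesis using one_minus_powr_le[OF m, of "1 / \<rho>"] \<rho> by simp
  qed
  \<comment> \<open>The logarithmic derivative of F^m at x does not exceed that of f^m. The maximum
    is one-sided, so only points to the right of x are compared.\<close>
  have lt: "slope \<epsilon> F EF x * f x powr m \<le> slope \<epsilon> f Ef x * F x powr m"
  proof (rule ccontr)
    assume nle: "\<not> ?thesis"
    define g where "g y = F y powr m * f x powr m - f y powr m * F x powr m" for y
    have "DERIV g x :> slope \<epsilon> F EF x * f x powr m - slope \<epsilon> f Ef x * F x powr m"
      unfolding g_def by (intro DERIV_diff DERIV_cmult_right DF(8) Df(8) x0)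
    from DERIV_pos_inc_right[OF this] nle
    obtain d where d: "0 < d" "\<And>h. 0 < h \<Longrightarrow> h < d \<Longrightarrow> g x < g (x + h)" by auto
    define h where "h = min (d / 2) ((x0 - x) / 2)"
    have h: "0 < h" "h < d" "x + h \<le> x0" using d(1) x by (auto simp: h_def min_def field_simps)
    have "F (x + h) powr m \<le> (\<rho> * f (x + h)) powr m"
      using max[of "x + h"] h DF(9)[of "x + h"] x0 m by (intro powr_mono2) auto
    then have "F (x + h) powr m * f x powr m \<le> (\<rho> * f (x + h)) powr m * f x powr m"
      by (intro mult_right_mono) auto
    also have "\<dots> = f (x + h) powr m * F x powr m"
      using \<rho> fx Df(9)[of "x + h"] h x0 by (simp add: powr_mult)
    finally have "g (x + h) \<le> 0" by (simp add: g_def)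
    moreover have "g x = 0" by (simp add: g_def)
    ultimately show False using d(2)[OF h(1,2)] by simp
  qed
  have "F x powr m * r = f x powr m"
    using \<rho> fx by (simp add: r_def powr_mult powr_minus field_simps)
  then have "slope \<epsilon> F EF x * (F x powr m * r) \<le> slope \<epsilon> f Ef x * F x powr m"
    using lt by simp
  then have "slope \<epsilon> F EF x * r * F x powr m \<le> slope \<epsilon> f Ef x * F x powr m"
    by (simp only: mult_ac)
  then have "slope \<epsilon> F EF x * r \<le> slope \<epsilon> f Ef x" using Fx by simp
  then have "x powr (- \<nu>) * ((EF x - \<epsilon> * x powr (\<nu> + \<kappa>) * F x) * r) \<le> x powr (- \<nu>) * (Ef x - \<epsilon> * x powr (\<nu> + \<kappa>) * f x)"
    by (simp add: slope_def algebra_simps)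
  then have "(EF x - \<epsilon> * x powr (\<nu> + \<kappa>) * F x) * r \<le> Ef x - \<epsilon> * x powr (\<nu> + \<kappa>) * f x"
    using x0(1) by simp
  then have up: "r * EF x - Ef x \<le> - (\<epsilon> * x powr (\<nu> + \<kappa>) * f x * (1 - \<rho> * r))"
    unfolding \<rho>(1) by (simp add: algebra_simps)
  define K where "K s = r * EF s - Ef s" for s
  have "\<exists>z. x < z \<and> z < x0 \<and> K x0 - K x = (x0 - x) * (r * flux_deriv \<epsilon> \<mu>' F z - flux_deriv \<epsilon> \<mu> f z)"
    unfolding K_def using x x0
    by (intro MVT2 DERIV_diff DERIV_cmult DF(7) Df(7)) auto
  then obtain z where z: "x < z" "z < x0" "K x0 - K x = (x0 - x) * (r * flux_deriv \<epsilon> \<mu>' F z - flux_deriv \<epsilon> \<mu> f z)"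
    by blast
  have z0: "0 < z" using z x0 by simp
  have fz: "0 < f z" "f z \<le> F z" "F z \<le> \<rho> * f z" "f z \<le> f x"
    using Df(5)[of z] le[of z] max[of z] dec[of z] z x0 by auto
  \<comment> \<open>The drift part has a favourable sign, because r F \<le> \<rho> r f \<le> f. What
    remains is 1 - r times the source of f, which is linear in f near the interface.\<close>
  have "r * flux_deriv \<epsilon> \<mu>' F z - flux_deriv \<epsilon> \<mu> f z \<le> C * f x * (1 - r)"
  proof -
    have "r * F z \<le> \<rho> * r * f z" using fz(3) r by (metis mult.assoc mult.commute mult_left_mono less_imp_le)
    also have "\<dots> \<le> 1 * f z" using r_lt fz(1) by (intro mult_right_mono) auto
    finally have 1: "\<epsilon> * B * z powr \<kappa> * (r * F z - f z) \<le> 0"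
      using \<epsilon> B_pos by (intro mult_nonneg_nonpos mult_nonneg_nonneg) auto
    have "\<mu> * f z powr p \<le> \<mu>' * F z powr p"
      using \<mu> fz p by (intro mult_mono powr_mono2) auto
    then have "r * (\<mu> * f z powr p) \<le> r * (\<mu>' * F z powr p)" using r by simp
    then have "\<epsilon> * B * z powr \<kappa> * (r * F z - f z) - r * (\<mu>' * F z powr p) + \<mu> * f z powr p
        \<le> (1 - r) * (\<mu> * f z powr p)" using 1 by (simp add: algebra_simps)
    then have "z powr (\<nu> - 1) * (\<epsilon> * B * z powr \<kappa> * (r * F z - f z) - r * (\<mu>' * F z powr p) + \<mu> * f z powr p)
        \<le> z powr (\<nu> - 1) * ((1 - r) * (\<mu> * f z powr p))" by (intro mult_left_mono) auto
    also have "\<dots> = (1 - r) * (z powr (\<nu> - 1) * (\<mu> * f z powr p))" by simp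
    also have "\<dots> \<le> (1 - r) * (C * f x)"
    proof (rule mult_left_mono)
      have "z powr (\<nu> - 1) * (\<mu> * f z powr p) \<le> C * f z" using C(2)[of z] z x by simp
      also have "\<dots> \<le> C * f x" using fz C(1) by simp
      finally show "z powr (\<nu> - 1) * (\<mu> * f z powr p) \<le> C * f x" .
    qed (use r_lt in simp)
    finally show ?thesis by (simp add: flux_deriv_def algebra_simps)
  qed
  then have "K x0 - K x \<le> (x0 - x) * (C * f x * (1 - r))"
    unfolding z(3) using x by (intro mult_left_mono) auto
  moreover have "K x0 = 0" using profile_outside[OF PF] profile_outside[OF Pf] by (simp add: K_def)
  ultimately have "\<epsilon> * x powr (\<nu> + \<kappa>) * f x * (1 - \<rho> * r) \<le> (x0 - x) * (C * f x * (1 - r))"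
    using up by (simp add: K_def)
  then have "(\<epsilon> * x powr (\<nu> + \<kappa>) * (1 - \<rho> * r)) * f x \<le> ((x0 - x) * C * (1 - r)) * f x"
    by (simp add: algebra_simps)
  \<comment> \<open>Both sides tend to 0 as \<rho> tends to 1, so \<open>young\<close> is used to
    compare 1 - r with 1 - \<rho> r uniformly in \<rho>; then the small factor x0 - x
    decides.\<close>
  then have "\<epsilon> * x powr (\<nu> + \<kappa>) * (1 - \<rho> * r) \<le> (x0 - x) * C * (1 - r)" using fx by simp
  then have "(m - 1) * (\<epsilon> * x powr (\<nu> + \<kappa>) * (1 - \<rho> * r)) \<le> (m - 1) * ((x0 - x) * C * (1 - r))"
    using m by simp
  also have "\<dots> = (x0 - x) * C * ((m - 1) * (1 - r))" by simp
  also have "\<dots> \<le> (x0 - x) * C * (m * (1 - \<rho> * r))"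
    using x C(1) by (intro mult_left_mono young) auto
  finally have "((m - 1) * (\<epsilon> * x powr (\<nu> + \<kappa>))) * (1 - \<rho> * r) \<le> ((x0 - x) * C * m) * (1 - \<rho> * r)"
    by (simp add: algebra_simps)
  then have "(m - 1) * (\<epsilon> * x powr (\<nu> + \<kappa>)) \<le> (x0 - x) * C * m" using r_lt by simp
  moreover have "(m - 1) * (\<epsilon> * (x0 / 2) powr (\<nu> + \<kappa>)) \<le> (m - 1) * (\<epsilon> * x powr (\<nu> + \<kappa>))"
    using m \<epsilon> x x0 \<nu> \<kappa> by (intro mult_left_mono powr_mono2) auto
  ultimately show False using small by linarith
qed

lemma contact_interface:
  assumes PF: "profile \<epsilon> \<mu>' x0 F EF" and Pf: "profile \<epsilon> \<mu> x0 f Ef" and \<mu>: "\<mu> < \<mu>'" "0 \<le> \<mu>" and \<epsilon>: "0 < \<epsilon>"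
    and le: "\<And>x. 0 \<le> x \<Longrightarrow> f x \<le> F x"
  shows False
proof -
  note DF = profileD[OF PF] and Df = profileD[OF Pf]
  obtain C d where C: "0 < C" "0 < d" "d \<le> x0 / 2"
    and dec: "\<And>x s. x0 - d < x \<Longrightarrow> x \<le> s \<Longrightarrow> s \<le> x0 \<Longrightarrow> f s \<le> f x"
    and src: "\<And>x. x0 / 2 \<le> x \<Longrightarrow> x \<le> x0 \<Longrightarrow> x powr (\<nu> - 1) * (\<mu> * f x powr p) \<le> C * f x"
    using profile_near_interface[OF Pf \<epsilon> \<mu>(2)] by metis
  \<comment> \<open>Close enough to x0 for the monotonicity of f and for the smallness condition of
    \<open>ratio_maximum_impossible\<close>.\<close>
  define a where "a = max (x0 - d) (x0 - (m - 1) * (\<epsilon> * (x0 / 2) powr (\<nu> + \<kappa>)) / (C * m))"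
  have a: "a < x0" "x0 - d \<le> a"
    using C m \<epsilon> DF(1) by (auto simp: a_def)
  have small: "(x0 - x) * C * m < (m - 1) * (\<epsilon> * (x0 / 2) powr (\<nu> + \<kappa>))" if "a < x" for x
  proof -
    have "x0 - x < (m - 1) * (\<epsilon> * (x0 / 2) powr (\<nu> + \<kappa>)) / (C * m)" using that by (auto simp: a_def)
    then show ?thesis using C(1) m by (simp add: pos_less_divide_eq mult.assoc)
  qed
  have pos: "0 < f x" "0 < F x" if "a < x" "x < x0" for x
    using Df(5)[of x] DF(5)[of x] that a C(3) DF(1) by auto
  have eq: "F x = f x" if x: "a < x" "x < x0" for x
  proof (rule ccontr)
    assume "F x \<noteq> f x"
    then have gt: "f x < F x" using le[of x] x a C(3) DF(1) by auto
    define R where "R x = F x powr (m - 1) / f x powr (m - 1)" for x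
    have R_alt: "R y = (F y / f y) powr (m - 1)" if "a < y" "y < x0" for y
      using pos[OF that] by (simp add: R_def powr_divide)
    have "1 < R x" unfolding R_alt[OF x]
      using gt pos[OF x] m by (intro gr_one_powr) auto
    have lim: "(R \<longlongrightarrow> 1) (at_left x0)"
      using pressure_ratio_tendsto_1[OF PF Pf \<epsilon>] \<mu> by (simp add: R_def[abs_def])
    have "\<forall>\<^sub>F y in at_left x0. R y < R x"
      using order_tendstoD(2)[OF lim \<open>1 < R x\<close>] .
    then obtain b where b: "b < x0" "\<And>y. b < y \<Longrightarrow> y < x0 \<Longrightarrow> R y < R x"
      by (auto simp: eventually_at_left[of "x0 - 1"])
    \<comment> \<open>Beyond b the ratio is below its value at x, so a maximum over the compact
      interval {x..c} is one over all of [x, x0).\<close>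
    define c where "c = max x ((b + x0) / 2)"
    have c: "x \<le> c" "b < c" "c < x0" using b(1) x by (auto simp: c_def max_def field_simps)
    have "continuous_on {x..c} R" unfolding R_def
    proof (intro continuous_on_divide continuous_on_powr' continuous_on_const ballI)
      show "continuous_on {x..c} F" "continuous_on {x..c} f"
        using x a C(3) DF(1) by (auto intro!: continuous_on_subset[OF DF(2)] continuous_on_subset[OF Df(2)])
      show "f y powr (m - 1) \<noteq> 0" "0 \<le> F y \<and> (F y = 0 \<longrightarrow> 0 < m - 1)" "0 \<le> f y \<and> (f y = 0 \<longrightarrow> 0 < m - 1)"
        if "y \<in> {x..c}" for y using pos[of y] that x c by auto
    qed
    then obtain y where y: "x \<le> y" "y \<le> c" "\<And>s. x \<le> s \<Longrightarrow> s \<le> c \<Longrightarrow> R s \<le> R y"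
      using continuous_attains_sup[of "{x..c}" R] c(1) by auto
    have yx: "a < y" "y < x0" using y x c by auto
    have "R x \<le> R y" using y(3)[of x] c by simp
    have Rmax: "R s \<le> R y" if "y \<le> s" "s < x0" for s
      using y(3)[of s] b(2)[of s] \<open>R x \<le> R y\<close> that y(1) c by (cases "s \<le> c") auto
    define \<rho> where "\<rho> = F y / f y"
    have \<rho>: "F y = \<rho> * f y" "1 < \<rho>"
    proof -
      show "F y = \<rho> * f y" using pos[OF yx] by (simp add: \<rho>_def)
      have "\<rho> powr (m - 1) > 1" using \<open>1 < R x\<close> \<open>R x \<le> R y\<close> R_alt[OF yx] by (simp add: \<rho>_def)
      then show "1 < \<rho>"
        using powr_mono2[of "m - 1" \<rho> 1] m pos[OF yx] by (force simp: \<rho>_def)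
    qed
    show False
    proof (rule ratio_maximum_impossible[OF PF Pf _ \<mu>(2) \<epsilon> le C(1) src _ yx(2) _ \<rho> _ small[OF yx(1)]])
      show "F s \<le> \<rho> * f s" if s: "y \<le> s" "s \<le> x0" for s
      proof (cases "s = x0")
        case True then show ?thesis using DF(6)[of s] Df(6)[of s] by simp
      next
        case False
        then have s': "a < s" "s < x0" using s yx by auto
        have "(F s / f s) powr (m - 1) \<le> \<rho> powr (m - 1)"
          using Rmax[of s] s s' R_alt[OF s'] R_alt[OF yx] by (simp add: \<rho>_def)
        then have "F s / f s \<le> \<rho>"
          using powr_less_mono2[of "m - 1" \<rho> "F s / f s"] m \<rho>(2) by force
        then show ?thesis using pos[OF s'] by (simp add: field_simps)
      qed
    qed (use \<mu> yx a C dec in auto)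
  qed
  \<comment> \<open>Now F = f to the left of the interface, hence also \<open>EF\<close> =
    \<open>Ef\<close> there; but the first equations differ by a multiple of (\<mu>' - \<mu>)
    F^p.\<close>
  define x where "x = (a + x0) / 2"
  have x: "a < x" "x < x0" "0 < x" using a C(3) DF(1) by (auto simp: x_def field_simps)
  have E_eq: "EF y = Ef y" if y: "a < y" "y < x0" for y
  proof -
    have y0: "0 < y" using y a C(3) DF(1) by auto
    have "DERIV (\<lambda>x. F x powr m) y :> slope \<epsilon> f Ef y"
      by (rule has_field_derivative_transform_within_open[OF Df(8)[OF y0], of "{a<..<x0}"]) (use y eq in auto)
    then have "slope \<epsilon> F EF y = slope \<epsilon> f Ef y" using DF(8)[OF y0] DERIV_unique by blast
    then show ?thesis using y0 eq[OF y] by (simp add: slope_def)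
  qed
  have "DERIV EF x :> flux_deriv \<epsilon> \<mu> f x"
    by (rule has_field_derivative_transform_within_open[OF Df(7)[OF x(3)], of "{a<..<x0}"]) (use x E_eq in auto)
  then have "flux_deriv \<epsilon> \<mu>' F x = flux_deriv \<epsilon> \<mu> f x" using DF(7)[OF x(3)] DERIV_unique by blast
  then show False using eq[OF x(1,2)] x \<mu> pos[OF x(1,2)] by (simp add: flux_deriv_def)
qed

section \<open>Comparison of profiles by scaling\<close>

lemma contact_impossible:
  assumes PF: "profile \<epsilon> \<mu>' xF F EF" and Pf: "profile \<epsilon> \<mu> xf f Ef" and \<mu>: "\<mu> < \<mu>'" "0 \<le> \<mu>" and \<epsilon>: "0 < \<epsilon>"
    and le: "\<And>x. 0 \<le> x \<Longrightarrow> f x \<le> F x" and y: "0 \<le> y" "y \<le> xf"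
  shows "f y < F y"
proof -
  note DF = profileD[OF PF] and Df = profileD[OF Pf]
  consider "y = 0" | "0 < y" "y < xf" | "y = xf" using y by linarith
  then show ?thesis
  proof cases
    case 1
    then show ?thesis using contact_origin[OF PF Pf \<mu>(1) less_imp_le[OF \<epsilon>] le] by simp
  next
    case 2
    then show ?thesis using contact_interior[OF PF Pf \<mu>(1) le] by simp
  next
    case 3
    have "xf \<le> xF"
    proof (rule ccontr)
      assume "\<not> xf \<le> xF"
      then have "0 < f xF" "F xF = 0" using Df(5)[of xF] DF(1) DF(6)[of xF] by auto
      then show False using le[of xF] DF(1) by simp
    qed
    moreover have "xf \<noteq> xF"
      using contact_interface[of \<epsilon> \<mu>' xf F EF \<mu> f Ef] PF Pf \<mu> \<epsilon> le by auto
    ultimately show ?thesis using 3 DF(5)[of xf] Df(1) Df(6)[of xf] by auto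
  qed
qed

lemma profile_le:
  assumes P1: "profile \<epsilon> \<mu> x1 f1 E1" and P2: "profile \<epsilon> \<mu> x2 f2 E2" and \<epsilon>: "0 < \<epsilon>" and \<mu>: "0 < \<mu>" and x: "0 \<le> x"
  shows "f2 x \<le> f1 x"
proof -
  note D1 = profileD[OF P1] and D2 = profileD[OF P2]
  \<comment> \<open>The power for which A = \<Lambda>^(-e) leaves \<epsilon> unchanged.
    Subcriticality gives e (m - p) > 1, so \<mu> gains a factor greater than 1 when \<Lambda> <
    1.\<close>
  define e where "e = (1 + \<kappa>) / (m - 1)"
  have e: "0 < e" using m \<kappa> by (simp add: e_def)
  have e1: "1 < e * (m - p)"
  proof -
    have "m - 1 < (1 + \<kappa>) * (m - p)" using subcritical by (simp add: algebra_simps)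
    then show ?thesis using m by (simp add: e_def field_simps)
  qed
  define G where "G \<Lambda> x = \<Lambda> powr (- e) * f1 (\<Lambda> * x)" for \<Lambda> x
  have PG: "\<exists>x0 E. profile \<epsilon> (\<mu> * \<Lambda> powr (1 - e * (m - p))) x0 (G \<Lambda>) E" if "0 < \<Lambda>" for \<Lambda>
  proof -
    have c1: "\<epsilon> * (\<Lambda> powr (- e)) powr (m - 1) * \<Lambda> powr (1 + \<kappa>) = \<epsilon>"
      using m that by (simp add: powr_powr e_def flip: powr_add)
    have c2: "\<mu> * (\<Lambda> powr (- e)) powr (m - p) * \<Lambda> = \<mu> * \<Lambda> powr (1 - e * (m - p))"
      using that powr_add[of \<Lambda> "- (e * (m - p))" 1] by (simp add: powr_powr)
    have "0 < \<Lambda> powr (- e)" using that by simp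
    from profile_scale[OF P1 this that, unfolded c1 c2] show ?thesis
      unfolding G_def[abs_def] by blast
  qed
  \<comment> \<open>The parameters for which the scaled f1 lies above f2. The argument works with
    the supremum of this set only; domination at the supremum follows by taking limits.\<close>
  define S where "S = {\<Lambda>. 0 < \<Lambda> \<and> \<Lambda> \<le> 1 \<and> (\<forall>x\<ge>0. f2 x \<le> G \<Lambda> x)}"
  have "S \<noteq> {}"
  proof -
    have "\<exists>y\<in>{0..x1 / 2}. \<forall>z\<in>{0..x1 / 2}. f1 y \<le> f1 z"
      using D1(1) by (intro continuous_attains_inf continuous_on_subset[OF D1(2)]) auto
    then obtain y where y: "0 \<le> y" "y \<le> x1 / 2" "\<And>z. 0 \<le> z \<Longrightarrow> z \<le> x1 / 2 \<Longrightarrow> f1 y \<le> f1 z" by auto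
    have c: "0 < f1 y" using D1(1,5) y by simp
    have "continuous_on {0..x2} f2" by (intro continuous_on_subset[OF D2(2)]) auto
    then obtain K where K: "0 < K" "\<And>x. 0 \<le> x \<Longrightarrow> x \<le> x2 \<Longrightarrow> \<bar>f2 x\<bar> \<le> K"
      by (rule continuous_on_Icc_bound) blast
    \<comment> \<open>The second bound keeps \<Lambda> z within [0, x1/2] for all z \<le> x2, where
      f1 is at least f1 y > 0. The third lifts the amplitude above the bound K of f2.\<close>
    define \<Lambda> where "\<Lambda> = min 1 (min (x1 / (2 * x2)) ((K / f1 y) powr (- 1 / e)))"
    have \<Lambda>: "0 < \<Lambda>" "\<Lambda> \<le> 1" "\<Lambda> \<le> x1 / (2 * x2)" "\<Lambda> \<le> (K / f1 y) powr (- 1 / e)"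
      using D1(1) D2(1) K(1) c by (auto simp: \<Lambda>_def)
    have "K / f1 y = ((K / f1 y) powr (- 1 / e)) powr (- e)"
      using e K(1) c by (simp add: powr_powr)
    also have "\<dots> \<le> \<Lambda> powr (- e)" using \<Lambda> e by (intro powr_mono2') auto
    finally have A: "K \<le> \<Lambda> powr (- e) * f1 y" using c by (simp add: field_simps)
    have "f2 z \<le> G \<Lambda> z" if z: "0 \<le> z" for z
    proof (cases "z \<le> x2")
      case True
      have "\<Lambda> * z \<le> x1 / (2 * x2) * x2" using \<Lambda> True z D1(1) D2(1) by (intro mult_mono) auto
      then have "f1 y \<le> f1 (\<Lambda> * z)" using y(3)[of "\<Lambda> * z"] \<Lambda>(1) z D2(1) by simp
      then have "\<Lambda> powr (- e) * f1 y \<le> G \<Lambda> z" unfolding G_def by (intro mult_left_mono) auto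
      then show ?thesis using A K(2)[of z] True z by simp
    next
      case False
      then show ?thesis using D2(6)[of z] D1(9)[of "\<Lambda> * z"] \<Lambda>(1) z by (simp add: G_def)
    qed
    then show ?thesis using \<Lambda> by (auto simp: S_def)
  qed
  then obtain \<Lambda>0 where \<Lambda>0: "\<Lambda>0 \<in> S" by blast
  have bdd: "bdd_above S" by (auto simp: S_def intro!: bdd_aboveI[of _ 1])
  define L where "L = Sup S"
  have L: "0 < L" "L \<le> 1"
    using cSup_upper[OF \<Lambda>0 bdd] \<Lambda>0 cSup_least[OF \<open>S \<noteq> {}\<close>, of 1] by (auto simp: L_def S_def)
  have Glim: "((\<lambda>n. G (l n) (z n)) \<longlongrightarrow> G L y) sequentially"
    if "l \<longlonglongrightarrow> L" "z \<longlonglongrightarrow> y" "\<And>n. 0 < l n" "\<And>n. 0 \<le> z n" "0 \<le> y" for l z y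
    unfolding G_def
  proof (intro tendsto_mult tendsto_powr)
    show "(\<lambda>n. f1 (l n * z n)) \<longlonglongrightarrow> f1 (L * y)"
      by (rule continuous_on_tendsto_compose[OF D1(2)])
         (use that L in \<open>auto intro!: tendsto_mult always_eventually simp: less_imp_le\<close>)
  qed (use that L in auto)
  have le: "f2 z \<le> G L z" if z: "0 \<le> z" for z
  proof -
    have "L \<in> closure S" unfolding L_def by (rule closure_contains_Sup[OF \<open>S \<noteq> {}\<close> bdd])
    then obtain l where l: "\<And>n. l n \<in> S" "l \<longlonglongrightarrow> L" unfolding closure_sequential by blast
    have "(\<lambda>n. G (l n) z) \<longlonglongrightarrow> G L z"
      using Glim[of l "\<lambda>_. z" z] l z by (auto simp: S_def)
    moreover have "\<forall>n. f2 z \<le> G (l n) z" using l z by (auto simp: S_def)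
    ultimately show ?thesis by (meson LIMSEQ_le_const)
  qed
  have "L = 1"
  proof (rule ccontr)
    assume "L \<noteq> 1"
    then have L1: "L < 1" using L by simp
    \<comment> \<open>Parameters decreasing to L lie outside S. The points where domination fails
      stay in the compact set {0..x2} and accumulate at a point of contact.\<close>
    define l where "l n = L + (1 - L) * inverse (real (Suc n))" for n
    have l: "L < l n" "l n \<le> 1" for n
    proof -
      have "(1 - L) * inverse (real (Suc n)) \<le> (1 - L) * 1"
        using L1 by (intro mult_left_mono) (auto simp: inverse_le_1_iff)
      then show "l n \<le> 1" by (simp add: l_def)
      show "L < l n" using L1 by (simp add: l_def)
    qed
    have lL: "l \<longlonglongrightarrow> L" unfolding l_def
      using tendsto_add[OF tendsto_const tendsto_mult[OF tendsto_const LIMSEQ_inverse_real_of_nat], of L "1 - L"] by simp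
    have "\<exists>z\<ge>0. G (l n) z < f2 z" for n
    proof -
      have "l n \<notin> S" using cSup_upper[OF _ bdd, of "l n"] l(1)[of n] by (auto simp: L_def)
      then show ?thesis using l[of n] L by (auto simp: S_def not_le)
    qed
    then obtain z where z: "\<And>n. 0 \<le> z n" "\<And>n. G (l n) (z n) < f2 (z n)" by metis
    have Gnn: "0 \<le> G (l n) (z n)" for n
      using D1(9)[of "l n * z n"] z(1)[of n] l(1)[of n] L by (simp add: G_def)
    have "z n \<le> x2" for n
      using D2(6)[of "z n"] Gnn[of n] z(2)[of n] by (cases "z n \<le> x2") auto
    then have "\<And>n. z n \<in> {0..x2}" using z(1) by auto
    then obtain y r where y: "y \<in> {0..x2}" "strict_mono r" "(z \<circ> r) \<longlonglongrightarrow> y"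
      using compact_Icc[of 0 x2] unfolding compact_def by metis
    have "(\<lambda>n. G ((l \<circ> r) n) ((z \<circ> r) n)) \<longlonglongrightarrow> G L y"
      using z(1) l(1) L y by (intro Glim LIMSEQ_subseq_LIMSEQ[OF lL]) (auto intro: less_trans simp: o_def)
    moreover have "(\<lambda>n. f2 ((z \<circ> r) n)) \<longlonglongrightarrow> f2 y"
      by (rule continuous_on_tendsto_compose[OF D2(2) y(3)]) (use y z in auto)
    ultimately have "G L y \<le> f2 y"
      by (rule LIMSEQ_le) (use z(2) in \<open>auto intro!: exI[of _ 0] less_imp_le\<close>)
    obtain x0 E where P: "profile \<epsilon> (\<mu> * L powr (1 - e * (m - p))) x0 (G L) E" using PG[OF L(1)] by blast
    have "1 < L powr (1 - e * (m - p))" using powr_less_mono'[of L "1 - e * (m - p)" 0] L(1) L1 e1 by simp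
    then have "\<mu> < \<mu> * L powr (1 - e * (m - p))" using \<mu> by simp
    then have "f2 y < G L y"
      by (rule contact_impossible[OF P P2 _ _ \<epsilon> le]) (use \<mu> y in auto)
    then show False using \<open>G L y \<le> f2 y\<close> by simp
  qed
  then show ?thesis using le[OF x] by (simp add: G_def)
qed

lemma profile_unique:
  assumes "profile \<epsilon> \<mu> x1 f1 E1" "profile \<epsilon> \<mu> x2 f2 E2" "0 < \<epsilon>" "0 < \<mu>" "0 \<le> x"
  shows "f1 x = f2 x"
  using profile_le[OF assms(1,2,3,4,5)] profile_le[OF assms(2,1,3,4,5)] by simp

end

section \<open>The initial value problem\<close>

lemma continuous_on_powr_const:
  fixes e :: real
  assumes "0 < e" "S \<subseteq> {0..}"
  shows "continuous_on S (\<lambda>x. x powr e)"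
  using assms by (intro continuous_on_powr' continuous_on_id continuous_on_const) auto

text \<open>The substitution \<open>y = s\<^sup>\<nu>\<close> turns the singular weight of the primitive of \<open>s\<^sup>\<nu>\<^sup>-\<^sup>1 h(s)\<close> into a constant.\<close>

definition wint :: "real \<Rightarrow> (real \<Rightarrow> real) \<Rightarrow> real \<Rightarrow> real" where
  "wint \<nu> h s = integral {0..s powr \<nu>} (\<lambda>y. h (y powr (1 / \<nu>))) / \<nu>"

lemma continuous_on_wint_integrand:
  fixes h :: "real \<Rightarrow> real"
  assumes "0 < \<nu>" "continuous_on {0..X} h" "0 \<le> X"
  shows "continuous_on {0..X powr \<nu>} (\<lambda>y. h (y powr (1 / \<nu>)))"
proof (rule continuous_on_compose2[OF assms(2)])
  show "continuous_on {0..X powr \<nu>} (\<lambda>y. y powr (1 / \<nu>))"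
    using assms(1) by (intro continuous_on_powr_const) auto
  show "(\<lambda>y. y powr (1 / \<nu>)) ` {0..X powr \<nu>} \<subseteq> {0..X}"
  proof
    fix z assume "z \<in> (\<lambda>y. y powr (1 / \<nu>)) ` {0..X powr \<nu>}"
    then obtain y where y: "0 \<le> y" "y \<le> X powr \<nu>" "z = y powr (1 / \<nu>)" by auto
    then have "z \<le> (X powr \<nu>) powr (1 / \<nu>)" using assms(1) by (auto intro!: powr_mono2)
    then show "z \<in> {0..X}" using assms y by (simp add: powr_powr)
  qed
qed

lemma wint_0 [simp]: "wint \<nu> h 0 = 0"
  by (simp add: wint_def)

lemma continuous_on_wint:
  assumes "0 < \<nu>" "continuous_on {0..X} h" "0 \<le> X"
  shows "continuous_on {0..X} (wint \<nu> h)"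
  unfolding wint_def
proof (intro continuous_intros)
  have "continuous_on {0..X powr \<nu>} (\<lambda>x. integral {0..x} (\<lambda>y. h (y powr (1 / \<nu>))))"
    by (intro indefinite_integral_continuous_1 integrable_continuous_interval continuous_on_wint_integrand assms)
  then show "continuous_on {0..X} (\<lambda>x. integral {0..x powr \<nu>} (\<lambda>y. h (y powr (1 / \<nu>))))"
    by (rule continuous_on_compose2) (use assms(1) in \<open>auto intro!: continuous_on_powr_const powr_mono2\<close>)
qed (use assms in auto)

lemma wint_has_derivative:
  assumes "0 < \<nu>" "continuous_on {0..X} h" "0 < s" "s < X"
  shows "DERIV (wint \<nu> h) s :> s powr (\<nu> - 1) * h s"
proof -
  let ?g = "\<lambda>y. h (y powr (1 / \<nu>))"
  have "((\<lambda>x. integral {0..x} ?g) has_real_derivative ?g (s powr \<nu>)) (at (s powr \<nu>) within {0..X powr \<nu>})"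
    using assms by (intro integral_has_real_derivative continuous_on_wint_integrand) (auto intro!: powr_mono2)
  moreover have "at (s powr \<nu>) within {0..X powr \<nu>} = at (s powr \<nu>)"
    using assms by (intro at_within_Icc_at) (auto intro!: powr_less_mono2)
  ultimately have "DERIV (\<lambda>x. integral {0..x} ?g) (s powr \<nu>) :> ?g (s powr \<nu>)" by simp
  then have "DERIV (\<lambda>x. integral {0..x powr \<nu>} ?g / \<nu>) s :> ?g (s powr \<nu>) * (\<nu> * s powr (\<nu> - 1)) / \<nu>"
    using assms by (intro DERIV_cdivide DERIV_chain2[of "\<lambda>x. integral {0..x} ?g"] has_real_derivative_powr)
  then show ?thesis using assms by (simp add: wint_def[abs_def] powr_powr mult.commute)
qed

lemma wint_bound:
  assumes "0 < \<nu>" "continuous_on {0..s} h" "0 \<le> s" "\<And>r. 0 \<le> r \<Longrightarrow> r \<le> s \<Longrightarrow> \<bar>h r\<bar> \<le> K"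
  shows "\<bar>wint \<nu> h s\<bar> \<le> s powr \<nu> * (K / \<nu>)"
proof -
  have "norm (integral {0..s powr \<nu>} (\<lambda>y. h (y powr (1 / \<nu>)))) \<le> K * (s powr \<nu> - 0)"
  proof (rule integral_bound)
    fix y assume y: "y \<in> {0..s powr \<nu>}"
    then have "y powr (1 / \<nu>) \<le> (s powr \<nu>) powr (1 / \<nu>)" using assms(1) by (auto intro!: powr_mono2)
    then show "norm (h (y powr (1 / \<nu>))) \<le> K" using assms(1,3,4) by (simp add: powr_powr)
  qed (use assms continuous_on_wint_integrand in auto)
  then show ?thesis using assms(1) by (simp add: wint_def abs_divide divide_right_mono mult.commute)
qed

lemma wint_diff:
  assumes "0 < \<nu>" "continuous_on {0..s} h1" "continuous_on {0..s} h2" "0 \<le> s"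
  shows "wint \<nu> h1 s - wint \<nu> h2 s = wint \<nu> (\<lambda>r. h1 r - h2 r) s"
  unfolding wint_def
  by (subst integral_diff)
     (use assms in \<open>auto intro!: integrable_continuous_interval continuous_on_wint_integrand simp: diff_divide_distrib\<close>)

text \<open>Up to the factor 1/\<nu> the expression is a weighted mean of h over [0, s], so
  comparison with the constant h 0 gives the limit. It removes the singularity of the slope at
  0.\<close>

lemma wint_over_powr_tendsto:
  assumes "0 < \<nu>" "continuous_on {0..X} h" "0 < X"
  shows "((\<lambda>s. s powr (- \<nu>) * wint \<nu> h s) \<longlongrightarrow> h 0 / \<nu>) (at 0 within {0..X})"
  unfolding tendsto_iff
proof (intro allI impI)
  fix e :: real assume e: "0 < e"
  obtain d where d: "0 < d" "\<And>x. 0 \<le> x \<Longrightarrow> x \<le> X \<Longrightarrow> x < d \<Longrightarrow> \<bar>h x - h 0\<bar> < e * \<nu> / 2"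
    using assms(2)[unfolded continuous_on_iff, rule_format, of 0 "e * \<nu> / 2"] e assms
    by (auto simp: dist_real_def)
  have ev: "\<forall>\<^sub>F s in at 0 within {0..X}. 0 < s \<and> s \<le> X \<and> s < d"
    using d(1) unfolding eventually_at by (auto simp: dist_real_def intro!: exI[of _ d])
  then show "\<forall>\<^sub>F s in at 0 within {0..X}. dist (s powr (- \<nu>) * wint \<nu> h s) (h 0 / \<nu>) < e"
  proof eventually_elim
    case (elim s)
    have c: "continuous_on {0..s} h" using elim by (intro continuous_on_subset[OF assms(2)]) auto
    have "wint \<nu> (\<lambda>_. h 0) s = s powr \<nu> * (h 0 / \<nu>)" by (simp add: wint_def)
    moreover have "\<bar>wint \<nu> h s - wint \<nu> (\<lambda>_. h 0) s\<bar> \<le> s powr \<nu> * (e * \<nu> / 2 / \<nu>)"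
      unfolding wint_diff[OF assms(1) c continuous_on_const less_imp_le[OF conjunct1[OF elim]]]
      using d(2) elim assms(1) c by (intro wint_bound) (auto intro!: continuous_intros less_imp_le)
    ultimately have "\<bar>wint \<nu> h s - s powr \<nu> * (h 0 / \<nu>)\<bar> \<le> s powr \<nu> * (e / 2)" using assms(1) by simp
    moreover have "\<bar>s powr (- \<nu>) * wint \<nu> h s - h 0 / \<nu>\<bar> = s powr (- \<nu>) * \<bar>wint \<nu> h s - s powr \<nu> * (h 0 / \<nu>)\<bar>"
    proof -
      have "s powr (- \<nu>) * (wint \<nu> h s - s powr \<nu> * (h 0 / \<nu>)) = s powr (- \<nu>) * wint \<nu> h s - h 0 / \<nu>"
        using elim by (simp add: right_diff_distrib powr_minus)
      then show ?thesis by (simp flip: abs_mult_pos add: abs_mult) (metis abs_mult abs_of_nonneg powr_ge_zero)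
    qed
    moreover have "s powr (- \<nu>) * (s powr \<nu> * (e / 2)) = e / 2" using elim by (simp add: powr_minus)
    ultimately have "\<bar>s powr (- \<nu>) * wint \<nu> h s - h 0 / \<nu>\<bar> \<le> e / 2"
      by (metis mult_left_mono powr_ge_zero)
    then show ?case using e by (simp add: dist_real_def)
  qed
qed

text \<open>On [\<delta>, infinity) the derivative e z^(e-1) is at most \<delta>^(e-1) \<le>
  1/\<delta>. The exponents that occur are 1/m and p/m.\<close>

lemma truncated_powr_lipschitz:
  fixes a b e \<delta> :: real
  assumes "0 < \<delta>" "\<delta> \<le> 1" "0 \<le> e" "e \<le> 1"
  shows "\<bar>max a \<delta> powr e - max b \<delta> powr e\<bar> \<le> \<bar>a - b\<bar> / \<delta>"
proof -
  have *: "v powr e - u powr e \<le> (v - u) / \<delta>" if uv: "\<delta> \<le> u" "u < v" for u v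
  proof -
    have "\<exists>z>u. z < v \<and> v powr e - u powr e = (v - u) * (e * z powr (e - 1))"
      using uv assms(1) by (intro MVT2 has_real_derivative_powr) auto
    then obtain z where z: "u < z" "z < v" "v powr e - u powr e = (v - u) * (e * z powr (e - 1))" by blast
    have "e * z powr (e - 1) \<le> 1 * \<delta> powr (e - 1)"
      using assms z uv by (intro mult_mono powr_mono2') auto
    also have "\<dots> \<le> \<delta> powr (- 1)" using assms powr_mono'[of "-1" "e - 1" \<delta>] by simp
    also have "\<dots> = 1 / \<delta>" using assms by (simp add: powr_minus_divide)
    finally have "(v - u) * (e * z powr (e - 1)) \<le> (v - u) * (1 / \<delta>)" using uv by (intro mult_left_mono) auto
    then show ?thesis using z(3) by simp
  qed
  have mono: "u powr e \<le> v powr e" if "\<delta> \<le> u" "u \<le> v" for u v :: real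
    using that assms by (intro powr_mono2) auto
  have **: "\<bar>u powr e - v powr e\<bar> \<le> \<bar>u - v\<bar> / \<delta>" if "\<delta> \<le> u" "\<delta> \<le> v" for u v
    using *[of u v] *[of v u] mono[of u v] mono[of v u] that
    by (cases u v rule: linorder_cases) (auto simp: abs_if)
  have "\<bar>max a \<delta> powr e - max b \<delta> powr e\<bar> \<le> \<bar>max a \<delta> - max b \<delta>\<bar> / \<delta>" by (rule **) auto
  also have "\<dots> \<le> \<bar>a - b\<bar> / \<delta>" using assms by (intro divide_right_mono) auto
  finally show ?thesis .
qed

section \<open>Picard iteration for the truncated problem\<close>

context profile_equation
begin

text \<open>Truncating \<open>G = F\<^sup>m\<close> from below at \<open>\<delta>\<close> makes the right-hand side Lipschitz.\<close>

definition src :: "real \<Rightarrow> real \<Rightarrow> (real \<Rightarrow> real) \<Rightarrow> real \<Rightarrow> real" where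
  "src \<tau> \<delta> G s = (1 - \<tau>) * B * s powr \<kappa> * max (G s) \<delta> powr (1 / m) - \<tau> * max (G s) \<delta> powr (p / m)"

text \<open>The slope of the second equation, with E replaced by the primitive of the source. The
  value at 0 is the limit found in \<open>wint_over_powr_tendsto\<close>, which makes the function
  continuous on closed intervals.\<close>

definition rate :: "real \<Rightarrow> real \<Rightarrow> (real \<Rightarrow> real) \<Rightarrow> real \<Rightarrow> real" where
  "rate \<tau> \<delta> G s = (if s = 0 then src \<tau> \<delta> G 0 / \<nu> else s powr (- \<nu>) * wint \<nu> (src \<tau> \<delta> G) s)
     - (1 - \<tau>) * s powr \<kappa> * max (G s) \<delta> powr (1 / m)"

definition picard :: "real \<Rightarrow> real \<Rightarrow> (real \<Rightarrow> real) \<Rightarrow> real \<Rightarrow> real" where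
  "picard \<tau> \<delta> G x = 1 + integral {0..x} (rate \<tau> \<delta> G)"

text \<open>A primitive of 1 + s^\<kappa>, which describes how the Lipschitz constant of
  \<open>rate\<close> grows with s. Weighting the supremum norm by exp(- growth * clock) makes the
  iteration a contraction on every interval [0, X], however long.\<close>

definition clock :: "real \<Rightarrow> real" where
  "clock x = x + x powr (\<kappa> + 1) / (\<kappa> + 1)"

text \<open>Twice the Lipschitz constant of \<open>rate\<close> relative to 1 + s^\<kappa>, so that
  the contraction factor is 1/2.\<close>

definition growth :: "real \<Rightarrow> real" where
  "growth \<delta> = 2 * (((B + 1) / \<nu> + 1) / \<delta>)"

lemma clock_mono: "0 \<le> x \<Longrightarrow> x \<le> y \<Longrightarrow> clock x \<le> clock y"
  using \<kappa> by (auto simp: clock_def intro!: add_mono divide_right_mono powr_mono2)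

lemma growth_pos: "0 < \<delta> \<Longrightarrow> 0 < growth \<delta>"
  using B_pos \<nu> by (auto simp: growth_def intro!: divide_pos_pos add_pos_pos)

lemma continuous_on_src:
  assumes "continuous_on {0..X} G" "0 < \<delta>"
  shows "continuous_on {0..X} (src \<tau> \<delta> G)"
  unfolding src_def[abs_def] using assms \<kappa>
  by (intro continuous_intros continuous_on_powr' continuous_on_max) auto

lemma continuous_on_rate:
  assumes "continuous_on {0..X} G" "0 < \<delta>" "0 \<le> X"
  shows "continuous_on {0..X} (rate \<tau> \<delta> G)"
proof (cases "X = 0")
  case False
  then have X: "0 < X" using assms by simp
  note c = continuous_on_src[OF assms(1,2), of \<tau>]
  let ?f = "\<lambda>s. if s = 0 then src \<tau> \<delta> G 0 / \<nu> else s powr (- \<nu>) * wint \<nu> (src \<tau> \<delta> G) s"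
  have "continuous_on {0..X} ?f"
    unfolding continuous_on_eq_continuous_within
  proof
    fix s assume s: "s \<in> {0..X}"
    show "continuous (at s within {0..X}) ?f"
    proof (cases "s = 0")
      case True
      have "(?f \<longlongrightarrow> src \<tau> \<delta> G 0 / \<nu>) (at 0 within {0..X})"
        by (rule Lim_transform_eventually[OF wint_over_powr_tendsto[OF \<nu> c X]])
           (auto simp: eventually_at_filter)
      then show ?thesis using True by (simp add: continuous_within)
    next
      case False
      have "continuous_on {0<..X} (\<lambda>s. s powr (- \<nu>) * wint \<nu> (src \<tau> \<delta> G) s)"
        by (intro continuous_intros continuous_on_subset[OF continuous_on_wint[OF \<nu> c]]) (use X in auto)
      then have "continuous_on {0<..X} ?f" by (rule continuous_on_eq) auto
      then have "continuous (at s within {0<..X}) ?f"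
        using s False by (auto simp: continuous_on_eq_continuous_within)
      moreover have "at s within {0<..X} = at s within {0..X}"
        using s False by (intro at_within_nhd[of s "{0<..}"]) auto
      ultimately show ?thesis by simp
    qed
  qed
  then show ?thesis unfolding rate_def[abs_def] using assms \<kappa>
    by (intro continuous_on_diff continuous_intros continuous_on_powr' continuous_on_max) auto
qed simp

lemma continuous_on_picard:
  assumes "continuous_on {0..X} G" "0 < \<delta>" "0 \<le> X"
  shows "continuous_on {0..X} (picard \<tau> \<delta> G)"
  unfolding picard_def[abs_def]
  by (intro continuous_intros indefinite_integral_continuous_1 integrable_continuous_interval continuous_on_rate assms)

lemma rate_diff_bound:
  assumes c: "continuous_on {0..s} G1" "continuous_on {0..s} G2" and \<delta>: "0 < \<delta>" and s: "0 \<le> s" and \<tau>: "0 \<le> \<tau>'" "\<tau>' \<le> 1"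
    and src: "\<And>r. 0 \<le> r \<Longrightarrow> r \<le> s \<Longrightarrow> \<bar>src \<tau> \<delta> G1 r - src \<tau>' \<delta> G2 r\<bar> \<le> K"
    and abs: "\<bar>(1 - \<tau>) * max (G1 s) \<delta> powr (1 / m) - (1 - \<tau>') * max (G2 s) \<delta> powr (1 / m)\<bar> \<le> K'"
  shows "\<bar>rate \<tau> \<delta> G1 s - rate \<tau>' \<delta> G2 s\<bar> \<le> K / \<nu> + s powr \<kappa> * K'"
proof -
  let ?f = "\<lambda>\<tau> G. if s = 0 then src \<tau> \<delta> G 0 / \<nu> else s powr (- \<nu>) * wint \<nu> (src \<tau> \<delta> G) s"
  have "\<bar>?f \<tau> G1 - ?f \<tau>' G2\<bar> \<le> K / \<nu>"
  proof (cases "s = 0")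
    case True
    then show ?thesis using src[of 0] \<nu> by (simp add: divide_right_mono flip: diff_divide_distrib)
  next
    case False
    have "\<bar>wint \<nu> (src \<tau> \<delta> G1) s - wint \<nu> (src \<tau>' \<delta> G2) s\<bar> \<le> s powr \<nu> * (K / \<nu>)"
      unfolding wint_diff[OF \<nu> continuous_on_src[OF c(1) \<delta>] continuous_on_src[OF c(2) \<delta>] s]
      by (intro wint_bound \<nu> continuous_on_diff continuous_on_src c \<delta> s src)
    then have "s powr (- \<nu>) * \<bar>wint \<nu> (src \<tau> \<delta> G1) s - wint \<nu> (src \<tau>' \<delta> G2) s\<bar> \<le> s powr (- \<nu>) * (s powr \<nu> * (K / \<nu>))"
      by (intro mult_left_mono) auto
    also have "\<dots> = K / \<nu>" using False s by (simp add: powr_minus)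
    finally show ?thesis using False by (simp add: abs_mult flip: right_diff_distrib)
  qed
  moreover have "\<bar>s powr \<kappa> * ((1 - \<tau>) * max (G1 s) \<delta> powr (1 / m) - (1 - \<tau>') * max (G2 s) \<delta> powr (1 / m))\<bar> \<le> s powr \<kappa> * K'"
    unfolding abs_mult using abs by (simp add: mult_left_mono)
  ultimately have "\<bar>(?f \<tau> G1 - ?f \<tau>' G2) - s powr \<kappa> * ((1 - \<tau>) * max (G1 s) \<delta> powr (1 / m) - (1 - \<tau>') * max (G2 s) \<delta> powr (1 / m))\<bar>
      \<le> K / \<nu> + s powr \<kappa> * K'" by linarith
  then show ?thesis unfolding rate_def by (simp add: algebra_simps)
qed

lemma clock_integral:
  assumes "0 < c" "0 \<le> x"
  shows "((\<lambda>s. c * (1 + s powr \<kappa>) * exp (c * clock s)) has_integral (exp (c * clock x) - 1)) {0..x}"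
proof -
  have "((\<lambda>s. c * (1 + s powr \<kappa>) * exp (c * clock s)) has_integral (exp (c * clock x) - exp (c * clock 0))) {0..x}"
  proof (rule fundamental_theorem_of_calculus_interior[OF assms(2)])
    show "continuous_on {0..x} (\<lambda>s. exp (c * clock s))"
      unfolding clock_def using \<kappa> by (intro continuous_intros continuous_on_powr') auto
    fix s assume "s \<in> {0<..<x}"
    then have s: "0 < s" by simp
    have "DERIV (\<lambda>s. exp (c * clock s)) s :> exp (c * clock s) * (c * (1 + (\<kappa> + 1) * s powr (\<kappa> + 1 - 1) / (\<kappa> + 1)))"
      unfolding clock_def using s \<kappa>
      by (intro DERIV_chain2[OF DERIV_exp] DERIV_cmult DERIV_add DERIV_ident DERIV_cdivide has_real_derivative_powr)
    then show "((\<lambda>s. exp (c * clock s)) has_vector_derivative c * (1 + s powr \<kappa>) * exp (c * clock s)) (at s)"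
      using \<kappa> by (simp add: has_real_derivative_iff_has_vector_derivative mult_ac)
  qed
  then show ?thesis using \<kappa> by (simp add: clock_def)
qed

lemma picard_contraction:
  assumes c: "continuous_on {0..X} G1" "continuous_on {0..X} G2" and \<delta>: "0 < \<delta>" "\<delta> \<le> 1" and \<tau>: "0 \<le> \<tau>" "\<tau> \<le> 1"
    and K: "0 \<le> K" "\<And>s. 0 \<le> s \<Longrightarrow> s \<le> X \<Longrightarrow> \<bar>G1 s - G2 s\<bar> \<le> K * exp (growth \<delta> * clock s)"
    and x: "0 \<le> x" "x \<le> X"
  shows "\<bar>picard \<tau> \<delta> G1 x - picard \<tau> \<delta> G2 x\<bar> \<le> K / 2 * exp (growth \<delta> * clock x)"
proof -
  let ?c = "growth \<delta>"
  have sub: "continuous_on {0..s} G1" "continuous_on {0..s} G2" if "s \<le> X" for s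
    using that by (auto intro: continuous_on_subset[OF c(1)] continuous_on_subset[OF c(2)])
  have rate: "\<bar>rate \<tau> \<delta> G1 s - rate \<tau> \<delta> G2 s\<bar> \<le> K / 2 * (?c * (1 + s powr \<kappa>) * exp (?c * clock s))"
    if s: "0 \<le> s" "s \<le> X" for s
  proof -
    define D where "D = K * exp (?c * clock s) / \<delta>"
    have D0: "0 \<le> D" using K \<delta> by (simp add: D_def)
    have lip: "\<bar>max (G1 r) \<delta> powr e - max (G2 r) \<delta> powr e\<bar> \<le> D" if "0 \<le> r" "r \<le> s" "0 \<le> e" "e \<le> 1" for r e
    proof -
      have "\<bar>max (G1 r) \<delta> powr e - max (G2 r) \<delta> powr e\<bar> \<le> \<bar>G1 r - G2 r\<bar> / \<delta>"
        by (rule truncated_powr_lipschitz) (use \<delta> that in auto)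
      also have "\<dots> \<le> K * exp (?c * clock r) / \<delta>" using K(2)[of r] that s \<delta> by (intro divide_right_mono) auto
      also have "\<dots> \<le> D" unfolding D_def using that \<delta> K(1) growth_pos[OF \<delta>(1)]
        by (intro divide_right_mono mult_left_mono) (auto intro!: clock_mono)
      finally show ?thesis .
    qed
    have "\<bar>rate \<tau> \<delta> G1 s - rate \<tau> \<delta> G2 s\<bar> \<le> (B + 1) * (1 + s powr \<kappa>) * D / \<nu> + s powr \<kappa> * D"
    proof (rule rate_diff_bound[OF sub[OF s(2)] \<delta>(1) s(1) \<tau>])
      show "\<bar>(1 - \<tau>) * max (G1 s) \<delta> powr (1 / m) - (1 - \<tau>) * max (G2 s) \<delta> powr (1 / m)\<bar> \<le> D"
      proof -
        have "(1 - \<tau>) * \<bar>max (G1 s) \<delta> powr (1 / m) - max (G2 s) \<delta> powr (1 / m)\<bar> \<le> 1 * D"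
          using lip[of s "1 / m"] s m \<tau> by (intro mult_mono) auto
        then show ?thesis using \<tau> by (simp add: abs_mult flip: right_diff_distrib)
      qed
      fix r assume r: "0 \<le> r" "r \<le> s"
      let ?a = "max (G1 r) \<delta> powr (1 / m) - max (G2 r) \<delta> powr (1 / m)"
      let ?b = "max (G1 r) \<delta> powr (p / m) - max (G2 r) \<delta> powr (p / m)"
      have "src \<tau> \<delta> G1 r - src \<tau> \<delta> G2 r = (1 - \<tau>) * B * r powr \<kappa> * ?a - \<tau> * ?b"
        by (simp add: src_def algebra_simps)
      also have "\<bar>\<dots>\<bar> \<le> \<bar>(1 - \<tau>) * B * r powr \<kappa> * ?a\<bar> + \<bar>\<tau> * ?b\<bar>" by (rule abs_triangle_ineq4)
      also have "\<dots> = (1 - \<tau>) * B * r powr \<kappa> * \<bar>?a\<bar> + \<tau> * \<bar>?b\<bar>"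
        using \<tau> B_pos by (simp add: abs_mult)
      also have "\<dots> \<le> 1 * B * s powr \<kappa> * D + 1 * D"
        using lip[of r "1 / m"] lip[of r "p / m"] r m p \<tau> B_pos \<kappa>
        by (intro add_mono mult_mono powr_mono2 mult_nonneg_nonneg) auto
      also have "\<dots> \<le> (B + 1) * (1 + s powr \<kappa>) * D"
        using D0 B_pos by (simp add: algebra_simps)
      finally show "\<bar>src \<tau> \<delta> G1 r - src \<tau> \<delta> G2 r\<bar> \<le> (B + 1) * (1 + s powr \<kappa>) * D" .
    qed
    also have "\<dots> \<le> (B + 1) * (1 + s powr \<kappa>) * D / \<nu> + (1 + s powr \<kappa>) * D"
      using D0 by (simp add: algebra_simps)
    also have "\<dots> = K / 2 * (?c * (1 + s powr \<kappa>) * exp (?c * clock s))"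
      by (simp add: D_def growth_def algebra_simps add_divide_distrib)
    finally show ?thesis .
  qed
  have int: "rate \<tau> \<delta> G integrable_on {0..x}" if "continuous_on {0..X} G" for G
    using that x \<delta> by (intro integrable_continuous_interval continuous_on_rate) (auto intro: continuous_on_subset)
  have hi: "((\<lambda>s. K / 2 * (?c * (1 + s powr \<kappa>) * exp (?c * clock s))) has_integral K / 2 * (exp (?c * clock x) - 1)) {0..x}"
    by (intro has_integral_mult_right clock_integral growth_pos \<delta> x)
  have "\<bar>picard \<tau> \<delta> G1 x - picard \<tau> \<delta> G2 x\<bar> = norm (integral {0..x} (\<lambda>s. rate \<tau> \<delta> G1 s - rate \<tau> \<delta> G2 s))"
    using int c by (simp add: picard_def integral_diff)
  also have "\<dots> \<le> integral {0..x} (\<lambda>s. K / 2 * (?c * (1 + s powr \<kappa>) * exp (?c * clock s)))"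
    using rate x hi int c by (intro integral_norm_bound_integral integrable_diff) auto
  also have "\<dots> = K / 2 * (exp (?c * clock x) - 1)" using hi by (rule integral_unique)
  also have "\<dots> \<le> K / 2 * exp (?c * clock x)" using K(1) by (simp add: algebra_simps)
  finally show ?thesis .
qed

text \<open>If \<open>G\<close> solves the fixed point equation up to \<open>\<eta>\<close> and \<open>G'\<close> solves it exactly, then the supremum \<open>K\<close> of
  the weighted distance satisfies \<open>K \<le> K / 2 + \<eta>\<close>.\<close>

lemma picard_stable:
  assumes c: "continuous_on {0..X} G" "continuous_on {0..X} G'" and \<delta>: "0 < \<delta>" "\<delta> \<le> 1" and \<tau>: "0 \<le> \<tau>" "\<tau> \<le> 1"
    and fixp: "\<And>x. 0 \<le> x \<Longrightarrow> x \<le> X \<Longrightarrow> picard \<tau> \<delta> G' x = G' x"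
    and near: "\<And>x. 0 \<le> x \<Longrightarrow> x \<le> X \<Longrightarrow> \<bar>picard \<tau> \<delta> G x - G x\<bar> \<le> \<eta>"
    and x: "0 \<le> x" "x \<le> X"
  shows "\<bar>G' x - G x\<bar> \<le> 2 * \<eta> * exp (growth \<delta> * clock x)"
proof -
  define D where "D x = \<bar>G' x - G x\<bar> * exp (- (growth \<delta> * clock x))" for x
  have D: "\<bar>G' s - G s\<bar> = D s * exp (growth \<delta> * clock s)" for s by (simp add: D_def exp_minus)
  have "continuous_on {0..X} D"
    unfolding D_def clock_def using \<kappa> c by (intro continuous_intros continuous_on_powr_const) auto
  then obtain y where y: "0 \<le> y" "y \<le> X" "\<And>s. 0 \<le> s \<Longrightarrow> s \<le> X \<Longrightarrow> D s \<le> D y"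
    using continuous_attains_sup[of "{0..X}" D] x by auto
  have "\<bar>picard \<tau> \<delta> G' y - picard \<tau> \<delta> G y\<bar> \<le> D y / 2 * exp (growth \<delta> * clock y)"
  proof (rule picard_contraction[OF c(2,1) \<delta> \<tau>])
    show "0 \<le> D y" by (simp add: D_def)
    show "\<bar>G' s - G s\<bar> \<le> D y * exp (growth \<delta> * clock s)" if "0 \<le> s" "s \<le> X" for s
      using y(3)[OF that] by (simp add: D)
  qed (use y in auto)
  moreover have "\<eta> \<le> \<eta> * exp (growth \<delta> * clock y)"
  proof -
    have "0 \<le> \<eta>" using near[OF x] by linarith
    moreover have "0 \<le> growth \<delta> * clock y"
      using growth_pos[OF \<delta>(1)] clock_mono[of 0 y] y \<kappa> by (simp add: clock_def)
    ultimately show ?thesis using mult_left_mono[of 1 "exp (growth \<delta> * clock y)" \<eta>] by simp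
  qed
  moreover have "\<bar>G' y - G y\<bar> \<le> \<bar>picard \<tau> \<delta> G' y - picard \<tau> \<delta> G y\<bar> + \<eta>"
    using fixp[OF y(1,2)] near[OF y(1,2)] by linarith
  ultimately have "D y * exp (growth \<delta> * clock y) \<le> (D y / 2 + \<eta>) * exp (growth \<delta> * clock y)"
    unfolding D by (simp add: algebra_simps)
  then have "D y \<le> 2 * \<eta>" by simp
  then have "D x \<le> 2 * \<eta>" using y(3)[OF x] by linarith
  then show ?thesis unfolding D by (intro mult_right_mono) auto
qed

lemma picard_fixed_point_exists:
  assumes \<delta>: "0 < \<delta>" "\<delta> \<le> 1" and \<tau>: "0 \<le> \<tau>" "\<tau> \<le> 1"
  shows "\<exists>G. continuous_on {0..} G \<and> (\<forall>x\<ge>0. picard \<tau> \<delta> G x = G x)"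
proof -
  define g where "g n = (picard \<tau> \<delta> ^^ n) (\<lambda>_. 1)" for n
  have g_Suc: "g (Suc n) = picard \<tau> \<delta> (g n)" for n by (simp add: g_def)
  have cg: "continuous_on {0..X} (g n)" if "0 \<le> X" for n X
  proof (induction n)
    case (Suc n)
    then show ?case unfolding g_Suc by (rule continuous_on_picard[OF _ \<delta>(1) that])
  qed (simp add: g_def)
  have diff: "\<exists>K\<ge>0. \<forall>n. \<forall>x\<in>{0..X}. \<bar>g (Suc n) x - g n x\<bar> \<le> K / 2 ^ n * exp (growth \<delta> * clock x)" if X: "0 \<le> X" for X
  proof -
    have "continuous_on {0..X} (\<lambda>x. g 1 x - g 0 x)" by (intro continuous_intros cg X)
    then obtain K where K: "0 < K" "\<And>x. 0 \<le> x \<Longrightarrow> x \<le> X \<Longrightarrow> \<bar>g 1 x - g 0 x\<bar> \<le> K"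
      by (rule continuous_on_Icc_bound) blast
    have "\<bar>g (Suc n) x - g n x\<bar> \<le> K / 2 ^ n * exp (growth \<delta> * clock x)" if "x \<in> {0..X}" for n x
      using that
    proof (induction n arbitrary: x)
      case 0
      have "0 \<le> growth \<delta> * clock x"
        using growth_pos[OF \<delta>(1)] clock_mono[of 0 x] 0 \<kappa> by (simp add: clock_def)
      then have "K * 1 \<le> K * exp (growth \<delta> * clock x)" using K(1) by (intro mult_left_mono) auto
      then show ?case using K(2)[of x] 0 by simp
    next
      case (Suc n)
      have "\<bar>picard \<tau> \<delta> (g (Suc n)) x - picard \<tau> \<delta> (g n) x\<bar> \<le> K / 2 ^ n / 2 * exp (growth \<delta> * clock x)"
        using Suc K(1) by (intro picard_contraction[OF cg[OF X] cg[OF X] \<delta> \<tau>]) auto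
      then show ?case by (simp add: g_Suc)
    qed
    then show ?thesis using K(1) by (intro exI[of _ K]) auto
  qed
  \<comment> \<open>The limit of the iterates as a telescoping series from the constant start 1. The
    weight is bounded on each {0..X}, so the convergence is locally uniform.\<close>
  define G where "G x = 1 + (\<Sum>n. g (Suc n) x - g n x)" for x
  have unif: "uniform_limit {0..X} g G sequentially" if X: "0 \<le> X" for X
  proof -
    obtain K where K: "0 \<le> K" "\<And>n x. x \<in> {0..X} \<Longrightarrow> \<bar>g (Suc n) x - g n x\<bar> \<le> K / 2 ^ n * exp (growth \<delta> * clock x)"
      using diff[OF X] by blast
    have "uniform_limit {0..X} (\<lambda>n x. \<Sum>i<n. g (Suc i) x - g i x) (\<lambda>x. \<Sum>i. g (Suc i) x - g i x) sequentially"
    proof (rule Weierstrass_m_test)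
      fix n x assume x: "x \<in> {0..X}"
      have "K / 2 ^ n * exp (growth \<delta> * clock x) \<le> K / 2 ^ n * exp (growth \<delta> * clock X)"
        using K(1) x growth_pos[OF \<delta>(1)] by (intro mult_left_mono) (auto intro!: clock_mono)
      then show "norm (g (Suc n) x - g n x) \<le> K * exp (growth \<delta> * clock X) * (1 / 2) ^ n"
        using K(2)[OF x, of n] by (simp add: power_divide mult_ac)
    next
      show "summable (\<lambda>n. K * exp (growth \<delta> * clock X) * (1 / 2) ^ n)"
        by (intro summable_mult summable_geometric) simp
    qed
    moreover have "(\<Sum>i<n. g (Suc i) x - g i x) = g n x - 1" for n x
      by (subst sum_lessThan_telescope) (simp add: g_def)
    ultimately have "uniform_limit {0..X} (\<lambda>n x. g n x - 1) (\<lambda>x. G x - 1) sequentially"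
      by (simp add: G_def)
    then show ?thesis unfolding uniform_limit_iff by (simp add: dist_real_def)
  qed
  have cG: "continuous_on {0..X} G" if "0 \<le> X" for X
    by (rule uniform_limit_theorem[OF _ unif[OF that]]) (use cg[OF that] in auto)
  have "picard \<tau> \<delta> G x = G x" if x: "0 \<le> x" for x
  proof -
    have "(\<lambda>n. picard \<tau> \<delta> (g n) x) \<longlonglongrightarrow> picard \<tau> \<delta> G x"
      unfolding tendsto_iff
    proof (intro allI impI)
      fix e :: real assume e: "0 < e"
      define e' where "e' = e / exp (growth \<delta> * clock x)"
      have e': "0 < e'" using e by (simp add: e'_def)
      have "\<forall>\<^sub>F n in sequentially. \<forall>s\<in>{0..x}. dist (g n s) (G s) < e'"
        using unif[OF x] e' unfolding uniform_limit_iff by blast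
      then show "\<forall>\<^sub>F n in sequentially. dist (picard \<tau> \<delta> (g n) x) (picard \<tau> \<delta> G x) < e"
      proof eventually_elim
        case (elim n)
        have "\<bar>g n s - G s\<bar> \<le> e' * exp (growth \<delta> * clock s)" if "0 \<le> s" "s \<le> x" for s
        proof -
          have "0 \<le> growth \<delta> * clock s"
            using growth_pos[OF \<delta>(1)] clock_mono[of 0 s] that \<kappa> by (simp add: clock_def)
          then have "e' * 1 \<le> e' * exp (growth \<delta> * clock s)" using e' by (intro mult_left_mono) auto
          then show ?thesis using elim that by (force simp: dist_real_def)
        qed
        then have "\<bar>picard \<tau> \<delta> (g n) x - picard \<tau> \<delta> G x\<bar> \<le> e' / 2 * exp (growth \<delta> * clock x)"
          using e' x by (intro picard_contraction[OF cg[OF x] cG[OF x] \<delta> \<tau>]) auto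
        also have "\<dots> < e" using e by (simp add: e'_def)
        finally show ?case by (simp add: dist_real_def)
      qed
    qed
    moreover have "(\<lambda>n. picard \<tau> \<delta> (g n) x) \<longlonglongrightarrow> G x"
      using tendsto_uniform_limitI[OF unif[OF x], of x] x LIMSEQ_Suc[of "\<lambda>n. g n x" "G x"] by (simp add: g_Suc)
    ultimately show ?thesis by (rule LIMSEQ_unique)
  qed
  moreover have "continuous_on {0..} G"
    unfolding continuous_on_eq_continuous_within
  proof
    fix x :: real assume x: "x \<in> {0..}"
    then have "continuous (at x within {0..x + 1}) G"
      using cG[of "x + 1"] by (auto simp: continuous_on_eq_continuous_within)
    moreover have "at x within {0..x + 1} = at x within {0..}"
      using x by (intro at_within_nhd[of x "{..<x + 1}"]) auto
    ultimately show "continuous (at x within {0..}) G" by simp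
  qed
  ultimately show ?thesis by blast
qed

end

lemma wint_cong:
  assumes "0 < \<nu>" "0 \<le> s" "\<And>r. 0 \<le> r \<Longrightarrow> r \<le> s \<Longrightarrow> h1 r = h2 r"
  shows "wint \<nu> h1 s = wint \<nu> h2 s"
proof -
  have "y powr (1 / \<nu>) \<le> s" if "y \<in> {0..s powr \<nu>}" for y
    using powr_mono2[of "1 / \<nu>" y "s powr \<nu>"] that assms by (simp add: powr_powr)
  then show ?thesis unfolding wint_def using assms(3) by (intro arg_cong2[where f="(/)"] integral_cong) auto
qed

lemma first_zero:
  fixes f :: "real \<Rightarrow> real"
  assumes "continuous_on {a..b} f" "a \<le> b" "0 < f a" "f b \<le> 0"
  obtains z where "a < z" "z \<le> b" "f z = 0" "\<And>s. a \<le> s \<Longrightarrow> s < z \<Longrightarrow> 0 < f s"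
proof -
  let ?S = "{s \<in> {a..b}. f s \<in> {..0}}"
  have "closed ?S" using continuous_closed_preimage[OF assms(1), of "{..0}"] by (simp add: vimage_def Int_def)
  then have "compact ?S" by (intro compact_eq_bounded_closed[THEN iffD2] conjI bounded_subset[OF bounded_closed_interval[of a b]]) auto
  moreover have "?S \<noteq> {}" using assms by auto
  ultimately obtain z where z: "z \<in> ?S" "\<And>s. s \<in> ?S \<Longrightarrow> z \<le> s" using compact_attains_inf[of ?S] by blast
  have az: "a < z" using z(1) assms(3) by (cases "a = z") auto
  have pos: "0 < f s" if "a \<le> s" "s < z" for s using z(2)[of s] z(1) that by force
  have "f z = 0"
  proof (rule ccontr)
    assume "f z \<noteq> 0"
    then have "f z < 0" using z(1) by auto
    moreover have "continuous_on {a..z} f" using z(1) by (auto intro: continuous_on_subset[OF assms(1)])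
    ultimately obtain y where "a \<le> y" "y \<le> z" "f y = 0"
      using IVT2'[of f z 0 a] assms(3) az by auto
    then show False using pos[of y] \<open>f z \<noteq> 0\<close> by (cases "y = z") auto
  qed
  then show thesis using that[of z] az z(1) pos by auto
qed

text \<open>For s < 1 the function g^(1-s) decreases at least at the constant rate (1 - s) k, so
  positivity is lost after a finite distance. It is applied with s = p/m and s = 1/m.\<close>

lemma absorption_extinction:
  fixes g d :: "real \<Rightarrow> real"
  assumes der: "\<And>x. R \<le> x \<Longrightarrow> DERIV g x :> d x" and k: "0 < k" and s: "0 < s" "s < 1"
    and le: "\<And>x. R \<le> x \<Longrightarrow> d x \<le> - k * g x powr s" and pos: "\<And>x. R \<le> x \<Longrightarrow> 0 < g x"
  shows False
proof -
  define c where "c = (1 - s) * k"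
  have c: "0 < c" using k s by (simp add: c_def)
  \<comment> \<open>At this point the linear bound would make g^(1-s) at most -1.\<close>
  define y where "y = R + (g R powr (1 - s) + 1) / c"
  have y: "R < y" using c by (simp add: y_def add_nonneg_pos)
  have "g y powr (1 - s) + c * y \<le> g R powr (1 - s) + c * R"
  proof (rule DERIV_nonpos_imp_nonincreasing[OF less_imp_le[OF y], of "\<lambda>x. g x powr (1 - s) + c * x"])
    fix x assume x: "R \<le> x" "x \<le> y"
    have "DERIV (\<lambda>x. g x powr (1 - s) + c * x) x :> (1 - s) * g x powr (1 - s - 1) * d x + c * 1"
      using pos[OF x(1)] by (intro DERIV_add DERIV_chain2[OF has_real_derivative_powr der[OF x(1)]] DERIV_cmult DERIV_ident) auto
    moreover have "(1 - s) * g x powr (1 - s - 1) * d x + c * 1 \<le> 0"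
    proof -
      have "(1 - s) * g x powr (1 - s - 1) * d x \<le> (1 - s) * g x powr (1 - s - 1) * (- k * g x powr s)"
        using s le[OF x(1)] by (intro mult_left_mono) auto
      also have "\<dots> = - c" using pos[OF x(1)] by (simp add: c_def powr_minus)
      finally show ?thesis by simp
    qed
    ultimately show "\<exists>z. DERIV (\<lambda>x. g x powr (1 - s) + c * x) x :> z \<and> z \<le> 0" by blast
  qed
  moreover have "c * y = c * R + g R powr (1 - s) + 1" using c by (simp add: y_def field_simps)
  moreover have "0 < g y powr (1 - s)" using pos[of y] y by simp
  ultimately show False by linarith
qed

section \<open>Positive solutions on compact intervals: uniqueness, continuation, dependence on
  \<tau>\<close>

context profile_equation
begin

text \<open>G stands for F^m, with initial value 1. Positivity is required up to X inclusive, so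
  that G is bounded below by some \<delta> and solves the truncated problem as well.\<close>

definition sol :: "real \<Rightarrow> real \<Rightarrow> (real \<Rightarrow> real) \<Rightarrow> (real \<Rightarrow> real) \<Rightarrow> bool" where
  "sol \<tau> X G E \<longleftrightarrow> 0 < X \<and> continuous_on {0..X} G \<and> continuous_on {0..X} E \<and> (\<forall>x\<in>{0..X}. 0 < G x) \<and>
     G 0 = 1 \<and> E 0 = 0 \<and>
     (\<forall>x. 0 < x \<and> x < X \<longrightarrow> DERIV E x :> flux_deriv (1 - \<tau>) \<tau> (\<lambda>x. G x powr (1 / m)) x) \<and>
     (\<forall>x. 0 < x \<and> x < X \<longrightarrow> DERIV G x :> slope (1 - \<tau>) (\<lambda>x. G x powr (1 / m)) E x)"

lemma solD:
  assumes "sol \<tau> X G E"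
  shows "0 < X" "continuous_on {0..X} G" "continuous_on {0..X} E" "\<And>x. 0 \<le> x \<Longrightarrow> x \<le> X \<Longrightarrow> 0 < G x"
    "G 0 = 1" "E 0 = 0"
    "\<And>x. 0 < x \<Longrightarrow> x < X \<Longrightarrow> DERIV E x :> flux_deriv (1 - \<tau>) \<tau> (\<lambda>x. G x powr (1 / m)) x"
    "\<And>x. 0 < x \<Longrightarrow> x < X \<Longrightarrow> DERIV G x :> slope (1 - \<tau>) (\<lambda>x. G x powr (1 / m)) E x"
  using assms unfolding sol_def by auto

lemma sol_cong:
  assumes S: "sol \<tau> X G E" and X': "0 < X'" "X' \<le> X" and eq: "\<And>x. 0 \<le> x \<Longrightarrow> x \<le> X' \<Longrightarrow> G' x = G x \<and> E' x = E x"
  shows "sol \<tau> X' G' E'"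
proof -
  note D = solD[OF S]
  have "DERIV E' x :> flux_deriv (1 - \<tau>) \<tau> (\<lambda>x. G' x powr (1 / m)) x"
    "DERIV G' x :> slope (1 - \<tau>) (\<lambda>x. G' x powr (1 / m)) E' x" if x: "0 < x" "x < X'" for x
  proof -
    have "flux_deriv (1 - \<tau>) \<tau> (\<lambda>x. G' x powr (1 / m)) x = flux_deriv (1 - \<tau>) \<tau> (\<lambda>x. G x powr (1 / m)) x"
      "slope (1 - \<tau>) (\<lambda>x. G' x powr (1 / m)) E' x = slope (1 - \<tau>) (\<lambda>x. G x powr (1 / m)) E x"
      using eq[of x] x by (simp_all add: flux_deriv_def slope_def)
    moreover have "DERIV E' x :> flux_deriv (1 - \<tau>) \<tau> (\<lambda>x. G x powr (1 / m)) x"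
      by (rule has_field_derivative_transform_within_open[OF D(7), of x "{0<..<X'}"]) (use x X' eq in auto)
    moreover have "DERIV G' x :> slope (1 - \<tau>) (\<lambda>x. G x powr (1 / m)) E x"
      by (rule has_field_derivative_transform_within_open[OF D(8), of x "{0<..<X'}"]) (use x X' eq in auto)
    ultimately show "DERIV E' x :> flux_deriv (1 - \<tau>) \<tau> (\<lambda>x. G' x powr (1 / m)) x"
    "DERIV G' x :> slope (1 - \<tau>) (\<lambda>x. G' x powr (1 / m)) E' x" by simp_all
  qed
  moreover have "continuous_on {0..X'} G'" "continuous_on {0..X'} E'"
    using X' eq by (auto intro!: continuous_on_eq[of "{0..X'}" G G'] continuous_on_eq[of "{0..X'}" E E']
        continuous_on_subset[OF D(2)] continuous_on_subset[OF D(3)])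
  moreover have "0 < G' x" if "0 \<le> x" "x \<le> X'" for x using D(4)[of x] eq[of x] that X' by simp
  ultimately show ?thesis unfolding sol_def using X' D(5,6) eq[of 0] by auto
qed

text \<open>A solution of the truncated problem on the whole half-line. Unlike solutions of the
  original system, these exist on a common interval for all \<tau>, which makes them
  comparable.\<close>

definition fp :: "real \<Rightarrow> real \<Rightarrow> real \<Rightarrow> real" where
  "fp \<tau> \<delta> = (SOME G. continuous_on {0..} G \<and> (\<forall>x\<ge>0. picard \<tau> \<delta> G x = G x))"

definition fpE :: "real \<Rightarrow> real \<Rightarrow> real \<Rightarrow> real" where
  "fpE \<tau> \<delta> = wint \<nu> (src \<tau> \<delta> (fp \<tau> \<delta>))"

lemma fp:
  assumes "0 < \<delta>" "\<delta> \<le> 1" "0 \<le> \<tau>" "\<tau> \<le> 1"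
  shows "continuous_on {0..} (fp \<tau> \<delta>)" "\<And>x. 0 \<le> x \<Longrightarrow> picard \<tau> \<delta> (fp \<tau> \<delta>) x = fp \<tau> \<delta> x" "fp \<tau> \<delta> 0 = 1"
proof -
  have *: "continuous_on {0..} (fp \<tau> \<delta>) \<and> (\<forall>x\<ge>0. picard \<tau> \<delta> (fp \<tau> \<delta>) x = fp \<tau> \<delta> x)"
    unfolding fp_def by (rule someI_ex[OF picard_fixed_point_exists[OF assms]])
  then show "continuous_on {0..} (fp \<tau> \<delta>)" "\<And>x. 0 \<le> x \<Longrightarrow> picard \<tau> \<delta> (fp \<tau> \<delta>) x = fp \<tau> \<delta> x" by auto
  from this(2)[of 0] show "fp \<tau> \<delta> 0 = 1" by (simp add: picard_def)
qed

lemma src_eq_flux_deriv: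
  assumes "\<delta> \<le> G x"  "0 < \<delta>"
  shows "x powr (\<nu> - 1) * src \<tau> \<delta> G x = flux_deriv (1 - \<tau>) \<tau> (\<lambda>x. G x powr (1 / m)) x"
  using assms by (simp add: src_def flux_deriv_def powr_powr max_absorb1)

lemma rate_eq_slope:
  assumes "\<delta> \<le> G x"  "0 < x" "wint \<nu> (src \<tau> \<delta> G) x = E x"
  shows "rate \<tau> \<delta> G x = slope (1 - \<tau>) (\<lambda>x. G x powr (1 / m)) E x"
proof -
  have e: "x powr (- \<nu>) * x powr (\<nu> + \<kappa>) = x powr \<kappa>" using assms by (simp flip: powr_add)
  have "slope (1 - \<tau>) (\<lambda>x. G x powr (1 / m)) E x =
      x powr (- \<nu>) * E x - (1 - \<tau>) * (x powr (- \<nu>) * x powr (\<nu> + \<kappa>)) * G x powr (1 / m)"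
    unfolding slope_def by algebra
  also have "\<dots> = rate \<tau> \<delta> G x"
    unfolding e using assms by (simp add: rate_def max_absorb1)
  finally show ?thesis by simp
qed

lemma picard_has_derivative:
  assumes "continuous_on {0..X} G" "0 < \<delta>" "0 < x" "x < X"
  shows "DERIV (picard \<tau> \<delta> G) x :> rate \<tau> \<delta> G x"
proof -
  have "((\<lambda>x. integral {0..x} (rate \<tau> \<delta> G)) has_real_derivative rate \<tau> \<delta> G x) (at x within {0..X})"
    using assms by (intro integral_has_real_derivative continuous_on_rate) auto
  then have "DERIV (\<lambda>x. integral {0..x} (rate \<tau> \<delta> G)) x :> rate \<tau> \<delta> G x"
    using at_within_Icc_at[OF assms(3,4)] by simp
  then show ?thesis unfolding picard_def[abs_def] by (auto intro!: derivative_eq_intros)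
qed

text \<open>Above \<delta> the truncation is inactive, so there the fixed point solves the original
  system.\<close>

lemma sol_fp:
  assumes par: "0 < \<delta>" "\<delta> \<le> 1" "0 \<le> \<tau>" "\<tau> \<le> 1" and X: "0 < X"
    and gt: "\<And>x. 0 \<le> x \<Longrightarrow> x \<le> X \<Longrightarrow> \<delta> < fp \<tau> \<delta> x"
  shows "sol \<tau> X (fp \<tau> \<delta>) (fpE \<tau> \<delta>)"
proof -
  note F = fp[OF par]
  have c: "continuous_on {0..X} (fp \<tau> \<delta>)" by (rule continuous_on_subset[OF F(1)]) auto
  have "DERIV (fpE \<tau> \<delta>) x :> flux_deriv (1 - \<tau>) \<tau> (\<lambda>x. fp \<tau> \<delta> x powr (1 / m)) x"
    if x: "0 < x" "x < X" for x
    using wint_has_derivative[OF \<nu> continuous_on_src[OF c par(1), of \<tau>] x]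
      src_eq_flux_deriv[of \<delta> "fp \<tau> \<delta>" x \<tau>] par(1) gt[of x] x by (simp add: fpE_def)
  moreover have "DERIV (fp \<tau> \<delta>) x :> slope (1 - \<tau>) (\<lambda>x. fp \<tau> \<delta> x powr (1 / m)) (fpE \<tau> \<delta>) x"
    if x: "0 < x" "x < X" for x
  proof -
    have "DERIV (picard \<tau> \<delta> (fp \<tau> \<delta>)) x :> slope (1 - \<tau>) (\<lambda>x. fp \<tau> \<delta> x powr (1 / m)) (fpE \<tau> \<delta>) x"
      using picard_has_derivative[OF c par(1) x, of \<tau>] rate_eq_slope[of \<delta> "fp \<tau> \<delta>" x \<tau> "fpE \<tau> \<delta>"] gt[of x] x
      by (simp add: fpE_def)
    then show ?thesis
      by (rule has_field_derivative_transform_within_open[of _ _ _ "{0<..}"]) (use x F(2) in auto)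
  qed
  moreover have "continuous_on {0..X} (fpE \<tau> \<delta>)"
    unfolding fpE_def using X by (intro continuous_on_wint \<nu> continuous_on_src c par) auto
  moreover have "\<forall>x\<in>{0..X}. 0 < fp \<tau> \<delta> x" using gt par(1) by (meson atLeastAtMost_iff less_trans)
  ultimately show ?thesis unfolding sol_def using X c F(3) by (simp add: fpE_def)
qed

text \<open>Integrating both equations turns a solution above \<delta> into an exact fixed point,
  and \<open>picard_stable\<close> with \<eta> = 0 identifies it with the chosen one. Uniqueness,
  continuation and dependence on \<tau> are all reduced to \<open>fp\<close> in this way.\<close>

lemma sol_eq_fp:
  assumes S: "sol \<tau> X G E" and par: "0 < \<delta>" "\<delta> \<le> 1" "0 \<le> \<tau>" "\<tau> \<le> 1"
    and gt: "\<And>x. 0 \<le> x \<Longrightarrow> x \<le> X \<Longrightarrow> \<delta> \<le> G x" and x: "0 \<le> x" "x \<le> X"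
  shows "fp \<tau> \<delta> x = G x" "fpE \<tau> \<delta> x = E x" "picard \<tau> \<delta> G x = G x"
proof -
  note D = solD[OF S] and F = fp[OF par]
  have wE: "wint \<nu> (src \<tau> \<delta> G) y = E y" if y: "0 \<le> y" "y \<le> X" for y
  proof -
    have "E y - wint \<nu> (src \<tau> \<delta> G) y = E 0 - wint \<nu> (src \<tau> \<delta> G) 0"
    proof (rule DERIV_isconst2[of 0 X "\<lambda>y. E y - wint \<nu> (src \<tau> \<delta> G) y"])
      show "continuous_on {0..X} (\<lambda>y. E y - wint \<nu> (src \<tau> \<delta> G) y)"
        using D(1) by (intro continuous_on_diff D(3) continuous_on_wint \<nu> continuous_on_src D(2) par) auto
      show "DERIV (\<lambda>y. E y - wint \<nu> (src \<tau> \<delta> G) y) z :> 0" if z: "0 < z" "z < X" for z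
        using DERIV_diff[OF D(7)[OF z] wint_has_derivative[OF \<nu> continuous_on_src[OF D(2) par(1), of \<tau>] z]]
          src_eq_flux_deriv[of \<delta> G z \<tau>] gt[of z] z par(1) by simp
    qed (use D(1) y in auto)
    then show ?thesis using D(6) by simp
  qed
  have pG: "picard \<tau> \<delta> G y = G y" if y: "0 \<le> y" "y \<le> X" for y
  proof -
    have "picard \<tau> \<delta> G y - G y = picard \<tau> \<delta> G 0 - G 0"
    proof (rule DERIV_isconst2[of 0 X "\<lambda>y. picard \<tau> \<delta> G y - G y"])
      show "continuous_on {0..X} (\<lambda>y. picard \<tau> \<delta> G y - G y)"
        using D(1) by (intro continuous_on_diff D(2) continuous_on_picard par) auto
      show "DERIV (\<lambda>y. picard \<tau> \<delta> G y - G y) z :> 0" if z: "0 < z" "z < X" for z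
        using DERIV_diff[OF picard_has_derivative[OF D(2) par(1) z, of \<tau>] D(8)[OF z]]
          rate_eq_slope[of \<delta> G z \<tau> E] gt[of z] wE[of z] z by simp
    qed (use D(1) y in auto)
    then show ?thesis using D(5) by (simp add: picard_def)
  qed
  show "picard \<tau> \<delta> G x = G x" by (rule pG[OF x])
  have fpG: "fp \<tau> \<delta> y = G y" if y: "0 \<le> y" "y \<le> X" for y
    using picard_stable[OF D(2) continuous_on_subset[OF F(1)] par F(2), where \<eta>=0 and x=y] pG y by auto
  show "fp \<tau> \<delta> x = G x" by (rule fpG[OF x])
  have "fpE \<tau> \<delta> x = wint \<nu> (src \<tau> \<delta> G) x"
    unfolding fpE_def by (rule wint_cong[OF \<nu> x(1)]) (use fpG x in \<open>simp add: src_def\<close>)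
  then show "fpE \<tau> \<delta> x = E x" using wE[OF x] by simp
qed

text \<open>The factor 2 leaves room for a perturbation smaller than \<delta> without reaching the
  truncation level.\<close>

lemma sol_lower_bound:
  assumes "sol \<tau> X G E"
  obtains \<delta> where "0 < \<delta>" "\<delta> \<le> 1" "\<And>x. 0 \<le> x \<Longrightarrow> x \<le> X \<Longrightarrow> 2 * \<delta> \<le> G x"
proof -
  note D = solD[OF assms]
  obtain y where y: "0 \<le> y" "y \<le> X" "\<And>z. 0 \<le> z \<Longrightarrow> z \<le> X \<Longrightarrow> G y \<le> G z"
    using continuous_attains_inf[OF _ _ D(2)] D(1) by auto
  have "G y \<le> 1" using y(3)[of 0] D(1,5) by simp
  then show thesis
    using y(3) D(4)[OF y(1,2)] by (intro that[of "G y / 2"]) auto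
qed

lemma sol_unique:
  assumes S: "sol \<tau> X G E" "sol \<tau> X' G' E'" and \<tau>: "0 \<le> \<tau>" "\<tau> \<le> 1" and x: "0 \<le> x" "x \<le> X" "x \<le> X'"
  shows "G x = G' x" "E x = E' x"
proof -
  obtain \<delta>1 where 1: "0 < \<delta>1" "\<delta>1 \<le> 1" "\<And>x. 0 \<le> x \<Longrightarrow> x \<le> X \<Longrightarrow> 2 * \<delta>1 \<le> G x"
    by (rule sol_lower_bound[OF S(1)]) blast
  obtain \<delta>2 where 2: "0 < \<delta>2" "\<delta>2 \<le> 1" "\<And>x. 0 \<le> x \<Longrightarrow> x \<le> X' \<Longrightarrow> 2 * \<delta>2 \<le> G' x"
    by (rule sol_lower_bound[OF S(2)]) blast
  define \<delta> where "\<delta> = min \<delta>1 \<delta>2"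
  have \<delta>: "0 < \<delta>" "\<delta> \<le> 1" using 1 2 by (auto simp: \<delta>_def)
  have g: "\<delta> \<le> G x" if "0 \<le> x" "x \<le> X" for x using 1(1) 1(3)[OF that] by (auto simp: \<delta>_def)
  have g': "\<delta> \<le> G' x" if "0 \<le> x" "x \<le> X'" for x using 2(1) 2(3)[OF that] by (auto simp: \<delta>_def)
  show "G x = G' x" "E x = E' x"
    using sol_eq_fp[OF S(1) \<delta> \<tau> g x(1,2)] sol_eq_fp[OF S(2) \<delta> \<tau> g' x(1,3)] by auto
qed

text \<open>A uniform lower bound l keeps the fixed point with level l/2 above the truncation up to
  x0 and, by continuity, a little further. For x0 = 0 the hypothesis is empty and local existence
  results; read backwards, it says that G becomes arbitrarily small at the end of a maximal
  interval.\<close>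

lemma sol_beyond:
  assumes \<tau>: "0 \<le> \<tau>" "\<tau> \<le> 1" and x0: "0 \<le> x0" and l: "0 < l" "l \<le> 1"
    and sols: "\<And>X. 0 < X \<Longrightarrow> X < x0 \<Longrightarrow> \<exists>G E. sol \<tau> X G E \<and> (\<forall>x\<in>{0..X}. l \<le> G x)"
  obtains X G E where "x0 < X" "sol \<tau> X G E"
proof -
  define \<delta> where "\<delta> = l / 2"
  have par: "0 < \<delta>" "\<delta> \<le> 1" using l by (auto simp: \<delta>_def)
  note F = fp[OF par \<tau>]
  have ge: "l \<le> fp \<tau> \<delta> x" if x: "0 \<le> x" "x < x0" for x
  proof (cases "x = 0")
    case False
    obtain G E where S: "sol \<tau> x G E" "\<forall>y\<in>{0..x}. l \<le> G y" using sols[of x] x False by auto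
    have "fp \<tau> \<delta> x = G x" by (rule sol_eq_fp[OF S(1) par \<tau>]) (use S(2) x l in \<open>force simp: \<delta>_def\<close>)+
    then show ?thesis using S(2) x by auto
  qed (use F(3) l in simp)
  have ge0: "l \<le> fp \<tau> \<delta> x0"
  proof (cases "x0 = 0")
    case False
    then have 0: "0 < x0" using x0 by simp
    have "isCont (fp \<tau> \<delta>) x0" using F(1) 0 by (auto intro!: continuous_on_interior)
    then have lim: "(fp \<tau> \<delta> \<longlongrightarrow> fp \<tau> \<delta> x0) (at_left x0)" by (simp add: isCont_def filterlim_at_split)
    have "\<forall>\<^sub>F x in at_left x0. l \<le> fp \<tau> \<delta> x"
      unfolding eventually_at_left[OF 0] using 0 ge by (intro exI[of _ 0]) auto
    with lim show ?thesis by (rule tendsto_lowerbound) simp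
  qed (use F(3) l in simp)
  obtain d where d: "0 < d" "\<And>x. 0 \<le> x \<Longrightarrow> \<bar>x - x0\<bar> < d \<Longrightarrow> \<bar>fp \<tau> \<delta> x - fp \<tau> \<delta> x0\<bar> < l / 2"
    using F(1)[unfolded continuous_on_iff, rule_format, of x0 "l / 2"] x0 l by (auto simp: dist_real_def)
  have "sol \<tau> (x0 + d / 2) (fp \<tau> \<delta>) (fpE \<tau> \<delta>)"
  proof (rule sol_fp[OF par \<tau>])
    show "\<delta> < fp \<tau> \<delta> x" if x: "0 \<le> x" "x \<le> x0 + d / 2" for x
    proof (cases "x < x0")
      case True
      then show ?thesis using ge[OF x(1)] l by (simp add: \<delta>_def)
    next
      case False
      then have "\<bar>fp \<tau> \<delta> x - fp \<tau> \<delta> x0\<bar> < l / 2" using d x by simp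
      then show ?thesis using ge0 unfolding \<delta>_def by linarith
    qed
  qed (use x0 d in auto)
  then show thesis using that[of "x0 + d / 2"] d by auto
qed

lemma sol_exists:
  assumes "0 \<le> \<tau>" "\<tau> \<le> 1"
  obtains X G E where "sol \<tau> X G E"
proof (rule sol_beyond[OF assms order_refl zero_less_one order_refl])
  show "\<exists>G E. sol \<tau> X G E \<and> (\<forall>x\<in>{0..X}. 1 \<le> G x)" if "0 < X" "X < 0" for X using that by simp
qed (rule that)

lemma sol_extend:
  assumes S: "sol \<tau> X G E" and \<tau>: "0 \<le> \<tau>" "\<tau> \<le> 1"
  obtains X' G' E' where "X < X'" "sol \<tau> X' G' E'"
proof -
  obtain \<delta> where \<delta>: "0 < \<delta>" "\<delta> \<le> 1" "\<And>x. 0 \<le> x \<Longrightarrow> x \<le> X \<Longrightarrow> 2 * \<delta> \<le> G x"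
    by (rule sol_lower_bound[OF S]) blast
  show thesis
  proof (rule sol_beyond[OF \<tau> less_imp_le[OF solD(1)[OF S]] \<delta>(1,2)])
    fix Y assume Y: "0 < Y" "Y < X"
    have "sol \<tau> Y G E" using Y by (intro sol_cong[OF S]) auto
    moreover have "\<forall>x\<in>{0..Y}. \<delta> \<le> G x" using \<delta> Y by (force dest: \<delta>(3)[rotated])
    ultimately show "\<exists>G E. sol \<tau> Y G E \<and> (\<forall>x\<in>{0..Y}. \<delta> \<le> G x)" by blast
  qed (rule that)
qed

lemma src_diff_bound:
  assumes \<delta>: "0 < \<delta>" "\<delta> \<le> 1" and \<tau>: "0 \<le> \<tau>" "\<tau> \<le> 1" and r: "0 \<le> r" "r \<le> X"
  shows "\<bar>src \<tau> \<delta> G1 r - src \<tau>' \<delta> G2 r\<bar> \<le> (B * X powr \<kappa> + 1) * (\<bar>G1 r - G2 r\<bar> / \<delta>)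
    + \<bar>\<tau> - \<tau>'\<bar> * (B * X powr \<kappa> * max (G2 r) \<delta> powr (1 / m) + max (G2 r) \<delta> powr (p / m))"
proof -
  let ?a = "max (G1 r) \<delta> powr (1 / m) - max (G2 r) \<delta> powr (1 / m)"
  let ?b = "max (G1 r) \<delta> powr (p / m) - max (G2 r) \<delta> powr (p / m)"
  let ?c = "B * r powr \<kappa> * max (G2 r) \<delta> powr (1 / m) + max (G2 r) \<delta> powr (p / m)"
  have k: "r powr \<kappa> \<le> X powr \<kappa>" using r \<kappa> by (intro powr_mono2) auto
  have "src \<tau> \<delta> G1 r - src \<tau>' \<delta> G2 r = (1 - \<tau>) * B * r powr \<kappa> * ?a - \<tau> * ?b - (\<tau> - \<tau>') * ?c"
    by (simp add: src_def algebra_simps)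
  moreover have "\<bar>x - y - z\<bar> \<le> \<bar>x\<bar> + \<bar>y\<bar> + \<bar>z\<bar>" for x y z :: real by linarith
  ultimately have "\<bar>src \<tau> \<delta> G1 r - src \<tau>' \<delta> G2 r\<bar> \<le> \<bar>(1 - \<tau>) * B * r powr \<kappa> * ?a\<bar> + \<bar>\<tau> * ?b\<bar> + \<bar>(\<tau> - \<tau>') * ?c\<bar>"
    by presburger
  also have "\<dots> = (1 - \<tau>) * B * r powr \<kappa> * \<bar>?a\<bar> + \<tau> * \<bar>?b\<bar> + \<bar>\<tau> - \<tau>'\<bar> * ?c"
    using \<tau> B_pos by (simp add: abs_mult)
  also have "\<dots> \<le> 1 * B * X powr \<kappa> * (\<bar>G1 r - G2 r\<bar> / \<delta>) + 1 * (\<bar>G1 r - G2 r\<bar> / \<delta>)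
      + \<bar>\<tau> - \<tau>'\<bar> * (B * X powr \<kappa> * max (G2 r) \<delta> powr (1 / m) + max (G2 r) \<delta> powr (p / m))"
    using \<tau> B_pos m p \<delta> k
    by (intro add_mono mult_mono truncated_powr_lipschitz mult_nonneg_nonneg add_nonneg_nonneg) auto
  finally show ?thesis by (simp add: algebra_simps)
qed

text \<open>For fixed G the functions \<open>src\<close> and \<open>rate\<close> are affine in
  \<tau>, so a solution for \<tau>0 misses the fixed point equation for \<tau> by a multiple of
  |\<tau> - \<tau>0|. \<open>picard_stable\<close> turns this into a Lipschitz estimate.\<close>

lemma fp_continuous_dependence:
  assumes S: "sol \<tau>0 X G E" and \<tau>0: "0 \<le> \<tau>0" "\<tau>0 \<le> 1" and \<delta>: "0 < \<delta>" "\<delta> \<le> 1"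
    and gt: "\<And>x. 0 \<le> x \<Longrightarrow> x \<le> X \<Longrightarrow> 2 * \<delta> \<le> G x"
  obtains C where "\<And>\<tau> x. 0 \<le> \<tau> \<Longrightarrow> \<tau> \<le> 1 \<Longrightarrow> 0 \<le> x \<Longrightarrow> x \<le> X \<Longrightarrow>
    \<bar>fp \<tau> \<delta> x - G x\<bar> \<le> C * \<bar>\<tau> - \<tau>0\<bar> \<and> \<bar>fpE \<tau> \<delta> x - E x\<bar> \<le> C * \<bar>\<tau> - \<tau>0\<bar>"
proof -
  note D = solD[OF S]
  have ge: "\<delta> \<le> G x" if "0 \<le> x" "x \<le> X" for x using gt[OF that] \<delta>(1) by linarith
  note eq = sol_eq_fp[OF S \<delta> \<tau>0 ge]
  have cpow: "continuous_on {0..X} (\<lambda>r. max (G r) \<delta> powr e)" for e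
    using D(2) \<delta>(1) by (intro continuous_on_powr continuous_on_max continuous_on_const) auto
  have "continuous_on {0..X} (\<lambda>r. B * X powr \<kappa> * max (G r) \<delta> powr (1 / m) + max (G r) \<delta> powr (p / m))"
    by (intro continuous_on_add continuous_on_mult continuous_on_const cpow)
  then obtain K1 where K1: "0 < K1" "\<And>r. 0 \<le> r \<Longrightarrow> r \<le> X \<Longrightarrow>
      \<bar>B * X powr \<kappa> * max (G r) \<delta> powr (1 / m) + max (G r) \<delta> powr (p / m)\<bar> \<le> K1"
    by (rule continuous_on_Icc_bound) blast
  obtain K2 where K2: "0 < K2" "\<And>r. 0 \<le> r \<Longrightarrow> r \<le> X \<Longrightarrow> \<bar>max (G r) \<delta> powr (1 / m)\<bar> \<le> K2"
    by (rule continuous_on_Icc_bound[OF cpow]) blast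
  define K where "K = K1 / \<nu> + X powr \<kappa> * K2"
  have K: "0 \<le> K" using K1 K2 \<nu> by (simp add: K_def)
  have src: "\<bar>src \<tau> \<delta> g r - src \<tau>0 \<delta> G r\<bar> \<le> (B * X powr \<kappa> + 1) * (\<bar>g r - G r\<bar> / \<delta>) + \<bar>\<tau> - \<tau>0\<bar> * K1"
    if "0 \<le> \<tau>" "\<tau> \<le> 1" "0 \<le> r" "r \<le> X" for \<tau> g r
  proof -
    have "\<bar>\<tau> - \<tau>0\<bar> * (B * X powr \<kappa> * max (G r) \<delta> powr (1 / m) + max (G r) \<delta> powr (p / m)) \<le> \<bar>\<tau> - \<tau>0\<bar> * K1"
      using K1(2)[OF that(3,4)] by (intro mult_left_mono) auto
    then show ?thesis using src_diff_bound[OF \<delta> that, of g \<tau>0 G] by linarith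
  qed
  have near: "\<bar>picard \<tau> \<delta> G x - G x\<bar> \<le> \<bar>\<tau> - \<tau>0\<bar> * K * X"
    if \<tau>: "0 \<le> \<tau>" "\<tau> \<le> 1" and x: "0 \<le> x" "x \<le> X" for \<tau> x
  proof -
    have cx: "continuous_on {0..x} G" by (rule continuous_on_subset[OF D(2)]) (use x in auto)
    have "\<bar>rate \<tau> \<delta> G s - rate \<tau>0 \<delta> G s\<bar> \<le> \<bar>\<tau> - \<tau>0\<bar> * K" if s: "0 \<le> s" "s \<le> x" for s
    proof -
      have cs: "continuous_on {0..s} G" by (rule continuous_on_subset[OF D(2)]) (use x s in auto)
      have "\<bar>rate \<tau> \<delta> G s - rate \<tau>0 \<delta> G s\<bar> \<le> (\<bar>\<tau> - \<tau>0\<bar> * K1) / \<nu> + s powr \<kappa> * (\<bar>\<tau> - \<tau>0\<bar> * K2)"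
      proof (rule rate_diff_bound[OF cs cs \<delta>(1) s(1) \<tau>0])
        show "\<bar>src \<tau> \<delta> G r - src \<tau>0 \<delta> G r\<bar> \<le> \<bar>\<tau> - \<tau>0\<bar> * K1" if "0 \<le> r" "r \<le> s" for r
          using src[OF \<tau>, of r G] that s x by simp
        have "(1 - \<tau>) * max (G s) \<delta> powr (1 / m) - (1 - \<tau>0) * max (G s) \<delta> powr (1 / m) = - (\<tau> - \<tau>0) * max (G s) \<delta> powr (1 / m)"
          by (simp add: algebra_simps)
        then show "\<bar>(1 - \<tau>) * max (G s) \<delta> powr (1 / m) - (1 - \<tau>0) * max (G s) \<delta> powr (1 / m)\<bar> \<le> \<bar>\<tau> - \<tau>0\<bar> * K2"
          using K2(2)[of s] s x by (simp add: abs_mult mult_left_mono abs_minus_commute[of \<tau>0])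
      qed
      also have "\<dots> \<le> (\<bar>\<tau> - \<tau>0\<bar> * K1) / \<nu> + X powr \<kappa> * (\<bar>\<tau> - \<tau>0\<bar> * K2)"
        using s x \<kappa> K2(1) by (intro add_mono mult_right_mono powr_mono2) auto
      finally show ?thesis by (simp add: K_def algebra_simps)
    qed
    moreover have "continuous_on {0..x} (\<lambda>s. rate \<tau> \<delta> G s - rate \<tau>0 \<delta> G s)"
      by (intro continuous_on_diff continuous_on_rate cx \<delta> x)
    ultimately have "norm (integral {0..x} (\<lambda>s. rate \<tau> \<delta> G s - rate \<tau>0 \<delta> G s)) \<le> \<bar>\<tau> - \<tau>0\<bar> * K * (x - 0)"
      by (intro integral_bound x) auto
    moreover have "integral {0..x} (\<lambda>s. rate \<tau> \<delta> G s - rate \<tau>0 \<delta> G s) = picard \<tau> \<delta> G x - picard \<tau>0 \<delta> G x"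
      unfolding picard_def by (subst integral_diff) (auto intro!: integrable_continuous_interval continuous_on_rate cx \<delta> x)
    moreover have "\<bar>\<tau> - \<tau>0\<bar> * K * x \<le> \<bar>\<tau> - \<tau>0\<bar> * K * X" using x K by (intro mult_left_mono) auto
    ultimately show ?thesis using eq(3)[OF _ _ x] by simp
  qed
  define C1 where "C1 = 2 * (K * X) * exp (growth \<delta> * clock X)"
  have C1: "0 \<le> C1" using K D(1) by (simp add: C1_def)
  have fpG: "\<bar>fp \<tau> \<delta> x - G x\<bar> \<le> C1 * \<bar>\<tau> - \<tau>0\<bar>"
    if \<tau>: "0 \<le> \<tau>" "\<tau> \<le> 1" and x: "0 \<le> x" "x \<le> X" for \<tau> x
  proof -
    have "\<bar>fp \<tau> \<delta> x - G x\<bar> \<le> 2 * (\<bar>\<tau> - \<tau>0\<bar> * K * X) * exp (growth \<delta> * clock x)"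
      using fp(1,2)[OF \<delta> \<tau>] near[OF \<tau>] x
      by (intro picard_stable[OF D(2) _ \<delta> \<tau>]) (auto intro: continuous_on_subset)
    also have "\<dots> \<le> 2 * (\<bar>\<tau> - \<tau>0\<bar> * K * X) * exp (growth \<delta> * clock X)"
      using K D(1) growth_pos[OF \<delta>(1)] clock_mono[OF x] by (intro mult_left_mono) auto
    finally show ?thesis by (simp add: C1_def mult_ac)
  qed
  define C2 where "C2 = (B * X powr \<kappa> + 1) * (C1 / \<delta>) + K1"
  have C2: "0 \<le> C2" using C1 \<delta> K1 B_pos by (simp add: C2_def)
  have E: "\<bar>fpE \<tau> \<delta> x - E x\<bar> \<le> X powr \<nu> * C2 / \<nu> * \<bar>\<tau> - \<tau>0\<bar>"
    if \<tau>: "0 \<le> \<tau>" "\<tau> \<le> 1" and x: "0 \<le> x" "x \<le> X" for \<tau> x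
  proof -
    have c: "continuous_on {0..x} (src \<tau> \<delta> (fp \<tau> \<delta>))"
      if "0 \<le> \<tau>" "\<tau> \<le> 1" for \<tau>
      by (intro continuous_on_src \<delta> continuous_on_subset[OF fp(1)[OF \<delta> that]]) auto
    have "\<bar>wint \<nu> (\<lambda>r. src \<tau> \<delta> (fp \<tau> \<delta>) r - src \<tau>0 \<delta> (fp \<tau>0 \<delta>) r) x\<bar> \<le> x powr \<nu> * ((C2 * \<bar>\<tau> - \<tau>0\<bar>) / \<nu>)"
    proof (rule wint_bound[OF \<nu> continuous_on_diff[OF c[OF \<tau>] c[OF \<tau>0]] x(1)])
      fix r assume r: "0 \<le> r" "r \<le> x"
      have "src \<tau>0 \<delta> (fp \<tau>0 \<delta>) r = src \<tau>0 \<delta> G r" using eq(1)[of r] r x by (simp add: src_def)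
      moreover have "(B * X powr \<kappa> + 1) * (\<bar>fp \<tau> \<delta> r - G r\<bar> / \<delta>) \<le> (B * X powr \<kappa> + 1) * (C1 * \<bar>\<tau> - \<tau>0\<bar> / \<delta>)"
        using fpG[OF \<tau>, of r] r x \<delta> B_pos by (intro mult_left_mono divide_right_mono) auto
      ultimately show "\<bar>src \<tau> \<delta> (fp \<tau> \<delta>) r - src \<tau>0 \<delta> (fp \<tau>0 \<delta>) r\<bar> \<le> C2 * \<bar>\<tau> - \<tau>0\<bar>"
        using src[OF \<tau>, of r "fp \<tau> \<delta>"] r x by (simp add: C2_def algebra_simps)
    qed
    also have "\<dots> \<le> X powr \<nu> * ((C2 * \<bar>\<tau> - \<tau>0\<bar>) / \<nu>)"
      using x \<nu> C2 by (intro mult_right_mono powr_mono2) auto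
    finally show ?thesis
      unfolding wint_diff[OF \<nu> c[OF \<tau>] c[OF \<tau>0] x(1), symmetric]
      using eq(2)[OF _ _ x] by (simp add: fpE_def)
  qed
  show thesis
  proof (rule that[of "C1 + X powr \<nu> * C2 / \<nu>"])
    fix \<tau> x :: real assume a: "0 \<le> \<tau>" "\<tau> \<le> 1" "0 \<le> x" "x \<le> X"
    have "0 \<le> C1 * \<bar>\<tau> - \<tau>0\<bar>" "0 \<le> X powr \<nu> * C2 / \<nu> * \<bar>\<tau> - \<tau>0\<bar>" using C1 C2 \<nu> by auto
    then show "\<bar>fp \<tau> \<delta> x - G x\<bar> \<le> (C1 + X powr \<nu> * C2 / \<nu>) * \<bar>\<tau> - \<tau>0\<bar> \<and>
        \<bar>fpE \<tau> \<delta> x - E x\<bar> \<le> (C1 + X powr \<nu> * C2 / \<nu>) * \<bar>\<tau> - \<tau>0\<bar>"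
      using fpG[OF a] E[OF a] unfolding distrib_right by linarith
  qed
qed

text \<open>The purpose is stability of strict inequalities at one point x < X: because X is kept,
  such an inequality persists for nearby \<tau>. Openness of both shooting alternatives is read off
  from this.\<close>

lemma sol_continuous_dependence:
  assumes S: "sol \<tau>0 X G E" and \<tau>0: "0 \<le> \<tau>0" "\<tau>0 \<le> 1"
  obtains g e where "\<forall>\<^sub>F \<tau> in at \<tau>0 within {0..1}. sol \<tau> X (g \<tau>) (e \<tau>)"
    "\<And>x. 0 \<le> x \<Longrightarrow> x \<le> X \<Longrightarrow> ((\<lambda>\<tau>. g \<tau> x) \<longlongrightarrow> G x) (at \<tau>0 within {0..1})"
    "\<And>x. 0 \<le> x \<Longrightarrow> x \<le> X \<Longrightarrow> ((\<lambda>\<tau>. e \<tau> x) \<longlongrightarrow> E x) (at \<tau>0 within {0..1})"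
proof -
  obtain \<delta> where \<delta>: "0 < \<delta>" "\<delta> \<le> 1" "\<And>x. 0 \<le> x \<Longrightarrow> x \<le> X \<Longrightarrow> 2 * \<delta> \<le> G x"
    by (rule sol_lower_bound[OF S]) blast
  obtain C where C: "\<And>\<tau> x. 0 \<le> \<tau> \<Longrightarrow> \<tau> \<le> 1 \<Longrightarrow> 0 \<le> x \<Longrightarrow> x \<le> X \<Longrightarrow>
    \<bar>fp \<tau> \<delta> x - G x\<bar> \<le> C * \<bar>\<tau> - \<tau>0\<bar> \<and> \<bar>fpE \<tau> \<delta> x - E x\<bar> \<le> C * \<bar>\<tau> - \<tau>0\<bar>"
    by (rule fp_continuous_dependence[OF S \<tau>0 \<delta>]) (assumption | rule that)+
  have lim0: "((\<lambda>\<tau>. C * \<bar>\<tau> - \<tau>0\<bar>) \<longlongrightarrow> 0) (at \<tau>0 within {0..1})"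
    by (auto intro!: tendsto_eq_intros)
  have ev01: "\<forall>\<^sub>F \<tau> in at \<tau>0 within {0..1}. 0 \<le> \<tau> \<and> \<tau> \<le> 1"
    by (auto simp: eventually_at_filter)
  have lim: "(h \<longlongrightarrow> L) (at \<tau>0 within {0..1})"
    if "\<And>\<tau>. 0 \<le> \<tau> \<Longrightarrow> \<tau> \<le> 1 \<Longrightarrow> \<bar>h \<tau> - L\<bar> \<le> C * \<bar>\<tau> - \<tau>0\<bar>" for h :: "real \<Rightarrow> real" and L
    by (rule Lim_transform_bound[OF _ lim0, THEN LIM_zero_cancel])
       (use ev01 in eventually_elim, use that in \<open>force intro: order_trans[OF that abs_ge_self]\<close>)
  show thesis
  proof (rule that[of "\<lambda>\<tau>. fp \<tau> \<delta>" "\<lambda>\<tau>. fpE \<tau> \<delta>"])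
    have "\<forall>\<^sub>F \<tau> in at \<tau>0 within {0..1}. C * \<bar>\<tau> - \<tau>0\<bar> < \<delta>" by (rule order_tendstoD(2)[OF lim0 \<delta>(1)])
    then show "\<forall>\<^sub>F \<tau> in at \<tau>0 within {0..1}. sol \<tau> X (fp \<tau> \<delta>) (fpE \<tau> \<delta>)"
      using ev01
    proof eventually_elim
      case (elim \<tau>)
      show ?case
      proof (rule sol_fp[OF \<delta>(1,2) _ _ solD(1)[OF S]])
        fix x assume x: "0 \<le> x" "x \<le> X"
        have "\<bar>fp \<tau> \<delta> x - G x\<bar> < \<delta>" using C[of \<tau> x] x elim by linarith
        then show "\<delta> < fp \<tau> \<delta> x" using \<delta>(3)[OF x] by linarith
      qed (use elim in auto)
    qed
  qed (use C in \<open>auto intro!: lim\<close>)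
qed

end

section \<open>Shooting\<close>

context profile_equation
begin

text \<open>x^\<nu> (F^m)', the diffusive part of \<open>E\<close>; it has the sign of the
  derivative of G.\<close>

definition flux :: "real \<Rightarrow> (real \<Rightarrow> real) \<Rightarrow> (real \<Rightarrow> real) \<Rightarrow> real \<Rightarrow> real" where
  "flux \<tau> G E y = E y - (1 - \<tau>) * y powr (\<nu> + \<kappa>) * G y powr (1 / m)"

text \<open>Where \<open>flux\<close> vanishes, its derivative is y^(\<nu>-1) F times this quantity.
  Of the coefficient B only q remains, because differentiating y^(\<nu>+\<kappa>) F consumes \<nu> +
  \<kappa>.\<close>

definition balance :: "real \<Rightarrow> (real \<Rightarrow> real) \<Rightarrow> real \<Rightarrow> real" where
  "balance \<tau> G y = (1 - \<tau>) * q * y powr \<kappa> - \<tau> * G y powr ((p - 1) / m)"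

lemma slope_eq_flux: "slope (1 - \<tau>) (\<lambda>x. G x powr (1 / m)) E y = y powr (- \<nu>) * flux \<tau> G E y"
  by (simp add: slope_def flux_def)

lemma flux_has_derivative:
  assumes S: "sol \<tau> X G E" and y: "0 < y" "y < X"
  shows "DERIV (flux \<tau> G E) y :> y powr (\<nu> - 1) * G y powr (1 / m) * balance \<tau> G y
    - (1 - \<tau>) * y powr (\<nu> + \<kappa>) * (G y powr (1 / m) / (m * G y)) * (y powr (- \<nu>) * flux \<tau> G E y)"
proof -
  note D = solD[OF S]
  have Gy: "0 < G y" using D(4)[of y] y by simp
  let ?s = "y powr (- \<nu>) * flux \<tau> G E y"
  have F: "DERIV (\<lambda>y. G y powr (1 / m)) y :> (1 / m * G y powr (1 / m - 1)) * ?s"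
    using D(8)[OF y] Gy unfolding slope_eq_flux
    by (intro DERIV_chain2[OF has_real_derivative_powr]) auto
  have d: "((\<lambda>y. E y - (1 - \<tau>) * y powr (\<nu> + \<kappa>) * G y powr (1 / m)) has_real_derivative
      flux_deriv (1 - \<tau>) \<tau> (\<lambda>x. G x powr (1 / m)) y
      - ((1 - \<tau>) * y powr (\<nu> + \<kappa>) * ((1 / m * G y powr (1 / m - 1)) * ?s)
         + (1 - \<tau>) * ((\<nu> + \<kappa>) * y powr (\<nu> + \<kappa> - 1)) * G y powr (1 / m))) (at y)"
    by (intro DERIV_diff DERIV_mult' DERIV_cmult D(7) F has_real_derivative_powr y)
  have e1: "1 / m * G y powr (1 / m - 1) = G y powr (1 / m) / (m * G y)" using Gy by (simp add: powr_diff)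
  have e2: "flux_deriv (1 - \<tau>) \<tau> (\<lambda>x. G x powr (1 / m)) y - (1 - \<tau>) * ((\<nu> + \<kappa>) * y powr (\<nu> + \<kappa> - 1)) * G y powr (1 / m)
     = y powr (\<nu> - 1) * G y powr (1 / m) * balance \<tau> G y"
  proof -
    have e1: "(G y powr (1 / m)) powr p = G y powr (1 / m) * G y powr ((p - 1) / m)"
      by (simp add: powr_powr diff_divide_distrib flip: powr_add)
    have e2: "y powr (\<nu> + \<kappa> - 1) = y powr (\<nu> - 1) * y powr \<kappa>" by (simp add: algebra_simps flip: powr_add)
    show ?thesis unfolding flux_deriv_def balance_def e1 e2 by (simp add: B_def algebra_simps)
  qed
  have "u - (v + w) = z - v'" if "u - w = z" "v = v'" for u v v' w z :: real using that by simp
  from this[OF e2] have "flux_deriv (1 - \<tau>) \<tau> (\<lambda>x. G x powr (1 / m)) y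
      - ((1 - \<tau>) * y powr (\<nu> + \<kappa>) * ((1 / m * G y powr (1 / m - 1)) * ?s)
         + (1 - \<tau>) * ((\<nu> + \<kappa>) * y powr (\<nu> + \<kappa> - 1)) * G y powr (1 / m))
    = y powr (\<nu> - 1) * G y powr (1 / m) * balance \<tau> G y
      - (1 - \<tau>) * y powr (\<nu> + \<kappa>) * (G y powr (1 / m) / (m * G y)) * ?s"
    unfolding e1 by (simp add: mult.assoc)
  with d show ?thesis unfolding flux_def[abs_def] by (simp only:)
qed

lemma continuous_on_flux:
  assumes S: "sol \<tau> X G E"
  shows "continuous_on {0..X} (flux \<tau> G E)"
proof -
  note D = solD[OF S]
  have "continuous_on {0..X} (\<lambda>y. G y powr (1 / m))"
    using D(4) by (intro continuous_on_powr D(2) continuous_on_const) force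
  then show ?thesis unfolding flux_def using \<nu> \<kappa>
    by (intro continuous_on_diff continuous_on_mult D(3) continuous_on_const continuous_on_powr_const) auto
qed

lemma continuous_on_balance:
  assumes S: "sol \<tau> X G E"
  shows "continuous_on {0..X} (balance \<tau> G)"
proof -
  note D = solD[OF S]
  have "continuous_on {0..X} (\<lambda>y. G y powr ((p - 1) / m))"
    using D(4) by (intro continuous_on_powr D(2) continuous_on_const) force
  then show ?thesis unfolding balance_def using \<kappa>
    by (intro continuous_on_diff continuous_on_mult continuous_on_const continuous_on_powr_const) auto
qed

definition trap :: "real \<Rightarrow> (real \<Rightarrow> real) \<Rightarrow> (real \<Rightarrow> real) \<Rightarrow> real \<Rightarrow> bool" where
  "trap \<tau> G E y \<longleftrightarrow> 0 < flux \<tau> G E y \<and> y powr (1 - \<nu>) * flux \<tau> G E y < q * m * G y \<and> 0 < balance \<tau> G y"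

text \<open>The second condition in \<open>trap\<close> says that \<open>F\<close> grows more slowly than \<open>x\<^sup>q\<close>. Subcriticality makes
  \<open>x\<^sup>q\<close> grow more slowly than the curve on which \<open>balance\<close> vanishes, so that the region is invariant.\<close>

lemma balance_pos_persists:
  assumes S: "sol \<tau> X G E" and \<tau>: "0 \<le> \<tau>" and x: "0 < x" "x < z" "z < X" and c: "0 < balance \<tau> G x"
    and le: "\<And>s. x \<le> s \<Longrightarrow> s \<le> z \<Longrightarrow> s powr (1 - \<nu>) * flux \<tau> G E s \<le> q * m * G s"
  shows "0 < balance \<tau> G z"
proof -
  note D = solD[OF S]
  define r where "r = (p - 1) / m"
  \<comment> \<open>\<tau> F^(p-1) x^(-\<kappa>); \<open>balance\<close> is positive where this is
    below (1 - \<tau>) q. The growth bound on G gives F^(p-1) x^(-\<kappa>) a logarithmic derivative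
    of at most ((p - 1) q - \<kappa>) / x, negative by subcriticality.\<close>
  define Z where "Z y = \<tau> * (G y powr r * y powr (- \<kappa>))" for y
  have r: "0 \<le> r" using p m by (simp add: r_def)
  have bal: "balance \<tau> G y = y powr \<kappa> * ((1 - \<tau>) * q - Z y)" if "0 < y" for y
    using that by (simp add: balance_def Z_def r_def powr_minus field_simps)
  have "Z z \<le> Z x"
  proof (rule DERIV_nonpos_imp_nonincreasing[OF less_imp_le[OF x(2)]])
    fix s assume s: "x \<le> s" "s \<le> z"
    have s': "0 < s" "s < X" using s x by auto
    have Gs: "0 < G s" using D(4)[of s] s' by simp
    let ?s = "s powr (- \<nu>) * flux \<tau> G E s"
    have dG: "DERIV (\<lambda>y. G y powr r) s :> (r * G s powr (r - 1)) * ?s"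
      using D(8)[OF s'] Gs unfolding slope_eq_flux by (intro DERIV_chain2[OF has_real_derivative_powr]) auto
    have "DERIV Z s :> \<tau> * (G s powr r * (- \<kappa> * s powr (- \<kappa> - 1)) + (r * G s powr (r - 1)) * ?s * s powr (- \<kappa>))"
      unfolding Z_def by (intro DERIV_cmult DERIV_mult' dG has_real_derivative_powr s')
    moreover have "\<tau> * (G s powr r * (- \<kappa> * s powr (- \<kappa> - 1)) + (r * G s powr (r - 1)) * ?s * s powr (- \<kappa>)) \<le> 0"
    proof -
      have e1: "s powr (- \<kappa>) = s powr (- \<kappa> - 1) * s" using s' by (simp add: powr_diff)
      have e2: "G s powr r = G s powr (r - 1) * G s" using Gs by (simp add: powr_diff)
      have e3: "?s * s = s powr (1 - \<nu>) * flux \<tau> G E s" using s' by (simp add: powr_diff powr_minus field_simps)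
      have "r * (?s * s) \<le> r * (q * m * G s)" unfolding e3 using le[OF s] r by (rule mult_left_mono)
      also have "\<dots> = ((p - 1) * q) * G s" using m by (simp add: r_def)
      also have "\<dots> \<le> \<kappa> * G s" using Gs subcritical p by (intro mult_right_mono) (auto simp: q_def field_simps)
      finally have "r * (?s * s) - \<kappa> * G s \<le> 0" by simp
      then have "\<tau> * (G s powr (r - 1) * s powr (- \<kappa> - 1) * (r * (?s * s) - \<kappa> * G s)) \<le> 0"
        using \<tau> by (intro mult_nonneg_nonpos) auto
      then show ?thesis unfolding e1 e2 by (simp add: algebra_simps)
    qed
    ultimately show "\<exists>d. DERIV Z s :> d \<and> d \<le> 0" by blast
  qed
  moreover have "0 < (1 - \<tau>) * q - Z x" using c bal[OF x(1)] x by (simp add: zero_less_mult_iff)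
  ultimately show ?thesis using bal[of z] x by simp
qed

lemma trap_invariant:
  assumes S: "sol \<tau> X G E" and \<tau>: "0 \<le> \<tau>" and x: "0 < x" "x \<le> y" "y < X" and tr: "trap \<tau> G E x"
  shows "trap \<tau> G E y"
proof (rule ccontr)
  assume ntr: "\<not> trap \<tau> G E y"
  note D = solD[OF S]
  define a b c where "a = flux \<tau> G E" and "b s = q * m * G s - s powr (1 - \<nu>) * flux \<tau> G E s"
    and "c = balance \<tau> G" for s
  \<comment> \<open>The region can only be left through a first zero of the smallest of the three
    functions. There \<open>balance\<close> is still positive, and each of the other two would
    vanish with a positive derivative.\<close>
  define f where "f s = min (a s) (min (b s) (c s))" for s
  have f_pos: "0 < f s \<longleftrightarrow> trap \<tau> G E s" for s by (auto simp: f_def a_def b_def c_def trap_def)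
  have sub: "{x..y} \<subseteq> {0..X}" using x by auto
  have ca: "continuous_on {x..y} a" unfolding a_def by (rule continuous_on_subset[OF continuous_on_flux[OF S] sub])
  have cb: "continuous_on {x..y} b"
    unfolding b_def using x
    by (intro continuous_intros continuous_on_subset[OF continuous_on_flux[OF S] sub] continuous_on_subset[OF D(2) sub]) auto
  have cc: "continuous_on {x..y} c" unfolding c_def by (rule continuous_on_subset[OF continuous_on_balance[OF S] sub])
  have "continuous_on {x..y} f" unfolding f_def by (intro continuous_on_min ca cb cc)
  then obtain z where z: "x < z" "z \<le> y" "f z = 0" "\<And>s. x \<le> s \<Longrightarrow> s < z \<Longrightarrow> 0 < f s"
    using first_zero[of x y f] x tr ntr f_pos by (metis not_less)
  have z0: "0 < z" "z < X" using z x by auto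
  have Gz: "0 < G z" using D(4)[of z] z0 by simp
  have abc: "0 \<le> a z" "0 \<le> b z" "0 \<le> c z" "a z = 0 \<or> b z = 0 \<or> c z = 0"
    using z(3) by (auto simp: f_def min_def split: if_splits)
  have left: "0 < a s" "0 < b s" if "x \<le> s" "s < z" for s using z(4)[OF that] by (auto simp: f_def)
  have cz: "0 < c z"
    unfolding c_def
  proof (rule balance_pos_persists[OF S \<tau> x(1) z(1) z0(2)])
    show "0 < balance \<tau> G x" using tr by (simp add: trap_def)
    show "s powr (1 - \<nu>) * flux \<tau> G E s \<le> q * m * G s" if "x \<le> s" "s \<le> z" for s
      using left(2)[of s] abc(2) that by (cases "s = z") (auto simp: b_def)
  qed
  note da = flux_has_derivative[OF S z0]
  have no_pos_deriv: False
    if g: "DERIV g z :> d" "0 < d" "g z = 0" "\<And>s. x \<le> s \<Longrightarrow> s < z \<Longrightarrow> 0 < g s" for g :: "real \<Rightarrow> real" and d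
  proof -
    obtain h where h: "0 < h" "\<And>t. 0 < t \<Longrightarrow> t < h \<Longrightarrow> g (z - t) < g z"
      using DERIV_pos_inc_left[OF g(1,2)] by blast
    define t where "t = min (h / 2) (z - x)"
    have "0 < t" "t < h" "x \<le> z - t" "z - t < z" using h(1) z(1) by (auto simp: t_def)
    then show False using h(2)[of t] g(3) g(4)[of "z - t"] by simp
  qed
  have az: "0 < a z"
  proof (rule ccontr)
    assume "\<not> 0 < a z"
    then have a0: "flux \<tau> G E z = 0" using abc(1) by (simp add: a_def)
    have "DERIV a z :> z powr (\<nu> - 1) * G z powr (1 / m) * c z"
      using da unfolding a0 a_def c_def by simp
    then show False by (rule no_pos_deriv) (use cz Gz z0 a0 left in \<open>auto simp: a_def\<close>)
  qed
  then have b0: "b z = 0" using abc(4) cz by auto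
  define da' where "da' = z powr (\<nu> - 1) * G z powr (1 / m) * balance \<tau> G z
    - (1 - \<tau>) * z powr (\<nu> + \<kappa>) * (G z powr (1 / m) / (m * G z)) * (z powr (- \<nu>) * flux \<tau> G E z)"
  have zb: "z powr (1 - \<nu>) * flux \<tau> G E z = q * m * G z" using b0 by (simp add: b_def)
  have "DERIV b z :> q * m * (z powr (- \<nu>) * flux \<tau> G E z)
      - (z powr (1 - \<nu>) * da' + (1 - \<nu>) * z powr (1 - \<nu> - 1) * flux \<tau> G E z)"
    unfolding b_def da'_def using D(8)[OF z0] unfolding slope_eq_flux
    by (intro DERIV_diff DERIV_cmult DERIV_mult' da has_real_derivative_powr z0)
  moreover have "0 < q * m * (z powr (- \<nu>) * flux \<tau> G E z)
      - (z powr (1 - \<nu>) * da' + (1 - \<nu>) * z powr (1 - \<nu> - 1) * flux \<tau> G E z)"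
  proof -
    let ?s = "z powr (- \<nu>) * flux \<tau> G E z"
    have s: "0 < ?s" using az z0 by (simp add: a_def)
    have zs: "z * ?s = q * m * G z" using zb z0 by (simp add: powr_diff powr_minus field_simps)
    have e: "z powr (\<nu> + \<kappa>) = z powr (\<nu> - 1) * z powr \<kappa> * z"
      using z0 by (simp add: powr_add powr_diff)
    \<comment> \<open>On the face b = 0 the drift term cancels the q part of \<open>balance\<close>
      and leaves only the source, whose sign is favourable. The remaining margin is q m - (1 -
      \<nu>), positive because q m = m/(m - p) > 1.\<close>
    have "(1 - \<tau>) * z powr (\<nu> + \<kappa>) * (G z powr (1 / m) / (m * G z)) * ?s
        = (1 - \<tau>) * z powr (\<nu> - 1) * z powr \<kappa> * (G z powr (1 / m) / (m * G z)) * (z * ?s)"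
      unfolding e by (simp only: mult_ac)
    also have "\<dots> = (1 - \<tau>) * z powr (\<nu> - 1) * z powr \<kappa> * G z powr (1 / m) * q"
      unfolding zs using Gz m by simp
    finally have "da' = - (\<tau> * z powr (\<nu> - 1) * G z powr (1 / m) * G z powr ((p - 1) / m))"
      unfolding da'_def balance_def by (simp add: algebra_simps)
    then have "z powr (1 - \<nu>) * da' \<le> 0" using \<tau> by (simp add: mult_nonneg_nonneg)
    moreover have "z powr (1 - \<nu> - 1) * flux \<tau> G E z = ?s" by simp
    moreover have "0 < (q * m - (1 - \<nu>)) * ?s"
    proof (rule mult_pos_pos[OF _ s])
      have "1 < q * m" using p m by (simp add: q_def)
      then show "0 < q * m - (1 - \<nu>)" using \<nu> by simp
    qed
    ultimately show ?thesis by (simp add: algebra_simps)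
  qed
  ultimately show False using b0 left(2) by (rule no_pos_deriv)
qed

text \<open>Near 0 the term with x^\<kappa> is negligible and F is close to 1, so E' is close to
  -\<tau> x^(\<nu>-1). For \<tau> > 0 the flux therefore starts out negative.\<close>

lemma scaled_flux_tendsto:
  assumes S: "sol \<tau> X G E"
  shows "((\<lambda>s. s powr (- \<nu>) * E s) \<longlongrightarrow> - \<tau> / \<nu>) (at_right 0)"
proof -
  note D = solD[OF S]
  have c: "continuous_on {0..X} (\<lambda>s. (1 - \<tau>) * B * s powr \<kappa> * G s powr (1 / m) - \<tau> * (G s powr (1 / m)) powr p)" (is "continuous_on _ ?h")
  proof -
    have "continuous_on {0..X} (\<lambda>y. G y powr (1 / m))"
      using D(4) by (intro continuous_on_powr D(2) continuous_on_const) force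
    then show ?thesis using D(4) by (intro continuous_on_weighted_source) auto
  qed
  have E: "E y = wint \<nu> ?h y" if y: "0 \<le> y" "y \<le> X" for y
  proof -
    have "E y - wint \<nu> ?h y = E 0 - wint \<nu> ?h 0"
    proof (rule DERIV_isconst2[of 0 X "\<lambda>y. E y - wint \<nu> ?h y"])
      show "continuous_on {0..X} (\<lambda>y. E y - wint \<nu> ?h y)"
        using D(1) by (intro continuous_on_diff D(3) continuous_on_wint \<nu> c) auto
      show "DERIV (\<lambda>y. E y - wint \<nu> ?h y) z :> 0" if z: "0 < z" "z < X" for z
        using DERIV_diff[OF D(7)[OF z] wint_has_derivative[OF \<nu> c z]] by (simp add: flux_deriv_def)
    qed (use D(1) y in auto)
    then show ?thesis using D(6) by simp
  qed
  have "((\<lambda>s. s powr (- \<nu>) * wint \<nu> ?h s) \<longlongrightarrow> - \<tau> / \<nu>) (at 0 within {0..X})"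
    by (rule tendsto_eq_rhs[OF wint_over_powr_tendsto[OF \<nu> c D(1)]]) (use D(5) \<kappa> in simp)
  moreover have "at 0 within {0..X} = at_right 0"
    using D(1) by (intro at_within_Icc_at_right)
  ultimately have "((\<lambda>s. s powr (- \<nu>) * wint \<nu> ?h s) \<longlongrightarrow> - \<tau> / \<nu>) (at_right 0)" by simp
  moreover have "\<forall>\<^sub>F s in at_right 0. s powr (- \<nu>) * wint \<nu> ?h s = s powr (- \<nu>) * E s"
    unfolding eventually_at_right[OF D(1)] using E D(1) by (intro exI[of _ X]) auto
  ultimately show ?thesis by (rule Lim_transform_eventually)
qed

text \<open>The first point at which the flux stops being nonpositive lies on the boundary of the trap, so the
  solution enters the trap unless its flux is nonpositive throughout.\<close>

lemma flux_nonpos_or_trapped: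
  assumes S: "sol \<tau> X G E" and \<tau>: "0 < \<tau>" "\<tau> \<le> 1" and ntr: "\<And>x. 0 < x \<Longrightarrow> x < X \<Longrightarrow> \<not> trap \<tau> G E x"
    and y: "0 < y" "y < X"
  shows "flux \<tau> G E y \<le> 0"
proof (rule ccontr)
  assume nle: "\<not> flux \<tau> G E y \<le> 0"
  note D = solD[OF S]
  let ?a = "flux \<tau> G E"
  have cont: "isCont ?a s" if "0 < s" "s < X" for s
    using continuous_on_interior[OF continuous_on_flux[OF S], of s] that by simp
  have "\<forall>\<^sub>F s in at_right 0. s powr (- \<nu>) * E s < 0"
    using order_tendstoD(2)[OF scaled_flux_tendsto[OF S], of 0] \<tau> \<nu> by (simp add: divide_neg_pos)
  then obtain d where d: "0 < d" "\<And>s. 0 < s \<Longrightarrow> s < d \<Longrightarrow> s powr (- \<nu>) * E s < 0"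
    unfolding eventually_at_right[OF zero_less_one] by blast
  have neg: "?a s < 0" if "0 < s" "s < d" for s
  proof -
    have "E s < 0" using d(2)[OF that] that(1) by (simp add: mult_less_0_iff)
    moreover have "0 \<le> (1 - \<tau>) * s powr (\<nu> + \<kappa>) * G s powr (1 / m)" using \<tau> by simp
    ultimately show ?thesis by (simp add: flux_def)
  qed
  \<comment> \<open>The points of positive flux. Their infimum is positive because the flux starts
    out negative.\<close>
  define W where "W = {s. 0 < s \<and> s < X \<and> 0 < ?a s}"
  have W: "y \<in> W" "bdd_below W" using y nle by (auto simp: W_def intro!: bdd_belowI[of _ 0])
  define w where "w = Inf W"
  have w_le: "w \<le> s" if "s \<in> W" for s unfolding w_def by (rule cInf_lower[OF that W(2)])
  have "d \<le> w" unfolding w_def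
  proof (rule cInf_greatest)
    show "d \<le> s" if "s \<in> W" for s using neg[of s] that by (force simp: W_def)
  qed (use W in auto)
  then have w: "0 < w" "w < X" using d(1) w_le[OF W(1)] y by auto
  have near: "\<exists>s\<in>W. s < t" if "w < t" for t
    using cInf_lessD[of W t] W that by (auto simp: w_def)
  have before: "?a s \<le> 0" if "0 < s" "s < w" for s
    using w_le[of s] that w by (force simp: W_def)
  have lim: "(?a \<longlongrightarrow> ?a w) (at w)" using cont[OF w] by (simp add: isCont_def)
  have a0: "?a w = 0"
  proof (rule antisym)
    have "\<forall>\<^sub>F s in at_left w. ?a s \<le> 0"
      unfolding eventually_at_left[OF w(1)] using w before by (intro exI[of _ 0]) auto
    moreover have "(?a \<longlongrightarrow> ?a w) (at_left w)" using lim by (simp add: filterlim_at_split)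
    ultimately show "?a w \<le> 0" by (intro tendsto_upperbound[of ?a "?a w" "at_left w"]) auto
    show "0 \<le> ?a w"
    proof (rule ccontr)
      assume "\<not> 0 \<le> ?a w"
      then have "\<forall>\<^sub>F s in at w. ?a s < 0" using order_tendstoD(2)[OF lim, of 0] by simp
      then obtain e where e: "0 < e" "\<And>s. s \<noteq> w \<Longrightarrow> dist s w < e \<Longrightarrow> ?a s < 0"
        unfolding eventually_at by auto
      obtain s where "s \<in> W" "s < w + e" using near[of "w + e"] e(1) by auto
      then show False using e(2)[of s] w_le[of s] \<open>\<not> 0 \<le> ?a w\<close> by (cases "s = w") (auto simp: W_def dist_real_def)
    qed
  qed
  have Gw: "0 < G w" using D(4)[of w] w by simp
  have da: "DERIV ?a w :> w powr (\<nu> - 1) * G w powr (1 / m) * balance \<tau> G w"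
    using flux_has_derivative[OF S w] unfolding a0 by simp
  \<comment> \<open>The flux reaches 0 at w from nonpositive values, so its derivative there, a
    positive multiple of \<open>balance\<close>, cannot be negative.\<close>
  have c0: "0 \<le> balance \<tau> G w"
  proof (rule ccontr)
    assume "\<not> 0 \<le> balance \<tau> G w"
    then have "w powr (\<nu> - 1) * G w powr (1 / m) * balance \<tau> G w < 0" using w Gw by (intro mult_pos_neg mult_pos_pos) auto
    from DERIV_neg_dec_left[OF da this] obtain h where h: "0 < h" "\<And>t. 0 < t \<Longrightarrow> t < h \<Longrightarrow> ?a w < ?a (w - t)" by blast
    define t where "t = min (h / 2) (w / 2)"
    have "0 < t" "t < h" "0 < w - t" using h(1) w by (auto simp: t_def min_def)
    then show False using h(2)[of t] before[of "w - t"] a0 by simp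
  qed
  have "\<tau> < 1"
  proof (rule ccontr)
    assume "\<not> \<tau> < 1"
    then have "balance \<tau> G w < 0" using \<tau> Gw by (simp add: balance_def)
    then show False using c0 by simp
  qed
  have dG: "DERIV G w :> 0"
    using D(8)[OF w] unfolding slope_eq_flux a0 by simp
  have "DERIV (\<lambda>y. G y powr ((p - 1) / m)) w :> ((p - 1) / m * G w powr ((p - 1) / m - 1)) * 0"
    using dG Gw by (intro DERIV_chain2[OF has_real_derivative_powr]) auto
  \<comment> \<open>As G' = 0 at w while x^\<kappa> grows, \<open>balance\<close> increases strictly
    at w even if it vanishes there. Points of W just beyond w therefore lie in the trap.\<close>
  then have "DERIV (balance \<tau> G) w :> (1 - \<tau>) * q * (\<kappa> * w powr (\<kappa> - 1)) - \<tau> * (((p - 1) / m * G w powr ((p - 1) / m - 1)) * 0)"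
    unfolding balance_def by (intro DERIV_diff DERIV_cmult has_real_derivative_powr w)
  moreover have "0 < (1 - \<tau>) * q * (\<kappa> * w powr (\<kappa> - 1)) - \<tau> * (((p - 1) / m * G w powr ((p - 1) / m - 1)) * 0)"
    using \<open>\<tau> < 1\<close> q_pos \<kappa> w by simp
  ultimately obtain h where h: "0 < h" "\<And>t. 0 < t \<Longrightarrow> t < h \<Longrightarrow> balance \<tau> G w < balance \<tau> G (w + t)"
    using DERIV_pos_inc_right by blast
  have "((\<lambda>s. q * m * G s - s powr (1 - \<nu>) * ?a s) \<longlongrightarrow> q * m * G w - w powr (1 - \<nu>) * ?a w) (at w)"
    using lim DERIV_isCont[OF dG] w by (intro tendsto_intros) (auto simp: isCont_def)
  moreover have "0 < q * m * G w - w powr (1 - \<nu>) * ?a w" using a0 q_pos m Gw by simp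
  ultimately have "\<forall>\<^sub>F s in at w. 0 < q * m * G s - s powr (1 - \<nu>) * ?a s" by (rule order_tendstoD(1))
  then obtain e where e: "0 < e" "\<And>s. s \<noteq> w \<Longrightarrow> dist s w < e \<Longrightarrow> 0 < q * m * G s - s powr (1 - \<nu>) * ?a s"
    unfolding eventually_at by auto
  obtain s where s: "s \<in> W" "s < w + min h e" using near[of "w + min h e"] h(1) e(1) by auto
  have ws: "w < s" using w_le[OF s(1)] a0 s(1) by (cases "s = w") (auto simp: W_def)
  have "s < w + h" "s < w + e" using s(2) by (auto simp: min_def split: if_splits)
  then have "trap \<tau> G E s"
    unfolding trap_def using s ws e(2)[of s] h(2)[of "s - w"] c0 by (auto simp: W_def dist_real_def)
  then show False using ntr[of s] s(1) by (auto simp: W_def)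
qed

section \<open>Loss of positivity with negative flux, and the two shooting alternatives\<close>

definition sink :: "(real \<Rightarrow> real) \<Rightarrow> (real \<Rightarrow> real) \<Rightarrow> real \<Rightarrow> bool" where
  "sink G E x \<longleftrightarrow> B * ((x + 1) powr (\<nu> + \<kappa>) / x) * G x powr (1 / m) < - E x / 2 \<and> G x * (x + 1) powr \<nu> < - E x / 2"

text \<open>In \<open>sink\<close> the flux is so negative compared with \<open>G\<close> that \<open>G\<close> reaches zero before the flux
  recovers half of its value.\<close>

lemma sink_persists:
  assumes S: "sol \<tau> X G E" and \<tau>: "0 \<le> \<tau>" "\<tau> \<le> 1" and x: "0 < x" "x \<le> y" "y < X" and sink: "sink G E x"
  shows "E y < 0"
proof -
  note D = solD[OF S]
  have Gx: "0 < G x" using D(4)[of x] x by simp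
  have "0 \<le> G x * (x + 1) powr \<nu>" using Gx by simp
  then have Ex: "E x < 0" using sink unfolding sink_def by linarith
  have der: "s powr (- \<nu>) * flux \<tau> G E s \<le> s powr (- \<nu>) * E s" if "0 < s" "s < X" for s
    using \<tau> by (intro mult_left_mono) (auto simp: flux_def)
  \<comment> \<open>Until E has recovered half of its value G decreases, so the first inequality of
    \<open>sink\<close> keeps E' below -E x / 2. Over a length of at most 1 half of E x cannot be
    regained.\<close>
  have E_lt: "E z < E x / 2" if z: "x \<le> z" "z \<le> x + 1" "z < X" for z
  proof (rule ccontr)
    assume "\<not> E z < E x / 2"
    then have nle: "E x / 2 - E z \<le> 0" by simp
    have c: "continuous_on {x..z} (\<lambda>s. E x / 2 - E s)"
      using x z by (intro continuous_intros continuous_on_subset[OF D(3)]) auto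
    obtain w where w: "x < w" "w \<le> z" "E x / 2 - E w = 0" "\<And>s. x \<le> s \<Longrightarrow> s < w \<Longrightarrow> 0 < E x / 2 - E s"
      using first_zero[OF c z(1) _ nle] Ex by (auto simp: field_simps)
    have Gle: "G s \<le> G x" if s: "x \<le> s" "s \<le> w" for s
    proof (rule DERIV_nonpos_imp_nonincreasing[OF s(1)])
      fix r assume r: "x \<le> r" "r \<le> s"
      have r': "0 < r" "r < X" using r s w z x by auto
      have "E r \<le> 0" using w(3) w(4)[of r] r s Ex by (cases "r = w") auto
      then have "r powr (- \<nu>) * E r \<le> 0" by (intro mult_nonneg_nonpos) auto
      then have "r powr (- \<nu>) * flux \<tau> G E r \<le> 0" using der[OF r'] by linarith
      then show "\<exists>d. DERIV G r :> d \<and> d \<le> 0"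
        using D(8)[OF r'] unfolding slope_eq_flux by blast
    qed
    have "\<exists>t>x. t < w \<and> E w - E x = (w - x) * flux_deriv (1 - \<tau>) \<tau> (\<lambda>x. G x powr (1 / m)) t"
      using w z x by (intro MVT2 D(7)) auto
    then obtain t where t: "x < t" "t < w" "E w - E x = (w - x) * flux_deriv (1 - \<tau>) \<tau> (\<lambda>x. G x powr (1 / m)) t" by blast
    have t0: "0 < t" "t < X" using t w z x by auto
    have Gt: "0 < G t" using D(4)[of t] t0 by simp
    have "flux_deriv (1 - \<tau>) \<tau> (\<lambda>x. G x powr (1 / m)) t \<le> t powr (\<nu> - 1) * ((1 - \<tau>) * B * t powr \<kappa> * G t powr (1 / m))"
      unfolding flux_deriv_def using \<tau> by (intro mult_left_mono) auto
    also have "\<dots> = (1 - \<tau>) * (B * (t powr (\<nu> + \<kappa>) / t) * G t powr (1 / m))"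
      using t0 by (simp add: powr_add powr_diff)
    also have "\<dots> \<le> 1 * (B * ((x + 1) powr (\<nu> + \<kappa>) / x) * G x powr (1 / m))"
      using \<tau> B_pos t0 t x w z Gle[of t] Gt \<nu> \<kappa> m
      by (intro mult_mono frac_le powr_mono2 mult_nonneg_nonneg divide_nonneg_nonneg) auto
    also have "\<dots> < - E x / 2" using sink by (simp add: sink_def)
    finally have lt: "flux_deriv (1 - \<tau>) \<tau> (\<lambda>x. G x powr (1 / m)) t < - E x / 2" .
    have "(w - x) * flux_deriv (1 - \<tau>) \<tau> (\<lambda>x. G x powr (1 / m)) t < (w - x) * (- E x / 2)"
      using lt w(1) by (intro mult_strict_left_mono) auto
    also have "\<dots> \<le> 1 * (- E x / 2)" using w z Ex by (intro mult_right_mono) auto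
    finally show False using t(3) w(3) by simp
  qed
  \<comment> \<open>If the solution lived beyond x + 1, the second inequality of \<open>sink\<close>
    would push G below 0 there.\<close>
  have "X \<le> x + 1"
  proof (rule ccontr)
    assume "\<not> X \<le> x + 1"
    then have X: "x + 1 < X" by simp
    have "\<exists>t>x. t < x + 1 \<and> G (x + 1) - G x = (x + 1 - x) * slope (1 - \<tau>) (\<lambda>x. G x powr (1 / m)) E t"
      using x X by (intro MVT2 D(8)) auto
    then obtain t where t: "x < t" "t < x + 1" "G (x + 1) - G x = t powr (- \<nu>) * flux \<tau> G E t"
      unfolding slope_eq_flux by auto
    have "t powr (- \<nu>) * flux \<tau> G E t \<le> t powr (- \<nu>) * E t" using der[of t] t x X by simp
    also have "\<dots> \<le> t powr (- \<nu>) * (E x / 2)" using E_lt[of t] t X by (intro mult_left_mono) auto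
    also have "\<dots> \<le> (x + 1) powr (- \<nu>) * (E x / 2)"
      using t x \<nu> Ex by (intro mult_right_mono_neg powr_mono2') auto
    also have "\<dots> < - G x"
    proof -
      have "(x + 1) powr (- \<nu>) * (G x * (x + 1) powr \<nu>) < (x + 1) powr (- \<nu>) * (- E x / 2)"
        using sink x by (intro mult_strict_left_mono) (auto simp: sink_def)
      moreover have "(x + 1) powr (- \<nu>) * (G x * (x + 1) powr \<nu>) = G x" using x by (simp add: powr_minus)
      ultimately show ?thesis by simp
    qed
    finally have "G (x + 1) < 0" using t(3) by linarith
    then show False using D(4)[of "x + 1"] X x by simp
  qed
  then show ?thesis using E_lt[of y] x Ex by simp
qed

definition trapped :: "real \<Rightarrow> bool" where
  "trapped \<tau> \<longleftrightarrow> (\<exists>X G E x. sol \<tau> X G E \<and> 0 < x \<and> x < X \<and> trap \<tau> G E x)"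

definition sinking :: "real \<Rightarrow> bool" where
  "sinking \<tau> \<longleftrightarrow> (\<exists>X G E x. sol \<tau> X G E \<and> 0 < x \<and> x < X \<and> sink G E x)"

text \<open>Both conditions have consequences for all later points, and at a common one a positive
  diffusive flux contradicts E < 0, since the drift is nonnegative.\<close>

lemma not_trapped_and_sinking:
  assumes \<tau>: "0 \<le> \<tau>" "\<tau> \<le> 1" and "trapped \<tau>" "sinking \<tau>"
  shows False
proof -
  obtain X1 G1 E1 x1 where 1: "sol \<tau> X1 G1 E1" "0 < x1" "x1 < X1" "trap \<tau> G1 E1 x1"
    using assms(3) unfolding trapped_def by blast
  obtain X2 G2 E2 x2 where 2: "sol \<tau> X2 G2 E2" "0 < x2" "x2 < X2" "sink G2 E2 x2"
    using assms(4) unfolding sinking_def by blast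
  obtain X G E where S: "sol \<tau> X G E" "X1 \<le> X" "X2 \<le> X"
  proof (cases "X1 \<le> X2")
    case True
    then show ?thesis by (intro that[OF 2(1)]) auto
  next
    case False
    then show ?thesis by (intro that[OF 1(1)]) auto
  qed
  have tr: "trap \<tau> G E x1"
    using 1(4) sol_unique[OF S(1) 1(1) \<tau>, of x1] 1(2,3) S(2)
    by (simp add: trap_def flux_def balance_def)
  have sk: "sink G E x2"
    using 2(4) sol_unique[OF S(1) 2(1) \<tau>, of x2] 2(2,3) S(3) by (simp add: sink_def)
  define y where "y = max x1 x2"
  have y: "x1 \<le> y" "x2 \<le> y" "y < X" using 1 2 S by (auto simp: y_def)
  have "0 < flux \<tau> G E y" using trap_invariant[OF S(1) \<tau>(1) 1(2) y(1,3) tr] by (simp add: trap_def)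
  moreover have "E y < 0" by (rule sink_persists[OF S(1) \<tau> 2(2) y(2,3) sk])
  moreover have "0 \<le> (1 - \<tau>) * y powr (\<nu> + \<kappa>) * G y powr (1 / m)" using \<tau> by simp
  ultimately show False by (simp add: flux_def)
qed

lemma trapped_open:
  assumes \<tau>: "0 \<le> \<tau>0" "\<tau>0 \<le> 1" and "trapped \<tau>0"
  shows "\<forall>\<^sub>F \<tau> in at \<tau>0 within {0..1}. trapped \<tau>"
proof -
  obtain X G E x where S: "sol \<tau>0 X G E" "0 < x" "x < X" "trap \<tau>0 G E x"
    using assms(3) unfolding trapped_def by blast
  obtain g e where ge0: "\<forall>\<^sub>F \<tau> in at \<tau>0 within {0..1}. sol \<tau> X (g \<tau>) (e \<tau>)"
    "\<And>x. 0 \<le> x \<Longrightarrow> x \<le> X \<Longrightarrow> ((\<lambda>\<tau>. g \<tau> x) \<longlongrightarrow> G x) (at \<tau>0 within {0..1})"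
    "\<And>x. 0 \<le> x \<Longrightarrow> x \<le> X \<Longrightarrow> ((\<lambda>\<tau>. e \<tau> x) \<longlongrightarrow> E x) (at \<tau>0 within {0..1})"
    by (rule sol_continuous_dependence[OF S(1) \<tau>]) (assumption | rule that)+
  have x: "0 \<le> x" "x \<le> X" using S(2,3) by auto
  note ge = ge0(1) ge0(2)[OF x] ge0(3)[OF x]
  have Gx: "G x \<noteq> 0" using solD(4)[OF S(1), of x] S(2,3) by simp
  have gp: "((\<lambda>\<tau>. g \<tau> x powr c) \<longlongrightarrow> G x powr c) (at \<tau>0 within {0..1})" for c
    by (rule tendsto_powr[OF ge(2) tendsto_const Gx])
  have f: "((\<lambda>\<tau>. flux \<tau> (g \<tau>) (e \<tau>) x) \<longlongrightarrow> flux \<tau>0 G E x) (at \<tau>0 within {0..1})"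
    unfolding flux_def by (intro tendsto_diff tendsto_mult tendsto_const tendsto_ident_at gp ge(3))
  have b: "((\<lambda>\<tau>. balance \<tau> (g \<tau>) x) \<longlongrightarrow> balance \<tau>0 G x) (at \<tau>0 within {0..1})"
    unfolding balance_def by (intro tendsto_diff tendsto_mult tendsto_const tendsto_ident_at gp)
  have d: "((\<lambda>\<tau>. q * m * g \<tau> x - x powr (1 - \<nu>) * flux \<tau> (g \<tau>) (e \<tau>) x) \<longlongrightarrow>
      q * m * G x - x powr (1 - \<nu>) * flux \<tau>0 G E x) (at \<tau>0 within {0..1})"
    by (intro tendsto_diff tendsto_mult tendsto_const ge(2) f)
  have a: "0 < flux \<tau>0 G E x" "0 < q * m * G x - x powr (1 - \<nu>) * flux \<tau>0 G E x" "0 < balance \<tau>0 G x"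
    using S(4) by (auto simp: trap_def)
  show ?thesis
    using order_tendstoD(1)[OF f a(1)] order_tendstoD(1)[OF b a(3)] order_tendstoD(1)[OF d a(2)] ge(1)
  proof eventually_elim
    case (elim \<tau>)
    then have "trap \<tau> (g \<tau>) (e \<tau>) x" by (simp add: trap_def)
    then show ?case unfolding trapped_def using elim S(2,3) by blast
  qed
qed

lemma sinking_open:
  assumes \<tau>: "0 \<le> \<tau>0" "\<tau>0 \<le> 1" and "sinking \<tau>0"
  shows "\<forall>\<^sub>F \<tau> in at \<tau>0 within {0..1}. sinking \<tau>"
proof -
  obtain X G E x where S: "sol \<tau>0 X G E" "0 < x" "x < X" "sink G E x"
    using assms(3) unfolding sinking_def by blast
  obtain g e where ge0: "\<forall>\<^sub>F \<tau> in at \<tau>0 within {0..1}. sol \<tau> X (g \<tau>) (e \<tau>)"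
    "\<And>x. 0 \<le> x \<Longrightarrow> x \<le> X \<Longrightarrow> ((\<lambda>\<tau>. g \<tau> x) \<longlongrightarrow> G x) (at \<tau>0 within {0..1})"
    "\<And>x. 0 \<le> x \<Longrightarrow> x \<le> X \<Longrightarrow> ((\<lambda>\<tau>. e \<tau> x) \<longlongrightarrow> E x) (at \<tau>0 within {0..1})"
    by (rule sol_continuous_dependence[OF S(1) \<tau>]) (assumption | rule that)+
  have x: "0 \<le> x" "x \<le> X" using S(2,3) by auto
  note ge = ge0(1) ge0(2)[OF x] ge0(3)[OF x]
  have Gx: "G x \<noteq> 0" using solD(4)[OF S(1), of x] S(2,3) by simp
  have gp: "((\<lambda>\<tau>. g \<tau> x powr c) \<longlongrightarrow> G x powr c) (at \<tau>0 within {0..1})" for c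
    by (rule tendsto_powr[OF ge(2) tendsto_const Gx])
  have l1: "((\<lambda>\<tau>. - e \<tau> x / 2 - B * ((x + 1) powr (\<nu> + \<kappa>) / x) * g \<tau> x powr (1 / m)) \<longlongrightarrow>
      - E x / 2 - B * ((x + 1) powr (\<nu> + \<kappa>) / x) * G x powr (1 / m)) (at \<tau>0 within {0..1})"
    by (intro tendsto_diff tendsto_mult tendsto_divide tendsto_minus tendsto_const gp ge(3)) auto
  have l2: "((\<lambda>\<tau>. - e \<tau> x / 2 - g \<tau> x * (x + 1) powr \<nu>) \<longlongrightarrow> - E x / 2 - G x * (x + 1) powr \<nu>) (at \<tau>0 within {0..1})"
    by (intro tendsto_diff tendsto_mult tendsto_divide tendsto_minus tendsto_const ge(2,3)) auto
  have a: "0 < - E x / 2 - B * ((x + 1) powr (\<nu> + \<kappa>) / x) * G x powr (1 / m)" "0 < - E x / 2 - G x * (x + 1) powr \<nu>"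
    using S(4) by (auto simp: sink_def)
  show ?thesis
    using order_tendstoD(1)[OF l1 a(1)] order_tendstoD(1)[OF l2 a(2)] ge(1)
  proof eventually_elim
    case (elim \<tau>)
    then have "sink (g \<tau>) (e \<tau>) x" by (simp add: sink_def)
    then show ?case unfolding sinking_def using elim S(2,3) by blast
  qed
qed

lemma trapped_0: "trapped 0"
proof -
  obtain X G E where S: "sol 0 X G E" using sol_exists[of 0] by auto
  note D = solD[OF S]
  have pos: "0 < flux 0 G E y" if y: "0 < y" "y < X" for y
  proof (rule ccontr)
    assume nle: "\<not> 0 < flux 0 G E y"
    have c: "continuous_on {0..y} (flux 0 G E)" using y by (intro continuous_on_subset[OF continuous_on_flux[OF S]]) auto
    obtain s where s: "0 \<le> s" "s \<le> y" "\<And>t. 0 \<le> t \<Longrightarrow> t \<le> y \<Longrightarrow> flux 0 G E s \<le> flux 0 G E t"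
      using continuous_attains_inf[OF _ _ c] y by auto
    \<comment> \<open>A minimum point of the flux other than 0: if the minimum is attained at 0, it
      equals 0, and y is a minimum point too. At w the flux is at most 0, so for \<tau> = 0 its
      derivative is positive.\<close>
    define w where "w = (if s = 0 then y else s)"
    have f0: "flux 0 G E 0 = 0" using \<nu> \<kappa> D(6) by (simp add: flux_def)
    have w: "0 < w" "w \<le> y" "w < X" using s y by (auto simp: w_def)
    have w_min: "flux 0 G E w \<le> flux 0 G E t" if "0 \<le> t" "t \<le> y" for t
      using s(3)[OF that] nle f0 by (auto simp: w_def split: if_splits)
    have fw: "flux 0 G E w \<le> 0" using w_min[of 0] f0 y by simp
    have Gw: "0 < G w" using D(4)[of w] w by simp
    have "0 < w powr (\<nu> - 1) * G w powr (1 / m) * balance 0 G w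
      - (1 - 0) * w powr (\<nu> + \<kappa>) * (G w powr (1 / m) / (m * G w)) * (w powr (- \<nu>) * flux 0 G E w)"
    proof -
      have "0 < w powr (\<nu> - 1) * G w powr (1 / m) * balance 0 G w"
        using w Gw q_pos by (simp add: balance_def)
      moreover have "(1 - 0) * w powr (\<nu> + \<kappa>) * (G w powr (1 / m) / (m * G w)) * (w powr (- \<nu>) * flux 0 G E w) \<le> 0"
        using Gw m fw by (intro mult_nonneg_nonpos mult_nonneg_nonneg) auto
      ultimately show ?thesis by linarith
    qed
    from DERIV_pos_inc_left[OF flux_has_derivative[OF S w(1,3)] this]
    obtain h where h: "0 < h" "\<And>t. 0 < t \<Longrightarrow> t < h \<Longrightarrow> flux 0 G E (w - t) < flux 0 G E w" by blast
    define t where "t = min (h / 2) w"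
    have "0 < t" "t < h" "0 \<le> w - t" "w - t \<le> y" using h(1) w by (auto simp: t_def)
    then show False using h(2)[of t] w_min[of "w - t"] by simp
  qed
  have lE: "((\<lambda>s. s powr (- \<nu>) * E s) \<longlongrightarrow> 0) (at_right 0)" using scaled_flux_tendsto[OF S] by simp
  have "(G \<longlongrightarrow> G 0) (at 0 within {0..X})" using D(1,2) by (auto simp: continuous_on)
  then have lG: "(G \<longlongrightarrow> 1) (at_right 0)" using at_within_Icc_at_right[OF D(1)] D(5) by simp
  have lF: "((\<lambda>s. G s powr (1 / m)) \<longlongrightarrow> 1 powr (1 / m)) (at_right 0)"
    by (intro tendsto_powr lG tendsto_const) simp
  have lp: "((\<lambda>s. s powr (1 + \<kappa>)) \<longlongrightarrow> 0 powr (1 + \<kappa>)) (at_right 0)"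
    using \<kappa> by (intro tendsto_powr' tendsto_ident_at tendsto_const) (auto simp: eventually_at_filter)
  \<comment> \<open>The growth condition of \<open>trap\<close> holds near 0, because q m G tends to
    q m while x^(1-\<nu>) times the flux tends to 0.\<close>
  have lb: "((\<lambda>s. q * m * G s - (s * (s powr (- \<nu>) * E s) - s powr (1 + \<kappa>) * G s powr (1 / m))) \<longlongrightarrow>
      q * m * 1 - (0 * 0 - 0 powr (1 + \<kappa>) * 1 powr (1 / m))) (at_right 0)"
    by (intro tendsto_diff tendsto_mult tendsto_const lE lG lp lF tendsto_ident_at)
  have "0 < q * m * 1 - (0 * 0 - 0 powr (1 + \<kappa>) * 1 powr (1 / m))" using q_pos m by simp
  from order_tendstoD(1)[OF lb this]
  have "\<forall>\<^sub>F s in at_right 0. 0 < q * m * G s - (s * (s powr (- \<nu>) * E s) - s powr (1 + \<kappa>) * G s powr (1 / m))"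
    .
  moreover have "\<forall>\<^sub>F s in at_right 0. 0 < s \<and> s < X"
    unfolding eventually_at_right[OF D(1)] using D(1) by blast
  ultimately have "\<forall>\<^sub>F s in at_right 0. 0 < s \<and> s < X \<and> trap 0 G E s"
  proof eventually_elim
    case (elim s)
    have "s powr (1 - \<nu>) * flux 0 G E s = s * (s powr (- \<nu>) * E s) - s powr (1 + \<kappa>) * G s powr (1 / m)"
    proof -
      have e1: "s powr (1 - \<nu>) = s * s powr (- \<nu>)" using elim by (simp add: powr_diff powr_minus field_simps)
      have e2: "s powr (1 - \<nu>) * s powr (\<nu> + \<kappa>) = s powr (1 + \<kappa>)" by (simp flip: powr_add)
      have "s powr (1 - \<nu>) * flux 0 G E s = s powr (1 - \<nu>) * E s - (s powr (1 - \<nu>) * s powr (\<nu> + \<kappa>)) * G s powr (1 / m)"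
        by (simp add: flux_def algebra_simps)
      then show ?thesis unfolding e2 by (simp add: e1)
    qed
    then show ?case using elim pos[of s] q_pos by (simp add: trap_def balance_def)
  qed
  then obtain s where "0 < s" "s < X" "trap 0 G E s"
    using eventually_happens[of _ "at_right (0::real)"] by auto
  then show ?thesis using S unfolding trapped_def by blast
qed

end

lemma continuous_on_atLeastI:
  fixes f :: "real \<Rightarrow> 'a::topological_space"
  assumes "\<And>X. a < X \<Longrightarrow> continuous_on {a..X} f"
  shows "continuous_on {a..} f"
  unfolding continuous_on_eq_continuous_within
proof
  fix x assume x: "x \<in> {a..}"
  then have "continuous (at x within {a..x + 1}) f"
    using assms[of "x + 1"] by (auto simp: continuous_on_eq_continuous_within)
  moreover have "at x within {a..x + 1} = at x within {a..}"
    using x by (intro at_within_nhd[of x "{..<x + 1}"]) auto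
  ultimately show "continuous (at x within {a..}) f" by simp
qed

section \<open>The maximal solution and its end point\<close>

context profile_equation
begin

text \<open>By \<open>sol_unique\<close> all solutions agree where they are defined; the choice
  yields the values of the maximal solution.\<close>

definition gsol :: "real \<Rightarrow> real \<Rightarrow> real" where
  "gsol \<tau> x = (SOME v. \<exists>X G E. sol \<tau> X G E \<and> x \<le> X \<and> v = G x)"

definition esol :: "real \<Rightarrow> real \<Rightarrow> real" where
  "esol \<tau> x = (SOME v. \<exists>X G E. sol \<tau> X G E \<and> x \<le> X \<and> v = E x)"

lemma gsol:
  assumes S: "sol \<tau> X G E" and \<tau>: "0 \<le> \<tau>" "\<tau> \<le> 1" and x: "0 \<le> x" "x \<le> X"
  shows "gsol \<tau> x = G x" "esol \<tau> x = E x"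
proof -
  show "gsol \<tau> x = G x"
    unfolding gsol_def
    by (rule some_equality) (use S x sol_unique(1)[OF _ S \<tau> x(1) _ x(2)] in blast)+
  show "esol \<tau> x = E x"
    unfolding esol_def
    by (rule some_equality) (use S x sol_unique(2)[OF _ S \<tau> x(1) _ x(2)] in blast)+
qed

lemma sol_gsol:
  assumes S: "sol \<tau> X G E" and \<tau>: "0 \<le> \<tau>" "\<tau> \<le> 1" and X': "0 < X'" "X' \<le> X"
  shows "sol \<tau> X' (gsol \<tau>) (esol \<tau>)"
  by (rule sol_cong[OF S X']) (use gsol[OF S \<tau>] X' in auto)

lemma flux_nonpos:
  assumes "sol \<tau> X G E" "0 < \<tau>" "\<tau> \<le> 1" "\<not> trapped \<tau>" "0 < y" "y < X"
  shows "flux \<tau> G E y \<le> 0"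
  using flux_nonpos_or_trapped[OF assms(1-3) _ assms(5,6)] assms(1,4) unfolding trapped_def by blast

lemma sol_antimono:
  assumes S: "sol \<tau> X G E" and nt: "0 < \<tau>" "\<tau> \<le> 1" "\<not> trapped \<tau>" and x: "0 \<le> x" "x \<le> y" "y \<le> X"
  shows "G y \<le> G x"
proof (rule DERIV_nonpos_imp_decreasing_open[OF x(2)])
  note D = solD[OF S]
  show "continuous_on {x..y} G" by (rule continuous_on_subset[OF D(2)]) (use x in auto)
  fix s assume s: "x < s" "s < y"
  have "s powr (- \<nu>) * flux \<tau> G E s \<le> 0"
    using flux_nonpos[OF S nt, of s] s x by (intro mult_nonneg_nonpos) auto
  then show "\<exists>d. DERIV G s :> d \<and> d \<le> 0"
    using D(8)[of s] s x unfolding slope_eq_flux by auto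
qed

text \<open>Without the \<epsilon> terms, E is minus the integral of s^(\<nu>-1) F^p. As F
  decreases, this is at most -F^p x^\<nu> / \<nu>, hence G' \<le> -G^(p/m) / \<nu>, and p < m forces
  extinction.\<close>

lemma not_global_tau_1:
  assumes sols: "\<And>X. 0 < X \<Longrightarrow> sol 1 X G E" and nt: "\<not> trapped 1"
  shows False
proof -
  have pos: "0 < G x" if "0 \<le> x" for x using solD(4)[OF sols[of "x + 1"], of x] that by simp
  have fl: "flux 1 G E x \<le> 0" if "0 < x" for x using flux_nonpos[OF sols[of "x + 1"] _ _ nt, of x] that by simp
  have dG: "DERIV G x :> x powr (- \<nu>) * E x" if "0 < x" for x
    using solD(8)[OF sols[of "x + 1"], of x] that unfolding slope_eq_flux by (simp add: flux_def)
  define H where "H x = E x + G x powr (p / m) * (x powr \<nu> / \<nu>)" for x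
  have H: "H x \<le> H 0" if x: "0 < x" for x
  proof (rule DERIV_nonpos_imp_decreasing_open[OF less_imp_le[OF x]])
    note D = solD[OF sols[OF x]]
    have "continuous_on {0..x} (\<lambda>x. G x powr (p / m))"
      using D(4) by (intro continuous_on_powr D(2) continuous_on_const) force
    then show "continuous_on {0..x} H"
      unfolding H_def using \<nu> by (intro continuous_on_add continuous_on_mult continuous_on_divide D(3) continuous_on_powr_const continuous_on_const) auto
    fix s assume s: "0 < s" "s < x"
    have dE: "DERIV E s :> - (s powr (\<nu> - 1) * G s powr (p / m))"
      using D(7)[OF s] by (simp add: flux_deriv_def powr_powr)
    have dp: "DERIV (\<lambda>x. G x powr (p / m)) s :> (p / m * G s powr (p / m - 1)) * (s powr (- \<nu>) * E s)"
      using pos[of s] s by (intro DERIV_chain2[OF has_real_derivative_powr] dG) auto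
    have "DERIV H s :> - (s powr (\<nu> - 1) * G s powr (p / m)) + (G s powr (p / m) * (\<nu> * s powr (\<nu> - 1) / \<nu>)
        + (p / m * G s powr (p / m - 1)) * (s powr (- \<nu>) * E s) * (s powr \<nu> / \<nu>))"
      unfolding H_def by (intro DERIV_add DERIV_mult' dE dp DERIV_cdivide has_real_derivative_powr s)
    moreover have "- (s powr (\<nu> - 1) * G s powr (p / m)) + (G s powr (p / m) * (\<nu> * s powr (\<nu> - 1) / \<nu>)
        + (p / m * G s powr (p / m - 1)) * (s powr (- \<nu>) * E s) * (s powr \<nu> / \<nu>)) =
        (p / m * G s powr (p / m - 1)) * (s powr (- \<nu>) * (s powr \<nu> / \<nu>)) * E s" using \<nu> by simp
    moreover have "\<dots> \<le> 0"
      using fl[of s] s p m \<nu> by (intro mult_nonneg_nonpos mult_nonneg_nonneg) (auto simp: flux_def)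
    ultimately show "\<exists>d. DERIV H s :> d \<and> d \<le> 0" by auto
  qed
  have H0: "H 0 = 0" using solD(6)[OF sols[OF zero_less_one]] \<nu> by (simp add: H_def)
  show False
  proof (rule absorption_extinction[of 1 G "\<lambda>x. x powr (- \<nu>) * E x" "1 / \<nu>" "p / m"])
    fix x :: real assume x: "1 \<le> x"
    show "0 < G x" using pos x by simp
    show "DERIV G x :> x powr (- \<nu>) * E x" using dG x by simp
    have "E x \<le> - (G x powr (p / m) * (x powr \<nu> / \<nu>))" using H[of x] H0 x by (simp add: H_def)
    then have "x powr (- \<nu>) * E x \<le> x powr (- \<nu>) * - (G x powr (p / m) * (x powr \<nu> / \<nu>))"
      by (intro mult_left_mono) auto
    also have "\<dots> = - (1 / \<nu>) * G x powr (p / m)" using x by (simp add: powr_minus)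
    finally show "x powr (- \<nu>) * E x \<le> - (1 / \<nu>) * G x powr (p / m)" .
  qed (use \<nu> p m in auto)
qed

text \<open>Far out the source is dominated by the \<epsilon> term. Either E stays nonpositive, and
  then G' \<le> -(1 - \<tau>) G^(1/m) forces extinction; or E is positive somewhere and then grows
  at least like x^M, whereas nonpositive flux and F \<le> 1 bound it by x^(\<nu>+\<kappa>).\<close>

lemma not_global_tau_less_1:
  assumes sols: "\<And>X. 0 < X \<Longrightarrow> sol \<tau> X G E" and \<tau>: "0 < \<tau>" "\<tau> < 1" and nt: "\<not> trapped \<tau>"
  shows False
proof -
  have pos: "0 < G x" if "0 \<le> x" for x using solD(4)[OF sols[of "x + 1"], of x] that by simp
  have fl: "flux \<tau> G E x \<le> 0" if "0 < x" for x
    using flux_nonpos[OF sols[of "x + 1"] _ _ nt, of x] that \<tau> by simp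
  have le1: "G x \<le> 1" if "0 < x" for x
    using sol_antimono[OF sols[OF that] _ _ nt, of 0 x] that \<tau> solD(5)[OF sols[OF that]] by simp
  have dG: "DERIV G x :> x powr (- \<nu>) * flux \<tau> G E x" if "0 < x" for x
    using solD(8)[OF sols[of "x + 1"], of x] that unfolding slope_eq_flux by simp
  have dE: "DERIV E x :> flux_deriv (1 - \<tau>) \<tau> (\<lambda>x. G x powr (1 / m)) x" if "0 < x" for x
    using solD(7)[OF sols[of "x + 1"], of x] that by simp
  \<comment> \<open>From R on the source uses up at most half of the q part of B, because F \<le> 1
    and p \<ge> 1 give F^p \<le> F. What is left is M, which still exceeds \<nu> + \<kappa>.\<close>
  define R where "R = max 1 ((2 * \<tau> / ((1 - \<tau>) * q)) powr (1 / \<kappa>))"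
  define M where "M = \<nu> + \<kappa> + q / 2"
  have M: "0 < M" using \<nu> \<kappa> q_pos by (simp add: M_def)
  have R: "\<tau> \<le> (1 - \<tau>) * (q / 2) * x powr \<kappa>" if x: "R \<le> x" for x
  proof -
    have "2 * \<tau> / ((1 - \<tau>) * q) = ((2 * \<tau> / ((1 - \<tau>) * q)) powr (1 / \<kappa>)) powr \<kappa>"
      using \<tau> q_pos \<kappa> by (simp add: powr_powr)
    also have "\<dots> \<le> x powr \<kappa>" using x \<kappa> by (intro powr_mono2) (auto simp: R_def)
    finally show ?thesis using \<tau> q_pos by (simp add: pos_divide_le_eq mult_ac)
  qed
  have E'_ge: "(1 - \<tau>) * M * x powr (\<nu> + \<kappa> - 1) * G x powr (1 / m) \<le> flux_deriv (1 - \<tau>) \<tau> (\<lambda>x. G x powr (1 / m)) x"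
    if x: "R \<le> x" for x
  proof -
    have x0: "0 < x" using x by (auto simp: R_def)
    have Gx: "0 < G x" "G x \<le> 1" using pos le1 x0 by auto
    have "(G x powr (1 / m)) powr p \<le> G x powr (1 / m)"
      using powr_mono'[of "1 / m" "p / m" "G x"] Gx p m by (simp add: powr_powr divide_right_mono)
    then have "\<tau> * (G x powr (1 / m)) powr p \<le> (1 - \<tau>) * (q / 2) * x powr \<kappa> * G x powr (1 / m)"
      using R[OF x] \<tau> q_pos by (intro mult_mono) auto
    moreover have "(1 - \<tau>) * B * x powr \<kappa> * G x powr (1 / m) =
        (1 - \<tau>) * M * x powr \<kappa> * G x powr (1 / m) + (1 - \<tau>) * (q / 2) * x powr \<kappa> * G x powr (1 / m)"
    proof -
      have "B = M + q / 2" by (simp add: M_def B_def)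
      then show ?thesis by (simp only: distrib_left distrib_right)
    qed
    ultimately have "(1 - \<tau>) * M * x powr \<kappa> * G x powr (1 / m) \<le> (1 - \<tau>) * B * x powr \<kappa> * G x powr (1 / m) - \<tau> * (G x powr (1 / m)) powr p"
      by linarith
    then have "x powr (\<nu> - 1) * ((1 - \<tau>) * M * x powr \<kappa> * G x powr (1 / m)) \<le> flux_deriv (1 - \<tau>) \<tau> (\<lambda>x. G x powr (1 / m)) x"
      unfolding flux_deriv_def by (intro mult_left_mono) auto
    moreover have "x powr (\<nu> + \<kappa> - 1) = x powr (\<nu> - 1) * x powr \<kappa>" by (simp add: algebra_simps flip: powr_add)
    ultimately show ?thesis by (simp add: mult_ac)
  qed
  show False
  proof (cases "\<forall>x\<ge>R. E x \<le> 0")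
    case True
    show False
    proof (rule absorption_extinction[of R G "\<lambda>x. x powr (- \<nu>) * flux \<tau> G E x" "1 - \<tau>" "1 / m"])
      fix x assume x: "R \<le> x"
      have x1: "1 \<le> x" using x by (simp add: R_def)
      show "0 < G x" "DERIV G x :> x powr (- \<nu>) * flux \<tau> G E x" using pos dG x1 by auto
      have "flux \<tau> G E x \<le> - ((1 - \<tau>) * x powr (\<nu> + \<kappa>) * G x powr (1 / m))"
        using True x by (simp add: flux_def)
      then have "x powr (- \<nu>) * flux \<tau> G E x \<le> x powr (- \<nu>) * - ((1 - \<tau>) * x powr (\<nu> + \<kappa>) * G x powr (1 / m))"
        by (intro mult_left_mono) auto
      also have "\<dots> = - ((1 - \<tau>) * (x powr \<kappa> * G x powr (1 / m)))"
        using x1 by (simp add: powr_add powr_minus)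
      also have "\<dots> \<le> - ((1 - \<tau>) * (1 * G x powr (1 / m)))"
        using x1 \<kappa> \<tau> unfolding neg_le_iff_le
        by (intro mult_left_mono mult_right_mono ge_one_powr_ge_zero) auto
      finally show "x powr (- \<nu>) * flux \<tau> G E x \<le> - (1 - \<tau>) * G x powr (1 / m)" by linarith
    qed (use \<tau> m in auto)
  next
    case False
    then obtain x1 where x1: "R \<le> x1" "0 < E x1" by auto
    have x10: "0 < x1" using x1 by (auto simp: R_def)
    have mono: "E x1 * x1 powr (- M) \<le> E x * x powr (- M)" if x: "x1 \<le> x" for x
    proof (rule DERIV_nonneg_imp_nondecreasing[OF x])
      fix s assume s: "x1 \<le> s" "s \<le> x"
      have s0: "0 < s" "R \<le> s" using s x1 x10 by auto
      have "((\<lambda>x. E x * x powr (- M)) has_real_derivative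
          E s * (- M * s powr (- M - 1)) + flux_deriv (1 - \<tau>) \<tau> (\<lambda>x. G x powr (1 / m)) s * s powr (- M)) (at s)"
        by (intro DERIV_mult' dE has_real_derivative_powr s0)
      moreover have "0 \<le> E s * (- M * s powr (- M - 1)) + flux_deriv (1 - \<tau>) \<tau> (\<lambda>x. G x powr (1 / m)) s * s powr (- M)"
      proof -
        have "E s \<le> (1 - \<tau>) * s powr (\<nu> + \<kappa>) * G s powr (1 / m)" using fl[OF s0(1)] by (simp add: flux_def)
        then have "M * E s / s \<le> M * ((1 - \<tau>) * s powr (\<nu> + \<kappa>) * G s powr (1 / m)) / s"
          using M s0 by (intro divide_right_mono mult_left_mono) auto
        also have "\<dots> = (1 - \<tau>) * M * s powr (\<nu> + \<kappa> - 1) * G s powr (1 / m)" using s0 by (simp add: powr_diff)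
        also have "\<dots> \<le> flux_deriv (1 - \<tau>) \<tau> (\<lambda>x. G x powr (1 / m)) s" by (rule E'_ge[OF s0(2)])
        finally have "0 \<le> s powr (- M) * (flux_deriv (1 - \<tau>) \<tau> (\<lambda>x. G x powr (1 / m)) s - M * E s / s)" by simp
        then show ?thesis using s0 by (simp add: powr_diff algebra_simps)
      qed
      ultimately show "\<exists>d. DERIV (\<lambda>x. E x * x powr (- M)) s :> d \<and> 0 \<le> d" by blast
    qed
    define c where "c = E x1 * x1 powr (- M)"
    have c: "0 < c" using x1 x10 by (simp add: c_def)
    define x where "x = max x1 ((2 / c) powr (2 / q))"
    have x: "x1 \<le> x" "0 < x" using x10 by (auto simp: x_def)
    have "2 / c = ((2 / c) powr (2 / q)) powr (q / 2)" using c q_pos by (simp add: powr_powr)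
    also have "\<dots> \<le> x powr (q / 2)" using q_pos by (intro powr_mono2) (auto simp: x_def)
    finally have 1: "2 \<le> c * x powr (q / 2)" using c by (simp add: field_simps)
    have "c \<le> E x * x powr (- M)" using mono[OF x(1)] by (simp add: c_def)
    also have "\<dots> \<le> x powr (\<nu> + \<kappa>) * x powr (- M)"
    proof (rule mult_right_mono)
      have "E x \<le> (1 - \<tau>) * x powr (\<nu> + \<kappa>) * G x powr (1 / m)" using fl[OF x(2)] by (simp add: flux_def)
      also have "\<dots> \<le> 1 * x powr (\<nu> + \<kappa>) * 1"
        using \<tau> le1[OF x(2)] pos[of x] x m by (intro mult_mono powr_le1) auto
      finally show "E x \<le> x powr (\<nu> + \<kappa>)" by simp
    qed simp
    also have "\<dots> = x powr (- (q / 2))" by (simp add: M_def flip: powr_add)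
    finally have "c * x powr (q / 2) \<le> x powr (- (q / 2)) * x powr (q / 2)" by (intro mult_right_mono) auto
    also have "\<dots> = 1" using x by (simp flip: powr_add)
    finally show False using 1 by simp
  qed
qed

lemma sol_bounded:
  assumes \<tau>: "0 < \<tau>" "\<tau> \<le> 1" and nt: "\<not> trapped \<tau>"
  shows "bdd_above {X. \<exists>G E. sol \<tau> X G E}"
proof (rule ccontr)
  assume nb: "\<not> bdd_above {X. \<exists>G E. sol \<tau> X G E}"
  have "sol \<tau> X (gsol \<tau>) (esol \<tau>)" if X: "0 < X" for X
  proof -
    have "\<forall>M. \<exists>x. (\<exists>G E. sol \<tau> x G E) \<and> M < x" using nb by (simp add: bdd_above_def not_le)
    then obtain Y G E where "sol \<tau> Y G E" "X < Y" by blast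
    then show ?thesis using \<tau> X by (intro sol_gsol[of \<tau> Y G E]) auto
  qed
  then show False
    using not_global_tau_1[of "gsol \<tau>" "esol \<tau>"] not_global_tau_less_1[of \<tau> "gsol \<tau>" "esol \<tau>"] \<tau> nt
    by (cases "\<tau> = 1") auto
qed

text \<open>At the end x0 of the maximal interval G tends to 0, because a lower bound would allow
  continuation, and E x0 \<le> 0 because the flux is nonpositive. A negative value yields
  \<open>sink\<close> once G is small enough; the value 0 makes the extension by zero a
  profile.\<close>

lemma profile_or_sinking:
  assumes \<tau>: "0 < \<tau>" "\<tau> \<le> 1" and nt: "\<not> trapped \<tau>"
  shows "sinking \<tau> \<or> (\<exists>x0 F E. profile (1 - \<tau>) \<tau> x0 F E)"
proof -
  define x0 where "x0 = Sup {X. \<exists>G E. sol \<tau> X G E}"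
  have \<tau>': "0 \<le> \<tau>" "\<tau> \<le> 1" using \<tau> by auto
  note bdd = sol_bounded[OF \<tau> nt]
  have upper: "X < x0" if X: "sol \<tau> X G E" for X G E
  proof -
    obtain X' G' E' where "X < X'" "sol \<tau> X' G' E'" by (rule sol_extend[OF X \<tau>'])
    then show ?thesis using cSup_upper[OF _ bdd, of X'] by (force simp: x0_def)
  qed
  obtain X1 G1 E1 where S1: "sol \<tau> X1 G1 E1" by (rule sol_exists[OF \<tau>'])
  have x0: "0 < x0" using upper[OF S1] solD(1)[OF S1] by simp
  have S: "sol \<tau> X (gsol \<tau>) (esol \<tau>)" if X: "0 < X" "X < x0" for X
  proof -
    obtain Y where "Y \<in> {X. \<exists>G E. sol \<tau> X G E}" "X < Y"
      using less_cSupD[of "{X. \<exists>G E. sol \<tau> X G E}" X] S1 X by (auto simp: x0_def)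
    then show ?thesis using X by (auto intro: sol_gsol[OF _ \<tau>'])
  qed
  have g_pos: "0 < gsol \<tau> x" if "0 \<le> x" "x < x0" for x
    using solD(4)[OF S[of "(x + x0) / 2"], of x] that by simp
  have g_mono: "gsol \<tau> y \<le> gsol \<tau> x" if "0 \<le> x" "x \<le> y" "y < x0" for x y
    using sol_antimono[OF S[of "(y + x0) / 2"] \<tau> nt, of x y] that by simp
  have g_small: "\<exists>x. 0 \<le> x \<and> x < x0 \<and> gsol \<tau> x < l" if l: "0 < l" for l
  proof (rule ccontr)
    assume no: "\<nexists>x. 0 \<le> x \<and> x < x0 \<and> gsol \<tau> x < l"
    have "\<exists>G E. sol \<tau> X G E \<and> (\<forall>x\<in>{0..X}. min l 1 \<le> G x)" if X: "0 < X" "X < x0" for X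
      using no S[OF X] X by (intro exI conjI ballI) (auto simp: not_less min_le_iff_disj)
    then obtain X G E where "x0 < X" "sol \<tau> X G E"
      using sol_beyond[OF \<tau>' less_imp_le[OF x0], of "min l 1"] l by (metis min.cobounded2 min_less_iff_conj zero_less_one)
    then show False using upper by fastforce
  qed
  define G where "G x = (if x < x0 then gsol \<tau> x else 0)" for x
  have G_nn: "0 \<le> G x" if "0 \<le> x" for x using g_pos[of x] that by (auto simp: G_def)
  have cG: "continuous_on {0..} G"
    unfolding continuous_on_eq_continuous_within
  proof
    fix x assume x: "x \<in> {0::real..}"
    consider "x < x0" | "x = x0" | "x0 < x" by linarith
    then show "continuous (at x within {0..}) G"
    proof cases
      case 1
      define X where "X = (x + x0) / 2"
      have X: "0 < X" "X < x0" "x < X" using 1 x x0 by (auto simp: X_def)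
      have "continuous_on {0..X} G"
        by (rule continuous_on_eq[OF solD(2)[OF S[OF X(1,2)]]]) (use X in \<open>auto simp: G_def\<close>)
      then have "continuous (at x within {0..X}) G" using x X by (auto simp: continuous_on_eq_continuous_within)
      moreover have "at x within {0..X} = at x within {0..}"
        using x X by (intro at_within_nhd[of x "{..<X}"]) auto
      ultimately show ?thesis by simp
    next
      case 2
      show ?thesis unfolding continuous_within tendsto_iff
      proof (intro allI impI)
        fix e :: real assume "0 < e"
        then obtain y where y: "0 \<le> y" "y < x0" "gsol \<tau> y < e" using g_small by blast
        have "\<bar>G s\<bar> < e" if "0 \<le> s" "y < s" for s
          using g_pos[of s] g_mono[of y s] y that \<open>0 < e\<close> by (auto simp: G_def)
        moreover have "G x = 0" using 2 by (simp add: G_def)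
        ultimately show "\<forall>\<^sub>F s in at x within {0..}. dist (G s) (G x) < e"
          unfolding eventually_at using y 2 by (intro exI[of _ "x0 - y"]) (auto simp: dist_real_def)
      qed
    next
      case 3
      have "(G \<longlongrightarrow> G x) (at x within {0..})"
        by (rule tendsto_eventually) (use 3 in \<open>auto simp: eventually_at G_def dist_real_def intro!: exI[of _ "x - x0"]\<close>)
      then show ?thesis by (simp add: continuous_within)
    qed
  qed
  define F where "F x = G x powr (1 / m)" for x
  have cF: "continuous_on {0..} F"
    unfolding F_def using G_nn m by (intro continuous_on_powr' cG continuous_on_const) auto
  have F_eq: "F x = gsol \<tau> x powr (1 / m)" if "x < x0" for x using that by (simp add: F_def G_def)
  have F0: "F x = 0" if "x0 \<le> x" for x using that by (simp add: F_def G_def)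
  define h where "h s = (1 - \<tau>) * B * s powr \<kappa> * F s - \<tau> * F s powr p" for s
  have ch: "continuous_on {0..X} h" for X
    unfolding h_def by (rule continuous_on_weighted_source[OF continuous_on_subset[OF cF]]) (auto simp: F_def)
  define E where "E = wint \<nu> h"
  have cE: "continuous_on {0..} E"
    unfolding E_def by (intro continuous_on_atLeastI continuous_on_wint \<nu> ch) auto
  have dE: "DERIV E x :> flux_deriv (1 - \<tau>) \<tau> F x" if "0 < x" for x
    using wint_has_derivative[OF \<nu> ch that, of "x + 1"] by (simp add: E_def h_def flux_deriv_def)
  have E_eq: "E y = esol \<tau> y" if y: "0 \<le> y" "y < x0" for y
  proof -
    define X where "X = (y + x0) / 2"
    have X: "0 < X" "X < x0" "y < X" using y x0 by (auto simp: X_def)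
    note D = solD[OF S[OF X(1,2)]]
    have "E y - esol \<tau> y = E 0 - esol \<tau> 0"
    proof (rule DERIV_isconst2[of 0 X "\<lambda>y. E y - esol \<tau> y"])
      show "continuous_on {0..X} (\<lambda>y. E y - esol \<tau> y)"
        by (intro continuous_on_diff D(3) continuous_on_subset[OF cE]) auto
      show "DERIV (\<lambda>y. E y - esol \<tau> y) z :> 0" if z: "0 < z" "z < X" for z
        using DERIV_diff[OF dE[OF z(1)] D(7)[OF z]] F_eq[of z] z X by (simp add: flux_deriv_def)
    qed (use X y in auto)
    then show ?thesis using D(6) by (simp add: E_def)
  qed
  have contE: "isCont E x0" and contF: "isCont F x0"
    using cE cF x0 by (auto intro!: continuous_on_interior)
  have ev: "\<forall>\<^sub>F x in at_left x0. 0 < x \<and> x < x0"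
    unfolding eventually_at_left[OF x0] using x0 by (intro exI[of _ 0]) auto
  have lE: "(E \<longlongrightarrow> E x0) (at_left x0)" and lF: "(F \<longlongrightarrow> 0) (at_left x0)"
    using contE contF F0[of x0] by (auto simp: isCont_def filterlim_at_split)
  have "E x0 \<le> 0"
  proof (rule tendsto_le[OF _ _ lE])
    show "((\<lambda>x. (1 - \<tau>) * x powr (\<nu> + \<kappa>) * F x) \<longlongrightarrow> 0) (at_left x0)"
      using x0 lF by (auto intro!: tendsto_eq_intros)
    show "\<forall>\<^sub>F x in at_left x0. E x \<le> (1 - \<tau>) * x powr (\<nu> + \<kappa>) * F x"
      using ev
    proof eventually_elim
      case (elim x)
      then have "flux \<tau> (gsol \<tau>) (esol \<tau>) x \<le> 0"
        by (intro flux_nonpos[OF S[of "(x + x0) / 2"] \<tau> nt]) auto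
      then show ?case using E_eq[of x] F_eq[of x] elim by (simp add: flux_def)
    qed
  qed simp
  show ?thesis
  proof (cases "E x0 = 0")
    case False
    then have neg: "E x0 < 0" using \<open>E x0 \<le> 0\<close> by simp
    have lG: "(G \<longlongrightarrow> 0) (at_left x0)"
    proof -
      have "isCont G x0" using cG x0 by (auto intro!: continuous_on_interior)
      then show ?thesis by (simp add: isCont_def filterlim_at_split G_def)
    qed
    have l1: "((\<lambda>x. - E x / 2 - B * ((x + 1) powr (\<nu> + \<kappa>) / x) * F x) \<longlongrightarrow> - E x0 / 2) (at_left x0)"
      using x0 by (auto intro!: tendsto_eq_intros lE lF)
    have l2: "((\<lambda>x. - E x / 2 - G x * (x + 1) powr \<nu>) \<longlongrightarrow> - E x0 / 2) (at_left x0)"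
      using x0 by (auto intro!: tendsto_eq_intros lE lG)
    have "0 < - E x0 / 2" using neg by simp
    from order_tendstoD(1)[OF l1 this] order_tendstoD(1)[OF l2 this] ev
    have "\<forall>\<^sub>F x in at_left x0. 0 < x \<and> x < x0 \<and> sink (gsol \<tau>) (esol \<tau>) x"
    proof eventually_elim
      case (elim x)
      then show ?case using E_eq[of x] by (simp add: sink_def F_def G_def)
    qed
    then obtain x where x: "0 < x" "x < x0" "sink (gsol \<tau>) (esol \<tau>) x"
      using eventually_happens[of _ "at_left x0"] by (auto simp: trivial_limit_at_left_real)
    have "sinking \<tau>" unfolding sinking_def
      using S[of "(x + x0) / 2"] x by (intro exI[of _ "(x + x0) / 2"] exI[of _ "gsol \<tau>"] exI[of _ "esol \<tau>"] exI[of _ x]) auto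
    then show ?thesis ..
  next
    case True
    have E0: "E x = 0" if x: "x0 \<le> x" for x
    proof (cases "x = x0")
      case False
      have "E x = E x0"
      proof (rule DERIV_isconst2[of x0 x E])
        show "continuous_on {x0..x} E" by (rule continuous_on_subset[OF cE]) (use x0 in auto)
        show "DERIV E z :> 0" if "x0 < z" "z < x" for z
          using dE[of z] F0[of z] that x0 by (simp add: flux_deriv_def)
      qed (use x False in auto)
      then show ?thesis using True by simp
    qed (use True in simp)
    have dG_in: "DERIV G x :> slope (1 - \<tau>) F E x" if x: "0 < x" "x < x0" for x
    proof -
      define X where "X = (x + x0) / 2"
      have X: "0 < X" "X < x0" "x < X" using x x0 by (auto simp: X_def)
      have "DERIV (gsol \<tau>) x :> slope (1 - \<tau>) F E x"
        using solD(8)[OF S[OF X(1,2)] x(1) X(3)] E_eq[of x] F_eq[of x] x by (simp add: slope_def)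
      then show ?thesis
        by (rule has_field_derivative_transform_within_open[of _ _ _ "{..<x0}"]) (use x in \<open>auto simp: G_def\<close>)
    qed
    have slope0: "slope (1 - \<tau>) F E x = 0" if "x0 \<le> x" for x
      using E0[OF that] F0[OF that] by (simp add: slope_def)
    define a where "a = x0 / 2"
    have a: "0 < a" "a < x0" using x0 by (auto simp: a_def)
    \<comment> \<open>A primitive of the slope across x0. It equals G on both sides, which proves
      the second equation at x0 itself.\<close>
    define K where "K y = G a + integral {a..y} (slope (1 - \<tau>) F E)" for y
    have cs: "continuous_on {a..x0 + 1} (slope (1 - \<tau>) F E)"
      unfolding slope_def using a
      by (intro continuous_intros continuous_on_subset[OF cE] continuous_on_subset[OF cF]) auto
    have cK: "continuous_on {a..x0 + 1} K"
      unfolding K_def by (intro continuous_intros indefinite_integral_continuous_1 integrable_continuous_interval cs)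
    have dK: "DERIV K x :> slope (1 - \<tau>) F E x" if x: "a < x" "x < x0 + 1" for x
    proof -
      have "((\<lambda>y. integral {a..y} (slope (1 - \<tau>) F E)) has_real_derivative slope (1 - \<tau>) F E x) (at x within {a..x0 + 1})"
        using x by (intro integral_has_real_derivative cs) auto
      then show ?thesis using at_within_Icc_at[OF x] unfolding K_def by (auto intro!: derivative_eq_intros)
    qed
    have K_in: "K y = G y" if y: "a \<le> y" "y \<le> x0" for y
    proof -
      have "K y - G y = K a - G a"
      proof (rule DERIV_isconst2[of a x0 "\<lambda>y. K y - G y"])
        show "continuous_on {a..x0} (\<lambda>y. K y - G y)"
          using a by (intro continuous_on_diff continuous_on_subset[OF cK] continuous_on_subset[OF cG]) auto
        show "DERIV (\<lambda>y. K y - G y) z :> 0" if z: "a < z" "z < x0" for z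
          using DERIV_diff[OF dK[of z] dG_in[of z]] z a by simp
      qed (use a y in auto)
      then show ?thesis by (simp add: K_def)
    qed
    have K_out: "K y = G y" if y: "x0 < y" "y \<le> x0 + 1" for y
    proof -
      have "K y = K x0"
      proof (rule DERIV_isconst2[of x0 "x0 + 1" K])
        show "continuous_on {x0..x0 + 1} K" using a by (intro continuous_on_subset[OF cK]) auto
        show "DERIV K z :> 0" if z: "x0 < z" "z < x0 + 1" for z
          using dK[of z] slope0[of z] z a by simp
      qed (use y in auto)
      then show ?thesis using K_in[of x0] a y by (simp add: G_def)
    qed
    have dG: "DERIV G x :> slope (1 - \<tau>) F E x" if x: "0 < x" for x
    proof -
      consider "x < x0" | "x = x0" | "x0 < x" by linarith
      then show ?thesis
      proof cases
        case 2
        have "DERIV K x :> slope (1 - \<tau>) F E x" using 2 a by (intro dK) auto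
        then show ?thesis
        proof (rule has_field_derivative_transform_within_open[of _ _ _ "{a<..<x0 + 1}"])
          show "K y = G y" if "y \<in> {a<..<x0 + 1}" for y
            using K_in[of y] K_out[of y] that by (cases "y \<le> x0") auto
        qed (use 2 a in auto)
      next
        case 3
        then have "DERIV (\<lambda>_. 0) x :> slope (1 - \<tau>) F E x" using slope0[of x] by simp
        then show ?thesis
          by (rule has_field_derivative_transform_within_open[of _ _ _ "{x0<..}"]) (use 3 in \<open>auto simp: G_def\<close>)
      qed (use dG_in x in auto)
    qed
    have "DERIV (\<lambda>x. F x powr m) x :> slope (1 - \<tau>) F E x" if x: "0 < x" for x
      by (rule has_field_derivative_transform_within_open[OF dG[OF x], of "{0<..}"])
         (use x G_nn m in \<open>auto simp: F_def powr_powr\<close>)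
    moreover have "0 < F x" if "0 \<le> x" "x < x0" for x using g_pos[OF that] that by (simp add: F_eq)
    moreover have "E 0 = 0" by (simp add: E_def)
    ultimately have "profile (1 - \<tau>) \<tau> x0 F E"
      unfolding profile_def using x0 cF cE F0 dE by blast
    then show ?thesis by blast
  qed
qed

text \<open>For \<tau> = 1 \<open>balance\<close> is never positive, which excludes trapping, and E
  decreases strictly on the support, which excludes a profile with E 0 = E x0 = 0.\<close>

lemma sinking_1: "sinking 1"
proof -
  have nt: "\<not> trapped 1"
  proof
    assume "trapped 1"
    then obtain X G E x where S: "sol 1 X G E" "0 < x" "x < X" "trap 1 G E x" unfolding trapped_def by blast
    have "0 < balance 1 G x" using S(4) by (simp add: trap_def)
    then show False by (simp add: balance_def)
  qed
  have "\<not> profile (1 - 1) 1 x0 F E" for x0 F E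
  proof
    assume P: "profile (1 - 1) 1 x0 F E"
    note D = profileD[OF P]
    have "E x0 < E 0"
    proof (rule DERIV_neg_imp_decreasing_open[OF D(1)])
      show "continuous_on {0..x0} E" by (rule continuous_on_subset[OF D(3)]) auto
      show "\<exists>d. DERIV E x :> d \<and> d < 0" if x: "0 < x" "x < x0" for x
        using D(7)[OF x(1)] D(5)[of x] x
        by (intro exI[of _ "flux_deriv (1 - 1) 1 F x"] conjI) (auto simp: flux_deriv_def)
    qed
    then show False using profile_outside[OF P, of x0] D(4) by simp
  qed
  then show ?thesis using profile_or_sinking[OF _ _ nt] by auto
qed

lemma normalized_profile_exists:
  obtains \<tau> x0 F E where "0 < \<tau>" "\<tau> < 1" "profile (1 - \<tau>) \<tau> x0 F E"
proof -
  have "\<exists>\<tau>\<in>{0..1}. \<not> trapped \<tau> \<and> \<not> sinking \<tau>"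
  proof (rule ccontr)
    assume no: "\<not> (\<exists>\<tau>\<in>{0..1}. \<not> trapped \<tau> \<and> \<not> sinking \<tau>)"
    \<comment> \<open>If every \<tau> were trapped or sinking, being trapped would be locally
      constant on a connected interval.\<close>
    have "trapped 0 = trapped 1"
    proof (rule connected_local_const[of "{0..1::real}"])
      show "\<forall>a\<in>{0..1}. \<forall>\<^sub>F b in at a within {0..1}. trapped a = trapped b"
      proof
        fix a :: real assume a: "a \<in> {0..1}"
        have ev: "\<forall>\<^sub>F b in at a within {0..1}. 0 \<le> b \<and> b \<le> 1" by (auto simp: eventually_at_filter)
        show "\<forall>\<^sub>F b in at a within {0..1}. trapped a = trapped b"
        proof (cases "trapped a")
          case True
          then show ?thesis using trapped_open[of a] a by simp
        next
          case False
          then have "sinking a" using no a by blast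
          then have "\<forall>\<^sub>F b in at a within {0..1}. sinking b" using sinking_open[of a] a by simp
          then have "\<forall>\<^sub>F b in at a within {0..1}. \<not> trapped b"
            using ev by eventually_elim (use not_trapped_and_sinking in blast)
          then show ?thesis using False by simp
        qed
      qed
    qed auto
    then show False using trapped_0 sinking_1 not_trapped_and_sinking[of 1] by simp
  qed
  then obtain \<tau> where \<tau>: "0 \<le> \<tau>" "\<tau> \<le> 1" "\<not> trapped \<tau>" "\<not> sinking \<tau>" by auto
  have "\<tau> \<noteq> 0" "\<tau> \<noteq> 1" using \<tau> trapped_0 sinking_1 by auto
  then show thesis using profile_or_sinking[of \<tau>] \<tau> that[of \<tau>] by auto
qed

text \<open>In logarithms the two conditions on the scaling factors are linear. Up to sign their
  determinant is k = (1 + \<kappa>) (m - p) - (m - 1), which subcriticality makes positive.\<close>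

lemma profile_exists:
  assumes \<epsilon>: "0 < \<epsilon>" and \<mu>: "0 < \<mu>"
  obtains x0 F E where "profile \<epsilon> \<mu> x0 F E"
proof -
  obtain \<tau> x0 F E where P: "0 < \<tau>" "\<tau> < 1" "profile (1 - \<tau>) \<tau> x0 F E" by (rule normalized_profile_exists)
  define k where "k = (1 + \<kappa>) * (m - p) - (m - 1)"
  have k: "0 < k" using subcritical by (simp add: k_def algebra_simps)
  define u v where "u = ln (\<epsilon> / (1 - \<tau>))" and "v = ln (\<mu> / \<tau>)"
  define a where "a = ((1 + \<kappa>) * v - u) / k"
  define l where "l = v - (m - p) * a"
  have eq1: "(m - 1) * a + (1 + \<kappa>) * l = u"
  proof -
    have "(m - 1) * a + (1 + \<kappa>) * l = (1 + \<kappa>) * v - k * a" by (simp add: l_def k_def algebra_simps)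
    also have "k * a = (1 + \<kappa>) * v - u" using k by (simp add: a_def)
    finally show ?thesis by simp
  qed
  have eq2: "(m - p) * a + l = v" by (simp add: l_def)
  have "(1 - \<tau>) * exp a powr (m - 1) * exp l powr (1 + \<kappa>) = (1 - \<tau>) * exp u"
    using eq1 by (simp add: powr_def mult.assoc flip: exp_add)
  also have "\<dots> = \<epsilon>" using P \<epsilon> by (simp add: u_def)
  finally have e1: "(1 - \<tau>) * exp a powr (m - 1) * exp l powr (1 + \<kappa>) = \<epsilon>" .
  have "\<tau> * exp a powr (m - p) * exp l = \<tau> * exp v"
    using eq2 by (simp add: powr_def mult.assoc flip: exp_add)
  also have "\<dots> = \<mu>" using P \<mu> by (simp add: v_def)
  finally have e2: "\<tau> * exp a powr (m - p) * exp l = \<mu>" .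
  from profile_scale[OF P(3), of "exp a" "exp l", unfolded e1 e2] show thesis
    by (intro that) auto
qed

end

section \<open>Partial derivatives and radial integrals\<close>

text \<open>A relation that carries existence and value together; \<open>partial_deriv\<close>,
  being built on \<open>deriv\<close>, does not assert existence.\<close>

definition has_partial :: "'a::euclidean_space \<Rightarrow> ('a \<Rightarrow> real) \<Rightarrow> real \<Rightarrow> 'a \<Rightarrow> bool" where
  "has_partial b f d z \<longleftrightarrow> DERIV (\<lambda>s. f (z + s *\<^sub>R b)) 0 :> d"

lemma has_partial_unique: "has_partial b f d z \<Longrightarrow> has_partial b f d' z \<Longrightarrow> d = d'"
  unfolding has_partial_def by (rule DERIV_unique)

lemma has_partial_imp_partial_deriv: "has_partial b f d z \<Longrightarrow> partial_deriv b f z = d"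
  unfolding has_partial_def partial_deriv_def by (rule DERIV_imp_deriv)

lemma has_partial_const [intro]: "has_partial b (\<lambda>_. c) 0 z"
  by (simp add: has_partial_def)

lemma has_partial_add: "has_partial b f d z \<Longrightarrow> has_partial b g e z \<Longrightarrow> has_partial b (\<lambda>z. f z + g z) (d + e) z"
  unfolding has_partial_def by (rule DERIV_add)

lemma has_partial_mult:
  "has_partial b f d z \<Longrightarrow> has_partial b g e z \<Longrightarrow> has_partial b (\<lambda>z. f z * g z) (f z * e + d * g z) z"
  unfolding has_partial_def by (drule (1) DERIV_mult') simp

lemma has_partial_compose:
  "DERIV g (f z) :> g' \<Longrightarrow> has_partial b f d z \<Longrightarrow> has_partial b (\<lambda>z. g (f z)) (g' * d) z"
  unfolding has_partial_def by (rule DERIV_chain2[where g="\<lambda>s. f (z + s *\<^sub>R b)"]) auto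

lemma has_partial_inner: "has_partial b (\<lambda>z. z \<bullet> c) (b \<bullet> c) z"
  unfolding has_partial_def by (auto intro!: derivative_eq_intros simp: inner_add_left)

lemma has_partial_transform_open:
  assumes "has_partial b f d z" "open U" "z \<in> U" "\<And>y. y \<in> U \<Longrightarrow> f y = g y"
  shows "has_partial b g d z"
proof -
  have "open ((\<lambda>s. z + s *\<^sub>R b) -` U)" by (intro open_vimage continuous_intros assms)
  then show ?thesis
    unfolding has_partial_def
    by (rule has_field_derivative_transform_within_open[OF assms(1)[unfolded has_partial_def]])
       (use assms in auto)
qed

lemma has_partial_along:
  assumes "has_partial b f d (z + t *\<^sub>R b)"
  shows "DERIV (\<lambda>s. f (z + s *\<^sub>R b)) t :> d"
proof -
  have "DERIV (\<lambda>s. f (z + (s + t) *\<^sub>R b)) 0 :> d"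
    using assms by (simp add: has_partial_def scaleR_add_left algebra_simps)
  then show ?thesis using DERIV_shift[of "\<lambda>s. f (z + s *\<^sub>R b)" d 0 t] by simp
qed

lemma integral_lborel_translate:
  fixes f :: "'a::euclidean_space \<Rightarrow> real"
  assumes "f \<in> borel_measurable borel"
  shows "integral\<^sup>L lborel (\<lambda>z. f (z + c)) = integral\<^sup>L lborel f"
proof -
  have "integral\<^sup>L (distr lborel borel ((+) c)) f = integral\<^sup>L lborel (\<lambda>z. f (c + z))"
    by (rule integral_distr) (use assms in auto)
  then show ?thesis by (simp add: lborel_distr_plus add.commute)
qed

lemma integrable_lborel_translate:
  fixes f :: "'a::euclidean_space \<Rightarrow> real"
  assumes "integrable lborel f"
  shows "integrable lborel (\<lambda>z. f (z + c))"
proof -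
  have "integrable (distr lborel borel ((+) c)) f" using assms by (simp add: lborel_distr_plus)
  then have "integrable lborel (\<lambda>z. f (c + z))" by (subst (asm) integrable_distr_eq) (use assms in auto)
  then show ?thesis by (simp add: add.commute)
qed

text \<open>By translation invariance the difference quotients of \<open>\<psi>\<close> have integral zero; they are dominated
  because \<open>\<psi>'\<close> is bounded with compact support.\<close>

lemma integral_partial_eq_0:
  fixes \<psi> \<psi>' :: "'a::euclidean_space \<Rightarrow> real"
  assumes U: "open U" and K: "compact K" "K \<subseteq> U" and zero: "\<And>z. z \<notin> K \<Longrightarrow> \<psi> z = 0"
    and der: "\<And>z. z \<in> U \<Longrightarrow> has_partial b \<psi> (\<psi>' z) z"
    and cont: "continuous_on U \<psi>" "continuous_on U \<psi>'"
  shows "set_integrable lborel U \<psi>'" "set_lebesgue_integral lborel U \<psi>' = 0"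
proof -
  \<comment> \<open>\<psi>' is meaningful on U only; D is the partial derivative of \<psi> on the
    whole space, zero off K.\<close>
  define D where "D z = (if z \<in> U then \<psi>' z else 0)" for z
  have oK: "open (- K)" using K(1) by (simp add: compact_imp_closed open_Compl)
  have cover: "U \<union> - K = UNIV" using K(2) by auto
  have dK: "has_partial b \<psi> 0 z" if "z \<notin> K" for z
    by (rule has_partial_transform_open[OF has_partial_const oK]) (use that zero in auto)
  have D: "has_partial b \<psi> (D z) z" for z
    using der[of z] dK[of z] K(2) by (auto simp: D_def)
  have D0: "D z = 0" if "z \<notin> K" for z using has_partial_unique[OF D dK[OF that]] .
  have cont_glue: "continuous_on UNIV h" if "continuous_on U h" "\<And>z. z \<notin> K \<Longrightarrow> h z = 0" for h :: "'a \<Rightarrow> real"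
  proof -
    have "continuous_on (- K) h" by (rule continuous_on_eq[of _ "\<lambda>_. 0"]) (use that in auto)
    then show ?thesis using continuous_on_open_Un[OF U oK that(1)] cover by simp
  qed
  have cD: "continuous_on UNIV D"
    by (rule cont_glue[OF _ D0]) (use cont(2) in \<open>auto simp: D_def cong: continuous_on_cong\<close>)
  have cpsi: "continuous_on UNIV \<psi>" by (rule cont_glue[OF cont(1) zero])
  have bound: "\<exists>L>0. \<forall>z. \<bar>h z\<bar> \<le> L" if "continuous_on UNIV h" "\<And>z. z \<notin> K \<Longrightarrow> h z = 0" for h :: "'a \<Rightarrow> real"
  proof -
    have "bounded (h ` K)" by (intro compact_imp_bounded compact_continuous_image continuous_on_subset[OF that(1)] K) auto
    then obtain L where L: "0 < L" "\<forall>y\<in>h ` K. norm y \<le> L" unfolding bounded_pos by blast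
    have "\<bar>h z\<bar> \<le> L" for z using L that(2)[of z] by (cases "z \<in> K") auto
    then show ?thesis using L(1) by blast
  qed
  obtain L where L: "0 < L" "\<And>z. \<bar>D z\<bar> \<le> L" using bound[OF cD D0] by blast
  have int_ind: "integrable lborel (\<lambda>z. c * indicator S z :: real)" if "compact S" for S :: "'a set" and c
    using emeasure_lborel_cbox_finite borel_compact[OF that] emeasure_compact_finite[OF that]
    by (intro integrable_mult_right integrable_real_indicator) auto
  have int: "integrable lborel h" if h: "continuous_on UNIV h" "\<And>z. z \<notin> K \<Longrightarrow> h z = 0" for h :: "'a \<Rightarrow> real"
  proof -
    obtain L where L: "0 < L" "\<And>z. \<bar>h z\<bar> \<le> L" using bound[OF h] by blast
    show ?thesis
    proof (rule Bochner_Integration.integrable_bound[OF int_ind[OF K(1), of L]])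
      show "h \<in> borel_measurable lborel" using borel_measurable_continuous_onI[OF h(1)] by simp
      show "AE x in lborel. norm (h x) \<le> norm (L * indicator K x)"
        using L h(2) by (auto simp: indicator_def)
    qed
  qed
  have iD: "integrable lborel D" by (rule int[OF cD D0])
  have ipsi: "integrable lborel \<psi>" by (rule int[OF cpsi zero])
  have mpsi: "\<psi> \<in> borel_measurable borel" using borel_measurable_continuous_onI[OF cpsi] by simp
  have mvt: "\<bar>\<psi> (z + t *\<^sub>R b) - \<psi> z\<bar> \<le> L * t" if "0 < t" for z t
  proof -
    have "\<exists>s>0. s < t \<and> \<psi> (z + t *\<^sub>R b) - \<psi> (z + 0 *\<^sub>R b) = (t - 0) * D (z + s *\<^sub>R b)"
      using that by (intro MVT2 has_partial_along D)
    then obtain s where "\<psi> (z + t *\<^sub>R b) - \<psi> z = t * D (z + s *\<^sub>R b)" by auto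
    then show ?thesis using L(2)[of "z + s *\<^sub>R b"] that by (simp add: abs_mult mult.commute)
  qed
  \<comment> \<open>A compact set containing the supports of all difference quotients with step in
    [0, 1].\<close>
  define K' where "K' = (\<lambda>(k, s). k - s *\<^sub>R b) ` (K \<times> {0..1::real})"
  have K': "compact K'"
    unfolding K'_def by (intro compact_continuous_image compact_Times K) (auto intro!: continuous_intros simp: split_beta)
  define f where "f n z = (\<psi> (z + inverse (real (Suc n)) *\<^sub>R b) - \<psi> z) / inverse (real (Suc n))" for n z
  have lim: "(\<lambda>n. integral\<^sup>L lborel (f n)) \<longlonglongrightarrow> integral\<^sup>L lborel D"
  proof (rule integral_dominated_convergence)
    show "integrable lborel (\<lambda>z. L * indicator K' z :: real)" by (rule int_ind[OF K'])
    show "D \<in> borel_measurable lborel" using iD by auto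
    show "f n \<in> borel_measurable lborel" for n
      using mpsi unfolding f_def by measurable
    show "AE z in lborel. (\<lambda>n. f n z) \<longlonglongrightarrow> D z"
    proof (rule AE_I2)
      fix z
      have "((\<lambda>h. (\<psi> (z + h *\<^sub>R b) - \<psi> z) / h) \<longlongrightarrow> D z) (at 0)"
        using D[of z] by (simp add: has_partial_def DERIV_def)
      then show "(\<lambda>n. f n z) \<longlonglongrightarrow> D z"
        unfolding f_def by (rule filterlim_compose)
          (auto simp: filterlim_at simp del: of_nat_Suc intro: LIMSEQ_inverse_real_of_nat)
    qed
    show "AE z in lborel. norm (f n z) \<le> L * indicator K' z" for n
    proof (rule AE_I2)
      fix z
      let ?t = "inverse (real (Suc n))"
      show "norm (f n z) \<le> L * indicator K' z"
      proof (cases "z \<in> K'")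
        case True
        have "\<bar>\<psi> (z + ?t *\<^sub>R b) - \<psi> z\<bar> / ?t \<le> L * ?t / ?t" by (intro divide_right_mono mvt) auto
        then show ?thesis using True by (simp add: f_def abs_divide)
      next
        case False
        have "z \<notin> K" using False unfolding K'_def by (force intro!: rev_image_eqI[of "(z, 0)"])
        moreover have "z + ?t *\<^sub>R b \<notin> K"
        proof
          assume "z + ?t *\<^sub>R b \<in> K"
          then have "z \<in> K'" unfolding K'_def
            by (intro rev_image_eqI[of "(z + ?t *\<^sub>R b, ?t)"]) (auto simp: inverse_le_1_iff)
          then show False using False by simp
        qed
        ultimately show ?thesis using zero L(1) by (simp add: f_def)
      qed
    qed
  qed
  have "integral\<^sup>L lborel (f n) = 0" for n
    unfolding f_def
    by (simp add: integral_lborel_translate[OF mpsi] integrable_lborel_translate[OF ipsi] ipsi)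
  then have "integral\<^sup>L lborel D = 0" using lim LIMSEQ_unique[of "\<lambda>_. 0" 0] by simp
  moreover have "D = (\<lambda>z. indicator U z *\<^sub>R \<psi>' z)" by (auto simp: D_def indicator_def)
  ultimately show "set_integrable lborel U \<psi>'" "set_lebesgue_integral lborel U \<psi>' = 0"
    using iD by (simp_all add: set_integrable_def set_lebesgue_integral_def)
qed

lemma second_difference_mean_value:
  fixes g :: "real \<Rightarrow> real \<Rightarrow> real"
  assumes h: "0 < h"
    and d1: "\<And>s t. DERIV (\<lambda>s. g s t) s :> g1 s t"
    and d2: "\<And>s t. DERIV (\<lambda>t. g1 s t) t :> g12 s t"
  obtains s t where "0 < s" "s < h" "0 < t" "t < h" "g h h - g 0 h - (g h 0 - g 0 0) = h * h * g12 s t"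
proof -
  have "\<exists>s>0. s < h \<and> (g h h - g h 0) - (g 0 h - g 0 0) = (h - 0) * (g1 s h - g1 s 0)"
    by (rule MVT2[OF h]) (intro DERIV_diff d1)
  then obtain s where s: "0 < s" "s < h" "(g h h - g h 0) - (g 0 h - g 0 0) = h * (g1 s h - g1 s 0)" by auto
  have "\<exists>t>0. t < h \<and> g1 s h - g1 s 0 = (h - 0) * g12 s t" by (rule MVT2[OF h d2])
  then obtain t where "0 < t" "t < h" "g1 s h - g1 s 0 = h * g12 s t" by auto
  then show thesis using s by (intro that[of s t]) auto
qed

text \<open>Schwarz's theorem: by the mean value theorem, taken in the two orders, the second
  difference over a small parallelogram is a nearby value of either mixed derivative. It will
  exchange time and space derivatives of test functions.\<close>

lemma mixed_partials_commute:
  fixes f :: "'a::euclidean_space \<Rightarrow> real"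
  assumes fa: "\<And>z. has_partial a f (fa z) z" and fb: "\<And>z. has_partial b f (fb z) z"
    and fab: "\<And>z. has_partial b fa (fab z) z" and fba: "\<And>z. has_partial a fb (fba z) z"
    and c: "continuous_on UNIV fab" "continuous_on UNIV fba"
  shows "fab z = fba z"
proof (rule ccontr)
  assume ne: "fab z \<noteq> fba z"
  define e where "e = \<bar>fab z - fba z\<bar> / 2"
  have e: "0 < e" using ne by (simp add: e_def)
  have near: "\<exists>d>0. \<forall>y. dist y z < d \<longrightarrow> \<bar>h y - h z\<bar> < e" if "continuous_on UNIV h" for h :: "'a \<Rightarrow> real"
    using that e unfolding continuous_on_iff dist_real_def by simp
  obtain d1 where d1: "0 < d1" "\<And>y. dist y z < d1 \<Longrightarrow> \<bar>fab y - fab z\<bar> < e" using near[OF c(1)] by blast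
  obtain d2 where d2: "0 < d2" "\<And>y. dist y z < d2 \<Longrightarrow> \<bar>fba y - fba z\<bar> < e" using near[OF c(2)] by blast
  define h where "h = min d1 d2 / (norm a + norm b + 1)"
  have h: "0 < h" using d1 d2 by (simp add: h_def add_nonneg_pos)
  have close: "dist (z + s *\<^sub>R a + t *\<^sub>R b) z < min d1 d2" if "0 < s" "s < h" "0 < t" "t < h" for s t
  proof -
    have "dist (z + s *\<^sub>R a + t *\<^sub>R b) z \<le> s * norm a + t * norm b"
      using norm_triangle_ineq[of "s *\<^sub>R a" "t *\<^sub>R b"] that by (simp add: dist_norm)
    also have "\<dots> \<le> h * norm a + h * norm b" using that by (intro add_mono mult_right_mono) auto
    also have "\<dots> < h * (norm a + norm b + 1)" using h by (simp add: algebra_simps)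
    also have "\<dots> = min d1 d2"
    proof -
      have "norm a + norm b + 1 \<noteq> 0" using norm_ge_zero[of a] norm_ge_zero[of b] by linarith
      then show ?thesis by (simp add: h_def)
    qed
    finally show ?thesis .
  qed
  have comm: "z + s *\<^sub>R a + t *\<^sub>R b = z + t *\<^sub>R b + s *\<^sub>R a" for s t by (simp add: algebra_simps)
  define g where "g s t = f (z + s *\<^sub>R a + t *\<^sub>R b)" for s t
  obtain s t where st: "0 < s" "s < h" "0 < t" "t < h" "g h h - g 0 h - (g h 0 - g 0 0) = h * h * fab (z + s *\<^sub>R a + t *\<^sub>R b)"
  proof (rule second_difference_mean_value[OF h, of g "\<lambda>s t. fa (z + s *\<^sub>R a + t *\<^sub>R b)" "\<lambda>s t. fab (z + s *\<^sub>R a + t *\<^sub>R b)"])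
    show "DERIV (\<lambda>s. g s t) s :> fa (z + s *\<^sub>R a + t *\<^sub>R b)" for s t
      unfolding g_def comm by (rule has_partial_along[OF fa])
    show "DERIV (\<lambda>t. fa (z + s *\<^sub>R a + t *\<^sub>R b)) t :> fab (z + s *\<^sub>R a + t *\<^sub>R b)" for s t
      by (rule has_partial_along[OF fab])
  qed (rule that)
  obtain t' s' where ts: "0 < t'" "t' < h" "0 < s'" "s' < h" "g h h - g h 0 - (g 0 h - g 0 0) = h * h * fba (z + s' *\<^sub>R a + t' *\<^sub>R b)"
  proof (rule second_difference_mean_value[OF h, of "\<lambda>t s. g s t" "\<lambda>t s. fb (z + s *\<^sub>R a + t *\<^sub>R b)" "\<lambda>t s. fba (z + s *\<^sub>R a + t *\<^sub>R b)"])
    show "DERIV (\<lambda>t. g s t) t :> fb (z + s *\<^sub>R a + t *\<^sub>R b)" for s t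
      unfolding g_def by (rule has_partial_along[OF fb])
    show "DERIV (\<lambda>s. fb (z + s *\<^sub>R a + t *\<^sub>R b)) s :> fba (z + s *\<^sub>R a + t *\<^sub>R b)" for s t
      unfolding comm by (rule has_partial_along[OF fba])
  qed (rule that)
  have "h * h * fab (z + s *\<^sub>R a + t *\<^sub>R b) = h * h * fba (z + s' *\<^sub>R a + t' *\<^sub>R b)"
    using st(5) ts(5) by linarith
  then have "fab (z + s *\<^sub>R a + t *\<^sub>R b) = fba (z + s' *\<^sub>R a + t' *\<^sub>R b)" using h by simp
  moreover have "\<bar>fab (z + s *\<^sub>R a + t *\<^sub>R b) - fab z\<bar> < e" using d1(2) close[OF st(1-4)] by simp
  moreover have "\<bar>fba (z + s' *\<^sub>R a + t' *\<^sub>R b) - fba z\<bar> < e" using d2(2) close[OF ts(3,4,1,2)] by simp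
  ultimately show False unfolding e_def by (smt (verit) field_sum_of_halves)
qed

section \<open>Polar coordinates and integrability of power weights\<close>

lemma distr_norm_lborel:
  "distr lborel borel (norm :: 'a::euclidean_space \<Rightarrow> real) =
   density lborel (\<lambda>r. ennreal (indicator {0<..} r * (real DIM('a) * unit_ball_vol DIM('a) * r powr (real DIM('a) - 1))))"
  (is "_ = density _ ?f")
proof (rule measure_eqI_generator_eq[where E="range (\<lambda>a::real. {..a})" and \<Omega>=UNIV and A="\<lambda>i. {..real i}"])
  let ?n = "real DIM('a)" and ?D = "distr lborel borel (norm :: 'a \<Rightarrow> real)"
  have n: "0 < ?n" using DIM_positive[where 'a='a] by linarith
  \<comment> \<open>The two measures are compared on half-lines {..a}, where both give the volume of
    the ball of radius a.\<close>
  have lhs: "emeasure ?D {..a} = ennreal (if 0 \<le> a then unit_ball_vol ?n * a powr ?n else 0)" for a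
  proof -
    have "emeasure ?D {..a} = emeasure lborel (norm -` {..a} :: 'a set)"
      by (subst emeasure_distr) auto
    also have "(norm -` {..a} :: 'a set) = cball 0 a" by auto
    also have "emeasure lborel \<dots> = ennreal (if 0 \<le> a then unit_ball_vol ?n * a powr ?n else 0)"
    proof (cases "0 \<le> a")
      case True
      then have "a powr ?n = a ^ DIM('a)" using n by (cases "a = 0") (auto simp: powr_realpow)
      then show ?thesis using True by (simp add: emeasure_cball)
    qed auto
    finally show ?thesis .
  qed
  have rhs: "emeasure (density lborel ?f) {..a} = ennreal (if 0 \<le> a then unit_ball_vol ?n * a powr ?n else 0)" for a
  proof (cases "0 \<le> a")
    case True
    have "((\<lambda>r. ?n * unit_ball_vol ?n * r powr (?n - 1)) has_integral ?n * unit_ball_vol ?n * (a powr (?n - 1 + 1) / (?n - 1 + 1))) {0..a}"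
      using True n by (intro has_integral_mult_right has_integral_powr_from_0) auto
    then have hi: "((\<lambda>r. ?n * unit_ball_vol ?n * r powr (?n - 1)) has_integral unit_ball_vol ?n * a powr ?n) {0..a}"
      using n by simp
    have "emeasure (density lborel ?f) {..a} = (\<integral>\<^sup>+r. ?f r * indicator {..a} r \<partial>lborel)"
      by (subst emeasure_density) auto
    also have "\<dots> = (\<integral>\<^sup>+r. ennreal (?n * unit_ball_vol ?n * r powr (?n - 1)) * indicator {0..a} r \<partial>lborel)"
      by (intro nn_integral_cong) (auto simp: indicator_def)
    also have "\<dots> = ennreal (unit_ball_vol ?n * a powr ?n)"
      using n by (intro nn_integral_has_integral_lebesgue' hi) auto
    finally show ?thesis using True by simp
  next
    case False
    have "emeasure (density lborel ?f) {..a} = (\<integral>\<^sup>+r. ?f r * indicator {..a} r \<partial>lborel)"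
      by (subst emeasure_density) auto
    also have "\<dots> = integral\<^sup>N lborel (\<lambda>r::real. 0)"
      using False by (intro nn_integral_cong) (auto simp: indicator_def)
    finally show ?thesis using False by simp
  qed
  show "emeasure ?D X = emeasure (density lborel ?f) X" if "X \<in> range (\<lambda>a. {..a})" for X
    using that lhs rhs by auto
  show "emeasure ?D {..real i} \<noteq> \<infinity>" for i using lhs by simp
  show "Int_stable (range (\<lambda>a::real. {..a}))" by (auto simp: Int_stable_def)
  show "sets ?D = sigma_sets UNIV (range (\<lambda>a::real. {..a}))" "sets (density lborel ?f) = sigma_sets UNIV (range (\<lambda>a::real. {..a}))"
    by (simp_all add: borel_eq_atMost)
  show "(\<Union>i. {..real i}) = UNIV" by (auto intro: real_arch_simple)
qed auto

lemma integral_radial: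
  fixes f :: "real \<Rightarrow> real"
  assumes [measurable]: "f \<in> borel_measurable borel"
  shows "integral\<^sup>L lborel (\<lambda>x::'a::euclidean_space. f (norm x)) =
    (\<integral>r. indicator {0<..} r * (real DIM('a) * unit_ball_vol DIM('a) * r powr (real DIM('a) - 1)) * f r \<partial>lborel)"
proof -
  have "integral\<^sup>L lborel (\<lambda>x::'a. f (norm x)) = integral\<^sup>L (distr lborel borel (norm :: 'a \<Rightarrow> real)) f"
    by (subst integral_distr) auto
  also have "\<dots> = (\<integral>r. (indicator {0<..} r * (real DIM('a) * unit_ball_vol DIM('a) * r powr (real DIM('a) - 1))) *\<^sub>R f r \<partial>lborel)"
    unfolding distr_norm_lborel by (rule integral_density) auto
  finally show ?thesis by simp
qed

text \<open>In polar coordinates this is the integral of r^(n-1+\<sigma>) over a bounded interval,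
  whose exponent exceeds -1.\<close>

lemma integrable_radial_powr:
  assumes \<sigma>: "- real DIM('a) < \<sigma>"
  shows "integrable lborel (\<lambda>x::'a::euclidean_space. indicator (cball 0 R) x * norm x powr \<sigma>)"
proof (rule integrableI_bounded)
  let ?n = "real DIM('a)" and ?c = "real DIM('a) * unit_ball_vol DIM('a)"
  define g where "g r = ennreal (indicator {..R} r * r powr \<sigma>)" for r :: real
  have [measurable]: "g \<in> borel_measurable borel" unfolding g_def[abs_def] by measurable
  have "integral\<^sup>N lborel (\<lambda>x::'a. ennreal (norm (indicator (cball 0 R) x * norm x powr \<sigma>))) = integral\<^sup>N lborel (\<lambda>x::'a. g (norm x))"
    by (intro nn_integral_cong) (auto simp: g_def indicator_def)
  also have "\<dots> = integral\<^sup>N (distr lborel borel (norm :: 'a \<Rightarrow> real)) g"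
    by (subst nn_integral_distr) auto
  also have "\<dots> = (\<integral>\<^sup>+r. ennreal (indicator {0<..} r * (?c * r powr (?n - 1))) * g r \<partial>lborel)"
    unfolding distr_norm_lborel by (rule nn_integral_density) auto
  also have "\<dots> = (\<integral>\<^sup>+r. ennreal (?c * r powr (?n - 1 + \<sigma>)) * indicator {0..max 0 R} r \<partial>lborel)"
    by (intro nn_integral_cong) (auto simp: g_def indicator_def powr_add mult.assoc simp flip: ennreal_mult')
  also have "\<dots> = ennreal (?c * (max 0 R powr (?n - 1 + \<sigma> + 1) / (?n - 1 + \<sigma> + 1)))"
    using \<sigma> by (intro nn_integral_has_integral_lebesgue' has_integral_mult_right has_integral_powr_from_0) auto
  finally show "integral\<^sup>N lborel (\<lambda>x::'a. ennreal (norm (indicator (cball 0 R) x * norm x powr \<sigma>))) < \<infinity>" by simp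
  show "(\<lambda>x::'a. indicator (cball 0 R) x * norm x powr \<sigma>) \<in> borel_measurable lborel"
    by (intro borel_measurable_times borel_measurable_indicator powr_real_measurable borel_measurable_norm) auto
qed

lemma integrable_lborel_tensor:
  fixes a :: "'a::euclidean_space \<Rightarrow> real" and b :: "'b::euclidean_space \<Rightarrow> real"
  assumes a: "integrable lborel a" and b: "integrable lborel b"
  shows "integrable lborel (\<lambda>z. a (fst z) * b (snd z))"
proof -
  have [measurable]: "a \<in> borel_measurable borel" "b \<in> borel_measurable borel" using a b by auto
  have "integrable (lborel \<Otimes>\<^sub>M lborel) (\<lambda>z. a (fst z) * b (snd z))"
  proof (rule lborel_pair.Fubini_integrable)
    have "integrable lborel (\<lambda>x. \<bar>a x\<bar> * (\<integral>y. \<bar>b y\<bar> \<partial>lborel))" using a by auto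
    then show "integrable lborel (\<lambda>x. \<integral>y. norm (a (fst (x, y)) * b (snd (x, y))) \<partial>lborel)"
      by (simp add: abs_mult)
  qed (use b in auto)
  then show ?thesis by (simp add: lborel_prod)
qed

lemma integrable_weight_compact:
  fixes K :: "('a::euclidean_space \<times> real) set"
  assumes K: "compact K" and w: "w \<in> borel_measurable borel" "\<And>z. z \<in> K \<Longrightarrow> \<bar>w z\<bar> \<le> C * norm (fst z) powr \<sigma>"
    and \<sigma>: "- real DIM('a) < \<sigma>"
  shows "integrable lborel (\<lambda>z. indicator K z * w z)"
proof -
  obtain R where R: "\<And>z. z \<in> K \<Longrightarrow> norm z \<le> R" using compact_imp_bounded[OF K] unfolding bounded_iff by blast
  have "integrable lborel (\<lambda>t::real. indicator {-R..R} t :: real)"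
    by (intro integrable_real_indicator) (auto simp: emeasure_lborel_Icc_eq)
  then have "integrable lborel (\<lambda>z::'a \<times> real. (indicator (cball 0 R) (fst z) * norm (fst z) powr \<sigma>) * indicator {-R..R} (snd z))"
    by (intro integrable_lborel_tensor integrable_radial_powr \<sigma>)
  then have dom: "integrable lborel (\<lambda>z::'a \<times> real. C * ((indicator (cball 0 R) (fst z) * norm (fst z) powr \<sigma>) * indicator {-R..R} (snd z)))"
    by (rule integrable_mult_right)
  show ?thesis
  proof (rule Bochner_Integration.integrable_bound[OF dom])
    have "K \<in> sets borel" using K by (rule borel_compact)
    then show "(\<lambda>z. indicator K z * w z) \<in> borel_measurable lborel" using w(1) by simp
    show "AE z in lborel. norm (indicator K z * w z) \<le> norm (C * ((indicator (cball 0 R) (fst z) * norm (fst z) powr \<sigma>) * indicator {-R..R} (snd z)))"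
    proof (rule AE_I2)
      fix z :: "'a \<times> real"
      show "norm (indicator K z * w z) \<le> norm (C * ((indicator (cball 0 R) (fst z) * norm (fst z) powr \<sigma>) * indicator {-R..R} (snd z)))"
      proof (cases "z \<in> K")
        case True
        have "norm (fst z) \<le> R" "\<bar>snd z\<bar> \<le> R"
          using R[OF True] norm_fst_le[of "fst z" "snd z"] norm_snd_le[of "snd z" "fst z"] by (auto intro: order_trans)
        moreover have "\<bar>w z\<bar> \<le> \<bar>C * norm (fst z) powr \<sigma>\<bar>" using w(2)[OF True] by linarith
        ultimately show ?thesis using True by (simp add: indicator_def abs_le_iff)
      qed simp
    qed
  qed
qed

text \<open>The time axis is a null set, so integrals over the region without the origin are
  integrals over the whole half-space.\<close>

lemma AE_fst_nonzero: "AE z in lborel. fst (z :: 'a::euclidean_space \<times> real) \<noteq> 0"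
proof -
  have "emeasure (lborel \<Otimes>\<^sub>M lborel) ({0::'a} \<times> (UNIV :: real set)) = emeasure lborel {0::'a} * emeasure lborel (UNIV :: real set)"
    by (rule lborel.emeasure_pair_measure_Times) auto
  then have "emeasure lborel ({0::'a} \<times> (UNIV :: real set)) = 0" by (simp add: lborel_prod)
  moreover have "closed ({0::'a} \<times> (UNIV :: real set))" by (intro closed_Times) auto
  ultimately have "{0::'a} \<times> (UNIV :: real set) \<in> null_sets lborel"
    by (intro null_setsI) (auto intro: borel_closed)
  then show ?thesis by (rule AE_I') auto
qed

lemma set_integrable_weight:
  fixes K :: "('a::euclidean_space \<times> real) set"
  assumes K: "compact K" and v: "continuous_on K v" and \<sigma>: "- real DIM('a) < \<sigma>"
  shows "set_integrable lborel K (\<lambda>z. norm (fst z) powr \<sigma> * v z)"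
proof -
  have "bounded (v ` K)" by (intro compact_imp_bounded compact_continuous_image v K)
  then obtain C where C: "\<And>z. z \<in> K \<Longrightarrow> \<bar>v z\<bar> \<le> C" unfolding bounded_iff by auto
  have Kb: "K \<in> sets borel" using K by (rule borel_compact)
  have [measurable]: "(\<lambda>z. indicator K z *\<^sub>R v z) \<in> borel_measurable borel"
    by (rule borel_measurable_continuous_on_indicator[OF Kb v])
  have "integrable lborel (\<lambda>z. indicator K z * (norm (fst z) powr \<sigma> * (indicator K z *\<^sub>R v z)))"
  proof (rule integrable_weight_compact[OF K _ _ \<sigma>, of _ C])
    have "(\<lambda>z::'a \<times> real. norm (fst z)) \<in> borel_measurable borel"
      by (intro borel_measurable_continuous_onI continuous_intros)
    then show "(\<lambda>z. norm (fst z) powr \<sigma> * (indicator K z *\<^sub>R v z)) \<in> borel_measurable borel"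
      by (intro borel_measurable_times powr_real_measurable borel_measurable_const
          borel_measurable_continuous_on_indicator[OF Kb v])
    show "\<bar>norm (fst z) powr \<sigma> * (indicator K z *\<^sub>R v z)\<bar> \<le> C * norm (fst z) powr \<sigma>" if "z \<in> K" for z
      using C[OF that] that by (simp add: abs_mult mult.commute[of C] mult_left_mono)
  qed
  moreover have "indicator K z * (norm (fst z) powr \<sigma> * (indicator K z *\<^sub>R v z)) = indicator K z *\<^sub>R (norm (fst z) powr \<sigma> * v z)" for z
    by (auto simp: indicator_def)
  ultimately show ?thesis unfolding set_integrable_def by (simp only:)
qed

section \<open>Test functions and the cutoff at the origin\<close>

lemma C_infinity_partial_deriv:
  assumes "C_infinity f" "b \<in> Basis"
  shows "C_infinity (partial_deriv b f)"
  unfolding C_infinity_def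
proof (intro allI impI)
  fix bs :: "'a list" assume "set bs \<subseteq> Basis"
  then have "set (b # bs) \<subseteq> Basis" using assms(2) by simp
  from assms(1)[unfolded C_infinity_def, rule_format, OF this]
  show "continuous_on UNIV (fold partial_deriv bs (partial_deriv b f)) \<and>
    (\<forall>ba\<in>Basis. \<forall>z. (\<lambda>s. fold partial_deriv bs (partial_deriv b f) (z + s *\<^sub>R ba)) differentiable at 0)" by simp
qed

lemma C_infinity_continuous: "C_infinity f \<Longrightarrow> continuous_on UNIV f"
  unfolding C_infinity_def by (auto dest!: spec[of _ "[]"])

lemma C_infinity_has_partial:
  assumes "C_infinity f" "b \<in> Basis"
  shows "has_partial b f (partial_deriv b f z) z"
proof -
  have "(\<lambda>s. f (z + s *\<^sub>R b)) differentiable at 0"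
    using assms unfolding C_infinity_def by (auto dest!: spec[of _ "[]"])
  then show ?thesis
    unfolding has_partial_def partial_deriv_def by (simp add: DERIV_deriv_iff_real_differentiable)
qed

lemma partial_deriv_outside:
  assumes "closed K" "\<And>z. z \<notin> K \<Longrightarrow> f z = 0" "z \<notin> K"
  shows "partial_deriv b f z = 0"
proof (rule has_partial_imp_partial_deriv)
  show "has_partial b f 0 z"
    by (rule has_partial_transform_open[OF has_partial_const, of "- K"]) (use assms in auto)
qed

text \<open>Applied to k |x| with k tending to infinity, it removes the origin. The divergence
  argument differentiates it once only, so continuous differentiability will do; the rational form
  makes s \<open>cutoff'\<close> s bounded and vanishing at infinity, which controls the error
  terms.\<close>

definition cutoff :: "real \<Rightarrow> real" where "cutoff s = (max 0 (s - 1))\<^sup>2 / (1 + (max 0 (s - 1))\<^sup>2)"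

definition cutoff' :: "real \<Rightarrow> real" where "cutoff' s = 2 * max 0 (s - 1) / (1 + (max 0 (s - 1))\<^sup>2)\<^sup>2"

lemma max_square_has_derivative: "DERIV (\<lambda>x::real. (max 0 x)\<^sup>2) x :> 2 * max 0 x"
proof -
  consider "x < 0" | "x = 0" | "0 < x" by linarith
  then show ?thesis
  proof cases
    case 1
    have "DERIV (\<lambda>x::real. 0) x :> 2 * max 0 x" using 1 by simp
    then show ?thesis
      by (rule has_field_derivative_transform_within_open[of _ _ _ "{..<0}"]) (use 1 in auto)
  next
    case 3
    have "DERIV (\<lambda>x::real. x\<^sup>2) x :> 2 * max 0 x"
      using 3 by (auto intro!: derivative_eq_intros)
    then show ?thesis
      by (rule has_field_derivative_transform_within_open[of _ _ _ "{0<..}"]) (use 3 in auto)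
  next
    case 2
    have "((\<lambda>h::real. ((max 0 h)\<^sup>2) / h) \<longlongrightarrow> 0) (at 0)"
    proof (rule Lim_null_comparison)
      show "\<forall>\<^sub>F h in at 0. norm ((max 0 h)\<^sup>2 / h) \<le> \<bar>h\<bar>" for h :: real
        by (rule always_eventually) (auto simp: max_def power2_eq_square)
      show "((\<lambda>h::real. \<bar>h\<bar>) \<longlongrightarrow> 0) (at 0)" by (auto intro!: tendsto_eq_intros)
    qed
    then show ?thesis using 2 by (simp add: DERIV_def)
  qed
qed

lemma cutoff_has_derivative: "DERIV cutoff s :> cutoff' s"
proof -
  let ?y = "max 0 (s - 1)"
  have d: "DERIV (\<lambda>s. (max 0 (s - 1))\<^sup>2) s :> 2 * ?y * 1"
    by (rule DERIV_chain2[OF max_square_has_derivative]) (auto intro!: derivative_eq_intros)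
  have nz: "1 + ?y\<^sup>2 \<noteq> 0" by (metis add_pos_nonneg less_irrefl zero_le_power2 zero_less_one)
  have "DERIV cutoff s :> (2 * ?y * 1 * (1 + ?y\<^sup>2) - ?y\<^sup>2 * (0 + 2 * ?y * 1)) / ((1 + ?y\<^sup>2) * (1 + ?y\<^sup>2))"
    unfolding cutoff_def by (intro DERIV_divide d DERIV_add DERIV_const nz)
  then show ?thesis by (simp add: cutoff'_def algebra_simps power2_eq_square)
qed

lemma cutoff_bounds: "0 \<le> cutoff s" "cutoff s \<le> 1" "\<bar>s * cutoff' s\<bar> \<le> 3"
proof -
  let ?y = "max 0 (s - 1)"
  have pos: "0 < 1 + ?y\<^sup>2" by (simp add: add_pos_nonneg)
  show "0 \<le> cutoff s" "cutoff s \<le> 1" using pos by (auto simp: cutoff_def)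
  show "\<bar>s * cutoff' s\<bar> \<le> 3"
  proof (cases "s \<le> 1")
    case False
    then have y: "?y = s - 1" "0 \<le> s - 1" by auto
    \<comment> \<open>The difference of the two sides is (s - 2)^2 + 2.\<close>
    have "s * (2 * (s - 1)) \<le> 3 * (1 + (s - 1)\<^sup>2)"
      using zero_le_power2[of "s - 2"] by (simp add: power2_eq_square algebra_simps)
    also have "\<dots> \<le> 3 * (1 + (s - 1)\<^sup>2)\<^sup>2"
      by (simp add: power2_eq_square[of "1 + (s - 1)\<^sup>2"] algebra_simps)
    finally have "s * (2 * (s - 1)) / (1 + (s - 1)\<^sup>2)\<^sup>2 \<le> 3"
      by (subst pos_divide_le_eq) (auto simp: add_pos_nonneg zero_less_power2 add_nonneg_eq_0_iff)
    then show ?thesis using y False by (simp add: cutoff'_def)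
  qed (simp add: cutoff'_def)
qed

lemma cutoff_zero: "s \<le> 1 \<Longrightarrow> cutoff s = 0" "s \<le> 1 \<Longrightarrow> cutoff' s = 0"
  by (simp_all add: cutoff_def cutoff'_def)

lemma cutoff_tendsto:
  "(cutoff \<longlongrightarrow> 1) at_top" "((\<lambda>s. s * cutoff' s) \<longlongrightarrow> 0) at_top"
proof -
  have ev: "\<forall>\<^sub>F s in at_top. (s - 1)\<^sup>2 / (1 + (s - 1)\<^sup>2) = cutoff s" "\<forall>\<^sub>F s in at_top. s * (2 * (s - 1) / (1 + (s - 1)\<^sup>2)\<^sup>2) = s * cutoff' s"
    using eventually_ge_at_top[of "1::real"] by (eventually_elim, simp add: cutoff_def cutoff'_def)+
  have "((\<lambda>s::real. (s - 1)\<^sup>2 / (1 + (s - 1)\<^sup>2)) \<longlongrightarrow> 1) at_top" by real_asymp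
  then show "(cutoff \<longlongrightarrow> 1) at_top" using ev(1) by (rule Lim_transform_eventually)
  have "((\<lambda>s::real. s * (2 * (s - 1) / (1 + (s - 1)\<^sup>2)\<^sup>2)) \<longlongrightarrow> 0) at_top" by real_asymp
  then show "((\<lambda>s. s * cutoff' s) \<longlongrightarrow> 0) at_top" using ev(2) by (rule Lim_transform_eventually)
qed

lemma continuous_on_cutoff: "continuous_on S cutoff" "continuous_on S cutoff'"
proof -
  show "continuous_on S cutoff"
    by (rule DERIV_continuous_on[OF has_field_derivative_at_within[OF cutoff_has_derivative]])
  have "1 + (max 0 (s - 1))\<^sup>2 \<noteq> 0" for s :: real by (metis add_pos_nonneg less_irrefl zero_le_power2 zero_less_one)
  then show "continuous_on S cutoff'" unfolding cutoff'_def by (intro continuous_intros) auto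
qed

section \<open>Weak solutions from radial fluxes\<close>

lemma has_partial_radial:
  fixes R :: "real \<Rightarrow> real \<Rightarrow> real" and R1 :: real and z :: "(real^'n) \<times> real"
  assumes "fst z \<noteq> 0" and d: "((\<lambda>r. R r (snd z)) has_real_derivative R1) (at (norm (fst z)))"
  shows "has_partial (axis i 1, 0) (\<lambda>z. R (norm (fst z)) (snd z)) (R1 * (fst z $ i / norm (fst z))) z"
proof -
  have n: "DERIV (\<lambda>s. norm (fst z + s *\<^sub>R axis i 1)) 0 :> fst z $ i / norm (fst z)"
  proof -
    have d0: "DERIV (\<lambda>s. (fst z + s *\<^sub>R axis i 1) \<bullet> (fst z + s *\<^sub>R axis i 1)) 0 :> 2 * (fst z $ i)"
      by (auto simp: algebra_simps inner_add_left inner_add_right inner_axis inner_axis' intro!: derivative_eq_intros)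
    have "0 < (fst z + 0 *\<^sub>R axis i 1) \<bullet> (fst z + 0 *\<^sub>R axis i 1)" using assms(1) by simp
    from DERIV_chain2[OF DERIV_real_sqrt[OF this] d0]
    have d1: "((\<lambda>s. sqrt ((fst z + s *\<^sub>R axis i 1) \<bullet> (fst z + s *\<^sub>R axis i 1))) has_real_derivative
        inverse (sqrt (fst z \<bullet> fst z)) / 2 * (2 * (fst z $ i))) (at 0)"
      by (simp only: scaleR_zero_left add_0_right)
    have eq: "inverse (sqrt A) / 2 * (2 * x) = x / sqrt A" for A x :: real by (simp add: inverse_eq_divide)
    show ?thesis using d1 unfolding eq norm_eq_sqrt_inner .
  qed
  have "DERIV (\<lambda>s. R (norm (fst z + s *\<^sub>R axis i 1)) (snd z)) 0 :> R1 * (fst z $ i / norm (fst z))"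
    by (rule DERIV_chain2[OF _ n]) (use d in simp)
  then show ?thesis by (simp add: has_partial_def)
qed

lemma has_partial_time:
  fixes z :: "'a::euclidean_space \<times> real"
  assumes "DERIV (\<lambda>t. R (fst z) t) (snd z) :> R1"
  shows "has_partial (0, 1) (\<lambda>z. R (fst z) (snd z)) R1 z"
proof -
  have "DERIV (\<lambda>s. R (fst z) (s + snd z)) 0 :> R1"
    using assms DERIV_shift[of "R (fst z)" R1 0 "snd z"] by simp
  then show ?thesis by (simp add: has_partial_def add.commute)
qed

lemma has_partial_coord:
  fixes z :: "(real^'n) \<times> real"
  shows "has_partial (axis i 1, 0) (\<lambda>z. fst z $ i) 1 z" "has_partial (0, 1) (\<lambda>z::(real^'n) \<times> real. fst z $ j) 0 z"
  by (auto simp: has_partial_def intro!: derivative_eq_intros)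

lemma axis_in_Basis_prod: "(axis i 1, 0) \<in> (Basis :: ((real^'n) \<times> real) set)" "(0, 1) \<in> (Basis :: ((real^'n) \<times> real) set)"
  by (auto simp: Basis_prod_def axis_in_Basis_iff)

lemma integrable_weight_test:
  fixes K :: "((real^'n) \<times> real) set" and v \<zeta> :: "(real^'n) \<times> real \<Rightarrow> real"
  assumes "compact K" "K \<subseteq> UNIV \<times> {0<..}" "continuous_on (UNIV \<times> {0<..}) v" "continuous_on UNIV \<zeta>" "\<And>z. z \<notin> K \<Longrightarrow> \<zeta> z = 0"
  shows "integrable lborel (\<lambda>z. indicator (UNIV \<times> {0<..}) z * (v z * \<zeta> z))"
    and "- real CARD('n) < \<sigma> \<Longrightarrow> integrable lborel (\<lambda>z. indicator (UNIV \<times> {0<..}) z * (norm (fst z) powr \<sigma> * v z * \<zeta> z))"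
proof -
  have c: "continuous_on K (\<lambda>z. v z * \<zeta> z)"
    by (intro continuous_on_mult continuous_on_subset[OF assms(3)] continuous_on_subset[OF assms(4)] assms(2)) auto
  have "integrable lborel (\<lambda>z. indicator K z *\<^sub>R (v z * \<zeta> z))" by (rule borel_integrable_compact[OF assms(1) c])
  moreover have "indicator K z *\<^sub>R (v z * \<zeta> z) = indicator (UNIV \<times> {0<..}) z * (v z * \<zeta> z)" for z
    using assms(2,5) by (cases "z \<in> K") (auto simp: indicator_def)
  ultimately show "integrable lborel (\<lambda>z. indicator (UNIV \<times> {0<..}) z * (v z * \<zeta> z))" by (simp only:)
  assume "- real CARD('n) < \<sigma>"
  then have "integrable lborel (\<lambda>z. indicator K z *\<^sub>R (norm (fst z) powr \<sigma> * (v z * \<zeta> z)))"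
    using set_integrable_weight[OF assms(1) c, of \<sigma>] by (simp add: set_integrable_def)
  moreover have "indicator K z *\<^sub>R (norm (fst z) powr \<sigma> * (v z * \<zeta> z)) = indicator (UNIV \<times> {0<..}) z * (norm (fst z) powr \<sigma> * v z * \<zeta> z)" for z
    using assms(2,5) by (cases "z \<in> K") (auto simp: indicator_def)
  ultimately show "integrable lborel (\<lambda>z. indicator (UNIV \<times> {0<..}) z * (norm (fst z) powr \<sigma> * v z * \<zeta> z))" by (simp only:)
qed

text \<open>\<open>P1\<close>, \<open>Q1\<close> and \<open>g1\<close> are derivatives in r,
  \<open>P2\<close> is the derivative of \<open>P\<close> in t; \<open>balance\<close> is the
  equation integrated once in r. \<open>bounds\<close> controls the origin: each quantity is
  O(r^(\<sigma>2+1)), so that the cutoff errors stay below a multiple of the integrable weight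
  |x|^\<sigma>2. For u^m this is why its value at r = 0 is subtracted.\<close>

locale radial_solution =
  fixes m p \<sigma>1 \<sigma>2 :: real and u P P1 P2 Q Q1 g1 :: "real \<Rightarrow> real \<Rightarrow> real" and N :: "'n::finite itself"
  assumes m: "0 < m" and p: "0 < p" and \<sigma>1: "- real CARD('n) < \<sigma>1" and \<sigma>2: "- real CARD('n) < \<sigma>2"
    and u_nonneg: "\<And>r t. 0 \<le> r \<Longrightarrow> 0 < t \<Longrightarrow> 0 \<le> u r t"
    and u_cont: "continuous_on ({0..} \<times> {0<..}) (\<lambda>(r, t). u r t)"
    and P_r: "\<And>r t. 0 < r \<Longrightarrow> 0 < t \<Longrightarrow> DERIV (\<lambda>r. P r t) r :> P1 r t"
    and P_t: "\<And>r t. 0 < r \<Longrightarrow> 0 < t \<Longrightarrow> DERIV (\<lambda>t. P r t) t :> P2 r t"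
    and Q_r: "\<And>r t. 0 < r \<Longrightarrow> 0 < t \<Longrightarrow> DERIV (\<lambda>r. Q r t) r :> Q1 r t"
    and g_r: "\<And>r t. 0 < r \<Longrightarrow> 0 < t \<Longrightarrow> DERIV (\<lambda>r. u r t powr m) r :> g1 r t"
    and cont: "continuous_on ({0<..} \<times> {0<..}) (\<lambda>(r, t). P r t)" "continuous_on ({0<..} \<times> {0<..}) (\<lambda>(r, t). P1 r t)"
      "continuous_on ({0<..} \<times> {0<..}) (\<lambda>(r, t). P2 r t)" "continuous_on ({0<..} \<times> {0<..}) (\<lambda>(r, t). Q r t)"
      "continuous_on ({0<..} \<times> {0<..}) (\<lambda>(r, t). Q1 r t)" "continuous_on ({0<..} \<times> {0<..}) (\<lambda>(r, t). g1 r t)"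
    and div_P: "\<And>r t. 0 < r \<Longrightarrow> 0 < t \<Longrightarrow> real CARD('n) * P r t + r * P1 r t = r powr \<sigma>1 * u r t"
    and div_Q: "\<And>r t. 0 < r \<Longrightarrow> 0 < t \<Longrightarrow> real CARD('n) * Q r t + r * Q1 r t = r powr \<sigma>2 * u r t powr p"
    and balance: "\<And>r t. 0 < r \<Longrightarrow> 0 < t \<Longrightarrow> g1 r t = r * (P2 r t - Q r t)"
    and bounds: "\<And>R a b. 0 < a \<Longrightarrow> \<exists>C. \<forall>r t. 0 < r \<and> r \<le> R \<and> a \<le> t \<and> t \<le> b \<longrightarrow>
      \<bar>r * P r t\<bar> \<le> C * r powr (\<sigma>2 + 1) \<and> \<bar>r * Q r t\<bar> \<le> C * r powr (\<sigma>2 + 1) \<and>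
      \<bar>u r t powr m - u 0 t powr m\<bar> / r \<le> C * r powr (\<sigma>2 + 1)"
begin

definition W :: "((real^'n) \<times> real) set" where "W = {z. fst z \<noteq> 0 \<and> 0 < snd z}"

definition H :: "((real^'n) \<times> real) set" where "H = UNIV \<times> {0<..}"

lemma open_W: "open W" "open H"
  by (auto simp: W_def H_def intro!: open_Collect_conj open_Collect_neq open_Collect_less continuous_intros open_Times)

lemma W_subset_H: "W \<subseteq> H" by (auto simp: W_def H_def)

lemma continuous_on_radial:
  assumes "continuous_on ({0<..} \<times> {0<..}) (\<lambda>(r, t). R r t)"
  shows "continuous_on W (\<lambda>z. R (norm (fst z)) (snd z) :: real)"
proof -
  have "continuous_on W (\<lambda>z. (\<lambda>(r, t). R r t) (norm (fst z), snd z))"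
    by (rule continuous_on_compose2[OF assms]) (auto simp: W_def intro!: continuous_intros)
  then show ?thesis by simp
qed

lemma continuous_on_u: "continuous_on H (\<lambda>z. u (norm (fst z)) (snd z))" "continuous_on H (\<lambda>z. u 0 (snd z))"
proof -
  have "continuous_on H (\<lambda>z. (\<lambda>(r, t). u r t) (norm (fst z), snd z))"
    by (rule continuous_on_compose2[OF u_cont]) (auto simp: H_def intro!: continuous_intros)
  then show "continuous_on H (\<lambda>z. u (norm (fst z)) (snd z))" by simp
  have "continuous_on H (\<lambda>z. (\<lambda>(r, t). u r t) (0, snd z))"
    by (rule continuous_on_compose2[OF u_cont]) (auto simp: H_def intro!: continuous_intros)
  then show "continuous_on H (\<lambda>z. u 0 (snd z))" by simp
qed

lemma continuous_on_u_powr: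
  assumes "0 < c"
  shows "continuous_on H (\<lambda>z. u (norm (fst z)) (snd z) powr c)" "continuous_on H (\<lambda>z. u 0 (snd z) powr c)"
proof -
  show "continuous_on H (\<lambda>z. u (norm (fst z)) (snd z) powr c)"
    by (rule continuous_on_powr'[OF continuous_on_u(1) continuous_on_const])
       (use assms u_nonneg in \<open>auto simp: H_def\<close>)
  show "continuous_on H (\<lambda>z. u 0 (snd z) powr c)"
    by (rule continuous_on_powr'[OF continuous_on_u(2) continuous_on_const])
       (use assms u_nonneg in \<open>auto simp: H_def\<close>)
qed

lemma sum_coord_square: "(\<Sum>i\<in>UNIV. (x::real^'n) $ i * (c * (x $ i / norm x))) = c * norm x"
proof (cases "x = 0")
  case False
  have "(\<Sum>i\<in>UNIV. x $ i * (c * (x $ i / norm x))) = c / norm x * (\<Sum>i\<in>UNIV. (x $ i)\<^sup>2)"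
    by (simp add: sum_distrib_left power2_eq_square algebra_simps)
  also have "(\<Sum>i\<in>UNIV. (x $ i)\<^sup>2) = (norm x)\<^sup>2"
    by (simp add: norm_vec_def L2_set_def sum_nonneg)
  finally show ?thesis using False by (simp add: power2_eq_square)
qed simp

text \<open>For a test function \<open>\<phi>\<close> the vector fields \<open>x P\<close> and \<open>x Q\<close> have divergence \<open>|x|\<^sup>\<sigma>\<^sup>1 u\<close> and
  \<open>|x|\<^sup>\<sigma>\<^sup>2 u\<^sup>p\<close>, and the gradient of \<open>u\<^sup>m\<close> is \<open>x (P\<^sub>t - Q)\<close>. Hence the integrand of the weak formulation,
  multiplied by the cutoff, is a divergence up to terms carrying the derivative of the cutoff.\<close>

lemma cutoff_identity:
  fixes \<phi> :: "(real^'n) \<times> real \<Rightarrow> real" and k :: real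
  assumes \<phi>: "C_infinity \<phi>" and K: "compact K" "K \<subseteq> H" and zero: "\<And>z. z \<notin> K \<Longrightarrow> \<phi> z = 0" and k: "0 < k"
  defines "\<phi>t \<equiv> partial_deriv (0, 1) \<phi>" and "\<phi>x \<equiv> \<lambda>i. partial_deriv (axis i 1, 0) \<phi>"
  defines "M \<equiv> \<lambda>z. norm (fst z) powr \<sigma>1 * u (norm (fst z)) (snd z) * \<phi>t z
      + (u (norm (fst z)) (snd z) powr m - u 0 (snd z) powr m) * space_laplacian \<phi> z
      + norm (fst z) powr \<sigma>2 * u (norm (fst z)) (snd z) powr p * \<phi> z"
    and "E \<equiv> \<lambda>z. norm (fst z) * P (norm (fst z)) (snd z) * \<phi>t z
      + (u (norm (fst z)) (snd z) powr m - u 0 (snd z) powr m) / norm (fst z) * (\<Sum>i\<in>UNIV. fst z $ i * \<phi>x i z)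
      + norm (fst z) * Q (norm (fst z)) (snd z) * \<phi> z"
  shows "integral\<^sup>L lborel (\<lambda>z. indicator W z * (cutoff (k * norm (fst z)) * M z + k * cutoff' (k * norm (fst z)) * E z)) = 0"
proof -
  define e where "e i = (axis i 1 :: real^'n, 0 :: real)" for i :: 'n
  have eB: "e i \<in> Basis" "(0, 1) \<in> (Basis :: ((real^'n) \<times> real) set)" for i
    using axis_in_Basis_prod by (auto simp: e_def)
  have clK: "closed K" using K(1) by (rule compact_imp_closed)
  define \<phi>xx where "\<phi>xx i = partial_deriv (e i) (\<phi>x i)" for i
  define \<phi>tx where "\<phi>tx i = partial_deriv (e i) \<phi>t" for i
  have \<phi>x_alt: "\<phi>x i = partial_deriv (e i) \<phi>" for i by (simp add: \<phi>x_def e_def)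
  have C: "C_infinity \<phi>t" "C_infinity (\<phi>x i)" for i
    unfolding \<phi>t_def \<phi>x_alt by (intro C_infinity_partial_deriv \<phi> eB)+
  have C2: "C_infinity (\<phi>xx i)" "C_infinity (\<phi>tx i)" "C_infinity (partial_deriv (0, 1) (\<phi>x i))" for i
    unfolding \<phi>xx_def \<phi>tx_def by (intro C_infinity_partial_deriv C eB)+
  note cont\<phi> = C_infinity_continuous[OF \<phi>] C_infinity_continuous[OF C(1)] C_infinity_continuous[OF C(2)]
    C_infinity_continuous[OF C2(1)] C_infinity_continuous[OF C2(2)]
  have cW: "continuous_on W h" if "continuous_on UNIV h" for h :: "(real^'n) \<times> real \<Rightarrow> real"
    using that by (rule continuous_on_subset) auto
  have d\<phi>: "has_partial (e i) \<phi> (\<phi>x i z) z" "has_partial (e i) (\<phi>x i) (\<phi>xx i z) z" "has_partial (e i) \<phi>t (\<phi>tx i z) z"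
    "has_partial (0, 1) (\<phi>x i) (\<phi>tx i z) z" for i z
  proof -
    show "has_partial (e i) \<phi> (\<phi>x i z) z" unfolding \<phi>x_alt by (rule C_infinity_has_partial[OF \<phi> eB(1)])
    show "has_partial (e i) (\<phi>x i) (\<phi>xx i z) z" unfolding \<phi>xx_def by (rule C_infinity_has_partial[OF C(2) eB(1)])
    show "has_partial (e i) \<phi>t (\<phi>tx i z) z" unfolding \<phi>tx_def by (rule C_infinity_has_partial[OF C(1) eB(1)])
    have "partial_deriv (0, 1) (\<phi>x i) z = \<phi>tx i z"
    proof (rule mixed_partials_commute[where f=\<phi> and a="e i" and b="(0, 1)" and fa="\<phi>x i" and fb=\<phi>t])
      show "has_partial (e i) \<phi> (\<phi>x i z) z" for z unfolding \<phi>x_alt by (rule C_infinity_has_partial[OF \<phi> eB(1)])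
      show "has_partial (0, 1) \<phi> (\<phi>t z) z" for z unfolding \<phi>t_def by (rule C_infinity_has_partial[OF \<phi> eB(2)])
      show "has_partial (0, 1) (\<phi>x i) (partial_deriv (0, 1) (\<phi>x i) z) z" for z by (rule C_infinity_has_partial[OF C(2) eB(2)])
      show "has_partial (e i) \<phi>t (\<phi>tx i z) z" for z unfolding \<phi>tx_def by (rule C_infinity_has_partial[OF C(1) eB(1)])
    qed (intro C_infinity_continuous C2)+
    then show "has_partial (0, 1) (\<phi>x i) (\<phi>tx i z) z" using C_infinity_has_partial[OF C(2) eB(2), of i z] by simp
  qed
  have zero': "\<phi>t z = 0" "\<phi>x i z = 0" if "z \<notin> K" for i z
    unfolding \<phi>t_def \<phi>x_def using zero that by (auto intro!: partial_deriv_outside[OF clK])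
  \<comment> \<open>P, u^m - u(0,t)^m and Q multiplied by the cutoff, and their derivatives: a
    suffix 1 stands for r, a suffix 2 for t.\<close>
  define a b c a1 b1 c1 a2 where "a r t = cutoff (k * r) * P r t"
    and "b r t = cutoff (k * r) * (u r t powr m - u 0 t powr m)" and "c r t = cutoff (k * r) * Q r t"
    and "a1 r t = k * cutoff' (k * r) * P r t + cutoff (k * r) * P1 r t"
    and "b1 r t = k * cutoff' (k * r) * (u r t powr m - u 0 t powr m) + cutoff (k * r) * g1 r t"
    and "c1 r t = k * cutoff' (k * r) * Q r t + cutoff (k * r) * Q1 r t"
    and "a2 r t = cutoff (k * r) * P2 r t" for r t
  have dk: "DERIV (\<lambda>r. cutoff (k * r)) r :> k * cutoff' (k * r)" for r
  proof -
    have "DERIV (\<lambda>r. k * r) r :> k * 1" by (rule DERIV_cmult[OF DERIV_ident])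
    from DERIV_chain2[OF cutoff_has_derivative this] show ?thesis by (simp add: mult.commute[of _ k])
  qed
  have d_abc: "DERIV (\<lambda>r. a r t) r :> a1 r t" "DERIV (\<lambda>r. b r t) r :> b1 r t"
    "DERIV (\<lambda>r. c r t) r :> c1 r t" "DERIV (\<lambda>t. a r t) t :> a2 r t"
    if "0 < r" "0 < t" for r t
  proof -
    show "DERIV (\<lambda>r. a r t) r :> a1 r t"
      unfolding a_def a1_def using DERIV_mult'[OF dk P_r[OF that]] by (simp add: add.commute)
    show "DERIV (\<lambda>r. c r t) r :> c1 r t"
      unfolding c_def c1_def using DERIV_mult'[OF dk Q_r[OF that]] by (simp add: add.commute)
    show "DERIV (\<lambda>r. b r t) r :> b1 r t"
      unfolding b_def b1_def using DERIV_mult'[OF dk DERIV_diff[OF g_r[OF that] DERIV_const]] by (simp add: add.commute)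
    show "DERIV (\<lambda>t. a r t) t :> a2 r t"
      unfolding a_def a2_def by (rule DERIV_cmult[OF P_t[OF that]])
  qed
  have c_cut: "continuous_on W (\<lambda>z. cutoff (k * norm (fst z)))" "continuous_on W (\<lambda>z. cutoff' (k * norm (fst z)))"
    by (auto intro!: continuous_on_compose2[OF continuous_on_cutoff(1)[of UNIV]]
        continuous_on_compose2[OF continuous_on_cutoff(2)[of UNIV]] continuous_intros)
  have c_g: "continuous_on W (\<lambda>z. u (norm (fst z)) (snd z) powr m - u 0 (snd z) powr m)"
    by (intro continuous_on_diff continuous_on_subset[OF continuous_on_u_powr(1)[OF m] W_subset_H]
        continuous_on_subset[OF continuous_on_u_powr(2)[OF m] W_subset_H])
  have c_abc: "continuous_on W (\<lambda>z. a (norm (fst z)) (snd z))" "continuous_on W (\<lambda>z. b (norm (fst z)) (snd z))"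
    "continuous_on W (\<lambda>z. c (norm (fst z)) (snd z))" "continuous_on W (\<lambda>z. a1 (norm (fst z)) (snd z))"
    "continuous_on W (\<lambda>z. b1 (norm (fst z)) (snd z))" "continuous_on W (\<lambda>z. c1 (norm (fst z)) (snd z))"
    "continuous_on W (\<lambda>z. a2 (norm (fst z)) (snd z))"
    unfolding a_def b_def c_def a1_def b1_def c1_def a2_def
    by (intro continuous_on_mult continuous_on_add continuous_on_const c_cut c_g
        cont[THEN continuous_on_radial])+
  have c_coord: "continuous_on W (\<lambda>z. fst z $ i)" "continuous_on W (\<lambda>z. fst z $ i / norm (fst z))" for i
    by (auto simp: W_def intro!: continuous_intros)
  \<comment> \<open>A compact set away from the origin that contains the support of the fields
    below.\<close>
  define L where "L = K \<inter> {z. 1 / k \<le> norm (fst z)}"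
  have cL: "compact L" unfolding L_def by (intro compact_Int_closed K closed_Collect_le continuous_intros)
  have LW: "L \<subseteq> W" using K(2) k by (auto simp: L_def W_def H_def)
  have abc_zero: "a r t = 0" "b r t = 0" "c r t = 0" if "r < 1 / k" for r t
  proof -
    have "k * r \<le> 1" using that k by (simp add: pos_less_divide_eq mult.commute)
    then show "a r t = 0" "b r t = 0" "c r t = 0" by (auto simp: a_def b_def c_def cutoff_zero)
  qed
  \<comment> \<open>The spatial components of the field. \<psi>0 is differentiated in time instead,
    and subtracting it removes the mixed derivatives \<open>\<phi>tx\<close> from the divergence. By
    \<open>balance\<close> the coefficient of x . grad \<phi> then reduces to a term with the
    derivative of the cutoff.\<close>
  define \<psi> where "\<psi> i z = fst z $ i * a (norm (fst z)) (snd z) * \<phi>t z + b (norm (fst z)) (snd z) * \<phi>x i z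
    + fst z $ i * c (norm (fst z)) (snd z) * \<phi> z" for i z
  define \<psi>' where "\<psi>' i z =
      (fst z $ i * a (norm (fst z)) (snd z) * \<phi>tx i z
        + (fst z $ i * (a1 (norm (fst z)) (snd z) * (fst z $ i / norm (fst z))) + 1 * a (norm (fst z)) (snd z)) * \<phi>t z)
    + (b (norm (fst z)) (snd z) * \<phi>xx i z + b1 (norm (fst z)) (snd z) * (fst z $ i / norm (fst z)) * \<phi>x i z)
    + (fst z $ i * c (norm (fst z)) (snd z) * \<phi>x i z
        + (fst z $ i * (c1 (norm (fst z)) (snd z) * (fst z $ i / norm (fst z))) + 1 * c (norm (fst z)) (snd z)) * \<phi> z)" for i z
  define \<psi>0 where "\<psi>0 i z = fst z $ i * a (norm (fst z)) (snd z) * \<phi>x i z" for i z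
  define \<psi>0' where "\<psi>0' i z = fst z $ i * a (norm (fst z)) (snd z) * \<phi>tx i z
    + (fst z $ i * a2 (norm (fst z)) (snd z) + 0 * a (norm (fst z)) (snd z)) * \<phi>x i z" for i z
  have vanish: "\<psi> i z = 0" "\<psi>0 i z = 0" if "z \<notin> L" for i z
  proof -
    have "z \<notin> K \<or> norm (fst z) < 1 / k" using that by (auto simp: L_def)
    then show "\<psi> i z = 0" "\<psi>0 i z = 0"
      unfolding \<psi>_def \<psi>0_def by (elim disjE; simp add: zero zero' abc_zero)+
  qed
  have d\<psi>: "has_partial (e i) (\<psi> i) (\<psi>' i z) z" if z: "z \<in> W" for i z
  proof -
    have z': "fst z \<noteq> 0" "0 < norm (fst z)" "0 < snd z" using z by (auto simp: W_def)
    note r = d_abc[OF z'(2,3)]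
    show ?thesis unfolding \<psi>_def \<psi>'_def e_def
      by (intro has_partial_add has_partial_mult has_partial_coord
          d\<phi>[unfolded e_def] has_partial_radial[where R=a, OF z'(1) r(1)] has_partial_radial[where R=b, OF z'(1) r(2)] has_partial_radial[where R=c, OF z'(1) r(3)])
  qed
  have d\<psi>0: "has_partial (0, 1) (\<psi>0 i) (\<psi>0' i z) z" if z: "z \<in> W" for i z
  proof -
    have z': "0 < norm (fst z)" "0 < snd z" using z by (auto simp: W_def)
    show ?thesis unfolding \<psi>0_def \<psi>0'_def
      by (intro has_partial_add has_partial_mult has_partial_coord d\<phi>
          has_partial_time[where R="\<lambda>x. a (norm x)"] d_abc(4) z')
  qed
  have c\<psi>: "continuous_on W (\<psi> i)" "continuous_on W (\<psi>' i)" "continuous_on W (\<psi>0 i)" "continuous_on W (\<psi>0' i)" for i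
    unfolding \<psi>_def \<psi>'_def \<psi>0_def \<psi>0'_def
    by (intro continuous_on_add continuous_on_mult continuous_on_const c_abc c_coord cont\<phi>[THEN cW])+
  note I = integral_partial_eq_0[OF open_W(1) cL LW vanish(1) d\<psi> c\<psi>(1,2)]
  note I0 = integral_partial_eq_0[OF open_W(1) cL LW vanish(2) d\<psi>0 c\<psi>(3,4)]
  have i: "integrable lborel (\<lambda>z. indicator W z *\<^sub>R \<psi>' i z)" "integrable lborel (\<lambda>z. indicator W z *\<^sub>R \<psi>0' i z)" for i
    using I(1) I0(1) unfolding set_integrable_def by blast+
  have z: "integral\<^sup>L lborel (\<lambda>z. indicator W z *\<^sub>R \<psi>' i z) = 0" "integral\<^sup>L lborel (\<lambda>z. indicator W z *\<^sub>R \<psi>0' i z) = 0" for i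
    using I(2) I0(2) unfolding set_lebesgue_integral_def by blast+
  have "integral\<^sup>L lborel (\<lambda>z. (\<Sum>i\<in>UNIV. indicator W z *\<^sub>R \<psi>' i z) - (\<Sum>i\<in>UNIV. indicator W z *\<^sub>R \<psi>0' i z))
      = (\<Sum>i\<in>UNIV. integral\<^sup>L lborel (\<lambda>z. indicator W z *\<^sub>R \<psi>' i z))
        - (\<Sum>i\<in>UNIV. integral\<^sup>L lborel (\<lambda>z. indicator W z *\<^sub>R \<psi>0' i z))"
    by (subst Bochner_Integration.integral_diff[OF Bochner_Integration.integrable_sum Bochner_Integration.integrable_sum],
        (rule i)+, subst (1 2) Bochner_Integration.integral_sum, (rule i)+, rule refl)
  then have "integral\<^sup>L lborel (\<lambda>z. (\<Sum>i\<in>UNIV. indicator W z *\<^sub>R \<psi>' i z) - (\<Sum>i\<in>UNIV. indicator W z *\<^sub>R \<psi>0' i z)) = 0"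
    unfolding z by simp
  moreover have "(\<Sum>i\<in>UNIV. indicator W z *\<^sub>R \<psi>' i z) - (\<Sum>i\<in>UNIV. indicator W z *\<^sub>R \<psi>0' i z)
      = indicator W z * (cutoff (k * norm (fst z)) * M z + k * cutoff' (k * norm (fst z)) * E z)" for z
  proof (cases "z \<in> W")
    case True
    define r t where "r = norm (fst z)" and "t = snd z"
    have r: "0 < r" "0 < t" using True by (auto simp: W_def r_def t_def)
    define n where "n = real CARD('n)"
    define S where "S = (\<Sum>i\<in>UNIV. fst z $ i * \<phi>x i z)"
    define T where "T = (\<Sum>i\<in>UNIV. fst z $ i * \<phi>tx i z)"
    have lap: "space_laplacian \<phi> z = (\<Sum>i\<in>UNIV. \<phi>xx i z)"
      by (simp add: space_laplacian_def \<phi>xx_def \<phi>x_def e_def)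
    have 1: "(\<Sum>i\<in>UNIV. \<psi>' i z) = a r t * T + (a1 r t * r + n * a r t) * \<phi>t z
        + (b r t * space_laplacian \<phi> z + b1 r t / r * S) + (c r t * S + (c1 r t * r + n * c r t) * \<phi> z)"
    proof -
      have "(\<Sum>i\<in>UNIV. fst z $ i * a r t * \<phi>tx i z) = a r t * T"
        by (simp add: T_def sum_distrib_left mult_ac)
      moreover have "(\<Sum>i\<in>UNIV. (fst z $ i * (h * (fst z $ i / r)) + 1 * h') * w) = (h * r + n * h') * w" for h h' w :: real
        using sum_coord_square[of "fst z" h] by (simp add: r_def n_def sum.distrib flip: sum_distrib_right)
      moreover have "(\<Sum>i\<in>UNIV. b r t * \<phi>xx i z) = b r t * space_laplacian \<phi> z"
        by (simp add: lap sum_distrib_left)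
      moreover have "(\<Sum>i\<in>UNIV. b1 r t * (fst z $ i / r) * \<phi>x i z) = b1 r t / r * S"
        by (simp add: S_def sum_distrib_left mult_ac)
      moreover have "(\<Sum>i\<in>UNIV. fst z $ i * c r t * \<phi>x i z) = c r t * S"
        by (simp add: S_def sum_distrib_left mult_ac)
      ultimately show ?thesis unfolding \<psi>'_def r_def[symmetric] t_def[symmetric] by (simp only: sum.distrib)
    qed
    have 2: "(\<Sum>i\<in>UNIV. \<psi>0' i z) = a r t * T + a2 r t * S"
      unfolding \<psi>0'_def r_def[symmetric] t_def[symmetric]
      by (simp add: sum.distrib S_def T_def sum_distrib_left mult_ac)
    define g where "g = u r t powr m - u 0 t powr m"
    have e1: "a1 r t * r + n * a r t = k * cutoff' (k * r) * (r * P r t) + cutoff (k * r) * (r powr \<sigma>1 * u r t)"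
      unfolding div_P[OF r, symmetric] by (simp add: a_def a1_def n_def algebra_simps)
    have e2: "c1 r t * r + n * c r t = k * cutoff' (k * r) * (r * Q r t) + cutoff (k * r) * (r powr \<sigma>2 * u r t powr p)"
      unfolding div_Q[OF r, symmetric] by (simp add: c_def c1_def n_def algebra_simps)
    have e3: "b1 r t / r + c r t - a2 r t = k * cutoff' (k * r) * (g / r)"
      unfolding b1_def balance[OF r] using r by (simp add: c_def a2_def g_def field_simps)
    have "(\<Sum>i\<in>UNIV. \<psi>' i z) - (\<Sum>i\<in>UNIV. \<psi>0' i z) = (a1 r t * r + n * a r t) * \<phi>t z
        + b r t * space_laplacian \<phi> z + (b1 r t / r + c r t - a2 r t) * S + (c1 r t * r + n * c r t) * \<phi> z"
      unfolding 1 2 by (simp add: algebra_simps)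
    also have "\<dots> = cutoff (k * r) * M z + k * cutoff' (k * r) * E z"
    proof -
      have M_eq: "M z = r powr \<sigma>1 * u r t * \<phi>t z + g * space_laplacian \<phi> z + r powr \<sigma>2 * u r t powr p * \<phi> z"
        by (simp add: M_def r_def t_def g_def)
      have E_eq: "E z = r * P r t * \<phi>t z + g / r * S + r * Q r t * \<phi> z"
        by (simp add: E_def r_def t_def g_def S_def)
      have b_eq: "b r t = cutoff (k * r) * g" by (simp add: b_def g_def)
      show ?thesis unfolding e1 e2 e3 M_eq E_eq b_eq by (simp add: algebra_simps)
    qed
    finally show ?thesis using True by (simp add: r_def)
  qed simp
  ultimately show ?thesis by simp
qed

lemma compact_time_bounds:
  assumes "compact K" "K \<subseteq> H"
  obtains a b R where "0 < a" "\<And>z. z \<in> K \<Longrightarrow> norm (fst z) \<le> R \<and> a \<le> snd z \<and> snd z \<le> b"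
proof (cases "K = {}")
  case False
  have "continuous_on K snd" by (intro continuous_intros)
  then obtain z0 where z0: "z0 \<in> K" "\<And>z. z \<in> K \<Longrightarrow> snd z0 \<le> snd z"
    using continuous_attains_inf[OF assms(1) False] by blast
  obtain R where R: "\<And>z. z \<in> K \<Longrightarrow> norm z \<le> R" using compact_imp_bounded[OF assms(1)] unfolding bounded_iff by blast
  have "norm (fst z) \<le> R \<and> snd z \<le> R" if "z \<in> K" for z
    using R[OF that] norm_fst_le[of "fst z" "snd z"] norm_snd_le[of "snd z" "fst z"] by simp
  then show thesis using z0 assms(2) by (intro that[of "snd z0" R R]) (auto simp: H_def)
qed (use that[of 1] in auto)

lemmas integrable_H = integrable_weight_test[where 'n='n, folded H_def]

text \<open>The limit of \<open>cutoff_identity\<close> as k grows. The error tends to 0 pointwise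
  because s \<open>cutoff'\<close> s does, and 3 L C |x|^\<sigma>2 on K dominates it. The subtracted
  term u(0,t)^m times the Laplacian of \<phi> integrates to 0, since u(0,t)^m does not depend on
  x.\<close>

lemma weak_identity:
  assumes "test_function \<phi>"
  shows "integral\<^sup>L lborel (\<lambda>z. indicator H z * (norm (fst z) powr \<sigma>1 * u (norm (fst z)) (snd z) * time_deriv \<phi> z
      + u (norm (fst z)) (snd z) powr m * space_laplacian \<phi> z
      + norm (fst z) powr \<sigma>2 * u (norm (fst z)) (snd z) powr p * \<phi> z)) = 0"
    (is "integral\<^sup>L lborel (\<lambda>z. indicator H z * ?full z) = 0")
proof -
  obtain K where \<phi>: "C_infinity \<phi>" and K: "compact K" "K \<subseteq> H" and zero: "\<And>z. z \<notin> K \<Longrightarrow> \<phi> z = 0"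
    using assms unfolding test_function_def H_def by blast
  have clK: "closed K" using K(1) by (rule compact_imp_closed)
  define \<phi>t where "\<phi>t = partial_deriv (0, 1) \<phi>"
  define \<phi>x where "\<phi>x = (\<lambda>i::'n. partial_deriv (axis i 1, 0) \<phi>)"
  define \<phi>xx where "\<phi>xx i = partial_deriv (axis i 1, 0) (\<phi>x i)" for i
  note eB = axis_in_Basis_prod
  have C: "C_infinity \<phi>t" "C_infinity (\<phi>x i)" "C_infinity (\<phi>xx i)" for i
    unfolding \<phi>xx_def \<phi>t_def \<phi>x_def by (intro C_infinity_partial_deriv \<phi> eB)+
  note c = C_infinity_continuous[OF \<phi>] C_infinity_continuous[OF C(1)] C_infinity_continuous[OF C(2)] C_infinity_continuous[OF C(3)]
  have zero': "\<phi>t z = 0" "\<phi>x i z = 0" "\<phi>xx i z = 0" if "z \<notin> K" for i z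
  proof -
    have x: "\<phi>x i z = 0" if "z \<notin> K" for z unfolding \<phi>x_def by (rule partial_deriv_outside[OF clK zero that])
    show "\<phi>t z = 0" unfolding \<phi>t_def by (rule partial_deriv_outside[OF clK zero that])
    show "\<phi>x i z = 0" by (rule x[OF that])
    show "\<phi>xx i z = 0" unfolding \<phi>xx_def by (rule partial_deriv_outside[OF clK x that])
  qed
  have lap: "space_laplacian \<phi> = (\<lambda>z. \<Sum>i\<in>UNIV. \<phi>xx i z)"
    by (auto simp: space_laplacian_def \<phi>xx_def \<phi>x_def)
  have c_lap: "continuous_on UNIV (space_laplacian \<phi>)" unfolding lap by (intro continuous_on_sum c)
  have z_lap: "space_laplacian \<phi> z = 0" if "z \<notin> K" for z using zero' that by (simp add: lap)
  define g0 where "g0 z = u 0 (snd z) powr m" for z :: "(real^'n) \<times> real"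
  have cg0: "continuous_on H g0" unfolding g0_def by (rule continuous_on_u_powr(2)[OF m])
  define M where "M = (\<lambda>z. norm (fst z) powr \<sigma>1 * u (norm (fst z)) (snd z) * \<phi>t z
      + (u (norm (fst z)) (snd z) powr m - u 0 (snd z) powr m) * space_laplacian \<phi> z
      + norm (fst z) powr \<sigma>2 * u (norm (fst z)) (snd z) powr p * \<phi> z)"
  define S where "S z = (\<Sum>i\<in>UNIV. fst z $ i * \<phi>x i z)" for z
  define E where "E = (\<lambda>z. norm (fst z) * P (norm (fst z)) (snd z) * \<phi>t z
      + (u (norm (fst z)) (snd z) powr m - u 0 (snd z) powr m) / norm (fst z) * (\<Sum>i\<in>UNIV. fst z $ i * \<phi>x i z)
      + norm (fst z) * Q (norm (fst z)) (snd z) * \<phi> z)"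
  define s where "s k z = indicator W z * (cutoff (real (Suc k) * norm (fst z)) * M z
      + real (Suc k) * cutoff' (real (Suc k) * norm (fst z)) * E z)" for k z
  have s0: "integral\<^sup>L lborel (s k) = 0" for k
    unfolding s_def M_def E_def \<phi>t_def \<phi>x_def
    by (rule cutoff_identity[OF \<phi> K zero]) auto
  have full: "?full z = M z + g0 z * space_laplacian \<phi> z" for z
    by (simp add: M_def g0_def time_deriv_def \<phi>t_def algebra_simps)
  have iT: "integrable lborel (\<lambda>z. indicator H z * (norm (fst z) powr \<sigma>1 * u (norm (fst z)) (snd z) * \<phi>t z))"
    "integrable lborel (\<lambda>z. indicator H z * (u (norm (fst z)) (snd z) powr m * space_laplacian \<phi> z))"
    "integrable lborel (\<lambda>z. indicator H z * (norm (fst z) powr \<sigma>2 * u (norm (fst z)) (snd z) powr p * \<phi> z))"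
    "integrable lborel (\<lambda>z. indicator H z * (g0 z * space_laplacian \<phi> z))"
    using integrable_H(2)[OF K continuous_on_u(1) c(2) zero'(1) \<sigma>1]
      integrable_H(1)[OF K continuous_on_u_powr(1)[OF m] c_lap z_lap]
      integrable_H(2)[OF K continuous_on_u_powr(1)[OF p] c(1) zero \<sigma>2]
      integrable_H(1)[OF K cg0 c_lap z_lap] by auto
  have iM: "integrable lborel (\<lambda>z. indicator H z * M z)"
  proof -
    have "indicator H z * M z = indicator H z * (norm (fst z) powr \<sigma>1 * u (norm (fst z)) (snd z) * \<phi>t z)
      + (indicator H z * (u (norm (fst z)) (snd z) powr m * space_laplacian \<phi> z)
      - indicator H z * (g0 z * space_laplacian \<phi> z))
      + indicator H z * (norm (fst z) powr \<sigma>2 * u (norm (fst z)) (snd z) powr p * \<phi> z)" for z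
      by (simp add: M_def g0_def algebra_simps)
    then show ?thesis
      by (simp only:) (intro Bochner_Integration.integrable_add Bochner_Integration.integrable_diff iT)
  qed
  have Wb: "W \<in> sets borel" using open_W(1) by (rule borel_open)
  have ind: "indicator W z * (indicator H z * h) = indicator W z * h" for z and h :: real
    using W_subset_H by (auto simp: indicator_def)
  have iMW: "integrable lborel (\<lambda>z. indicator W z * M z)"
    using integrable_mult_indicator[OF _ iM, of W] Wb by (simp add: ind)
  obtain a b R where abR: "0 < a" "\<And>z. z \<in> K \<Longrightarrow> norm (fst z) \<le> R \<and> a \<le> snd z \<and> snd z \<le> b"
    by (rule compact_time_bounds[OF K]) blast
  obtain C' where C': "\<And>r t. 0 < r \<Longrightarrow> r \<le> R \<Longrightarrow> a \<le> t \<Longrightarrow> t \<le> b \<Longrightarrow>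
      \<bar>r * P r t\<bar> \<le> C' * r powr (\<sigma>2 + 1) \<and> \<bar>r * Q r t\<bar> \<le> C' * r powr (\<sigma>2 + 1) \<and>
      \<bar>u r t powr m - u 0 t powr m\<bar> / r \<le> C' * r powr (\<sigma>2 + 1)"
    using bounds[OF abR(1), of R b] by blast
  define C where "C = \<bar>C'\<bar>"
  have C0: "0 \<le> C" by (simp add: C_def)
  have Cb: "\<bar>r * P r t\<bar> \<le> C * r powr (\<sigma>2 + 1) \<and> \<bar>r * Q r t\<bar> \<le> C * r powr (\<sigma>2 + 1) \<and>
      \<bar>u r t powr m - u 0 t powr m\<bar> / r \<le> C * r powr (\<sigma>2 + 1)"
    if "0 < r" "r \<le> R" "a \<le> t" "t \<le> b" for r t
  proof -
    have "C' * r powr (\<sigma>2 + 1) \<le> C * r powr (\<sigma>2 + 1)" by (intro mult_right_mono) (auto simp: C_def)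
    then show ?thesis using C'[OF that] by auto
  qed
  have cS: "continuous_on UNIV S" unfolding S_def by (intro continuous_intros c)
  have "bounded ((\<lambda>z. \<bar>\<phi>t z\<bar> + \<bar>S z\<bar> + \<bar>\<phi> z\<bar>) ` K)"
    by (intro compact_imp_bounded compact_continuous_image K continuous_intros)
       (auto intro: continuous_on_subset[OF c(1)] continuous_on_subset[OF c(2)] continuous_on_subset[OF cS])
  then obtain L where L: "0 < L" "\<And>z. z \<in> K \<Longrightarrow> \<bar>\<phi>t z\<bar> + \<bar>S z\<bar> + \<bar>\<phi> z\<bar> \<le> L"
    unfolding bounded_pos by fastforce
  have E_bound: "\<bar>E z\<bar> \<le> C * norm (fst z) powr (\<sigma>2 + 1) * L" if z: "z \<in> K" "z \<in> W" for z
  proof -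
    define r t where "r = norm (fst z)" and "t = snd z"
    have r: "0 < r" "r \<le> R" "a \<le> t" "t \<le> b" using abR(2)[OF z(1)] z(2) by (auto simp: r_def t_def W_def)
    let ?c = "C * r powr (\<sigma>2 + 1)"
    have E_eq: "E z = r * P r t * \<phi>t z + (u r t powr m - u 0 t powr m) / r * S z + r * Q r t * \<phi> z"
      by (simp add: E_def S_def r_def t_def)
    have "\<bar>E z\<bar> \<le> \<bar>r * P r t * \<phi>t z\<bar> + \<bar>(u r t powr m - u 0 t powr m) / r * S z\<bar> + \<bar>r * Q r t * \<phi> z\<bar>"
      unfolding E_eq by (meson abs_triangle_ineq add_right_mono order_trans)
    also have "\<dots> \<le> ?c * \<bar>\<phi>t z\<bar> + ?c * \<bar>S z\<bar> + ?c * \<bar>\<phi> z\<bar>"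
      using Cb[OF r] r(1) unfolding abs_mult[of "r * P r t"] abs_mult[of "r * Q r t"] abs_mult[of "(u r t powr m - u 0 t powr m) / r"]
      by (intro add_mono mult_right_mono) (auto simp: abs_divide)
    also have "\<dots> = ?c * (\<bar>\<phi>t z\<bar> + \<bar>S z\<bar> + \<bar>\<phi> z\<bar>)" by (simp add: algebra_simps)
    also have "\<dots> \<le> ?c * L"
    proof (rule mult_left_mono[OF L(2)[OF z(1)]])
      show "0 \<le> ?c" using Cb[OF r] abs_ge_zero[of "r * P r t"] by linarith
    qed
    finally show ?thesis by (simp add: r_def)
  qed
  have E0: "E z = 0" if "z \<notin> K" for z using zero zero' that by (simp add: E_def)
  have lim: "(\<lambda>k. integral\<^sup>L lborel (s k)) \<longlonglongrightarrow> integral\<^sup>L lborel (\<lambda>z. indicator W z * M z)"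
  proof (rule integral_dominated_convergence[where w="\<lambda>z. \<bar>indicator W z * M z\<bar> + 3 * L * C * (indicator K z * norm (fst z) powr \<sigma>2)"])
    have c1: "continuous_on W (\<lambda>z. norm (fst z) powr \<sigma>)" for \<sigma>
      by (intro continuous_intros) (auto simp: W_def)
    have sub: "continuous_on W h" if "continuous_on H h" for h :: "_ \<Rightarrow> real"
      using that W_subset_H by (rule continuous_on_subset)
    have subU: "continuous_on W h" if "continuous_on UNIV h" for h :: "_ \<Rightarrow> real"
      using that by (rule continuous_on_subset) auto
    have cM: "continuous_on W M"
      unfolding M_def
      by (intro continuous_on_add continuous_on_mult continuous_on_diff c1 sub[OF continuous_on_u(1)] subU[OF c(2)] subU[OF c(1)] subU[OF c_lap]
          sub[OF continuous_on_u_powr(1)[OF m]] sub[OF continuous_on_u_powr(2)[OF m]] sub[OF continuous_on_u_powr(1)[OF p]])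
    have cE: "continuous_on W E"
      unfolding E_def
      by (intro continuous_on_add continuous_on_mult continuous_on_diff continuous_on_divide continuous_on_sum continuous_on_radial[OF cont(1)] continuous_on_radial[OF cont(4)]
          subU[OF c(2)] subU[OF c(1)] subU[OF c(3)] sub[OF continuous_on_u_powr(1)[OF m]] sub[OF continuous_on_u_powr(2)[OF m]])
         (auto intro!: continuous_intros simp: W_def)
    have c_cut: "continuous_on W (\<lambda>z. cutoff (k * norm (fst z)))" "continuous_on W (\<lambda>z. cutoff' (k * norm (fst z)))" for k
      by (auto intro!: continuous_on_compose2[OF continuous_on_cutoff(1)[of UNIV]]
        continuous_on_compose2[OF continuous_on_cutoff(2)[of UNIV]] continuous_intros)
    show "(\<lambda>z. indicator W z * M z) \<in> borel_measurable lborel"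
      using borel_measurable_continuous_on_indicator[OF Wb cM] by simp
    show "s k \<in> borel_measurable lborel" for k
    proof -
      have "continuous_on W (\<lambda>z. cutoff (real (Suc k) * norm (fst z)) * M z
          + real (Suc k) * cutoff' (real (Suc k) * norm (fst z)) * E z)"
        by (intro continuous_on_add continuous_on_mult continuous_on_const c_cut cM cE)
      from borel_measurable_continuous_on_indicator[OF Wb this]
      show ?thesis unfolding s_def[abs_def] by simp
    qed
    have "integrable lborel (\<lambda>z. indicator K z * norm (fst z) powr \<sigma>2)"
      using set_integrable_weight[OF K(1), of "\<lambda>_. 1" \<sigma>2] \<sigma>2 by (simp add: set_integrable_def)
    then show "integrable lborel (\<lambda>z. \<bar>indicator W z * M z\<bar> + 3 * L * C * (indicator K z * norm (fst z) powr \<sigma>2))"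
      by (intro Bochner_Integration.integrable_add integrable_abs iMW integrable_mult_right)
    show "AE z in lborel. (\<lambda>k. s k z) \<longlonglongrightarrow> indicator W z * M z"
    proof (rule AE_I2)
      fix z
      show "(\<lambda>k. s k z) \<longlonglongrightarrow> indicator W z * M z"
      proof (cases "z \<in> W")
        case True
        then have r: "0 < norm (fst z)" by (simp add: W_def)
        have top: "filterlim (\<lambda>k. real (Suc k) * norm (fst z)) at_top sequentially"
          using r by (intro filterlim_at_top_mult_tendsto_pos[OF tendsto_const] filterlim_compose[OF filterlim_real_sequentially filterlim_Suc]) auto
        have l1: "(\<lambda>k. cutoff (real (Suc k) * norm (fst z))) \<longlonglongrightarrow> 1"
          by (rule filterlim_compose[OF cutoff_tendsto(1) top])
        have l2: "(\<lambda>k. (real (Suc k) * norm (fst z)) * cutoff' (real (Suc k) * norm (fst z))) \<longlonglongrightarrow> 0"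
          by (rule filterlim_compose[OF cutoff_tendsto(2) top])
        have "(\<lambda>k. cutoff (real (Suc k) * norm (fst z)) * M z
            + ((real (Suc k) * norm (fst z)) * cutoff' (real (Suc k) * norm (fst z))) * (E z / norm (fst z))) \<longlonglongrightarrow> 1 * M z + 0 * (E z / norm (fst z))"
          by (intro tendsto_add tendsto_mult l1 l2 tendsto_const)
        moreover have "s k z = cutoff (real (Suc k) * norm (fst z)) * M z
            + ((real (Suc k) * norm (fst z)) * cutoff' (real (Suc k) * norm (fst z))) * (E z / norm (fst z))" for k
          using True r by (simp add: s_def del: of_nat_Suc)
        ultimately show ?thesis using True by (simp del: of_nat_Suc)
      qed (simp add: s_def)
    qed
    show "AE z in lborel. norm (s k z) \<le> \<bar>indicator W z * M z\<bar> + 3 * L * C * (indicator K z * norm (fst z) powr \<sigma>2)" for k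
    proof (rule AE_I2)
      fix z
      show "norm (s k z) \<le> \<bar>indicator W z * M z\<bar> + 3 * L * C * (indicator K z * norm (fst z) powr \<sigma>2)"
      proof (cases "z \<in> W \<and> z \<in> K")
        case True
        define r where "r = norm (fst z)"
        have r: "0 < r" using True by (simp add: W_def r_def)
        define k' where "k' = real (Suc k)"
        have "\<bar>cutoff (k' * r) * M z\<bar> \<le> 1 * \<bar>M z\<bar>"
          using cutoff_bounds(1,2)[of "k' * r"] unfolding abs_mult by (intro mult_right_mono) auto
        moreover have "\<bar>k' * cutoff' (k' * r) * E z\<bar> \<le> 3 * L * C * r powr \<sigma>2"
        proof -
          have "\<bar>k' * cutoff' (k' * r) * E z\<bar> = \<bar>(k' * r) * cutoff' (k' * r)\<bar> * (\<bar>E z\<bar> / r)"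
            using r by (simp add: abs_mult)
          also have "\<dots> \<le> 3 * ((C * r powr (\<sigma>2 + 1) * L) / r)"
            using E_bound[of z] True r cutoff_bounds(3)[of "k' * r"]
            by (intro mult_mono divide_right_mono) (auto simp: r_def)
          also have "\<dots> = 3 * L * C * r powr \<sigma>2" using r by (simp add: powr_add)
          finally show ?thesis .
        qed
        ultimately have "\<bar>cutoff (k' * r) * M z + k' * cutoff' (k' * r) * E z\<bar> \<le> \<bar>M z\<bar> + 3 * L * C * r powr \<sigma>2"
          using abs_triangle_ineq[of "cutoff (k' * r) * M z" "k' * cutoff' (k' * r) * E z"] by linarith
        then show ?thesis using True by (simp add: s_def r_def k'_def del: of_nat_Suc)
      next
        case False
        have "M z = 0" if "z \<notin> K" using zero zero' z_lap that by (simp add: M_def)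
        moreover have "0 \<le> 3 * L * C * (indicator K z * norm (fst z) powr \<sigma>2)" using L(1) C0 by simp
        ultimately show ?thesis using False E0 by (cases "z \<in> W") (auto simp: s_def)
      qed
    qed
  qed
  then have MW: "integral\<^sup>L lborel (\<lambda>z. indicator W z * M z) = 0"
    unfolding s0 using LIMSEQ_unique[OF tendsto_const] by metis
  have g\<phi>: "set_lebesgue_integral lborel H (\<lambda>z. g0 z * \<phi>xx i z) = 0" "set_integrable lborel H (\<lambda>z. g0 z * \<phi>xx i z)" for i
  proof -
    have *: "has_partial (axis i 1, 0) (\<lambda>z. g0 z * \<phi>x i z) (g0 z * \<phi>xx i z) z" for z
    proof -
      have "has_partial (axis i 1, 0) g0 0 z" by (simp add: has_partial_def g0_def)
      moreover have "has_partial (axis i 1, 0) (\<phi>x i) (\<phi>xx i z) z" unfolding \<phi>xx_def by (rule C_infinity_has_partial[OF C(2) eB(1)])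
      ultimately have "has_partial (axis i 1, 0) (\<lambda>z. g0 z * \<phi>x i z) (g0 z * \<phi>xx i z + 0 * \<phi>x i z) z" by (rule has_partial_mult)
      then show ?thesis by simp
    qed
    have cc: "continuous_on H (\<lambda>z. g0 z * \<phi>x i z)" "continuous_on H (\<lambda>z. g0 z * \<phi>xx i z)"
      by (intro continuous_on_mult cg0 continuous_on_subset[OF c(3)] continuous_on_subset[OF c(4)]; simp)+
    have zz: "g0 z * \<phi>x i z = 0" if "z \<notin> K" for z using zero'(2)[OF that] by simp
    show "set_lebesgue_integral lborel H (\<lambda>z. g0 z * \<phi>xx i z) = 0" "set_integrable lborel H (\<lambda>z. g0 z * \<phi>xx i z)"
      using integral_partial_eq_0[OF open_W(2) K zz * cc] by auto
  qed
  have i: "integral\<^sup>L lborel (\<lambda>z. indicator H z *\<^sub>R (g0 z * \<phi>xx i z)) = 0" "integrable lborel (\<lambda>z. indicator H z *\<^sub>R (g0 z * \<phi>xx i z))" for i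
    using g\<phi> unfolding set_lebesgue_integral_def set_integrable_def by blast+
  have "integral\<^sup>L lborel (\<lambda>z. \<Sum>i\<in>UNIV. indicator H z *\<^sub>R (g0 z * \<phi>xx i z)) = 0"
    by (subst Bochner_Integration.integral_sum, rule i(2)) (simp only: i(1) sum.neutral_const)
  moreover have "(\<Sum>i\<in>UNIV. indicator H z *\<^sub>R (g0 z * \<phi>xx i z)) = indicator H z * (g0 z * space_laplacian \<phi> z)" for z
    by (simp only: lap real_scaleR_def sum_distrib_left)
  ultimately have lap0: "integral\<^sup>L lborel (\<lambda>z. indicator H z * (g0 z * space_laplacian \<phi> z)) = 0" by (simp only:)
  have "integral\<^sup>L lborel (\<lambda>z. indicator H z * M z) = integral\<^sup>L lborel (\<lambda>z. indicator W z * M z)"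
  proof (rule integral_cong_AE)
    show "AE z in lborel. indicator H z * M z = indicator W z * M z"
      using AE_fst_nonzero by eventually_elim (auto simp: indicator_def H_def W_def)
  qed (use iM iMW in auto)
  then have "integral\<^sup>L lborel (\<lambda>z. indicator H z * M z) = 0" using MW by simp
  moreover have "indicator H z * ?full z = indicator H z * M z + indicator H z * (g0 z * space_laplacian \<phi> z)" for z
    unfolding full by (rule distrib_left)
  ultimately show ?thesis using lap0 iM iT(4) by (simp only: Bochner_Integration.integral_add)
qed

theorem weak_solution: "weak_solution m p \<sigma>1 \<sigma>2 (\<lambda>(x::real^'n) t. u (norm x) t)"
  unfolding weak_solution_def
proof (intro conjI allI impI)
  show "0 \<le> u (norm x) t" if "0 < t" for x :: "real^'n" and t using u_nonneg that by simp
  show "continuous_on (UNIV \<times> {0<..}) (\<lambda>(x::real^'n, t). u (norm x) t)"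
    using continuous_on_u(1) by (simp add: H_def case_prod_unfold)
next
  fix K :: "((real^'n) \<times> real) set" assume "compact K \<and> K \<subseteq> UNIV \<times> {0<..}"
  then have K: "compact K" "K \<subseteq> H" by (auto simp: H_def)
  show "set_integrable lborel K (\<lambda>(x, t). norm x powr \<sigma>1 * u (norm x) t)"
    using set_integrable_weight[OF K(1) continuous_on_subset[OF continuous_on_u(1) K(2)], of \<sigma>1] \<sigma>1 by (simp add: case_prod_unfold)
  show "set_integrable lborel K (\<lambda>(x, t). norm x powr \<sigma>2 * u (norm x) t powr p)"
    using set_integrable_weight[OF K(1) continuous_on_subset[OF continuous_on_u_powr(1)[OF p] K(2)], of \<sigma>2] \<sigma>2 by (simp add: case_prod_unfold)
  show "set_integrable lborel K (\<lambda>(x, t). u (norm x) t powr m)"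
    using borel_integrable_compact[OF K(1) continuous_on_subset[OF continuous_on_u_powr(1)[OF m] K(2)]]
    by (simp add: set_integrable_def case_prod_unfold)
next
  fix \<phi> :: "(real^'n) \<times> real \<Rightarrow> real" assume "test_function \<phi>"
  from weak_identity[OF this] show "set_lebesgue_integral lborel (UNIV \<times> {0<..})
      (\<lambda>(x, t). norm x powr \<sigma>1 * u (norm x) t * time_deriv \<phi> (x, t)
        + u (norm x) t powr m * space_laplacian \<phi> (x, t) + norm x powr \<sigma>2 * u (norm x) t powr p * \<phi> (x, t)) = 0"
    by (simp add: set_lebesgue_integral_def H_def case_prod_unfold)
qed

end

section \<open>Smooth test functions\<close>

text \<open>The functions x^(-k) exp(-1/x), extended by zero. As a family they are closed under
  differentiation up to linear combination, which exp(-1/x) alone is not.\<close>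

definition flat :: "nat \<Rightarrow> real \<Rightarrow> real" where
  "flat k x = (if 0 < x then (1 / x) ^ k * exp (- (1 / x)) else 0)"

lemma flat_tendsto_0: "(flat k \<longlongrightarrow> 0) (at 0)"
proof -
  have "((\<lambda>y::real. y ^ k / exp y) \<longlongrightarrow> 0) at_top" by (rule tendsto_power_div_exp_0)
  from filterlim_compose[OF this filterlim_inverse_at_top_right]
  have "((\<lambda>x::real. inverse x ^ k / exp (inverse x)) \<longlongrightarrow> 0) (at_right 0)" .
  moreover have "\<forall>\<^sub>F x::real in at_right 0. inverse x ^ k / exp (inverse x) = flat k x"
    using eventually_at_right_less[of "0::real"]
    by eventually_elim (simp add: flat_def exp_minus inverse_eq_divide)
  ultimately have r: "(flat k \<longlongrightarrow> 0) (at_right 0)" by (rule Lim_transform_eventually)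
  have "\<forall>\<^sub>F x::real in at_left 0. 0 = flat k x"
    by (auto simp: eventually_at_filter flat_def)
  with tendsto_const have "(flat k \<longlongrightarrow> 0) (at_left 0)" by (rule Lim_transform_eventually)
  with r show ?thesis by (simp add: filterlim_split_at)
qed

lemma flat_has_derivative: "DERIV (flat k) x :> - real k * flat (k + 1) x + flat (k + 2) x"
proof -
  consider "x < 0" | "x = 0" | "0 < x" by linarith
  then show ?thesis
  proof cases
    case 1
    have "DERIV (\<lambda>x. 0) x :> 0" by simp
    then have "DERIV (flat k) x :> 0"
      by (rule has_field_derivative_transform_within_open[of _ _ _ "{..<0}"]) (use 1 in \<open>auto simp: flat_def\<close>)
    then show ?thesis using 1 by (simp add: flat_def)
  next
    case 2
    have "\<forall>\<^sub>F h in at 0. flat (Suc k) h = (flat k (0 + h) - flat k 0) / h"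
      by (auto simp: eventually_at_filter flat_def)
    from Lim_transform_eventually[OF flat_tendsto_0 this] show ?thesis
      unfolding DERIV_def 2 by (simp add: flat_def)
  next
    case 3
    have i: "DERIV (\<lambda>x. 1 / x) x :> - (1 / x * (1 / x))"
      using 3 by (auto intro!: derivative_eq_intros)
    have o: "DERIV (\<lambda>y. y ^ k * exp (- y)) y :> real k * y ^ (k - 1) * exp (- y) - y ^ k * exp (- y)" for y :: real
      by (auto intro!: derivative_eq_intros)
    have "(real k * y ^ (k - 1) * e - y ^ k * e) * - (y * y) = - real k * (y ^ (k + 1) * e) + y ^ (k + 2) * e" for y e :: real
      by (cases k) (simp_all add: algebra_simps)
    then have "DERIV (\<lambda>x. (1 / x) ^ k * exp (- (1 / x))) x :> - real k * flat (k + 1) x + flat (k + 2) x"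
      using DERIV_chain2[OF o i] 3 by (simp only: flat_def if_True)
    then show ?thesis
      by (rule has_field_derivative_transform_within_open[of _ _ _ "{0<..}"]) (use 3 in \<open>auto simp: flat_def\<close>)
  qed
qed

lemma continuous_on_flat: "continuous_on S (flat k)"
  by (rule DERIV_continuous_on[OF has_field_derivative_at_within[OF flat_has_derivative]])

definition bump :: "real \<Rightarrow> real" where "bump x = flat 0 x * flat 0 (1 - x)"

lemma bump_nonneg: "0 \<le> bump x"
  by (simp add: bump_def flat_def)

lemma bump_pos_iff: "0 < bump x \<longleftrightarrow> 0 < x \<and> x < 1"
  by (simp add: bump_def flat_def)

lemma bump_zero: "x \<le> 0 \<or> 1 \<le> x \<Longrightarrow> bump x = 0"
  by (auto simp: bump_def flat_def)

lemma continuous_on_bump: "continuous_on S bump"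
  unfolding bump_def
  by (intro continuous_intros continuous_on_flat continuous_on_compose2[OF continuous_on_flat[of UNIV]]) auto

lemma ex_primitive:
  fixes g :: "real \<Rightarrow> real"
  assumes "continuous_on UNIV g"
  obtains G where "\<And>x. DERIV G x :> g x"
proof -
  have "\<exists>G. \<forall>x::real. - \<infinity> < ereal x \<longrightarrow> ereal x < \<infinity> \<longrightarrow> (G has_vector_derivative g x) (at x)"
    by (rule einterval_antiderivative) (use assms in \<open>auto simp: continuous_on_eq_continuous_within\<close>)
  then show thesis using that by (auto simp: has_real_derivative_iff_has_vector_derivative)
qed

lemma ex_step:
  obtains S d where "\<And>x. DERIV S x :> d * bump x" "0 < d" "\<And>x. x \<le> 0 \<Longrightarrow> S x = 0" "\<And>x. 1 \<le> x \<Longrightarrow> S x = 1"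
    "\<And>x. 0 \<le> S x" "\<And>x. S x \<le> 1"
proof -
  obtain G where G: "\<And>x. DERIV G x :> bump x"
    by (rule ex_primitive[OF continuous_on_bump]) blast
  have mono: "G x \<le> G y" if "x \<le> y" for x y
    by (rule DERIV_nonneg_imp_nondecreasing[OF that]) (use G bump_nonneg in blast)
  have lt: "G 0 < G 1"
  proof (rule DERIV_pos_imp_increasing_open[of 0 1 G])
    fix x :: real assume "0 < x" "x < 1"
    then show "\<exists>y. DERIV G x :> y \<and> 0 < y" using G bump_pos_iff by blast
  qed (auto intro!: DERIV_continuous_on[OF has_field_derivative_at_within[OF G]])
  have z: "G x = G 0" if "x \<le> 0" for x
  proof (rule antisym[OF mono[OF that]])
    show "G 0 \<le> G x"
    proof (rule DERIV_nonpos_imp_nonincreasing[OF that])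
      fix t :: real assume "t \<le> 0"
      then show "\<exists>y. DERIV G t :> y \<and> y \<le> 0" using G[of t] bump_zero[of t] by auto
    qed
  qed
  have o: "G x = G 1" if "1 \<le> x" for x
  proof (rule antisym[OF _ mono[OF that]])
    show "G x \<le> G 1"
    proof (rule DERIV_nonpos_imp_nonincreasing[OF that])
      fix t :: real assume "1 \<le> t"
      then show "\<exists>y. DERIV G t :> y \<and> y \<le> 0" using G[of t] bump_zero[of t] by auto
    qed
  qed
  have b: "G 0 \<le> G x" "G x \<le> G 1" for x
    using z[of x] o[of x] mono[of 0 x] mono[of x 1] mono[of 0 1] by linarith+
  show thesis
  proof (rule that[of "\<lambda>x. (G x - G 0) / (G 1 - G 0)" "1 / (G 1 - G 0)"])
    show "DERIV (\<lambda>x. (G x - G 0) / (G 1 - G 0)) x :> 1 / (G 1 - G 0) * bump x" for x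
      using DERIV_cdivide[OF DERIV_diff[OF G[of x] DERIV_const[of "G 0"]], of "G 1 - G 0"] by simp
    show "(G x - G 0) / (G 1 - G 0) \<le> 1" for x using b(2)[of x] lt by (simp add: divide_le_eq)
    show "0 \<le> (G x - G 0) / (G 1 - G 0)" for x using b(1)[of x] lt by simp
    show "(G x - G 0) / (G 1 - G 0) = 0" if "x \<le> 0" for x using z[OF that] by simp
    show "(G x - G 0) / (G 1 - G 0) = 1" if "1 \<le> x" for x unfolding o[OF that] using lt by simp
  qed (use lt in simp)
qed

text \<open>A class of functions closed under partial differentiation, which avoids a product and a chain
  rule for iterated derivatives.\<close>

inductive_set smooth_fun :: "('a::euclidean_space \<times> real \<Rightarrow> real) set" where
  const: "(\<lambda>_. c) \<in> smooth_fun"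
| inner: "(\<lambda>z. z \<bullet> c) \<in> smooth_fun"
| add: "f \<in> smooth_fun \<Longrightarrow> g \<in> smooth_fun \<Longrightarrow> (\<lambda>z. f z + g z) \<in> smooth_fun"
| mult: "f \<in> smooth_fun \<Longrightarrow> g \<in> smooth_fun \<Longrightarrow> (\<lambda>z. f z * g z) \<in> smooth_fun"
| time_powr: "(\<lambda>z. snd z powr e) \<in> smooth_fun"
| flat: "f \<in> smooth_fun \<Longrightarrow> (\<lambda>z. flat k (f z)) \<in> smooth_fun"
| primitive: "f \<in> smooth_fun \<Longrightarrow> (\<lambda>z. g' (f z)) \<in> smooth_fun \<Longrightarrow> (\<And>x. DERIV g x :> g' x) \<Longrightarrow>
    (\<lambda>z. g (f z)) \<in> smooth_fun"

lemma smooth_fun_continuous: "f \<in> smooth_fun \<Longrightarrow> continuous_on (UNIV \<times> {0<..}) f"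
proof (induction rule: smooth_fun.induct)
  case (flat f k)
  show ?case by (rule continuous_on_compose2[OF continuous_on_flat[of UNIV] flat(2)]) auto
next
  case (primitive f g' g)
  have "continuous_on UNIV g" by (rule DERIV_continuous_on[OF has_field_derivative_at_within[OF primitive(3)]])
  from this primitive(4) show ?case by (rule continuous_on_compose2) simp
qed (auto intro!: continuous_intros)

lemma smooth_fun_partial:
  "f \<in> smooth_fun \<Longrightarrow> \<exists>g\<in>smooth_fun. \<forall>z. 0 < snd z \<longrightarrow> has_partial b f (g z) z"
proof (induction rule: smooth_fun.induct)
  case (const c)
  show ?case by (rule bexI[OF _ smooth_fun.const[of 0]]) auto
next
  case (inner c)
  show ?case by (rule bexI[OF _ smooth_fun.const[of "b \<bullet> c"]]) (auto intro: has_partial_inner)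
next
  case (add f g)
  from add(3,4) obtain f' g' where "f' \<in> smooth_fun" "g' \<in> smooth_fun"
    "\<And>z. 0 < snd z \<Longrightarrow> has_partial b f (f' z) z" "\<And>z. 0 < snd z \<Longrightarrow> has_partial b g (g' z) z" by blast
  note f' = this
  show ?case by (rule bexI[OF _ smooth_fun.add[OF f'(1,2)]]) (use f'(3,4) in \<open>blast intro: has_partial_add\<close>)
next
  case (mult f g)
  from mult(3,4) obtain f' g' where f': "f' \<in> smooth_fun" "g' \<in> smooth_fun"
    "\<And>z. 0 < snd z \<Longrightarrow> has_partial b f (f' z) z" "\<And>z. 0 < snd z \<Longrightarrow> has_partial b g (g' z) z" by blast
  have "has_partial b (\<lambda>z. f z * g z) (f z * g' z + f' z * g z) z" if "0 < snd z" for z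
    by (rule has_partial_mult[OF f'(3,4)[OF that]])
  then show ?case
    by (intro bexI[OF _ smooth_fun.add[OF smooth_fun.mult[OF mult(1) f'(2)] smooth_fun.mult[OF f'(1) mult(2)]]]) blast
next
  case (time_powr e)
  have "has_partial b (\<lambda>z. snd z powr e) (e * snd z powr (e - 1) * snd b) z" if "0 < snd z" for z
  proof (rule has_partial_compose[where g="\<lambda>t. t powr e"])
    show "DERIV (\<lambda>t. t powr e) (snd z) :> e * snd z powr (e - 1)"
      using that by (rule has_real_derivative_powr)
    show "has_partial b snd (snd b) z" unfolding has_partial_def by (auto intro!: derivative_eq_intros)
  qed
  then show ?case
    by (intro bexI[OF _ smooth_fun.mult[OF smooth_fun.mult[OF smooth_fun.const[of e] smooth_fun.time_powr[of "e - 1"]] smooth_fun.const[of "snd b"]]]) auto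
next
  case (flat f k)
  from flat(2) obtain f' where f': "f' \<in> smooth_fun" "\<And>z. 0 < snd z \<Longrightarrow> has_partial b f (f' z) z" by blast
  have "has_partial b (\<lambda>z. flat k (f z)) ((- real k * flat (k + 1) (f z) + flat (k + 2) (f z)) * f' z) z" if "0 < snd z" for z
    by (rule has_partial_compose[where g="flat k", OF flat_has_derivative f'(2)[OF that]])
  then show ?case
    by (intro bexI[OF _ smooth_fun.mult[OF smooth_fun.add[OF smooth_fun.mult[OF smooth_fun.const[of "- real k"]
        smooth_fun.flat[OF flat(1), of "k + 1"]] smooth_fun.flat[OF flat(1), of "k + 2"]] f'(1)]]) blast
next
  case (primitive f g' g)
  from primitive(4) obtain f' where f': "f' \<in> smooth_fun" "\<And>z. 0 < snd z \<Longrightarrow> has_partial b f (f' z) z" by blast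
  have "has_partial b (\<lambda>z. g (f z)) (g' (f z) * f' z) z" if "0 < snd z" for z
    by (rule has_partial_compose[where g=g, OF primitive(3) f'(2)[OF that]])
  then show ?case
    by (intro bexI[OF _ smooth_fun.mult[OF primitive(2) f'(1)]]) blast
qed

text \<open>Real powers of t are handled only for t > 0, so agreement with the class is demanded
  there, and a compact support inside t > 0 takes care of the rest. The two conditions together,
  \<open>nice\<close>, pass to partial derivatives and hence to iterated ones.\<close>

lemma smooth_fun_C_infinity:
  fixes \<phi> :: "'a::euclidean_space \<times> real \<Rightarrow> real"
  assumes f: "f \<in> smooth_fun" and C: "compact C" "C \<subseteq> UNIV \<times> {0<..}"
    and eq: "\<And>z. 0 < snd z \<Longrightarrow> \<phi> z = f z" and zero: "\<And>z. z \<notin> C \<Longrightarrow> \<phi> z = 0"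
  shows "C_infinity \<phi>"
proof -
  define nice where "nice \<psi> \<longleftrightarrow> (\<exists>g\<in>smooth_fun. \<forall>z. 0 < snd z \<longrightarrow> \<psi> z = g z) \<and> (\<forall>z. z \<notin> C \<longrightarrow> \<psi> z = 0)"
    for \<psi> :: "'a \<times> real \<Rightarrow> real"
  have clC: "closed C" using C(1) by (rule compact_imp_closed)
  have opU: "open (UNIV \<times> {0<..} :: ('a \<times> real) set)" by (intro open_Times) auto
  have part: "\<exists>\<psi>'. nice \<psi>' \<and> (\<forall>z. has_partial b \<psi> (\<psi>' z) z)" if nice: "nice \<psi>" for \<psi> b
  proof -
    obtain g where g: "g \<in> smooth_fun" "\<And>z. 0 < snd z \<Longrightarrow> \<psi> z = g z" and z: "\<And>z. z \<notin> C \<Longrightarrow> \<psi> z = 0"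
      using nice unfolding nice_def by blast
    obtain g' where g': "g' \<in> smooth_fun" "\<And>z. 0 < snd z \<Longrightarrow> has_partial b g (g' z) z"
      using smooth_fun_partial[OF g(1)] by blast
    define \<psi>' where "\<psi>' z = (if 0 < snd z then g' z else 0)" for z
    have pos: "has_partial b \<psi> (\<psi>' z) z" if "0 < snd z" for z
    proof -
      have "has_partial b \<psi> (g' z) z"
        by (rule has_partial_transform_open[OF g'(2)[OF that] opU]) (use that g(2) in \<open>auto simp: mem_Times_iff\<close>)
      then show ?thesis using that by (simp add: \<psi>'_def)
    qed
    have out: "has_partial b \<psi> 0 z" if "z \<notin> C" for z
      by (rule has_partial_transform_open[OF has_partial_const, of "- C"]) (use clC that z in auto)
    have 0: "\<psi>' z = 0" if "z \<notin> C" for z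
      using has_partial_unique[OF pos out[OF that]] by (auto simp: \<psi>'_def)
    have "has_partial b \<psi> (\<psi>' z) z" for z
    proof (cases "0 < snd z")
      case False
      then have "z \<notin> C" using C(2) by auto
      then show ?thesis using 0 out by simp
    qed (rule pos)
    moreover have "nice \<psi>'" unfolding nice_def using g'(1) 0 by (auto simp: \<psi>'_def)
    ultimately show ?thesis by blast
  qed
  have cont: "continuous_on UNIV \<psi>" if nice: "nice \<psi>" for \<psi>
  proof -
    obtain g where g: "g \<in> smooth_fun" "\<And>z. 0 < snd z \<Longrightarrow> \<psi> z = g z" and z: "\<And>z. z \<notin> C \<Longrightarrow> \<psi> z = 0"
      using nice unfolding nice_def by blast
    have "continuous_on (UNIV \<times> {0<..}) \<psi>"
      using continuous_on_cong[THEN iffD1, OF refl _ smooth_fun_continuous[OF g(1)], of \<psi>] g(2) by auto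
    moreover have "continuous_on (- C) \<psi>"
      using continuous_on_cong[THEN iffD1, OF refl _ continuous_on_const[of "- C" 0], of \<psi>] z by auto
    ultimately have "continuous_on (UNIV \<times> {0<..} \<union> - C) \<psi>" using opU clC by (intro continuous_on_open_Un) auto
    moreover have "UNIV \<times> {0<..} \<union> - C = UNIV" using C(2) by auto
    ultimately show ?thesis by simp
  qed
  have step: "nice (partial_deriv b \<psi>)" if nice: "nice \<psi>" for \<psi> b
  proof -
    obtain \<psi>' where \<psi>': "nice \<psi>'" "\<And>z. has_partial b \<psi> (\<psi>' z) z" using part[OF nice] by blast
    have "partial_deriv b \<psi> = \<psi>'" by (rule ext) (rule has_partial_imp_partial_deriv[OF \<psi>'(2)])
    then show ?thesis using \<psi>'(1) by simp
  qed
  have iter: "nice (fold partial_deriv bs \<psi>)" if "nice \<psi>" for bs \<psi>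
    using that by (induction bs arbitrary: \<psi>) (auto intro: step)
  have "nice \<phi>" unfolding nice_def using f eq zero by blast
  then have n: "nice (fold partial_deriv bs \<phi>)" for bs by (rule iter)
  show ?thesis
    unfolding C_infinity_def
  proof (intro allI impI conjI ballI)
    fix bs show "continuous_on UNIV (fold partial_deriv bs \<phi>)" by (rule cont[OF n])
    fix b z
    obtain \<psi>' where "\<And>z. has_partial b (fold partial_deriv bs \<phi>) (\<psi>' z) z" using part[OF n] by blast
    from this[of z] show "(\<lambda>s. fold partial_deriv bs \<phi> (z + s *\<^sub>R b)) differentiable at 0"
      unfolding has_partial_def by (auto simp: real_differentiable_def)
  qed
qed

lemma smooth_fun_affine: "f \<in> smooth_fun \<Longrightarrow> (\<lambda>z. c * f z + d) \<in> smooth_fun"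
  using smooth_fun.add[OF smooth_fun.mult[OF smooth_fun.const[of c]] smooth_fun.const[of d]] .

lemma smooth_fun_bump: "f \<in> smooth_fun \<Longrightarrow> (\<lambda>z. bump (f z)) \<in> smooth_fun"
  using smooth_fun.mult[OF smooth_fun.flat[of f 0] smooth_fun.flat[OF smooth_fun_affine[of f "-1" 1], of 0]]
  by (simp add: bump_def)

lemma smooth_fun_time: "snd \<in> smooth_fun"
  using smooth_fun.inner[of "(0, 1)"] by (simp add: inner_prod_def)

lemma smooth_fun_sum: "(\<And>i. i \<in> I \<Longrightarrow> f i \<in> smooth_fun) \<Longrightarrow> (\<lambda>z. \<Sum>i\<in>I. f i z) \<in> smooth_fun"
  by (induction I rule: infinite_finite_induct) (auto intro: smooth_fun.const smooth_fun.add)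

text \<open>Unlike the norm, its square is smooth at the origin; hence the similarity variable |x|^2
  t^(-2 \<beta>) in the test functions.\<close>

lemma smooth_fun_norm_square: "(\<lambda>z. (norm (fst z))\<^sup>2) \<in> smooth_fun"
proof -
  have "(\<lambda>z::'a \<times> real. \<Sum>b\<in>Basis. (z \<bullet> (b, 0)) * (z \<bullet> (b, 0))) \<in> smooth_fun"
    by (intro smooth_fun_sum smooth_fun.mult smooth_fun.inner)
  moreover have "(\<Sum>b\<in>Basis. (z \<bullet> (b, 0)) * (z \<bullet> (b, 0))) = (norm (fst z))\<^sup>2" for z :: "'a \<times> real"
    by (simp add: inner_prod_def euclidean_inner[of "fst z" "fst z"] power2_norm_eq_inner)
  ultimately show ?thesis by simp
qed

section \<open>The profile equation of a self-similar weak solution\<close>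

definition bump' :: "real \<Rightarrow> real" where "bump' x = flat 2 x * flat 0 (1 - x) - flat 0 x * flat 2 (1 - x)"

lemma bump_has_derivative: "DERIV bump x :> bump' x"
proof -
  have "DERIV (\<lambda>x. 1 - x) x :> -1" by (auto intro!: derivative_eq_intros)
  from DERIV_chain2[OF flat_has_derivative this, of 0]
  have "DERIV (\<lambda>x. flat 0 (1 - x)) x :> flat 2 (1 - x) * -1" by (simp add: numeral_2_eq_2)
  from DERIV_mult'[OF flat_has_derivative[of 0 x] this]
  show ?thesis by (simp add: bump_def[abs_def] bump'_def algebra_simps numeral_2_eq_2)
qed

lemma continuous_on_bump': "continuous_on S bump'"
  unfolding bump'_def
  by (intro continuous_intros continuous_on_flat continuous_on_compose2[OF continuous_on_flat[of UNIV]]) auto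

lemma bump'_zero: "x \<le> 0 \<or> 1 \<le> x \<Longrightarrow> bump' x = 0"
  by (auto simp: bump'_def flat_def)

lemma has_partial_norm_square:
  "has_partial (axis i 1, 0) (\<lambda>z::(real^'n) \<times> real. (norm (fst z))\<^sup>2) (2 * fst z $ i) z"
  "has_partial (0, 1) (\<lambda>z::(real^'n) \<times> real. (norm (fst z))\<^sup>2) 0 z"
  unfolding has_partial_def power2_norm_eq_inner
  by (auto simp: algebra_simps inner_add_left inner_add_right inner_axis inner_axis' intro!: derivative_eq_intros)

lemma has_partial_snd:
  assumes "DERIV g (snd z) :> d"
  shows "has_partial (axis i 1, 0) (\<lambda>z::(real^'n) \<times> real. g (snd z)) 0 z" "has_partial (0, 1) (\<lambda>z::(real^'n) \<times> real. g (snd z)) d z"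
  using has_partial_time[of "\<lambda>_. g" z d] assms by (simp_all add: has_partial_def)

lemma integrable_half_line_powr:
  fixes g :: "real \<Rightarrow> real"
  assumes a: "-1 < a" and g: "continuous_on {0..} g" and zero: "\<And>x. R \<le> x \<Longrightarrow> g x = 0"
  shows "integrable lborel (\<lambda>x. indicator {0<..} x * (x powr a * g x))"
proof -
  define g' where "g' x = g (max 0 x)" for x
  have cg: "continuous_on UNIV g'" unfolding g'_def by (rule continuous_on_compose2[OF g]) (auto intro!: continuous_intros)
  then have [measurable]: "g' \<in> borel_measurable borel" by (rule borel_measurable_continuous_onI)
  have "bounded (g' ` {0..R})"
    by (intro compact_imp_bounded compact_continuous_image continuous_on_subset[OF cg]) auto
  then obtain C where "\<forall>x\<in>g' ` {0..R}. norm x \<le> C" unfolding bounded_iff by blast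
  then have C: "\<bar>g' x\<bar> \<le> C" if "0 \<le> x" "x \<le> R" for x using that by auto
  have i: "integrable lborel (\<lambda>x::real. C * (indicator (cball 0 R) x * norm x powr a))"
    by (intro integrable_mult_right integrable_radial_powr) (use a in simp)
  have "integrable lborel (\<lambda>x. indicator {0<..} x * (x powr a * g' x))"
  proof (rule Bochner_Integration.integrable_bound[OF i])
    show "AE x in lborel. norm (indicator {0<..} x * (x powr a * g' x)) \<le> norm (C * (indicator (cball 0 R) x * norm x powr a))"
    proof (rule AE_I2)
      fix x
      show "norm (indicator {0<..} x * (x powr a * g' x)) \<le> norm (C * (indicator (cball 0 R) x * norm x powr a))"
      proof (cases "0 < x \<and> x \<le> R")
        case True
        then have "\<bar>x powr a * g' x\<bar> \<le> x powr a * C" using C[of x] by (simp add: abs_mult mult_left_mono)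
        then show ?thesis using True by (simp add: mult.commute abs_mult)
      next
        case False
        then show ?thesis using zero[of x] by (auto simp: g'_def)
      qed
    qed
  qed simp
  moreover have "indicator {0<..} x * (x powr a * g' x) = indicator {0<..} x * (x powr a * g x)" for x
    by (auto simp: g'_def)
  ultimately show ?thesis by simp
qed

text \<open>The identities \<open>exponents\<close> say that under the self-similar form all three
  terms of the equation carry the same power of t, namely \<alpha> + \<beta> \<sigma>1 - 1.\<close>

locale self_similar_weak =
  fixes m p \<sigma>1 \<sigma>2 \<alpha> \<beta> :: real and n :: real and v :: "real^'n::finite \<Rightarrow> real \<Rightarrow> real" and f :: "real \<Rightarrow> real"
  assumes n_eq: "n = real CARD('n)" and weak_sol: "weak_solution m p \<sigma>1 \<sigma>2 v"
    and form: "\<And>x t. 0 < t \<Longrightarrow> v x t = t powr \<alpha> * f (norm x * t powr (- \<beta>))"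
    and m: "0 < m" and p: "0 < p" and \<sigma>1: "- n < \<sigma>1" and \<sigma>2: "- n < \<sigma>2"
    and exponents: "\<alpha> * m - 2 * \<beta> = \<alpha> + \<beta> * \<sigma>1 - 1" "\<alpha> * p + \<beta> * \<sigma>2 = \<alpha> + \<beta> * \<sigma>1 - 1"
begin

text \<open>The exponent of the weighted mass: the spatial integral of |x|^\<sigma>1 u scales like
  t^A.\<close>

definition A :: real where "A = \<alpha> + \<beta> * (n + \<sigma>1)"

text \<open>The profile is read off at t = 1 along a coordinate axis, so it inherits continuity and
  sign from the weak solution.\<close>

lemma profile_continuous_nonneg: "continuous_on {0..} f" "0 \<le> \<xi> \<Longrightarrow> 0 \<le> f \<xi>"
proof -
  have v: "\<And>x t. 0 < t \<Longrightarrow> 0 \<le> v x t" "continuous_on (UNIV \<times> {0<..}) (\<lambda>(x, t). v x t)"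
    using weak_sol unfolding weak_solution_def by auto
  define e where "e = (axis undefined 1 :: real^'n)"
  have fv: "f \<xi> = v (\<xi> *\<^sub>R e) 1" if "0 \<le> \<xi>" for \<xi>
    using form[of 1 "\<xi> *\<^sub>R e"] that by (simp add: e_def norm_axis_1)
  show "0 \<le> f \<xi>" if "0 \<le> \<xi>" using fv[OF that] v(1)[of 1] by simp
  have "continuous_on {0..} (\<lambda>\<xi>. (\<lambda>(x, t). v x t) (\<xi> *\<^sub>R e, 1))"
    by (rule continuous_on_compose2[OF v(2)]) (auto intro!: continuous_intros)
  then show "continuous_on {0..} f" by (rule continuous_on_cong[THEN iffD1, rotated 2]) (auto simp: fv)
qed

text \<open>The test function is \<open>bump (t - 1)\<close> times h of s = |x|^2 t^(-2 \<beta>),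
  and \<open>F\<close> is the integrand of the weak formulation in r and t. The Laplacian of h(s) is
  t^(-2 \<beta>) (4 s h2 + 2 n h1).\<close>

lemma tested:
  fixes h h1 h2 :: "real \<Rightarrow> real" and S :: real
  assumes h: "\<And>s. DERIV h s :> h1 s" "\<And>s. DERIV h1 s :> h2 s"
    and h2: "continuous_on UNIV h2" and vanish: "\<And>s. S \<le> s \<Longrightarrow> h s = 0" "0 \<le> S"
    and smooth: "\<And>g. g \<in> (smooth_fun :: ((real^'n) \<times> real \<Rightarrow> real) set) \<Longrightarrow> (\<lambda>z. h (g z)) \<in> smooth_fun"
  defines "s \<equiv> \<lambda>r t. r\<^sup>2 * t powr (- 2 * \<beta>)" and "v' \<equiv> \<lambda>r t. t powr \<alpha> * f (r * t powr (- \<beta>))"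
  defines "F \<equiv> \<lambda>r t. r powr \<sigma>1 * v' r t * (bump' (t - 1) * h (s r t) + bump (t - 1) * (h1 (s r t) * (r\<^sup>2 * (- 2 * \<beta> * t powr (- 2 * \<beta> - 1)))))
      + v' r t powr m * (bump (t - 1) * t powr (- 2 * \<beta>) * (4 * s r t * h2 (s r t) + 2 * n * h1 (s r t)))
      + r powr \<sigma>2 * v' r t powr p * (bump (t - 1) * h (s r t))"
  shows "integrable lborel (\<lambda>z::(real^'n) \<times> real. indicator (UNIV \<times> {0<..}) z * F (norm (fst z)) (snd z))"
    and "integral\<^sup>L lborel (\<lambda>z::(real^'n) \<times> real. indicator (UNIV \<times> {0<..}) z * F (norm (fst z)) (snd z)) = 0"
proof -
  define q where "q = (\<lambda>z::(real^'n) \<times> real. s (norm (fst z)) (snd z))"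
  define \<phi> where "\<phi> = (\<lambda>z. bump (snd z - 1) * h (q z))"
  define U where "U = (UNIV \<times> {0<..} :: ((real^'n) \<times> real) set)"
  have opU: "open U" unfolding U_def by (intro open_Times) auto
  \<comment> \<open>Times in {1..2} and |x| t^(-\<beta>) at most sqrt S, written as a continuous
    image of a product so that compactness is immediate.\<close>
  define C where "C = (\<lambda>z::(real^'n) \<times> real. (snd z powr \<beta> *\<^sub>R fst z, snd z)) ` (cball 0 (sqrt S) \<times> {1..2})"
  have C: "compact C" "C \<subseteq> U"
  proof -
    show "compact C" unfolding C_def
      by (intro compact_continuous_image compact_Times) (auto intro!: continuous_intros)
    show "C \<subseteq> U" by (auto simp: C_def U_def)
  qed
  have q_smooth: "q \<in> smooth_fun"
    unfolding q_def s_def by (intro smooth_fun.mult smooth_fun_norm_square smooth_fun.time_powr)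
  have \<phi>_smooth: "\<phi> \<in> smooth_fun"
    unfolding \<phi>_def
    using smooth_fun.mult[OF smooth_fun_bump[OF smooth_fun_affine[OF smooth_fun_time, of 1 "-1"]] smooth[OF q_smooth]] by simp
  have zero: "\<phi> z = 0" if "z \<notin> C" for z
  proof (cases "1 \<le> snd z \<and> snd z \<le> 2")
    case True
    define t x where "t = snd z" and "x = fst z"
    have t: "0 < t" "1 \<le> t" "t \<le> 2" using True by (auto simp: t_def)
    have "z = (\<lambda>z. (snd z powr \<beta> *\<^sub>R fst z, snd z)) (t powr (- \<beta>) *\<^sub>R x, t)"
      using t by (simp add: t_def x_def prod_eq_iff flip: powr_add)
    then have "t powr (- \<beta>) *\<^sub>R x \<notin> cball 0 (sqrt S)" using that t unfolding C_def by (metis (no_types, lifting) SigmaI atLeastAtMost_iff imageI)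
    then have "sqrt S < t powr (- \<beta>) * norm x" by simp
    then have "(sqrt S)\<^sup>2 \<le> (t powr (- \<beta>) * norm x)\<^sup>2" using vanish(2) by (intro power_mono) auto
    also have "\<dots> = q z" using t by (simp add: q_def s_def t_def x_def power_mult_distrib powr_power mult.commute)
    finally show ?thesis using vanish by (simp add: \<phi>_def)
  next
    case False
    then show ?thesis by (auto simp: \<phi>_def bump_zero)
  qed
  have C\<phi>: "C_infinity \<phi>" by (rule smooth_fun_C_infinity[OF \<phi>_smooth C[unfolded U_def] refl zero])
  have test: "test_function \<phi>" unfolding test_function_def using C\<phi> C zero by (auto simp: U_def)
  have q_der: "has_partial (axis i 1, 0) q (2 * fst z $ i * snd z powr (- 2 * \<beta>)) z"
    "has_partial (0, 1) q ((norm (fst z))\<^sup>2 * (- 2 * \<beta> * snd z powr (- 2 * \<beta> - 1))) z" if "0 < snd z" for z i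
  proof -
    note d = has_partial_snd[of "\<lambda>t. t powr (- 2 * \<beta>)", OF has_real_derivative_powr[OF that]]
    show "has_partial (axis i 1, 0) q (2 * fst z $ i * snd z powr (- 2 * \<beta>)) z"
      using has_partial_mult[OF has_partial_norm_square(1) d(1)] by (simp add: q_def s_def)
    show "has_partial (0, 1) q ((norm (fst z))\<^sup>2 * (- 2 * \<beta> * snd z powr (- 2 * \<beta> - 1))) z"
      using has_partial_mult[OF has_partial_norm_square(2) d(2)] by (simp add: q_def s_def)
  qed
  have "DERIV (\<lambda>t. t - 1) t :> 1" for t :: real by (auto intro!: derivative_eq_intros)
  from DERIV_chain2[OF bump_has_derivative this]
  have b_der: "DERIV (\<lambda>t. bump (t - 1)) t :> bump' (t - 1)" for t by simp
  note b = has_partial_snd[of "\<lambda>t. bump (t - 1)", OF b_der]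
  have \<phi>t: "time_deriv \<phi> z = bump' (snd z - 1) * h (q z) + bump (snd z - 1) * (h1 (q z) * ((norm (fst z))\<^sup>2 * (- 2 * \<beta> * snd z powr (- 2 * \<beta> - 1))))"
    if "0 < snd z" for z
    unfolding time_deriv_def \<phi>_def
    by (rule has_partial_imp_partial_deriv)
       (use has_partial_mult[OF b(2) has_partial_compose[where g=h, OF h(1) q_der(2)[OF that]]] in \<open>simp add: add.commute\<close>)
  have \<phi>x: "partial_deriv (axis i 1, 0) \<phi> z = bump (snd z - 1) * (h1 (q z) * (2 * fst z $ i * snd z powr (- 2 * \<beta>)))"
    if "0 < snd z" for z i
    unfolding \<phi>_def
    by (rule has_partial_imp_partial_deriv)
       (use has_partial_mult[OF b(1) has_partial_compose[where g=h, OF h(1) q_der(1)[OF that]]] in simp)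
  have \<phi>xx: "partial_deriv (axis i 1, 0) (partial_deriv (axis i 1, 0) \<phi>) z =
      bump (snd z - 1) * (h1 (q z) * (2 * snd z powr (- 2 * \<beta>)) + h2 (q z) * (2 * fst z $ i * snd z powr (- 2 * \<beta>)) * (2 * fst z $ i * snd z powr (- 2 * \<beta>)))"
    if t: "0 < snd z" for z i
  proof (rule has_partial_imp_partial_deriv)
    have d: "has_partial (axis i 1, 0) (\<lambda>z. 2 * fst z $ i * snd z powr (- 2 * \<beta>)) (2 * snd z powr (- 2 * \<beta>)) z"
      using has_partial_mult[OF has_partial_mult[OF has_partial_const[of _ 2] has_partial_coord(1)]
          has_partial_snd(1)[of "\<lambda>t. t powr (- 2 * \<beta>)", OF has_real_derivative_powr[OF t]]] by simp
    have "has_partial (axis i 1, 0) (\<lambda>z. bump (snd z - 1) * (h1 (q z) * (2 * fst z $ i * snd z powr (- 2 * \<beta>))))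
      (bump (snd z - 1) * (h1 (q z) * (2 * snd z powr (- 2 * \<beta>)) + h2 (q z) * (2 * fst z $ i * snd z powr (- 2 * \<beta>)) * (2 * fst z $ i * snd z powr (- 2 * \<beta>)))) z"
      using has_partial_mult[OF b(1) has_partial_mult[OF has_partial_compose[where g=h1, OF h(2) q_der(1)[OF t]] d]] by simp
    then show "has_partial (axis i 1, 0) (partial_deriv (axis i 1, 0) \<phi>)
      (bump (snd z - 1) * (h1 (q z) * (2 * snd z powr (- 2 * \<beta>)) + h2 (q z) * (2 * fst z $ i * snd z powr (- 2 * \<beta>)) * (2 * fst z $ i * snd z powr (- 2 * \<beta>)))) z"
      by (rule has_partial_transform_open[OF _ opU]) (use t \<phi>x in \<open>auto simp: U_def mem_Times_iff\<close>)
  qed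
  have lap: "space_laplacian \<phi> z = bump (snd z - 1) * snd z powr (- 2 * \<beta>) * (4 * q z * h2 (q z) + 2 * n * h1 (q z))"
    if t: "0 < snd z" for z
  proof -
    have sq: "(\<Sum>i\<in>UNIV. fst z $ i * fst z $ i) = (norm (fst z))\<^sup>2"
      by (simp add: power2_norm_eq_inner inner_vec_def)
    have "space_laplacian \<phi> z = (\<Sum>i\<in>UNIV. bump (snd z - 1) * (h1 (q z) * (2 * snd z powr (- 2 * \<beta>)))
        + bump (snd z - 1) * h2 (q z) * 4 * (snd z powr (- 2 * \<beta>))\<^sup>2 * (fst z $ i * fst z $ i))"
      unfolding space_laplacian_def \<phi>xx[OF t] by (intro sum.cong refl) (simp add: algebra_simps power2_eq_square)
    also have "\<dots> = n * (bump (snd z - 1) * (h1 (q z) * (2 * snd z powr (- 2 * \<beta>))))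
        + bump (snd z - 1) * h2 (q z) * 4 * (snd z powr (- 2 * \<beta>))\<^sup>2 * (norm (fst z))\<^sup>2"
      by (simp add: n_eq sum.distrib sq flip: sum_distrib_left)
    also have "\<dots> = bump (snd z - 1) * snd z powr (- 2 * \<beta>) * (4 * q z * h2 (q z) + 2 * n * h1 (q z))"
      by (simp add: q_def s_def algebra_simps power2_eq_square)
    finally show ?thesis .
  qed
  define T where "T z = norm (fst z) powr \<sigma>1 * v (fst z) (snd z) * time_deriv \<phi> z
      + v (fst z) (snd z) powr m * space_laplacian \<phi> z + norm (fst z) powr \<sigma>2 * v (fst z) (snd z) powr p * \<phi> z" for z
  have FT: "indicator U z * F (norm (fst z)) (snd z) = indicator U z * T z" for z
  proof (cases "z \<in> U")
    case True
    then have t: "0 < snd z" by (auto simp: U_def)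
    show ?thesis unfolding T_def F_def \<phi>t[OF t] lap[OF t] form[OF t] v'_def unfolding \<phi>_def q_def by simp
  qed simp
  have eq: "(\<lambda>z. indicator (UNIV \<times> {0<..}) z * F (norm (fst z)) (snd z)) = (\<lambda>z. indicator U z * T z)"
    using FT unfolding U_def by (rule ext)
  have v: "\<And>x t. 0 < t \<Longrightarrow> 0 \<le> v x t" "continuous_on U (\<lambda>z. v (fst z) (snd z))"
    using weak_sol unfolding weak_solution_def U_def by (auto simp: case_prod_unfold)
  have vp: "continuous_on U (\<lambda>z. v (fst z) (snd z) powr c)" if "0 < c" for c
    by (rule continuous_on_powr'[OF v(2) continuous_on_const]) (use that v(1) in \<open>auto simp: U_def\<close>)
  have eB: "(axis i 1, 0) \<in> (Basis :: ((real^'n) \<times> real) set)" "(0, 1) \<in> (Basis :: ((real^'n) \<times> real) set)" for i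
    using axis_in_Basis_prod by blast+
  have clC: "closed C" using C(1) by (rule compact_imp_closed)
  have x0: "partial_deriv (axis i 1, 0) \<phi> z = 0" if "z \<notin> C" for z i
    by (rule partial_deriv_outside[OF clC zero that])
  have t0: "time_deriv \<phi> z = 0" if "z \<notin> C" for z
    unfolding time_deriv_def by (rule partial_deriv_outside[OF clC zero that])
  have l0: "space_laplacian \<phi> z = 0" if "z \<notin> C" for z
    unfolding space_laplacian_def by (intro sum.neutral ballI partial_deriv_outside[OF clC x0 that])
  have c: "continuous_on UNIV (time_deriv \<phi>)" "continuous_on UNIV (space_laplacian \<phi>)"
    unfolding time_deriv_def space_laplacian_def[abs_def]
    by (intro continuous_on_sum C_infinity_continuous C_infinity_partial_deriv C\<phi> eB)+
  have "integrable lborel (\<lambda>z. indicator U z * (norm (fst z) powr \<sigma>1 * v (fst z) (snd z) * time_deriv \<phi> z)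
      + indicator U z * (v (fst z) (snd z) powr m * space_laplacian \<phi> z)
      + indicator U z * (norm (fst z) powr \<sigma>2 * v (fst z) (snd z) powr p * \<phi> z))"
    unfolding U_def
    by (intro Bochner_Integration.integrable_add
        integrable_weight_test(1)[OF C[unfolded U_def] vp[OF m, unfolded U_def] c(2) l0]
        integrable_weight_test(2)[OF C[unfolded U_def] v(2)[unfolded U_def] c(1) t0 \<sigma>1[unfolded n_eq]]
        integrable_weight_test(2)[OF C[unfolded U_def] vp[OF p, unfolded U_def] C_infinity_continuous[OF C\<phi>] zero \<sigma>2[unfolded n_eq]])
  then have "integrable lborel (\<lambda>z. indicator U z * T z)" by (simp add: T_def distrib_left)
  then show "integrable lborel (\<lambda>z::(real^'n) \<times> real. indicator (UNIV \<times> {0<..}) z * F (norm (fst z)) (snd z))"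
    by (rule ssubst[OF eq, of "integrable lborel"])
  have "set_lebesgue_integral lborel (UNIV \<times> {0<..})
      (\<lambda>(x, t). norm x powr \<sigma>1 * v x t * time_deriv \<phi> (x, t) + v x t powr m * space_laplacian \<phi> (x, t)
        + norm x powr \<sigma>2 * v x t powr p * \<phi> (x, t)) = 0"
    using weak_sol test unfolding weak_solution_def by blast
  then have "integral\<^sup>L lborel (\<lambda>z. indicator U z * T z) = 0"
    by (simp add: set_lebesgue_integral_def case_prod_unfold T_def U_def)
  then show "integral\<^sup>L lborel (\<lambda>z::(real^'n) \<times> real. indicator (UNIV \<times> {0<..}) z * F (norm (fst z)) (snd z)) = 0"
    by (rule ssubst[OF eq, of "\<lambda>k. integral\<^sup>L lborel k = 0"])
qed

text \<open>The substitution r = t^\<beta> \<xi> separates the variables: the spatial integral at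
  time t is a constant times t^A bump'(t - 1) IX + t^(A-1) bump(t - 1) IY. Integrating by parts in t
  turns t^A bump'(t - 1) into -A t^(A-1) bump(t - 1), and as t^(A-1) bump(t - 1) has nonzero
  integral, IY = A IX.\<close>

lemma profile_identity:
  fixes h h1 h2 :: "real \<Rightarrow> real" and S :: real
  assumes h: "\<And>s. DERIV h s :> h1 s" "\<And>s. DERIV h1 s :> h2 s"
    and h2: "continuous_on UNIV h2"
    and vanish: "0 \<le> S" "\<And>s. S \<le> s \<Longrightarrow> h s = 0" "\<And>s. S \<le> s \<Longrightarrow> h1 s = 0" "\<And>s. S \<le> s \<Longrightarrow> h2 s = 0"
    and smooth: "\<And>g. g \<in> (smooth_fun :: ((real^'n) \<times> real \<Rightarrow> real) set) \<Longrightarrow> (\<lambda>z. h (g z)) \<in> smooth_fun"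
  defines "X \<equiv> \<lambda>\<xi>. \<xi> powr (n - 1 + \<sigma>1) * (f \<xi> * h (\<xi>\<^sup>2))"
    and "Y \<equiv> \<lambda>\<xi>. \<xi> powr (n + 1 + \<sigma>1) * (- 2 * \<beta> * (f \<xi> * h1 (\<xi>\<^sup>2)))
      + \<xi> powr (n - 1) * (f \<xi> powr m * (4 * \<xi>\<^sup>2 * h2 (\<xi>\<^sup>2) + 2 * n * h1 (\<xi>\<^sup>2)))
      + \<xi> powr (n - 1 + \<sigma>2) * (f \<xi> powr p * h (\<xi>\<^sup>2))"
  shows "integrable lborel (\<lambda>\<xi>. indicator {0<..} \<xi> * X \<xi>)" "integrable lborel (\<lambda>\<xi>. indicator {0<..} \<xi> * Y \<xi>)"
    and "(\<integral>\<xi>. indicator {0<..} \<xi> * Y \<xi> \<partial>lborel) = A * (\<integral>\<xi>. indicator {0<..} \<xi> * X \<xi> \<partial>lborel)"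
proof -
  have n1: "1 \<le> n" using n_eq by (simp add: Suc_leI)
  have ch: "continuous_on UNIV h" "continuous_on UNIV h1"
    by (rule DERIV_continuous_on[OF has_field_derivative_at_within[OF h(1)]],
        rule DERIV_continuous_on[OF has_field_derivative_at_within[OF h(2)]])
  have csq: "continuous_on {0..} (\<lambda>\<xi>::real. g (\<xi>\<^sup>2))" if "continuous_on UNIV g" for g :: "real \<Rightarrow> real"
    by (rule continuous_on_compose2[OF that]) (auto intro!: continuous_intros)
  note cf = profile_continuous_nonneg(1)
  have cfp: "continuous_on {0..} (\<lambda>\<xi>. f \<xi> powr c)" if "0 < c" for c
    by (rule continuous_on_powr'[OF cf continuous_on_const]) (use that profile_continuous_nonneg(2) in auto)
  have big: "S \<le> \<xi>\<^sup>2" if "max 1 S \<le> \<xi>" for \<xi> :: real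
  proof -
    have "S \<le> 1 * \<xi>" using that by simp
    also have "\<dots> \<le> \<xi> * \<xi>" using that by (intro mult_right_mono) auto
    finally show ?thesis by (simp only: power2_eq_square)
  qed
  note vz = vanish(2-4)[OF big]
  have i1: "integrable lborel (\<lambda>\<xi>. indicator {0<..} \<xi> * (\<xi> powr (n - 1 + \<sigma>1) * (f \<xi> * h (\<xi>\<^sup>2))))"
    by (intro integrable_half_line_powr[where R="max 1 S"] continuous_on_mult cf csq ch) (use \<sigma>1 \<sigma>2 n1 in simp, simp only: vz mult_zero_right add_0_right)
  have i2: "integrable lborel (\<lambda>\<xi>. indicator {0<..} \<xi> * (\<xi> powr (n + 1 + \<sigma>1) * (- 2 * \<beta> * (f \<xi> * h1 (\<xi>\<^sup>2)))))"
    by (intro integrable_half_line_powr[where R="max 1 S"] continuous_on_mult continuous_on_const cf csq ch) (use \<sigma>1 \<sigma>2 n1 in simp, simp only: vz mult_zero_right add_0_right)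
  have i3: "integrable lborel (\<lambda>\<xi>. indicator {0<..} \<xi> * (\<xi> powr (n - 1) * (f \<xi> powr m * (4 * \<xi>\<^sup>2 * h2 (\<xi>\<^sup>2) + 2 * n * h1 (\<xi>\<^sup>2)))))"
    by (intro integrable_half_line_powr[where R="max 1 S"] continuous_on_mult continuous_on_add continuous_on_const continuous_on_power
        continuous_on_id cfp m csq ch h2) (use \<sigma>1 \<sigma>2 n1 in simp, simp only: vz mult_zero_right add_0_right)
  have i4: "integrable lborel (\<lambda>\<xi>. indicator {0<..} \<xi> * (\<xi> powr (n - 1 + \<sigma>2) * (f \<xi> powr p * h (\<xi>\<^sup>2))))"
    by (intro integrable_half_line_powr[where R="max 1 S"] continuous_on_mult cfp p csq ch) (use \<sigma>1 \<sigma>2 n1 in simp, simp only: vz mult_zero_right add_0_right)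
  show iX: "integrable lborel (\<lambda>\<xi>. indicator {0<..} \<xi> * X \<xi>)" using i1 by (simp add: X_def)
  have "integrable lborel (\<lambda>\<xi>. indicator {0<..} \<xi> * (\<xi> powr (n + 1 + \<sigma>1) * (- 2 * \<beta> * (f \<xi> * h1 (\<xi>\<^sup>2))))
      + indicator {0<..} \<xi> * (\<xi> powr (n - 1) * (f \<xi> powr m * (4 * \<xi>\<^sup>2 * h2 (\<xi>\<^sup>2) + 2 * n * h1 (\<xi>\<^sup>2))))
      + indicator {0<..} \<xi> * (\<xi> powr (n - 1 + \<sigma>2) * (f \<xi> powr p * h (\<xi>\<^sup>2))))"
    by (intro Bochner_Integration.integrable_add i2 i3 i4)
  then show iY: "integrable lborel (\<lambda>\<xi>. indicator {0<..} \<xi> * Y \<xi>)" unfolding Y_def distrib_left .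
  define IX IY where "IX = (\<integral>\<xi>. indicator {0<..} \<xi> * X \<xi> \<partial>lborel)" and "IY = (\<integral>\<xi>. indicator {0<..} \<xi> * Y \<xi> \<partial>lborel)"
  define c where "c = n * unit_ball_vol n"
  have c: "0 < c" using n1 by (simp add: c_def)
  define k where "k t = t powr A * bump' (t - 1) * IX + t powr (A - 1) * bump (t - 1) * IY" for t
  \<comment> \<open>f is constrained only on [0, infinity); this version is continuous on the whole
    line, hence measurable.\<close>
  define g where "g \<xi> = f (max 0 \<xi>)" for \<xi>
  have cg: "continuous_on UNIV g" unfolding g_def by (rule continuous_on_compose2[OF cf]) (auto intro!: continuous_intros)
  have [measurable]: "g \<in> borel_measurable borel" "h \<in> borel_measurable borel" "h1 \<in> borel_measurable borel" "h2 \<in> borel_measurable borel"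
    using cg ch h2 by (auto intro: borel_measurable_continuous_onI)
  define s where "s r t = r\<^sup>2 * t powr (- 2 * \<beta>)" for r t
  define v' where "v' r t = t powr \<alpha> * g (r * t powr (- \<beta>))" for r t
  define F where "F r t = r powr \<sigma>1 * v' r t * (bump' (t - 1) * h (s r t) + bump (t - 1) * (h1 (s r t) * (r\<^sup>2 * (- 2 * \<beta> * t powr (- 2 * \<beta> - 1)))))
      + v' r t powr m * (bump (t - 1) * t powr (- 2 * \<beta>) * (4 * s r t * h2 (s r t) + 2 * n * h1 (s r t)))
      + r powr \<sigma>2 * v' r t powr p * (bump (t - 1) * h (s r t))" for r t
  have F_eq: "F (norm (fst z)) (snd z) = norm (fst z) powr \<sigma>1 * (snd z powr \<alpha> * f (norm (fst z) * snd z powr - \<beta>)) *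
        (bump' (snd z - 1) * h ((norm (fst z))\<^sup>2 * snd z powr (- 2 * \<beta>)) +
         bump (snd z - 1) * (h1 ((norm (fst z))\<^sup>2 * snd z powr (- 2 * \<beta>)) * ((norm (fst z))\<^sup>2 * (- 2 * \<beta> * snd z powr (- 2 * \<beta> - 1))))) +
        (snd z powr \<alpha> * f (norm (fst z) * snd z powr - \<beta>)) powr m *
        (bump (snd z - 1) * snd z powr (- 2 * \<beta>) *
         (4 * ((norm (fst z))\<^sup>2 * snd z powr (- 2 * \<beta>)) * h2 ((norm (fst z))\<^sup>2 * snd z powr (- 2 * \<beta>)) +
          2 * n * h1 ((norm (fst z))\<^sup>2 * snd z powr (- 2 * \<beta>)))) +
        norm (fst z) powr \<sigma>2 * (snd z powr \<alpha> * f (norm (fst z) * snd z powr - \<beta>)) powr p *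
        (bump (snd z - 1) * h ((norm (fst z))\<^sup>2 * snd z powr (- 2 * \<beta>)))" for z :: "(real^'n) \<times> real"
    by (simp add: F_def v'_def s_def g_def max_absorb2)
  note T = tested[OF h h2 vanish(2,1) smooth, folded F_eq]
  have F_meas: "(\<lambda>r. F r t) \<in> borel_measurable borel" for t
    unfolding F_def v'_def s_def by measurable
  have scaled: "indicator {0<..} (t powr \<beta> * \<xi>) * (c * (t powr \<beta> * \<xi>) powr (n - 1)) * F (t powr \<beta> * \<xi>) t
      = c * t powr (- \<beta>) * (t powr A * bump' (t - 1) * (indicator {0<..} \<xi> * X \<xi>) + t powr (A - 1) * bump (t - 1) * (indicator {0<..} \<xi> * Y \<xi>))"
    if t: "0 < t" for t \<xi>
  proof (cases "0 < \<xi>")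
    case True
    define r where "r = t powr \<beta> * \<xi>"
    have r: "0 < r" using t True by (simp add: r_def)
    have arg: "g (r * t powr (- \<beta>)) = f \<xi>" using t True by (simp add: r_def g_def powr_minus field_simps)
    have s_eq: "s r t = \<xi>\<^sup>2" using t by (simp add: s_def r_def power_mult_distrib powr_power powr_minus mult.commute)
    have f0: "0 \<le> f \<xi>" using profile_continuous_nonneg(2) True by simp
    have rp: "r powr e = t powr (\<beta> * e) * \<xi> powr e" for e using t True by (simp add: r_def powr_mult powr_powr)
    have vp: "v' r t powr e = t powr (\<alpha> * e) * f \<xi> powr e" for e using t f0 by (simp add: v'_def arg powr_mult powr_powr)
    have e1: "r powr (n - 1) * (r powr \<sigma>1 * v' r t) = t powr (- \<beta>) * (t powr A * (\<xi> powr (n - 1 + \<sigma>1) * f \<xi>))"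
    proof -
      have "t powr (- \<beta>) * t powr A = t powr (\<beta> * (n - 1)) * t powr (\<beta> * \<sigma>1) * t powr \<alpha>"
        using t by (simp add: A_def algebra_simps flip: powr_add)
      then show ?thesis by (simp add: rp v'_def arg powr_add mult_ac)
    qed
    have e2: "r powr (n - 1) * (v' r t powr m * t powr (- 2 * \<beta>)) = t powr (- \<beta>) * (t powr (A - 1) * (\<xi> powr (n - 1) * f \<xi> powr m))"
    proof -
      have "t powr (- \<beta>) * t powr (A - 1) = t powr (\<beta> * (n - 1)) * t powr (\<alpha> * m) * t powr (- 2 * \<beta>)"
        unfolding powr_add[symmetric] using exponents(1)
        by (intro arg_cong[where f="\<lambda>e. t powr e"]) (unfold A_def, algebra)
      then show ?thesis by (simp add: rp vp mult_ac)
    qed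
    have e3: "r powr (n - 1) * (r powr \<sigma>2 * v' r t powr p) = t powr (- \<beta>) * (t powr (A - 1) * (\<xi> powr (n - 1 + \<sigma>2) * f \<xi> powr p))"
    proof -
      have "t powr (- \<beta>) * t powr (A - 1) = t powr (\<beta> * (n - 1)) * t powr (\<beta> * \<sigma>2) * t powr (\<alpha> * p)"
        unfolding powr_add[symmetric] using exponents(2)
        by (intro arg_cong[where f="\<lambda>e. t powr e"]) (unfold A_def, algebra)
      then show ?thesis by (simp add: rp vp powr_add mult_ac)
    qed
    have e4: "r\<^sup>2 * t powr (- 2 * \<beta> - 1) = \<xi>\<^sup>2 / t"
    proof -
      have "t powr (- 2 * \<beta> - 1) = t powr (- 2 * \<beta>) / t" using t by (simp add: powr_diff)
      then show ?thesis using s_eq by (simp add: s_def)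
    qed
    have e5: "t powr A / t = t powr (A - 1)" using t by (simp add: powr_diff)
    have e6: "\<xi> powr (n - 1 + \<sigma>1) * \<xi>\<^sup>2 = \<xi> powr (n + 1 + \<sigma>1)"
      using True by (simp add: powr_add powr_diff power2_eq_square)
    have "c * r powr (n - 1) * F r t = c * (r powr (n - 1) * (r powr \<sigma>1 * v' r t)) * (bump' (t - 1) * h (\<xi>\<^sup>2) - 2 * \<beta> * bump (t - 1) * h1 (\<xi>\<^sup>2) * (r\<^sup>2 * t powr (- 2 * \<beta> - 1)))
        + c * (r powr (n - 1) * (v' r t powr m * t powr (- 2 * \<beta>))) * (bump (t - 1) * (4 * \<xi>\<^sup>2 * h2 (\<xi>\<^sup>2) + 2 * n * h1 (\<xi>\<^sup>2)))
        + c * (r powr (n - 1) * (r powr \<sigma>2 * v' r t powr p)) * (bump (t - 1) * h (\<xi>\<^sup>2))"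
      unfolding F_def s_eq by (simp only: distrib_left right_diff_distrib) (simp add: mult_ac)
    also have "\<dots> = c * t powr (- \<beta>) * (t powr A * bump' (t - 1) * X \<xi> + t powr (A - 1) * bump (t - 1) * Y \<xi>)"
      unfolding e1 e2 e3 e4 X_def Y_def e5[symmetric] e6[symmetric] by (simp add: algebra_simps)
    finally show ?thesis using True r by (simp add: r_def[symmetric])
  next
    case False
    then have "\<not> 0 < t powr \<beta> * \<xi>" using t by (simp add: zero_less_mult_iff)
    then show ?thesis using False by simp
  qed
  have inner: "integral\<^sup>L lborel (\<lambda>x::real^'n. F (norm x) t) = c * k t" if t: "0 < t" for t
  proof -
    have "integral\<^sup>L lborel (\<lambda>x::real^'n. F (norm x) t) = (\<integral>r. indicator {0<..} r * (c * r powr (n - 1)) * F r t \<partial>lborel)"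
      using integral_radial[OF F_meas[of t], where 'a="real^'n"] by (simp add: c_def n_eq)
    also have "\<dots> = \<bar>t powr \<beta>\<bar> * (\<integral>\<xi>. indicator {0<..} (0 + t powr \<beta> * \<xi>) * (c * (0 + t powr \<beta> * \<xi>) powr (n - 1)) * F (0 + t powr \<beta> * \<xi>) t \<partial>lborel)"
      using lborel_integral_real_affine[of "t powr \<beta>" "\<lambda>r. indicator {0<..} r * (c * r powr (n - 1)) * F r t" 0] t by simp
    also have "\<dots> = t powr \<beta> * (c * t powr (- \<beta>) * k t)"
      unfolding add_0 scaled[OF t] using iX iY by (simp add: k_def IX_def IY_def)
    finally show ?thesis using t by (simp add: powr_minus)
  qed
  have "integrable (lborel \<Otimes>\<^sub>M lborel) (\<lambda>(x::real^'n, t::real). indicator {0<..} t * F (norm x) t)"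
    using T(1) by (simp add: lborel_prod case_prod_unfold indicator_times)
  from lborel_pair.integral_snd[OF this]
  have "(\<integral>t. integral\<^sup>L lborel (\<lambda>x::real^'n. indicator {0<..} t * F (norm x) t) \<partial>lborel) = 0"
    using T(2) by (simp add: lborel_prod case_prod_unfold indicator_times)
  moreover have "integral\<^sup>L lborel (\<lambda>x::real^'n. indicator {0<..} t * F (norm x) t) = c * (indicator {1..2} t *\<^sub>R k t)" for t
  proof (cases "0 < t")
    case True
    have "k t = 0" if "t \<notin> {1..2}"
      using that bump_zero[of "t - 1"] bump'_zero[of "t - 1"] by (auto simp: k_def)
    then have "k t = indicator {1..2} t * k t" by (cases "t \<in> {1..2}") simp_all
    then show ?thesis using inner[OF True] True by simp
  qed auto
  ultimately have "set_lebesgue_integral lborel {1..2} k = 0" using c by (simp add: set_lebesgue_integral_def)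
  moreover have ck: "continuous_on {1..2} k" and cb: "continuous_on {1..2} (\<lambda>t. t powr (A - 1) * bump (t - 1))"
    unfolding k_def
    by (intro continuous_intros continuous_on_compose2[OF continuous_on_bump[of UNIV]] continuous_on_compose2[OF continuous_on_bump'[of UNIV]]; auto)+
  ultimately have k0: "integral {1..2} k = 0"
    using set_borel_integral_eq_integral(2)[OF borel_integrable_atLeastAtMost'[OF ck]] by simp
  define J where "J = integral {1..2} (\<lambda>t. t powr (A - 1) * bump (t - 1))"
  have J: "J \<noteq> 0"
  proof
    assume "J = 0"
    then have "\<forall>t\<in>{1..2}. t powr (A - 1) * bump (t - 1) = 0"
      unfolding J_def using integral_eq_0_iff[OF cb] bump_nonneg by simp
    from this[rule_format, of "3/2"] show False using bump_pos_iff[of "1/2"] by simp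
  qed
  have "((\<lambda>t. t powr A * bump' (t - 1) + A * t powr (A - 1) * bump (t - 1)) has_integral (2 powr A * bump (2 - 1) - 1 powr A * bump (1 - 1))) {1..2}"
  proof (rule fundamental_theorem_of_calculus)
    fix t :: real assume t: "t \<in> {1..2}"
    have "DERIV (\<lambda>t. t - 1) t :> 1" by (auto intro!: derivative_eq_intros)
    from DERIV_mult'[OF has_real_derivative_powr[of t A] DERIV_chain2[OF bump_has_derivative this]] t
    have "DERIV (\<lambda>t. t powr A * bump (t - 1)) t :> t powr A * bump' (t - 1) + A * t powr (A - 1) * bump (t - 1)" by simp
    then show "((\<lambda>t. t powr A * bump (t - 1)) has_vector_derivative t powr A * bump' (t - 1) + A * t powr (A - 1) * bump (t - 1)) (at t within {1..2})"
      by (simp add: has_real_derivative_iff_has_vector_derivative has_vector_derivative_at_within)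
  qed simp
  then have "((\<lambda>t. IX * (t powr A * bump' (t - 1) + A * t powr (A - 1) * bump (t - 1)) + (IY - A * IX) * (t powr (A - 1) * bump (t - 1)))
      has_integral IX * 0 + (IY - A * IX) * J) {1..2}"
    unfolding J_def
    by (intro has_integral_add has_integral_mult_right integrable_integral integrable_continuous_interval cb) (simp add: bump_zero)
  moreover have "(\<lambda>t. IX * (t powr A * bump' (t - 1) + A * t powr (A - 1) * bump (t - 1)) + (IY - A * IX) * (t powr (A - 1) * bump (t - 1))) = k"
    by (rule ext) (simp add: k_def algebra_simps)
  ultimately have "(IY - A * IX) * J = 0" using k0 by (simp add: integral_unique)
  then show "(\<integral>\<xi>. indicator {0<..} \<xi> * Y \<xi> \<partial>lborel) = A * (\<integral>\<xi>. indicator {0<..} \<xi> * X \<xi> \<partial>lborel)"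
    using J by (simp add: IX_def IY_def)
qed

end

text \<open>With K = k + 1 the weight is the derivative of S(K (\<xi>^2 - a)). It has mass 1 and
  lives where 0 < \<xi>^2 - a < 1/K, so it is an approximate identity at sqrt a.\<close>

lemma bump_average_tendsto:
  fixes G S :: "real \<Rightarrow> real"
  assumes S: "\<And>x. DERIV S x :> d * bump x" "\<And>x. x \<le> 0 \<Longrightarrow> S x = 0" "\<And>x. 1 \<le> x \<Longrightarrow> S x = 1" "0 < d"
    and G: "continuous_on {0..T} G" and a: "0 < a" "a + 1 \<le> T"
  shows "(\<lambda>k. integral {0..T} (\<lambda>\<xi>. d * bump (real (Suc k) * \<xi>\<^sup>2 + - (real (Suc k) * a)) * (real (Suc k) * (2 * \<xi>)) * G \<xi>)) \<longlonglongrightarrow> G (sqrt a)"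
proof -
  define w where "w k \<xi> = d * bump (real (Suc k) * \<xi>\<^sup>2 + - (real (Suc k) * a)) * (real (Suc k) * (2 * \<xi>))" for k \<xi>
  have T: "0 \<le> T" "T \<le> T\<^sup>2" using a self_le_power[of T 2] by auto
  have w0: "0 \<le> w k \<xi>" if "0 \<le> \<xi>" for k \<xi> using that S(4) bump_nonneg by (simp add: w_def)
  have cw: "continuous_on {0..T} (w k)" for k
    unfolding w_def by (intro continuous_intros continuous_on_compose2[OF continuous_on_bump[of UNIV]]) auto
  have w1: "(w k has_integral 1) {0..T}" for k
  proof -
    let ?K = "real (Suc k)"
    have "(w k has_integral S (?K * T\<^sup>2 + - (?K * a)) - S (?K * 0\<^sup>2 + - (?K * a))) {0..T}"
    proof (rule fundamental_theorem_of_calculus[OF T(1)])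
      fix \<xi> :: real
      have "DERIV (\<lambda>\<xi>. ?K * \<xi>\<^sup>2 + - (?K * a)) \<xi> :> ?K * (2 * \<xi>)"
        by (auto intro!: derivative_eq_intros)
      from DERIV_chain2[OF S(1) this]
      show "((\<lambda>\<xi>. S (?K * \<xi>\<^sup>2 + - (?K * a))) has_vector_derivative w k \<xi>) (at \<xi> within {0..T})"
        unfolding w_def by (simp add: has_real_derivative_iff_has_vector_derivative has_vector_derivative_at_within del: of_nat_Suc)
    qed
    moreover have "1 \<le> ?K * T\<^sup>2 + - (?K * a)"
    proof -
      have "1 * 1 \<le> ?K * (T\<^sup>2 - a)" using T a by (intro mult_mono) auto
      then show ?thesis by (simp add: algebra_simps)
    qed
    ultimately show ?thesis using S(2,3) a by simp
  qed
  have sq: "sqrt a \<in> {0..T}"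
  proof -
    have "sqrt a \<le> sqrt (T\<^sup>2)" using a T by (intro real_sqrt_le_mono) auto
    then show ?thesis using T a by simp
  qed
  show ?thesis unfolding w_def[symmetric]
  proof (rule LIMSEQ_I)
    fix r :: real assume r: "0 < r"
    obtain \<delta> where \<delta>: "0 < \<delta>" "\<And>\<xi>. \<xi> \<in> {0..T} \<Longrightarrow> \<bar>\<xi> - sqrt a\<bar> < \<delta> \<Longrightarrow> \<bar>G \<xi> - G (sqrt a)\<bar> < r / 2"
      using G[unfolded continuous_on_iff, rule_format, OF sq, of "r / 2"] r by (auto simp: dist_real_def)
    have "0 < \<delta> * sqrt a" using \<delta>(1) a by simp
    then obtain n0 where n0: "inverse (real (Suc n0)) < \<delta> * sqrt a" using reals_Archimedean by blast
    show "\<exists>no. \<forall>k\<ge>no. norm (integral {0..T} (\<lambda>\<xi>. w k \<xi> * G \<xi>) - G (sqrt a)) < r"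
    proof (intro exI[of _ n0] allI impI)
      fix k assume k: "n0 \<le> k"
      let ?K = "real (Suc k)"
      have b: "norm (w k \<xi> * (G \<xi> - G (sqrt a))) \<le> w k \<xi> * (r / 2)" if \<xi>: "\<xi> \<in> {0..T}" for \<xi>
      proof (cases "w k \<xi> = 0")
        case False
        then have "0 < bump (?K * \<xi>\<^sup>2 + - (?K * a))" using bump_nonneg[of "?K * \<xi>\<^sup>2 + - (?K * a)"] unfolding w_def by (auto simp: less_le)
        then have x: "0 < ?K * (\<xi>\<^sup>2 - a)" "?K * (\<xi>\<^sup>2 - a) < 1" by (auto simp: bump_pos_iff right_diff_distrib)
        have "a < \<xi>\<^sup>2" using x(1) by (simp add: zero_less_mult_iff)
        then have lt: "sqrt a < \<xi>" using real_sqrt_less_mono[of a "\<xi>\<^sup>2"] \<xi> by simp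
        have "\<xi>\<^sup>2 - a < inverse ?K" using x(2) by (simp add: field_simps)
        also have "\<dots> \<le> inverse (real (Suc n0))" using k by (intro le_imp_inverse_le) auto
        also note n0
        finally have 1: "\<xi>\<^sup>2 - a < \<delta> * sqrt a" .
        have "(\<xi> - sqrt a) * sqrt a \<le> (\<xi> - sqrt a) * (\<xi> + sqrt a)" using lt a \<xi> by (intro mult_left_mono) auto
        also have "\<dots> = \<xi>\<^sup>2 - a" using a by (simp add: algebra_simps power2_eq_square)
        finally have "(\<xi> - sqrt a) * sqrt a < \<delta> * sqrt a" using 1 by simp
        then have "\<xi> - sqrt a < \<delta>" using a by simp
        then have "\<bar>G \<xi> - G (sqrt a)\<bar> < r / 2" using lt by (intro \<delta>(2)[OF \<xi>]) auto
        then have "w k \<xi> * \<bar>G \<xi> - G (sqrt a)\<bar> \<le> w k \<xi> * (r / 2)" using w0[of \<xi> k] \<xi> by (intro mult_left_mono) auto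
        then show ?thesis using w0[of \<xi> k] \<xi> by (simp add: abs_mult)
      qed simp
      have "norm (integral {0..T} (\<lambda>\<xi>. w k \<xi> * (G \<xi> - G (sqrt a)))) \<le> integral {0..T} (\<lambda>\<xi>. w k \<xi> * (r / 2))"
        by (intro integral_norm_bound_integral b integrable_continuous_interval continuous_intros cw G)
      also have "\<dots> = r / 2" using integral_unique[OF has_integral_mult_left[OF w1[of k], of "r / 2"]] by simp
      also have "integral {0..T} (\<lambda>\<xi>. w k \<xi> * (G \<xi> - G (sqrt a))) = integral {0..T} (\<lambda>\<xi>. w k \<xi> * G \<xi>) - G (sqrt a)"
      proof -
        have "((\<lambda>\<xi>. w k \<xi> * G \<xi> - w k \<xi> * G (sqrt a)) has_integral integral {0..T} (\<lambda>\<xi>. w k \<xi> * G \<xi>) - 1 * G (sqrt a)) {0..T}"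
          by (intro has_integral_diff has_integral_mult_left w1 integrable_integral integrable_continuous_interval continuous_intros cw G)
        then show ?thesis by (simp add: right_diff_distrib integral_unique)
      qed
      finally show "norm (integral {0..T} (\<lambda>\<xi>. w k \<xi> * G \<xi>) - G (sqrt a)) < r" using r by simp
    qed
  qed
qed

context self_similar_weak begin

text \<open>It will turn out to be \<xi>^(n-1) (f^m)' + \<beta> \<xi>^(n+\<sigma>1) f. It is defined
  through f alone, because no derivative of f is known yet; integration starts at 0 because the
  equation holds across the origin.\<close>

definition flux :: "real \<Rightarrow> real" where
  "flux \<xi> = A * wint (n + \<sigma>1) f \<xi> - wint (n + \<sigma>2) (\<lambda>\<xi>. f \<xi> powr p) \<xi>"

lemma continuous_on_profile_powr: "0 < c \<Longrightarrow> continuous_on {0..} (\<lambda>\<xi>. f \<xi> powr c)"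
  by (rule continuous_on_powr'[OF profile_continuous_nonneg(1) continuous_on_const])
     (use profile_continuous_nonneg(2) in auto)

lemma flux_has_derivative:
  assumes "0 < \<xi>"
  shows "DERIV flux \<xi> :> A * (\<xi> powr (n - 1 + \<sigma>1) * f \<xi>) - \<xi> powr (n - 1 + \<sigma>2) * f \<xi> powr p"
proof -
  have "continuous_on {0..\<xi> + 1} f" "continuous_on {0..\<xi> + 1} (\<lambda>\<xi>. f \<xi> powr p)"
    by (auto intro: continuous_on_subset[OF profile_continuous_nonneg(1)] continuous_on_subset[OF continuous_on_profile_powr[OF p]])
  note d = wint_has_derivative[OF _ this(1), of "n + \<sigma>1" \<xi>] wint_has_derivative[OF _ this(2), of "n + \<sigma>2" \<xi>]
  have e: "n - 1 + \<sigma>1 = n + \<sigma>1 - 1" "n - 1 + \<sigma>2 = n + \<sigma>2 - 1" by simp_all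
  show ?thesis unfolding flux_def[abs_def] e
    using DERIV_diff[OF DERIV_cmult[OF d(1), of A] d(2)] \<sigma>1 \<sigma>2 assms by simp
qed

lemma continuous_on_flux: "continuous_on {0..} flux"
proof (rule continuous_on_atLeastI)
  fix X :: real assume "0 < X"
  then show "continuous_on {0..X} flux"
    unfolding flux_def using \<sigma>1 \<sigma>2
    by (intro continuous_intros continuous_on_wint continuous_on_subset[OF profile_continuous_nonneg(1)]
        continuous_on_subset[OF continuous_on_profile_powr[OF p]]) auto
qed

text \<open>The test functions whose derivative in the similarity variable is a difference of two smoothed
  steps extract, in the limit of steep steps, a first integral of the profile equation.\<close>

theorem profile_ode:
  assumes "0 < \<xi>"
  shows "DERIV (\<lambda>\<xi>. f \<xi> powr m) \<xi> :> \<xi> powr (1 - n) * (flux \<xi> - \<beta> * \<xi> powr (n + \<sigma>1) * f \<xi>)"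
proof -
  define N where "N = CARD('n)"
  have N: "0 < N" "n = real N" by (simp_all add: N_def n_eq)
  note cf = profile_continuous_nonneg(1)
  \<comment> \<open>Integrating the terms with h by parts turns the identity into the integral of
    h1(\<xi>^2) q + 4 \<xi>^(n+1) f^m h2(\<xi>^2). With V a primitive of q, a second integration by
    parts leaves h2(\<xi>^2) 2 \<xi> G with G = 2 \<xi>^N f^m - V.\<close>
  define q where "q \<xi> = 2 * \<xi> * flux \<xi> - 2 * \<beta> * \<xi> powr (n + 1 + \<sigma>1) * f \<xi> + 2 * n * \<xi> ^ (N - 1) * f \<xi> powr m" for \<xi>
  have cq: "continuous_on {0..} q"
  proof -
    have "continuous_on {0..} (\<lambda>\<xi>::real. \<xi> powr (n + 1 + \<sigma>1))"
      by (rule continuous_on_powr'[OF continuous_on_id continuous_on_const]) (use \<sigma>1 in auto)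
    then show ?thesis unfolding q_def
      by (intro continuous_on_add continuous_on_diff continuous_on_mult continuous_on_const continuous_on_id continuous_on_power
          continuous_on_flux cf continuous_on_profile_powr m)
  qed
  have "continuous_on UNIV (\<lambda>\<xi>. q (max 0 \<xi>))" by (rule continuous_on_compose2[OF cq]) (auto intro!: continuous_intros)
  then obtain V where "\<And>\<xi>. DERIV V \<xi> :> q (max 0 \<xi>)" by (rule ex_primitive) blast
  then have V: "DERIV V \<xi> :> q \<xi>" if "0 \<le> \<xi>" for \<xi> using that by (metis max_absorb2)
  have cV: "continuous_on {0..} V" by (rule DERIV_continuous_on[OF has_field_derivative_at_within[OF V]]) simp
  define G where "G \<xi> = 2 * \<xi> ^ N * f \<xi> powr m - V \<xi>" for \<xi>
  have cG: "continuous_on {0..} G" unfolding G_def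
    by (intro continuous_on_diff continuous_on_mult continuous_on_const continuous_on_id continuous_on_power continuous_on_profile_powr m cV)
  obtain S d where S: "\<And>x. DERIV S x :> d * bump x" "0 < d" "\<And>x. x \<le> 0 \<Longrightarrow> S x = 0" "\<And>x. 1 \<le> x \<Longrightarrow> S x = 1"
    by (rule ex_step) blast
  have G_const: "G (sqrt a) = G (sqrt b)" if ab: "0 < a" "0 < b" for a b
  proof -
    define T where "T = a + b + 1"
    have T: "0 < T" "T \<le> T\<^sup>2" "a + 1 \<le> T" "b + 1 \<le> T" using ab self_le_power[of T 2] by (auto simp: T_def)
    define av where "av c k = integral {0..T} (\<lambda>\<xi>. d * bump (real (Suc k) * \<xi>\<^sup>2 + - (real (Suc k) * c)) * (real (Suc k) * (2 * \<xi>)) * G \<xi>)" for c k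
    have cG': "continuous_on {0..T} G" using cG by (rule continuous_on_subset) auto
    have lim: "av a \<longlonglongrightarrow> G (sqrt a)" "av b \<longlonglongrightarrow> G (sqrt b)"
      unfolding av_def by (rule bump_average_tendsto[OF S(1,3,4,2) cG']; use ab T in simp)+
    have "av a k = av b k" for k
    proof -
      define K where "K = real (Suc k)"
      have K: "1 \<le> K" by (simp add: K_def)
      \<comment> \<open>The difference of steps just to the right of a and of b vanishes near 0 and
        beyond T. Its primitive h may be nonzero at 0, so the origin is tested too; the boundary
        term there drops out because the flux is 0 at 0.\<close>
      define h1 where "h1 s = S (K * s + - (K * a)) + (-1) * S (K * s + - (K * b))" for s
      define h2 where "h2 s = d * bump (K * s + - (K * a)) * K - d * bump (K * s + - (K * b)) * K" for s
      have dlin: "DERIV (\<lambda>s. K * s + - (K * c)) s :> K" for c s by (auto intro!: derivative_eq_intros)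
      have h12: "DERIV h1 s :> h2 s" for s
        unfolding h1_def h2_def
        using DERIV_add[OF DERIV_chain2[OF S(1) dlin[of a s]] DERIV_cmult[OF DERIV_chain2[OF S(1) dlin[of b s]], of "-1"]] by simp
      have ch2: "continuous_on UNIV h2"
        unfolding h2_def by (intro continuous_intros continuous_on_compose2[OF continuous_on_bump[of UNIV]]) auto
      have ch1: "continuous_on UNIV h1" by (rule DERIV_continuous_on[OF has_field_derivative_at_within[OF h12]])
      obtain H where H: "\<And>s. DERIV H s :> h1 s" by (rule ex_primitive[OF ch1]) blast
      define h where "h s = H s + - H T" for s
      have hd: "DERIV h s :> h1 s" for s
        unfolding h_def using DERIV_add[OF H DERIV_const[of "- H T"]] by simp
      have big: "1 \<le> K * s + - (K * a)" "1 \<le> K * s + - (K * b)" if "T \<le> s" for s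
      proof -
        have "1 * 1 \<le> K * (s - a)" by (rule mult_mono) (use K T that in auto)
        moreover have "1 * 1 \<le> K * (s - b)" by (rule mult_mono) (use K T that in auto)
        ultimately show "1 \<le> K * s + - (K * a)" "1 \<le> K * s + - (K * b)" by (simp_all add: right_diff_distrib)
      qed
      have z: "h1 s = 0" "h2 s = 0" if "T \<le> s" for s
        using big[OF that] by (simp_all add: h1_def h2_def S(4) bump_zero)
      have z0: "h s = 0" if "T \<le> s" for s
      proof -
        have "H T \<le> H s" "H s \<le> H T"
          by (rule DERIV_nonneg_imp_nondecreasing[OF that] DERIV_nonpos_imp_nonincreasing[OF that];
              intro exI conjI, rule H, simp add: z(1))+
        then show ?thesis by (simp add: h_def)
      qed
      have smooth: "(\<lambda>z. h (g z)) \<in> smooth_fun" if g: "g \<in> (smooth_fun :: ((real^'n) \<times> real \<Rightarrow> real) set)" for g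
      proof -
        have s: "(\<lambda>z. S (K * g z + c)) \<in> smooth_fun" for c
          by (rule smooth_fun.primitive[where g=S and g'="\<lambda>x. d * bump x", OF smooth_fun_affine[OF g] _ S(1)])
             (intro smooth_fun.mult smooth_fun.const smooth_fun_bump smooth_fun_affine g)
        have "(\<lambda>z. h1 (g z)) \<in> smooth_fun" unfolding h1_def by (intro smooth_fun.add smooth_fun.mult smooth_fun.const s)
        then show ?thesis by (rule smooth_fun.primitive[where g=h, OF g _ hd])
      qed
      define X where "X \<xi> = \<xi> powr (n - 1 + \<sigma>1) * (f \<xi> * h (\<xi>\<^sup>2))" for \<xi>
      define Y where "Y \<xi> = \<xi> powr (n + 1 + \<sigma>1) * (- 2 * \<beta> * (f \<xi> * h1 (\<xi>\<^sup>2)))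
        + \<xi> powr (n - 1) * (f \<xi> powr m * (4 * \<xi>\<^sup>2 * h2 (\<xi>\<^sup>2) + 2 * n * h1 (\<xi>\<^sup>2)))
        + \<xi> powr (n - 1 + \<sigma>2) * (f \<xi> powr p * h (\<xi>\<^sup>2))" for \<xi>
      note I = profile_identity[OF hd h12 ch2 less_imp_le[OF T(1)] z0 z smooth, folded X_def Y_def]
      define Z where "Z \<xi> = Y \<xi> - A * X \<xi>" for \<xi>
      have ind: "indicator {0..T} \<xi> *\<^sub>R Z \<xi> = indicator {0<..} \<xi> * Y \<xi> - A * (indicator {0<..} \<xi> * X \<xi>)" for \<xi>
      proof -
        have "Z \<xi> = 0" if "T < \<xi>"
        proof -
          have "\<xi> \<le> \<xi>\<^sup>2" using that T ab self_le_power[of \<xi> 2] by (simp add: T_def)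
          then have "T \<le> \<xi>\<^sup>2" using that by simp
          then show ?thesis using z z0 by (simp add: Z_def X_def Y_def)
        qed
        moreover have "Z 0 = 0" by (simp add: Z_def X_def Y_def)
        ultimately show ?thesis by (cases "\<xi> = 0") (auto simp: indicator_def Z_def not_le)
      qed
      have iZ: "set_integrable lborel {0..T} Z"
        unfolding set_integrable_def ind by (intro Bochner_Integration.integrable_diff integrable_mult_right I(1,2))
      have "set_lebesgue_integral lborel {0..T} Z = 0"
        unfolding set_lebesgue_integral_def ind
        by (subst Bochner_Integration.integral_diff) (use I in auto)
      then have Z0: "integral {0..T} Z = 0" using set_borel_integral_eq_integral(2)[OF iZ] by simp
      define R where "R \<xi> = h2 (\<xi>\<^sup>2) * (2 * \<xi>) * G \<xi>" for \<xi>
      have sqd: "DERIV (\<lambda>\<xi>. \<xi>\<^sup>2) \<xi> :> 2 * \<xi>" for \<xi> :: real by (auto intro!: derivative_eq_intros)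
      have csq: "continuous_on {0..T} (\<lambda>\<xi>. g (\<xi>\<^sup>2))" if "continuous_on UNIV g" for g :: "real \<Rightarrow> real"
        by (rule continuous_on_compose2[OF that]) (auto intro!: continuous_intros)
      have cR: "continuous_on {0..T} R" unfolding R_def by (intro continuous_intros csq ch2 cG')
      have "((\<lambda>\<xi>. Z \<xi> - R \<xi>) has_integral (h1 (T\<^sup>2) * V T - flux T * h (T\<^sup>2)) - (h1 (0\<^sup>2) * V 0 - flux 0 * h (0\<^sup>2))) {0..T}"
      proof (rule fundamental_theorem_of_calculus_interior)
        have chh: "continuous_on UNIV h" by (rule DERIV_continuous_on[OF has_field_derivative_at_within[OF hd]])
        show "continuous_on {0..T} (\<lambda>\<xi>. h1 (\<xi>\<^sup>2) * V \<xi> - flux \<xi> * h (\<xi>\<^sup>2))"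
          by (intro continuous_intros csq ch1 chh continuous_on_subset[OF cV] continuous_on_subset[OF continuous_on_flux]) auto
        fix \<xi> assume "\<xi> \<in> {0<..<T}"
        then have \<xi>: "0 < \<xi>" by simp
        have pw: "\<xi> powr (n - 1) = \<xi> ^ (N - 1)" "\<xi> ^ N = \<xi> * \<xi> ^ (N - 1)"
          using powr_realpow[OF \<xi>, of "N - 1"] N by (simp_all add: of_nat_diff power_eq_if)
        have "((\<lambda>\<xi>. h1 (\<xi>\<^sup>2) * V \<xi> - flux \<xi> * h (\<xi>\<^sup>2)) has_real_derivative
          (h1 (\<xi>\<^sup>2) * q \<xi> + h2 (\<xi>\<^sup>2) * (2 * \<xi>) * V \<xi>) - (flux \<xi> * (h1 (\<xi>\<^sup>2) * (2 * \<xi>))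
            + (A * (\<xi> powr (n - 1 + \<sigma>1) * f \<xi>) - \<xi> powr (n - 1 + \<sigma>2) * f \<xi> powr p) * h (\<xi>\<^sup>2))) (at \<xi>)"
          by (rule DERIV_diff[OF DERIV_mult'[OF DERIV_chain2[OF h12 sqd] V[OF less_imp_le[OF \<xi>]]]
              DERIV_mult'[OF flux_has_derivative[OF \<xi>] DERIV_chain2[OF hd sqd]]])
        moreover have "(h1 (\<xi>\<^sup>2) * q \<xi> + h2 (\<xi>\<^sup>2) * (2 * \<xi>) * V \<xi>) - (flux \<xi> * (h1 (\<xi>\<^sup>2) * (2 * \<xi>))
            + (A * (\<xi> powr (n - 1 + \<sigma>1) * f \<xi>) - \<xi> powr (n - 1 + \<sigma>2) * f \<xi> powr p) * h (\<xi>\<^sup>2)) = Z \<xi> - R \<xi>"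
          unfolding Z_def R_def X_def Y_def q_def G_def pw by (simp add: algebra_simps power2_eq_square)
        ultimately show "((\<lambda>\<xi>. h1 (\<xi>\<^sup>2) * V \<xi> - flux \<xi> * h (\<xi>\<^sup>2)) has_vector_derivative Z \<xi> - R \<xi>) (at \<xi>)"
          by (simp add: has_real_derivative_iff_has_vector_derivative)
      qed (use T in simp)
      moreover have "h1 0 = 0" using ab K by (simp add: h1_def S(3))
      ultimately have "((\<lambda>\<xi>. Z \<xi> - R \<xi>) has_integral 0) {0..T}"
        using z(1)[OF T(2)] z0[OF T(2)] by (simp add: flux_def)
      from has_integral_add[OF this integrable_integral[OF integrable_continuous_interval[OF cR]]]
      have R0: "integral {0..T} R = 0" using Z0 by (simp add: integral_unique)
      have cb: "continuous_on {0..T} (\<lambda>\<xi>. d * bump (K * \<xi>\<^sup>2 + - (K * c)) * (K * (2 * \<xi>)) * G \<xi>)" for c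
        by (intro continuous_intros continuous_on_compose2[OF continuous_on_bump[of UNIV]] cG') auto
      have R_eq: "R = (\<lambda>\<xi>. d * bump (K * \<xi>\<^sup>2 + - (K * a)) * (K * (2 * \<xi>)) * G \<xi> - d * bump (K * \<xi>\<^sup>2 + - (K * b)) * (K * (2 * \<xi>)) * G \<xi>)"
        by (rule ext) (simp add: R_def h2_def left_diff_distrib)
      have "av a k - av b k = integral {0..T} R"
        unfolding av_def K_def[symmetric] R_eq
        by (rule integral_diff[symmetric]; rule integrable_continuous_interval[OF cb])
      then show ?thesis using R0 by simp
    qed
    then have "av a = av b" by (rule ext)
    then show ?thesis using lim LIMSEQ_unique by metis
  qed
  \<comment> \<open>As G is constant, f^m is an explicit expression in V and a power of x; this is
    where its differentiability comes from.\<close>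
  define c where "c = G 1"
  have eq: "f x powr m = (c + V x) / (2 * x ^ N)" if x: "0 < x" for x
    using G_const[of "x\<^sup>2" 1] x by (simp add: G_def c_def field_simps)
  have "((\<lambda>x. (c + V x) / (2 * x ^ N)) has_real_derivative
      ((0 + q \<xi>) * (2 * \<xi> ^ N) - (c + V \<xi>) * (2 * (real N * \<xi> ^ (N - 1)))) / ((2 * \<xi> ^ N) * (2 * \<xi> ^ N))) (at \<xi>)"
  proof (rule DERIV_divide)
    show "DERIV (\<lambda>x. 2 * x ^ N) \<xi> :> 2 * (real N * \<xi> ^ (N - 1))"
      using DERIV_cmult[OF DERIV_pow[of N \<xi>], of 2] by simp
  qed (use assms V[of \<xi>] DERIV_add[OF DERIV_const] in auto)
  moreover have "((0 + q \<xi>) * (2 * \<xi> ^ N) - (c + V \<xi>) * (2 * (real N * \<xi> ^ (N - 1)))) / ((2 * \<xi> ^ N) * (2 * \<xi> ^ N))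
      = \<xi> powr (1 - n) * (flux \<xi> - \<beta> * \<xi> powr (n + \<sigma>1) * f \<xi>)"
  proof -
    have pw: "\<xi> ^ N = \<xi> * \<xi> ^ (N - 1)" using N by (simp add: power_eq_if)
    have cV': "c + V \<xi> = 2 * \<xi> ^ N * f \<xi> powr m" using eq[OF assms] assms by simp
    have p1: "\<xi> powr (1 - n) = 1 / \<xi> ^ (N - 1)"
      using powr_realpow[OF assms, of "N - 1"] N assms powr_minus_divide[of \<xi> "n - 1"] by (simp add: of_nat_diff)
    have p2: "\<xi> powr (n + 1 + \<sigma>1) = \<xi> * \<xi> powr (n + \<sigma>1)"
      using assms by (simp add: powr_add)
    have num: "q \<xi> * (2 * \<xi> ^ N) - (c + V \<xi>) * (2 * (real N * \<xi> ^ (N - 1)))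
        = 2 * \<xi> ^ N * (2 * \<xi> * (flux \<xi> - \<beta> * \<xi> powr (n + \<sigma>1) * f \<xi>))"
      unfolding q_def cV' p2 N(2)[symmetric] by (simp add: algebra_simps)
    show ?thesis unfolding p1 add_0 num using assms by (simp add: pw)
  qed
  ultimately have "DERIV (\<lambda>x. (c + V x) / (2 * x ^ N)) \<xi> :> \<xi> powr (1 - n) * (flux \<xi> - \<beta> * \<xi> powr (n + \<sigma>1) * f \<xi>)"
    by simp
  then show ?thesis
    by (rule has_field_derivative_transform_within_open[of _ _ _ "{0<..}"]) (use assms eq in auto)
qed

end

section \<open>Similarity exponents and the expansion at the origin\<close>

lemma tendsto_at_right_of_continuous_on:
  fixes g :: "real \<Rightarrow> 'a::topological_space"
  assumes "continuous_on {a..} g"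
  shows "(g \<longlongrightarrow> g a) (at_right a)"
proof -
  have "(g \<longlongrightarrow> g a) (at a within {a..})" using assms by (simp add: continuous_on)
  then show ?thesis by (rule tendsto_within_subset) auto
qed

context profile_equation
begin

lemma profile_tendsto_0:
  assumes "profile \<epsilon> \<mu> x0 F E"
  shows "(F \<longlongrightarrow> F 0) (at_right 0)" "(E \<longlongrightarrow> 0) (at_right 0)"
  using tendsto_at_right_of_continuous_on[OF profileD(2)[OF assms]]
    tendsto_at_right_of_continuous_on[OF profileD(3)[OF assms]] profileD(4)[OF assms] by simp_all

lemma powr_tendsto_0: "0 < c \<Longrightarrow> ((\<lambda>x::real. x powr c) \<longlongrightarrow> 0) (at_right 0)"
  using tendsto_at_right_of_continuous_on[OF continuous_on_powr'[OF continuous_on_id continuous_on_const], of 0 c] by auto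

text \<open>L'Hopital's rule for E / x^\<nu>, applicable because E 0 = 0; the drift is of order
  x^\<kappa> and drops out.\<close>

lemma slope_tendsto_0:
  assumes P: "profile \<epsilon> \<mu> x0 F E"
  shows "(slope \<epsilon> F E \<longlongrightarrow> - \<mu> * F 0 powr p / \<nu>) (at_right 0)"
proof -
  note D = profileD[OF P]
  note F0 = profile_tendsto_0(1)[OF P]
  have pos: "\<forall>\<^sub>F x::real in at_right 0. 0 < x" by (rule eventually_at_right_less)
  have Fp: "((\<lambda>x. F x powr p) \<longlongrightarrow> F 0 powr p) (at_right 0)"
    by (rule tendsto_powr[OF F0 tendsto_const]) (use D(5)[of 0] D(1) in simp)
  have "((\<lambda>x. (\<epsilon> * B * x powr \<kappa> * F x - \<mu> * F x powr p) / \<nu>) \<longlongrightarrow> (\<epsilon> * B * 0 * F 0 - \<mu> * F 0 powr p) / \<nu>) (at_right 0)"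
    by (intro tendsto_divide tendsto_diff tendsto_mult tendsto_const powr_tendsto_0 F0 Fp \<kappa>) (use \<nu> in simp)
  then have lim: "((\<lambda>x. flux_deriv \<epsilon> \<mu> F x / (\<nu> * x powr (\<nu> - 1))) \<longlongrightarrow> - \<mu> * F 0 powr p / \<nu>) (at_right 0)"
    by (rule Lim_transform_eventually[OF _ eventually_mono[OF pos], THEN tendsto_eq_rhs])
       (simp_all add: flux_deriv_def)
  have "((\<lambda>x. E x / x powr \<nu>) \<longlongrightarrow> - \<mu> * F 0 powr p / \<nu>) (at_right 0)"
  proof (rule lhopital_right_0[OF profile_tendsto_0(2)[OF P] powr_tendsto_0[OF \<nu>] _ _ _ _ lim])
    show "\<forall>\<^sub>F x in at_right 0. DERIV E x :> flux_deriv \<epsilon> \<mu> F x"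
      using pos by eventually_elim (rule D(7))
    show "\<forall>\<^sub>F x in at_right 0. DERIV (\<lambda>x. x powr \<nu>) x :> \<nu> * x powr (\<nu> - 1)"
      using pos by eventually_elim (rule has_real_derivative_powr)
    show "\<forall>\<^sub>F x::real in at_right 0. x powr \<nu> \<noteq> 0" using pos by eventually_elim simp
    show "\<forall>\<^sub>F x::real in at_right 0. \<nu> * x powr (\<nu> - 1) \<noteq> 0" using pos by eventually_elim (use \<nu> in simp)
  qed
  moreover have "((\<lambda>x. \<epsilon> * x powr \<kappa> * F x) \<longlongrightarrow> \<epsilon> * 0 * F 0) (at_right 0)"
    by (intro tendsto_mult tendsto_const powr_tendsto_0 F0 \<kappa>)
  ultimately have "((\<lambda>x. E x / x powr \<nu> - \<epsilon> * x powr \<kappa> * F x) \<longlongrightarrow> - \<mu> * F 0 powr p / \<nu> - \<epsilon> * 0 * F 0) (at_right 0)"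
    by (rule tendsto_diff)
  moreover have "\<forall>\<^sub>F x in at_right 0. E x / x powr \<nu> - \<epsilon> * x powr \<kappa> * F x = slope \<epsilon> F E x"
    using pos by eventually_elim (simp add: slope_def powr_add powr_minus right_diff_distrib inverse_eq_divide)
  ultimately show ?thesis using Lim_transform_eventually by fastforce
qed

text \<open>F and the explicit expression agree at 0, and the coefficient of x is chosen so that
  their derivatives have the same limit -\<mu> F(0)^(p-m+1) / (m \<nu>); l'Hopital's rule then makes
  the error o(x). With x = \<xi>^a this is the required o(\<xi>^(\<sigma>2+2)).\<close>

lemma profile_expansion:
  assumes P: "profile \<epsilon> \<mu> x0 F E"
  shows "((\<lambda>x. (F x - (F 0 powr (m - p) - (m - p) * \<mu> / (m * \<nu>) * x) powr q) / x) \<longlongrightarrow> 0) (at_right 0)"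
proof -
  note D = profileD[OF P]
  define d k where "d = F 0 powr (m - p)" and "k = (m - p) * \<mu> / (m * \<nu>)"
  have F0: "0 < F 0" using D(1,5) by simp
  have d: "0 < d" using F0 by (simp add: d_def)
  have pos: "\<forall>\<^sub>F x::real in at_right 0. 0 < x" by (rule eventually_at_right_less)
  have near: "\<forall>\<^sub>F x::real in at_right 0. 0 < x \<and> x < x0"
    using D(1) eventually_at_right_real[of 0 x0] by (auto elim: eventually_mono)
  have lin: "((\<lambda>x. d - k * x) \<longlongrightarrow> d - k * 0) (at_right 0)" by (intro tendsto_intros)
  have dpos: "\<forall>\<^sub>F x in at_right 0. 0 < d - k * x"
    using order_tendstoD(1)[OF lin, of 0] d by simp
  have lin_powr: "((\<lambda>x. (d - k * x) powr e) \<longlongrightarrow> d powr e) (at_right 0)" for e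
    using tendsto_powr[OF lin tendsto_const, of e] d by simp
  have Fm: "((\<lambda>x. F x powr (m - 1)) \<longlongrightarrow> F 0 powr (m - 1)) (at_right 0)"
    by (rule tendsto_powr[OF profile_tendsto_0(1)[OF P] tendsto_const]) (use F0 in simp)
  let ?h' = "\<lambda>x. slope \<epsilon> F E x / (m * F x powr (m - 1)) - q * (d - k * x) powr (q - 1) * (- k)"
  have "(?h' \<longlongrightarrow> (- \<mu> * F 0 powr p / \<nu>) / (m * F 0 powr (m - 1)) - q * d powr (q - 1) * (- k)) (at_right 0)"
    by (intro tendsto_diff tendsto_divide tendsto_mult tendsto_const slope_tendsto_0[OF P] Fm lin_powr) (use m F0 in simp)
  moreover have "(- \<mu> * F 0 powr p / \<nu>) / (m * F 0 powr (m - 1)) - q * d powr (q - 1) * (- k) = 0"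
  proof -
    have "(m - p) * (q - 1) = p - (m - 1)" using p by (simp add: q_def right_diff_distrib)
    then have "d powr (q - 1) = F 0 powr (p - (m - 1))" by (simp only: d_def powr_powr)
    also have "\<dots> = F 0 powr p / F 0 powr (m - 1)" by (rule powr_diff)
    finally have "d powr (q - 1) = F 0 powr p / F 0 powr (m - 1)" .
    moreover have "q * k = \<mu> / (m * \<nu>)" using p by (simp add: q_def k_def)
    ultimately show ?thesis using m \<nu> F0 by (simp add: field_simps)
  qed
  ultimately have lim: "(?h' \<longlongrightarrow> 0) (at_right 0)" by simp
  have "((\<lambda>x. (F x - (d - k * x) powr q) / x) \<longlongrightarrow> 0) (at_right 0)"
  proof (rule lhopital_right_0[where f'="?h'" and g'="\<lambda>_. 1"])
    have "d powr q = F 0" using F0 p by (simp add: d_def q_def powr_powr)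
    then show "((\<lambda>x. F x - (d - k * x) powr q) \<longlongrightarrow> 0) (at_right 0)"
      using tendsto_diff[OF profile_tendsto_0(1)[OF P] lin_powr[of q]] by simp
    show "\<forall>\<^sub>F x in at_right 0. DERIV (\<lambda>x. F x - (d - k * x) powr q) x :> ?h' x"
      using near dpos
    proof eventually_elim
      case (elim x)
      have "DERIV (\<lambda>x. d - k * x) x :> - k" by (auto intro!: derivative_eq_intros)
      from DERIV_chain2[OF has_real_derivative_powr[of "d - k * x" q] this]
      have "DERIV (\<lambda>x. (d - k * x) powr q) x :> q * (d - k * x) powr (q - 1) * (- k)" using elim by simp
      then show ?case using profile_deriv[OF P] elim by (intro DERIV_diff) auto
    qed
    show "((\<lambda>x::real. x) \<longlongrightarrow> 0) (at_right 0)" by (rule tendsto_ident_at)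
    show "\<forall>\<^sub>F x::real in at_right 0. x \<noteq> 0" using pos by eventually_elim simp
  qed (use lim in auto)
  then show ?thesis by (simp add: d_def k_def)
qed

lemma slope_bounded:
  assumes P: "profile \<epsilon> \<mu> x0 F E"
  obtains C where "0 < C" "\<And>x. 0 < x \<Longrightarrow> \<bar>slope \<epsilon> F E x\<bar> \<le> C"
proof -
  note D = profileD[OF P]
  define l where "l = - \<mu> * F 0 powr p / \<nu>"
  have "\<forall>\<^sub>F x in at_right 0. dist (slope \<epsilon> F E x) l < 1"
    using slope_tendsto_0[OF P] unfolding l_def by (auto simp: tendsto_iff)
  then obtain b where b: "0 < b" "\<And>x. 0 < x \<Longrightarrow> x < b \<Longrightarrow> dist (slope \<epsilon> F E x) l < 1"
    unfolding eventually_at_right_field by auto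
  define c where "c = min b x0 / 2"
  have c: "0 < c" "c < b" "c < x0" using b(1) D(1) by (auto simp: c_def)
  have "continuous_on {c..x0} (slope \<epsilon> F E)"
    unfolding slope_def
    by (intro continuous_intros continuous_on_subset[OF D(2)] continuous_on_subset[OF D(3)]) (use c in auto)
  then obtain K where K: "0 < K" "\<And>x. c \<le> x \<Longrightarrow> x \<le> x0 \<Longrightarrow> \<bar>slope \<epsilon> F E x\<bar> \<le> K" by (rule continuous_on_Icc_bound) blast
  show thesis
  proof (rule that[of "K + \<bar>l\<bar> + 1"])
    fix x :: real assume x: "0 < x"
    consider "x < c" | "c \<le> x" "x \<le> x0" | "x0 < x" by linarith
    then show "\<bar>slope \<epsilon> F E x\<bar> \<le> K + \<bar>l\<bar> + 1"
    proof cases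
      case 1
      then show ?thesis using b(2)[OF x] c K(1) by (auto simp: dist_real_def)
    next
      case 2
      then show ?thesis using K(2)[of x] by linarith
    next
      case 3
      then show ?thesis using profile_outside[OF P, of x] D(6)[of x] K(1) by (simp add: slope_def)
    qed
  qed (use K in auto)
qed

text \<open>The derivative of F^m is bounded up to 0. With x = \<xi>^a this becomes the
  O(r^(\<sigma>2+2)) estimate for u^m - u(0,t)^m.\<close>

lemma profile_power_increment:
  assumes P: "profile \<epsilon> \<mu> x0 F E"
  obtains C where "0 < C" "\<And>x. 0 \<le> x \<Longrightarrow> \<bar>F x powr m - F 0 powr m\<bar> \<le> C * x"
proof -
  note D = profileD[OF P]
  obtain C where C: "0 < C" "\<And>x. 0 < x \<Longrightarrow> \<bar>slope \<epsilon> F E x\<bar> \<le> C" by (rule slope_bounded[OF P]) blast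
  show thesis
  proof (rule that[OF C(1)])
    fix x :: real assume "0 \<le> x"
    show "\<bar>F x powr m - F 0 powr m\<bar> \<le> C * x"
    proof (cases "x = 0")
      case False
      then have x: "0 < x" using \<open>0 \<le> x\<close> by simp
      have "continuous_on {0..x} (\<lambda>x. F x powr m)"
        by (rule continuous_on_powr'[OF continuous_on_subset[OF D(2)] continuous_on_const]) (use D(9) m in auto)
      then obtain l z where z: "0 < z" "z < x" "DERIV (\<lambda>x. F x powr m) z :> l" "F x powr m - F 0 powr m = (x - 0) * l"
        using MVT[OF x, of "\<lambda>x. F x powr m"] D(8) by (auto simp: real_differentiable_def)
      moreover have "l = slope \<epsilon> F E z" using DERIV_unique[OF z(3) D(8)[OF z(1)]] .
      ultimately show ?thesis using mult_left_mono[OF C(2)[of z], of x] x by (simp add: abs_mult mult.commute)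
    qed simp
  qed
qed

end

section \<open>From the similarity exponents to the normalised equation\<close>

locale exponent_range =
  fixes m p \<sigma>1 \<sigma>2 n :: real
  assumes m_gt: "1 < m" and \<sigma>2_gt: "-2 < \<sigma>2" and \<sigma>12: "\<sigma>2 < \<sigma>1" and p_ge: "1 \<le> p" and p_lt: "p < p_crit m \<sigma>1 \<sigma>2"
    and n_pos: "0 < n" and n\<sigma>2: "- n < \<sigma>2"
begin

definition a :: real where "a = \<sigma>2 + 2"
definition \<alpha> :: real where "\<alpha> = alpha_exp m p \<sigma>1 \<sigma>2"
definition \<beta> :: real where "\<beta> = beta_exp m p \<sigma>1 \<sigma>2"
definition A :: real where "A = \<alpha> + \<beta> * (n + \<sigma>1)"

lemma a_pos: "0 < a" using \<sigma>2_gt by (simp add: a_def)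

text \<open>One inequality behind two facts: it is the negativity of L, and after regrouping it is
  the subcriticality of the normalised equation.\<close>

lemma crit: "(m - 1) * a < (m - p) * (\<sigma>1 + 2)"
proof -
  have "(m - 1) * (\<sigma>2 + 2) / (\<sigma>1 + 2) < m - p" using p_lt by (simp add: p_crit_def)
  then show ?thesis using \<sigma>2_gt \<sigma>12 by (simp add: pos_divide_less_eq a_def)
qed

lemma p_less_m: "p < m"
proof -
  have "0 < (m - p) * (\<sigma>1 + 2)" using crit m_gt a_pos by (smt (verit) mult_pos_pos)
  then show ?thesis using \<sigma>2_gt \<sigma>12 by (simp add: zero_less_mult_iff)
qed

lemma L_eq: "L_exp m p \<sigma>1 \<sigma>2 = (m - 1) * a - (m - p) * (\<sigma>1 + 2)"
  by (simp add: L_exp_def a_def algebra_simps)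

lemma exponents: "0 < \<alpha>" "0 < \<beta>" "\<alpha> * (m - p) = \<beta> * a" "\<alpha> * (m - 1) = \<beta> * (\<sigma>1 + 2) - 1"
proof -
  have L: "L_exp m p \<sigma>1 \<sigma>2 < 0" using crit by (simp add: L_eq)
  show "0 < \<alpha>" "0 < \<beta>" using L a_pos p_less_m
    unfolding \<alpha>_def \<beta>_def alpha_exp_def beta_exp_def a_def by (auto intro!: divide_neg_neg)
  show "\<alpha> * (m - p) = \<beta> * a"
    by (simp add: \<alpha>_def \<beta>_def alpha_exp_def beta_exp_def a_def) (simp add: algebra_simps)
  have "\<alpha> * (m - 1) = - ((m - 1) * a) / L_exp m p \<sigma>1 \<sigma>2"
  proof -
    have "\<alpha> = - a / L_exp m p \<sigma>1 \<sigma>2" by (simp add: \<alpha>_def alpha_exp_def a_def)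
    then show ?thesis by (simp add: mult.commute)
  qed
  also have "\<dots> = (- ((m - p) * (\<sigma>1 + 2)) - L_exp m p \<sigma>1 \<sigma>2) / L_exp m p \<sigma>1 \<sigma>2"
    by (simp add: L_eq)
  also have "\<dots> = \<beta> * (\<sigma>1 + 2) - 1"
  proof -
    have "\<beta> * (\<sigma>1 + 2) = - ((m - p) * (\<sigma>1 + 2)) / L_exp m p \<sigma>1 \<sigma>2"
      unfolding \<beta>_def beta_exp_def times_divide_eq_left mult_minus_left by (rule refl)
    then show ?thesis using L unfolding diff_divide_distrib by simp
  qed
  finally show "\<alpha> * (m - 1) = \<beta> * (\<sigma>1 + 2) - 1" .
qed

sublocale profile_equation m p "(n + \<sigma>2) / a" "(\<sigma>1 - \<sigma>2) / a"
proof
  have "(p - 1) * a < (\<sigma>1 - \<sigma>2) * (m - p)" using crit by (simp add: a_def algebra_simps)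
  then show "p - 1 < (\<sigma>1 - \<sigma>2) / a * (m - p)" using a_pos by (simp add: pos_less_divide_eq)
qed (use m_gt p_ge p_less_m n\<sigma>2 \<sigma>12 a_pos in auto)

lemma A_eq: "A = \<beta> * a * B"
proof -
  have "\<alpha> = \<beta> * a * q" using exponents(3) p_less_m by (simp add: q_def field_simps)
  moreover have "a * B = a * q + (n + \<sigma>1)"
  proof -
    have "a * ((n + \<sigma>2) / a) = n + \<sigma>2" "a * ((\<sigma>1 - \<sigma>2) / a) = \<sigma>1 - \<sigma>2" using a_pos by simp_all
    then show ?thesis unfolding B_def distrib_left by simp
  qed
  ultimately show ?thesis unfolding A_def mult.assoc[of \<beta> a B] by (simp add: distrib_left)
qed

text \<open>The substitution \<open>x = \<xi>\<^sup>a\<close> turns the radial profile equation into the normalised one.\<close>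

lemma flux_deriv_power:
  assumes "0 < \<xi>"
  shows "flux_deriv (c * \<beta> / a) (1 / a\<^sup>2) F (\<xi> powr a) =
    (c * A * (\<xi> powr (n - 1 + \<sigma>1) * F (\<xi> powr a)) - \<xi> powr (n - 1 + \<sigma>2) * F (\<xi> powr a) powr p) * \<xi> powr (1 - a) / a\<^sup>2"
proof -
  have e1: "(\<xi> powr a) powr ((n + \<sigma>2) / a - 1) = \<xi> powr (n - 1 + \<sigma>2) * \<xi> powr (1 - a)"
  proof -
    have "a * ((n + \<sigma>2) / a - 1) = (n - 1 + \<sigma>2) + (1 - a)" using a_pos by (simp add: right_diff_distrib)
    then show ?thesis by (simp only: powr_powr powr_add)
  qed
  have e2: "(\<xi> powr a) powr ((\<sigma>1 - \<sigma>2) / a) = \<xi> powr (\<sigma>1 - \<sigma>2)"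
    using a_pos by (simp add: powr_powr)
  have e3: "\<xi> powr (n - 1 + \<sigma>1) = \<xi> powr (n - 1 + \<sigma>2) * \<xi> powr (\<sigma>1 - \<sigma>2)"
    unfolding powr_add[symmetric] by (rule arg_cong[where f="\<lambda>e. \<xi> powr e"]) simp
  have e4: "c * \<beta> / a * B = c * A / a\<^sup>2" using a_pos by (simp add: A_eq power2_eq_square)
  show ?thesis unfolding flux_deriv_def e1 e2 e3 e4 using a_pos by (simp add: field_simps)
qed

lemma slope_power:
  assumes "0 < \<xi>"
  shows "slope (c * \<beta> / a) F E (\<xi> powr a) =
    \<xi> powr (1 - n) * (a * E (\<xi> powr a) - c * \<beta> * \<xi> powr (n + \<sigma>1) * F (\<xi> powr a)) * \<xi> powr (1 - a) / a"
proof -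
  have e1: "(\<xi> powr a) powr (- ((n + \<sigma>2) / a)) = \<xi> powr (1 - n) * \<xi> powr (1 - a)"
    using a_pos by (simp add: powr_powr a_def flip: powr_add)
  have e2: "(\<xi> powr a) powr ((n + \<sigma>2) / a + (\<sigma>1 - \<sigma>2) / a) = \<xi> powr (n + \<sigma>1)"
  proof -
    have "a * ((n + \<sigma>2) / a + (\<sigma>1 - \<sigma>2) / a) = n + \<sigma>1" using a_pos by (simp add: field_simps)
    then show ?thesis by (simp only: powr_powr)
  qed
  show ?thesis unfolding slope_def e1 e2 using a_pos by (simp add: field_simps)
qed

text \<open>D = F(0)^(m-p). For \<mu> = 1/a^2 and \<nu> = (n + \<sigma>2)/a the constant of
  \<open>profile_expansion\<close> becomes the prescribed coefficient. \<epsilon> is left arbitrary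
  because it changes with the time unit, while \<mu> does not.\<close>

lemma profile_origin:
  assumes P: "profile \<epsilon> (1 / a\<^sup>2) x0 F E" and f: "\<And>\<xi>. 0 < \<xi> \<Longrightarrow> f \<xi> = F (\<xi> powr a)" and N: "n = real N"
  shows "\<exists>D>0. origin_behavior N m p \<sigma>2 D f" "\<exists>\<xi>0>0. compactly_supported_at m \<xi>0 f"
proof -
  note D = profileD[OF P]
  have F0: "0 < F 0" using D(1,5) by simp
  have pos: "\<forall>\<^sub>F x::real in at_right 0. 0 < x" by (rule eventually_at_right_less)
  have "filterlim (\<lambda>\<xi>::real. \<xi> powr a) (at_right 0) (at_right 0)"
    unfolding filterlim_at using powr_tendsto_0[OF a_pos] pos by (auto elim: eventually_mono)
  from filterlim_compose[OF profile_expansion[OF P] this]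
  have lim: "((\<lambda>\<xi>. (F (\<xi> powr a) - (F 0 powr (m - p) - (m - p) * (1 / a\<^sup>2) / (m * ((n + \<sigma>2) / a)) * \<xi> powr a) powr q) / \<xi> powr a) \<longlongrightarrow> 0) (at_right 0)" .
  have k: "(m - p) * (1 / a\<^sup>2) / (m * ((n + \<sigma>2) / a)) = (m - p) / (m * (real N + \<sigma>2) * (2 + \<sigma>2))"
    using a_pos by (simp add: N power2_eq_square a_def add.commute mult.assoc)
  have "((\<lambda>\<xi>. (f \<xi> - (F 0 powr (m - p) - (m - p) / (m * (real N + \<sigma>2) * (2 + \<sigma>2)) * \<xi> powr (\<sigma>2 + 2)) powr (1 / (m - p))) / \<xi> powr (\<sigma>2 + 2)) \<longlongrightarrow> 0) (at_right 0)"
    by (rule Lim_transform_eventually[OF lim[unfolded k] eventually_mono[OF pos]]) (simp add: f a_def q_def)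
  then have "origin_behavior N m p \<sigma>2 (F 0 powr (m - p)) f"
    unfolding origin_behavior_def
    by (rule smalloI_tendsto) (use pos in \<open>auto elim: eventually_mono\<close>)
  then show "\<exists>D>0. origin_behavior N m p \<sigma>2 D f" using F0 by (intro exI[of _ "F 0 powr (m - p)"]) simp
  define \<xi>0 where "\<xi>0 = x0 powr (1 / a)"
  have \<xi>0: "0 < \<xi>0" "\<xi>0 powr a = x0" using D(1) a_pos by (simp_all add: \<xi>0_def powr_powr)
  have "compactly_supported_at m \<xi>0 f"
    unfolding compactly_supported_at_def
  proof (intro conjI allI impI)
    fix \<xi> assume \<xi>: "0 < \<xi> \<and> \<xi> < \<xi>0"
    then have "\<xi> powr a < x0" using powr_less_mono2[of a \<xi> \<xi>0] a_pos \<xi>0 by simp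
    then show "0 < f \<xi>" using \<xi> f D(5) by simp
  next
    fix \<xi> assume \<xi>: "\<xi>0 \<le> \<xi>"
    then have "x0 \<le> \<xi> powr a" using powr_mono2[of a \<xi>0 \<xi>] a_pos \<xi>0 by simp
    then show "f \<xi> = 0" using \<xi> \<xi>0 f D(6) by simp
  next
    have "slope \<epsilon> F E x0 = 0" using profile_outside[OF P, of x0] D(6)[of x0] by (simp add: slope_def)
    then have "DERIV (\<lambda>x. F x powr m) (\<xi>0 powr a) :> 0" using D(8)[OF D(1)] \<xi>0 by simp
    from DERIV_chain2[OF this has_real_derivative_powr[OF \<xi>0(1)]]
    have "DERIV (\<lambda>\<xi>. F (\<xi> powr a) powr m) \<xi>0 :> 0" by simp
    then show "DERIV (\<lambda>\<xi>. f \<xi> powr m) \<xi>0 :> 0"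
      by (rule has_field_derivative_transform_within_open[of _ _ _ "{0<..}"]) (use \<xi>0 f in auto)
  qed
  then show "\<exists>\<xi>0>0. compactly_supported_at m \<xi>0 f" using \<xi>0 by blast
qed

text \<open>The support condition gives positivity only for \<xi> > 0, whereas a normalised profile
  is also positive at 0. The expansion identifies the limit at 0 as D^(1/(m-p)), and continuity
  makes it the value.\<close>

lemma origin_positive:
  assumes "origin_behavior N m p \<sigma>2 D f" "0 < D" "continuous_on {0..} f"
  shows "0 < f 0"
proof -
  define k where "k = (m - p) / (m * (real N + \<sigma>2) * (2 + \<sigma>2))"
  have pos: "\<forall>\<^sub>F x::real in at_right 0. 0 < x" by (rule eventually_at_right_less)
  have z: "((\<lambda>\<xi>::real. \<xi> powr (\<sigma>2 + 2)) \<longlongrightarrow> 0) (at_right 0)"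
    using powr_tendsto_0[OF a_pos] by (simp add: a_def)
  have "((\<lambda>\<xi>. (f \<xi> - (D - k * \<xi> powr (\<sigma>2 + 2)) powr (1 / (m - p))) / \<xi> powr (\<sigma>2 + 2)) \<longlongrightarrow> 0) (at_right 0)"
    using smalloD_tendsto[OF assms(1)[unfolded origin_behavior_def]] by (simp add: k_def)
  from tendsto_mult[OF this z]
  have "((\<lambda>\<xi>. (f \<xi> - (D - k * \<xi> powr (\<sigma>2 + 2)) powr (1 / (m - p))) / \<xi> powr (\<sigma>2 + 2) * \<xi> powr (\<sigma>2 + 2)) \<longlongrightarrow> 0) (at_right 0)" by simp
  then have e: "((\<lambda>\<xi>. f \<xi> - (D - k * \<xi> powr (\<sigma>2 + 2)) powr (1 / (m - p))) \<longlongrightarrow> 0) (at_right 0)"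
    by (rule Lim_transform_eventually) (use pos in \<open>eventually_elim, simp\<close>)
  have "((\<lambda>\<xi>. (D - k * \<xi> powr (\<sigma>2 + 2)) powr (1 / (m - p))) \<longlongrightarrow> (D - k * 0) powr (1 / (m - p))) (at_right 0)"
    by (rule tendsto_powr[OF tendsto_diff[OF tendsto_const tendsto_mult[OF tendsto_const z]] tendsto_const]) (use assms(2) in simp)
  from tendsto_add[OF e this] have "(f \<longlongrightarrow> D powr (1 / (m - p))) (at_right 0)" by simp
  moreover have "(f \<longlongrightarrow> f 0) (at_right 0)" by (rule tendsto_at_right_of_continuous_on[OF assms(3)])
  ultimately have "f 0 = D powr (1 / (m - p))" using tendsto_unique[of "at_right (0::real)"] by simp
  then show ?thesis using assms(2) by simp
qed

end

section \<open>Existence and uniqueness\<close>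

text \<open>Adding the two end values covers both signs of the exponent.\<close>

lemma powr_le_sum:
  fixes t :: real
  assumes "0 < a" "a \<le> t" "t \<le> b"
  shows "t powr e \<le> a powr e + b powr e"
proof (cases "0 \<le> e")
  case True
  then have "t powr e \<le> b powr e" using assms by (intro powr_mono2) auto
  then show ?thesis by (simp add: add_increasing)
next
  case False
  then have "t powr e \<le> a powr e" using assms by (intro powr_mono2') auto
  then show ?thesis by (simp add: add_increasing2)
qed

context exponent_range
begin

text \<open>\<open>profile_ode\<close> supplies the equations on all of \<xi> > 0; substituting
  \<xi> = x^(1/a) and dividing the flux by a brings them into normalised form.\<close>

lemma self_similar_profile:
  fixes v :: "real^'n::finite \<Rightarrow> real \<Rightarrow> real"
  assumes S: "self_similar_weak m p \<sigma>1 \<sigma>2 \<alpha> \<beta> n v f" and f0: "0 < f 0" and cs: "0 < \<xi>0" "compactly_supported_at m \<xi>0 f"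
  obtains x0 E where "profile (\<beta> / a) (1 / a\<^sup>2) x0 (\<lambda>x. f (x powr (1 / a))) E"
proof -
  interpret S: self_similar_weak m p \<sigma>1 \<sigma>2 \<alpha> \<beta> n v f by (rule S)
  have SA: "S.A = A" by (simp add: S.A_def A_def)
  let ?F = "\<lambda>x. f (x powr (1 / a))" and ?E = "\<lambda>x. S.flux (x powr (1 / a)) / a"
  have ce: "continuous_on {0..} (\<lambda>x. g (x powr (1 / a)))" if "continuous_on {0..} g" for g :: "real \<Rightarrow> real"
    by (rule continuous_on_compose2[OF that continuous_on_powr'[OF continuous_on_id continuous_on_const]]) (use a_pos in auto)
  have pos: "0 < f \<xi>" if "0 < \<xi>" "\<xi> < \<xi>0" for \<xi> using cs(2) that by (simp add: compactly_supported_at_def)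
  have zero: "f \<xi> = 0" if "\<xi>0 \<le> \<xi>" for \<xi> using cs(2) that by (simp add: compactly_supported_at_def)
  have bk: "(x powr (1 / a)) powr a = x" if "0 < x" for x using that a_pos by (simp add: powr_powr)
  have sub: "(x powr (1 / a)) powr (1 - a) = x powr (1 / a - 1)" for x
    using a_pos by (simp add: powr_powr diff_divide_distrib)
  have dE: "DERIV ?E x :> flux_deriv (\<beta> / a) (1 / a\<^sup>2) ?F x" if x: "0 < x" for x
  proof -
    have \<xi>: "0 < x powr (1 / a)" using x by simp
    from DERIV_cdivide[OF DERIV_chain2[OF S.flux_has_derivative[OF \<xi>] has_real_derivative_powr[OF x]], of a]
    show ?thesis
      using flux_deriv_power[OF \<xi>, of 1 ?F] a_pos
      unfolding bk[OF x] sub SA by (simp add: power2_eq_square mult_ac)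
  qed
  have dF: "DERIV (\<lambda>x. ?F x powr m) x :> slope (\<beta> / a) ?F ?E x" if x: "0 < x" for x
  proof -
    have \<xi>: "0 < x powr (1 / a)" using x by simp
    from DERIV_chain2[OF S.profile_ode[OF \<xi>] has_real_derivative_powr[OF x]]
    show ?thesis
      using slope_power[OF \<xi>, of 1 ?F ?E] a_pos
      unfolding bk[OF x] sub by (simp add: mult_ac)
  qed
  have "profile (\<beta> / a) (1 / a\<^sup>2) (\<xi>0 powr a) ?F ?E"
    unfolding profile_def
  proof (intro conjI allI impI)
    show "continuous_on {0..} ?F" by (rule ce[OF S.profile_continuous_nonneg(1)])
    show "continuous_on {0..} ?E" by (intro continuous_intros ce[OF S.continuous_on_flux]) (use a_pos in simp)
    show "?E 0 = 0" by (simp add: S.flux_def)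
  next
    fix x assume x: "0 \<le> x \<and> x < \<xi>0 powr a"
    show "0 < ?F x"
    proof (cases "x = 0")
      case False
      then have "x powr (1 / a) < (\<xi>0 powr a) powr (1 / a)" using x a_pos by (intro powr_less_mono2) auto
      then show ?thesis using x False cs(1) a_pos by (intro pos) (simp_all add: powr_powr)
    qed (use f0 in simp)
  next
    fix x assume x: "\<xi>0 powr a \<le> x"
    then have "(\<xi>0 powr a) powr (1 / a) \<le> x powr (1 / a)" using a_pos by (intro powr_mono2) auto
    then show "?F x = 0" using cs(1) a_pos by (intro zero) (simp add: powr_powr)
  qed (use cs(1) dE dF in auto)
  then show thesis by (rule that)
qed

text \<open>The fields are integrals over balls: r^n P is the integral of s^(n-1+\<sigma>1) u over 0
  < s < r, and r^n Q that of s^(n-1+\<sigma>2) u^p, both written in the similarity variable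
  \<open>w\<close>. Their size near the origin then follows from the boundedness of f.\<close>

lemma profile_weak_solution:
  assumes Pr: "profile (\<beta> / a) (1 / a\<^sup>2) x0 F E" and n: "n = real CARD('n::finite)"
  shows "weak_solution m p \<sigma>1 \<sigma>2 (\<lambda>(x::real^'n) t. t powr \<alpha> * F ((norm x * t powr (- \<beta>)) powr a))"
proof -
  note D = profileD[OF Pr]
  have \<sigma>1: "- n < \<sigma>1" using n\<sigma>2 \<sigma>12 by simp
  have p0: "0 < p" using p_ge by simp
  have m0: "0 < m" using m_gt by simp
  define f where "f \<xi> = F (\<xi> powr a)" for \<xi>
  have f0: "0 \<le> f \<xi>" for \<xi> unfolding f_def by (rule D(9)) simp
  have cf: "continuous_on {0..} f"
    unfolding f_def
    by (rule continuous_on_compose2[OF D(2) continuous_on_powr'[OF continuous_on_id continuous_on_const]]) (use a_pos in auto)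
  have cfc: "continuous_on {0..} (\<lambda>\<xi>. f \<xi> powr c)" if "0 < c" for c
    by (rule continuous_on_powr'[OF cf continuous_on_const]) (use that f0 in auto)
  obtain K where K: "0 < K" "\<And>\<xi>. \<bar>f \<xi>\<bar> \<le> K"
  proof -
    obtain K where K: "0 < K" "\<And>x. 0 \<le> x \<Longrightarrow> x \<le> x0 \<Longrightarrow> \<bar>F x\<bar> \<le> K"
      by (rule continuous_on_Icc_bound[OF continuous_on_subset[OF D(2)], of 0 x0]) auto
    have "\<bar>f \<xi>\<bar> \<le> K" for \<xi> using K D(6)[of "\<xi> powr a"] by (cases "\<xi> powr a \<le> x0") (auto simp: f_def)
    then show thesis using K(1) that by blast
  qed
  define e1 e2 where "e1 = wint (n + \<sigma>1) f" and "e2 = wint (n + \<sigma>2) (\<lambda>\<xi>. f \<xi> powr p)"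
  have ce: "continuous_on {0..} e1" "continuous_on {0..} e2"
    by (rule continuous_on_atLeastI, unfold e1_def e2_def, rule continuous_on_wint;
        use \<sigma>1 n\<sigma>2 in \<open>auto intro: continuous_on_subset[OF cf] continuous_on_subset[OF cfc[OF p0]]\<close>)+
  have de1: "DERIV e1 \<xi> :> \<xi> powr (n - 1 + \<sigma>1) * f \<xi>" if "0 < \<xi>" for \<xi>
  proof -
    have e: "n - 1 + \<sigma>1 = n + \<sigma>1 - 1" by simp
    show ?thesis unfolding e1_def e
      by (rule wint_has_derivative[where X="\<xi> + 1"]) (use that \<sigma>1 in \<open>auto intro: continuous_on_subset[OF cf]\<close>)
  qed
  have de2: "DERIV e2 \<xi> :> \<xi> powr (n - 1 + \<sigma>2) * f \<xi> powr p" if "0 < \<xi>" for \<xi>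
  proof -
    have e: "n - 1 + \<sigma>2 = n + \<sigma>2 - 1" by simp
    show ?thesis unfolding e2_def e
      by (rule wint_has_derivative[where X="\<xi> + 1"]) (use that n\<sigma>2 in \<open>auto intro: continuous_on_subset[OF cfc[OF p0]]\<close>)
  qed
  have b1: "\<bar>e1 \<xi>\<bar> \<le> \<xi> powr (n + \<sigma>1) * (K / (n + \<sigma>1))" if "0 \<le> \<xi>" for \<xi>
    unfolding e1_def by (rule wint_bound) (use that \<sigma>1 K in \<open>auto intro: continuous_on_subset[OF cf]\<close>)
  have b2: "\<bar>e2 \<xi>\<bar> \<le> \<xi> powr (n + \<sigma>2) * (K powr p / (n + \<sigma>2))" if "0 \<le> \<xi>" for \<xi>
    unfolding e2_def
  proof (rule wint_bound)
    show "\<bar>f r powr p\<bar> \<le> K powr p" for r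
      using powr_mono2[of p "f r" K] p0 f0[of r] K(2)[of r] by simp
  qed (use that n\<sigma>2 in \<open>auto intro: continuous_on_subset[OF cfc[OF p0]]\<close>)
  have dx: "DERIV (\<lambda>\<xi>. \<xi> powr a) \<xi> :> a * \<xi> powr (a - 1)" if "0 < \<xi>" for \<xi>
    using that by (rule has_real_derivative_powr)
  have inv: "\<xi> powr (1 - a) * \<xi> powr (a - 1) = 1" if "0 < \<xi>" for \<xi> :: real using that by (simp flip: powr_add)
  \<comment> \<open>Both sides vanish at 0 and have the same derivative. This splits the flux into
    the contributions of |x|^\<sigma>1 u and |x|^\<sigma>2 u^p.\<close>
  have aE: "a * E (\<xi> powr a) = A * e1 \<xi> - e2 \<xi>" if \<xi>: "0 < \<xi>" for \<xi>
  proof -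
    let ?d = "\<lambda>\<xi>. a * E (\<xi> powr a) - (A * e1 \<xi> - e2 \<xi>)"
    have "?d \<xi> = ?d 0"
    proof (rule DERIV_isconst_end[OF \<xi>])
      show "continuous_on {0..\<xi>} ?d"
        by (intro continuous_on_diff continuous_on_mult continuous_on_const
            continuous_on_compose2[OF D(3) continuous_on_powr'[OF continuous_on_id continuous_on_const]]
            continuous_on_subset[OF ce(1)] continuous_on_subset[OF ce(2)]) (use a_pos in auto)
      fix y assume "0 < y" "y < \<xi>"
      then have y: "0 < y" by simp
      have "flux_deriv (\<beta> / a) (1 / a\<^sup>2) F (y powr a) * (a * y powr (a - 1)) * a
          = A * (y powr (n - 1 + \<sigma>1) * f y) - y powr (n - 1 + \<sigma>2) * f y powr p"
        using flux_deriv_power[OF y, of 1 F] inv[OF y] a_pos by (simp add: f_def power2_eq_square)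
      moreover have "DERIV ?d y :> a * (flux_deriv (\<beta> / a) (1 / a\<^sup>2) F (y powr a) * (a * y powr (a - 1)))
          - (A * (y powr (n - 1 + \<sigma>1) * f y) - y powr (n - 1 + \<sigma>2) * f y powr p)"
        using y by (intro DERIV_diff DERIV_cmult de1 de2 DERIV_chain2[where f=E and g="\<lambda>\<xi>. \<xi> powr a"] D(7) dx) auto
      ultimately show "DERIV ?d y :> 0" by (simp add: mult_ac)
    qed
    then show ?thesis by (simp add: e1_def e2_def D(4))
  qed
  define G where "G \<xi> = \<xi> powr (1 - n) * (A * e1 \<xi> - e2 \<xi> - \<beta> * \<xi> powr (n + \<sigma>1) * f \<xi>)" for \<xi>
  have dfm: "DERIV (\<lambda>\<xi>. f \<xi> powr m) \<xi> :> G \<xi>" if \<xi>: "0 < \<xi>" for \<xi>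
  proof -
    have "DERIV (\<lambda>\<xi>. F (\<xi> powr a) powr m) \<xi> :> slope (\<beta> / a) F E (\<xi> powr a) * (a * \<xi> powr (a - 1))"
      using \<xi> by (intro DERIV_chain2[where f="\<lambda>x. F x powr m" and g="\<lambda>\<xi>. \<xi> powr a"] D(8) dx) auto
    moreover have "slope (\<beta> / a) F E (\<xi> powr a) * (a * \<xi> powr (a - 1)) = G \<xi>"
      using slope_power[OF \<xi>, of 1 F E] inv[OF \<xi>] a_pos aE[OF \<xi>] by (simp add: G_def f_def)
    ultimately show ?thesis by (simp add: f_def)
  qed
  obtain C3 where C3: "0 < C3" "\<And>x. 0 \<le> x \<Longrightarrow> \<bar>F x powr m - F 0 powr m\<bar> \<le> C3 * x"
    by (rule profile_power_increment[OF Pr]) blast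
  define w where "w r t = r * t powr (- \<beta>)" for r t
  have w: "0 < w r t" if "0 < r" "0 < t" for r t using that by (simp add: w_def)
  have wp: "w r t powr e = r powr e * t powr (- \<beta> * e)" if "0 < r" "0 < t" for r t e
    using that by (simp add: w_def powr_mult powr_powr)
  have w_r: "DERIV (\<lambda>r. w r t) r :> t powr (- \<beta>)" for r t
    unfolding w_def by (auto intro!: derivative_eq_intros)
  have w_t: "DERIV (\<lambda>t. w r t) t :> r * (- \<beta> * t powr (- \<beta> - 1))" if "0 < t" for r t
    unfolding w_def by (intro DERIV_cmult has_real_derivative_powr that)
  define u where "u r t = t powr \<alpha> * f (w r t)" for r t
  define P where "P r t = r powr (- n) * (t powr A * e1 (w r t))" for r t
  define P1 where "P1 r t = r powr (- n) * (t powr A * (w r t powr (n - 1 + \<sigma>1) * f (w r t) * t powr (- \<beta>)))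
    + (- n * r powr (- n - 1)) * (t powr A * e1 (w r t))" for r t
  define P2 where "P2 r t = r powr (- n) * (t powr A * (w r t powr (n - 1 + \<sigma>1) * f (w r t) * (r * (- \<beta> * t powr (- \<beta> - 1))))
    + (A * t powr (A - 1)) * e1 (w r t))" for r t
  define Q where "Q r t = r powr (- n) * (t powr (A - 1) * e2 (w r t))" for r t
  define Q1 where "Q1 r t = r powr (- n) * (t powr (A - 1) * (w r t powr (n - 1 + \<sigma>2) * f (w r t) powr p * t powr (- \<beta>)))
    + (- n * r powr (- n - 1)) * (t powr (A - 1) * e2 (w r t))" for r t
  define g1 where "g1 r t = t powr (\<alpha> * m) * (G (w r t) * t powr (- \<beta>))" for r t
  have um: "u r t powr c = t powr (\<alpha> * c) * f (w r t) powr c" for r t c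
    using f0 by (simp add: u_def powr_mult powr_powr)
  have ex: "\<alpha> * m - 2 * \<beta> = A - 1 - \<beta> * n" "\<alpha> * p = A - 1 - \<beta> * n - \<beta> * \<sigma>2"
  proof -
    have "\<alpha> * m = \<alpha> + \<beta> * (\<sigma>1 + 2) - 1" using exponents(4) by (simp add: algebra_simps)
    then show "\<alpha> * m - 2 * \<beta> = A - 1 - \<beta> * n" by (simp add: A_def algebra_simps)
    have "\<alpha> * p = \<alpha> * m - \<beta> * a" using exponents(3) by (simp add: algebra_simps)
    then show "\<alpha> * p = A - 1 - \<beta> * n - \<beta> * \<sigma>2"
      using \<open>\<alpha> * m - 2 * \<beta> = A - 1 - \<beta> * n\<close> by (simp add: a_def algebra_simps)
  qed
  have cw: "continuous_on ({0<..} \<times> {0<..}) (\<lambda>z. w (fst z) (snd z))"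
    unfolding w_def by (intro continuous_intros) auto
  have cgw: "continuous_on ({0<..} \<times> {0<..}) (\<lambda>z. g (w (fst z) (snd z)))" if "continuous_on {0..} g" for g :: "real \<Rightarrow> real"
    by (rule continuous_on_compose2[OF that cw]) (auto simp: w_def)
  have cwp: "continuous_on ({0<..} \<times> {0<..}) (\<lambda>z. w (fst z) (snd z) powr c)" for c
    by (intro continuous_on_powr cw continuous_on_const) (auto simp: w_def)
  have cr: "continuous_on ({0<..} \<times> {0<..}) (\<lambda>z::real \<times> real. fst z powr c)" "continuous_on ({0<..} \<times> {0<..}) (\<lambda>z::real \<times> real. snd z powr c)" for c
    by (intro continuous_intros; auto)+
  have cid: "continuous_on S (\<lambda>z::real \<times> real. fst z)" for S by (intro continuous_intros)
  note cs = cgw[OF cf] cgw[OF ce(1)] cgw[OF ce(2)] cgw[OF cfc[OF p0]] cwp cr cid continuous_on_const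
  interpret R: radial_solution m p \<sigma>1 \<sigma>2 u P P1 P2 Q Q1 g1 "TYPE('n)"
  proof
    show "0 < m" "0 < p" by (fact m0 p0)+
    show "- real CARD('n) < \<sigma>1" "- real CARD('n) < \<sigma>2" using \<sigma>1 n\<sigma>2 n by simp_all
    show "0 \<le> u r t" for r t using f0 by (simp add: u_def)
    show "continuous_on ({0..} \<times> {0<..}) (\<lambda>(r, t). u r t)"
      unfolding u_def w_def case_prod_unfold
      by (intro continuous_on_mult continuous_on_compose2[OF cf]) (auto intro!: continuous_intros)
    show "continuous_on ({0<..} \<times> {0<..}) (\<lambda>(r, t). P r t)" "continuous_on ({0<..} \<times> {0<..}) (\<lambda>(r, t). P1 r t)"
      "continuous_on ({0<..} \<times> {0<..}) (\<lambda>(r, t). P2 r t)" "continuous_on ({0<..} \<times> {0<..}) (\<lambda>(r, t). Q r t)"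
      "continuous_on ({0<..} \<times> {0<..}) (\<lambda>(r, t). Q1 r t)" "continuous_on ({0<..} \<times> {0<..}) (\<lambda>(r, t). g1 r t)"
      unfolding P_def P1_def P2_def Q_def Q1_def g1_def G_def case_prod_unfold
      by (intro continuous_on_add continuous_on_diff continuous_on_mult cs)+
  next
    fix r t :: real assume r: "0 < r" and t: "0 < t"
    note d1 = DERIV_chain2[where f=e1 and g="\<lambda>r. w r t" and x=r, OF de1[OF w[OF r t]] w_r]
      and d1' = DERIV_chain2[where f=e1 and g="\<lambda>t. w r t" and x=t, OF de1[OF w[OF r t]] w_t[OF t]]
      and d2 = DERIV_chain2[where f=e2 and g="\<lambda>r. w r t" and x=r, OF de2[OF w[OF r t]] w_r]
      and dm = DERIV_chain2[where f="\<lambda>\<xi>. f \<xi> powr m" and g="\<lambda>r. w r t" and x=r, OF dfm[OF w[OF r t]] w_r]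
    show "DERIV (\<lambda>r. P r t) r :> P1 r t"
      unfolding P_def P1_def by (rule DERIV_mult'[OF has_real_derivative_powr[OF r] DERIV_cmult[OF d1]])
    show "DERIV (\<lambda>r. Q r t) r :> Q1 r t"
      unfolding Q_def Q1_def by (rule DERIV_mult'[OF has_real_derivative_powr[OF r] DERIV_cmult[OF d2]])
    show "DERIV (\<lambda>t. P r t) t :> P2 r t"
      unfolding P_def P2_def by (rule DERIV_cmult[OF DERIV_mult'[OF has_real_derivative_powr[OF t] d1']])
    show "DERIV (\<lambda>r. u r t powr m) r :> g1 r t"
      unfolding um g1_def by (rule DERIV_cmult[OF dm])
    have rn: "r * r powr (- n - 1) = r powr (- n)" using r powr_add[of r 1 "- n - 1"] by simp
    \<comment> \<open>The factor r^(-n) makes the divergence of x P or x Q reduce to the derivative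
      of the primitive.\<close>
    have cancel: "n * (r powr (- n) * X) + r * (r powr (- n) * Y + (- n * r powr (- n - 1)) * X) = r * r powr (- n) * Y" for X Y
    proof -
      have "n * (r powr (- n) * X) + r * (r powr (- n) * Y + (- n * r powr (- n - 1)) * X)
          = n * (r powr (- n) * X) + r * r powr (- n) * Y - n * (r * r powr (- n - 1)) * X"
        by (simp only: distrib_left) (simp add: mult_ac)
      then show ?thesis unfolding rn by simp
    qed
    show "real CARD('n) * P r t + r * P1 r t = r powr \<sigma>1 * u r t"
    proof -
      have "r powr 1 * r powr (- n) * r powr (n - 1 + \<sigma>1) = r powr \<sigma>1" unfolding powr_add[symmetric] by (rule arg_cong[where f="\<lambda>e. r powr e"]) simp
      moreover have "t powr A * t powr (- \<beta> * (n - 1 + \<sigma>1)) * t powr (- \<beta>) = t powr \<alpha>"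
        unfolding powr_add[symmetric] by (rule arg_cong[where f="\<lambda>e. t powr e"]) (simp add: A_def algebra_simps)
      moreover have "r * r powr (- n) * (t powr A * (w r t powr (n - 1 + \<sigma>1) * f (w r t) * t powr (- \<beta>)))
          = (r powr 1 * r powr (- n) * r powr (n - 1 + \<sigma>1)) * ((t powr A * t powr (- \<beta> * (n - 1 + \<sigma>1)) * t powr (- \<beta>)) * f (w r t))"
        using r by (simp add: wp[OF r t] mult_ac)
      ultimately show ?thesis unfolding n[symmetric] P_def P1_def cancel by (simp only: u_def)
    qed
    show "real CARD('n) * Q r t + r * Q1 r t = r powr \<sigma>2 * u r t powr p"
    proof -
      have "r powr 1 * r powr (- n) * r powr (n - 1 + \<sigma>2) = r powr \<sigma>2" unfolding powr_add[symmetric] by (rule arg_cong[where f="\<lambda>e. r powr e"]) simp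
      moreover have "t powr (A - 1) * t powr (- \<beta> * (n - 1 + \<sigma>2)) * t powr (- \<beta>) = t powr (\<alpha> * p)"
        unfolding powr_add[symmetric] ex(2) by (rule arg_cong[where f="\<lambda>e. t powr e"]) (simp add: algebra_simps)
      moreover have "r * r powr (- n) * (t powr (A - 1) * (w r t powr (n - 1 + \<sigma>2) * f (w r t) powr p * t powr (- \<beta>)))
          = (r powr 1 * r powr (- n) * r powr (n - 1 + \<sigma>2)) * ((t powr (A - 1) * t powr (- \<beta> * (n - 1 + \<sigma>2)) * t powr (- \<beta>)) * f (w r t) powr p)"
        using r by (simp add: wp[OF r t] mult_ac)
      ultimately show ?thesis unfolding n[symmetric] Q_def Q1_def cancel by (simp only: um)
    qed
    show "g1 r t = r * (P2 r t - Q r t)"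
    proof -
      have "t powr (\<alpha> * m) * t powr (- \<beta> * (1 - n)) * t powr (- \<beta>) = t powr (A - 1)"
        unfolding powr_add[symmetric] using ex(1) by (intro arg_cong[where f="\<lambda>e. t powr e"]) (simp add: algebra_simps)
      then have l: "g1 r t = r powr (1 - n) * t powr (A - 1) * (A * e1 (w r t) - e2 (w r t) - \<beta> * w r t powr (n + \<sigma>1) * f (w r t))"
        unfolding g1_def G_def wp[OF r t, of "1 - n"] by (simp add: mult_ac)
      have wn: "w r t powr (n + \<sigma>1) = w r t powr (n - 1 + \<sigma>1) * (r * t powr (- \<beta>))"
        using w[OF r t] powr_add[of "w r t" "n - 1 + \<sigma>1" 1] by (simp add: w_def)
      have tt: "t powr A * t powr (- \<beta> - 1) = t powr (A - 1) * t powr (- \<beta>)" unfolding powr_add[symmetric] by (rule arg_cong[where f="\<lambda>e. t powr e"]) (simp add: A_def algebra_simps)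
      have "P2 r t - Q r t = r powr (- n) * (- \<beta> * (w r t powr (n - 1 + \<sigma>1) * f (w r t) * r * (t powr A * t powr (- \<beta> - 1)))
          + A * t powr (A - 1) * e1 (w r t) - t powr (A - 1) * e2 (w r t))"
        unfolding P2_def Q_def by (simp add: algebra_simps)
      also have "\<dots> = r powr (- n) * t powr (A - 1) * (A * e1 (w r t) - e2 (w r t) - \<beta> * w r t powr (n + \<sigma>1) * f (w r t))"
        unfolding tt wn by (simp add: algebra_simps)
      finally have "r * (P2 r t - Q r t) = (r powr 1 * r powr (- n)) * t powr (A - 1) * (A * e1 (w r t) - e2 (w r t) - \<beta> * w r t powr (n + \<sigma>1) * f (w r t))"
        using r by simp
      then show ?thesis unfolding l powr_add[symmetric] by simp
    qed
  next
    fix R a' b' :: real assume a': "0 < a'"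
    define s where "s e = a' powr e + b' powr e" for e
    have s0: "0 \<le> s e" for e by (simp add: s_def)
    define M1 M2 where "M1 = K / (n + \<sigma>1)" and "M2 = K powr p / (n + \<sigma>2)"
    have M: "0 \<le> M1" "0 \<le> M2" using K \<sigma>1 n\<sigma>2 by (simp_all add: M1_def M2_def)
    \<comment> \<open>r P is O(r^(\<sigma>1+1)), hence the factor R^(\<sigma>1-\<sigma>2); r Q is
      O(r^(\<sigma>2+1)); the last one divides the O(r^(\<sigma>2+2)) increment of u^m by r.\<close>
    define c1 c2 c3 where "c1 = R powr (\<sigma>1 - \<sigma>2) * s \<alpha> * M1" and "c2 = s (A - 1 - \<beta> * (n + \<sigma>2)) * M2"
      and "c3 = s (\<alpha> * m - \<beta> * a) * C3"
    have c: "0 \<le> c1" "0 \<le> c2" "0 \<le> c3" using M s0 C3(1) by (simp_all add: c1_def c2_def c3_def)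
    show "\<exists>C. \<forall>r t. 0 < r \<and> r \<le> R \<and> a' \<le> t \<and> t \<le> b' \<longrightarrow>
        \<bar>r * P r t\<bar> \<le> C * r powr (\<sigma>2 + 1) \<and> \<bar>r * Q r t\<bar> \<le> C * r powr (\<sigma>2 + 1) \<and>
        \<bar>u r t powr m - u 0 t powr m\<bar> / r \<le> C * r powr (\<sigma>2 + 1)"
    proof (intro exI[of _ "c1 + c2 + c3"] allI impI)
      fix r t assume "0 < r \<and> r \<le> R \<and> a' \<le> t \<and> t \<le> b'"
      then have r: "0 < r" "r \<le> R" and t: "0 < t" "a' \<le> t" "t \<le> b'" using a' by auto
      have ts: "t powr e \<le> s e" for e unfolding s_def by (rule powr_le_sum[OF a' t(2,3)])
      let ?y = "r powr (\<sigma>2 + 1)"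
      have up: "X \<le> (c1 + c2 + c3) * ?y" if "X \<le> c * ?y" "c \<le> c1 + c2 + c3" for X c
        using that by (meson mult_right_mono order_trans powr_ge_zero)
      have B1: "\<bar>r * P r t\<bar> \<le> c1 * ?y"
      proof -
        have "\<bar>r * P r t\<bar> = r * r powr (- n) * t powr A * \<bar>e1 (w r t)\<bar>" using r by (simp add: P_def abs_mult)
        also have "\<dots> \<le> r * r powr (- n) * t powr A * (w r t powr (n + \<sigma>1) * M1)"
          using b1[of "w r t"] w[OF r(1) t(1)] r by (intro mult_left_mono) (auto simp: M1_def)
        also have "\<dots> = (r powr 1 * r powr (- n) * r powr (n + \<sigma>1)) * (t powr A * t powr (- \<beta> * (n + \<sigma>1))) * M1"
          using r by (simp add: wp[OF r(1) t(1)] mult_ac)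
        also have "r powr 1 * r powr (- n) * r powr (n + \<sigma>1) = r powr (\<sigma>1 - \<sigma>2) * ?y" unfolding powr_add[symmetric] by (rule arg_cong[where f="\<lambda>e. r powr e"]) simp
        also have "t powr A * t powr (- \<beta> * (n + \<sigma>1)) = t powr \<alpha>" unfolding powr_add[symmetric] by (rule arg_cong[where f="\<lambda>e. t powr e"]) (simp add: A_def algebra_simps)
        also have "r powr (\<sigma>1 - \<sigma>2) * ?y * t powr \<alpha> * M1 \<le> R powr (\<sigma>1 - \<sigma>2) * ?y * s \<alpha> * M1"
          using r \<sigma>12 M ts by (intro mult_right_mono mult_mono powr_mono2) auto
        finally show ?thesis by (simp add: c1_def mult_ac)
      qed
      have B2: "\<bar>r * Q r t\<bar> \<le> c2 * ?y"
      proof -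
        have "\<bar>r * Q r t\<bar> = r * r powr (- n) * t powr (A - 1) * \<bar>e2 (w r t)\<bar>" using r by (simp add: Q_def abs_mult)
        also have "\<dots> \<le> r * r powr (- n) * t powr (A - 1) * (w r t powr (n + \<sigma>2) * M2)"
          using b2[of "w r t"] w[OF r(1) t(1)] r by (intro mult_left_mono) (auto simp: M2_def)
        also have "\<dots> = (r powr 1 * r powr (- n) * r powr (n + \<sigma>2)) * (t powr (A - 1) * t powr (- \<beta> * (n + \<sigma>2))) * M2"
          using r by (simp add: wp[OF r(1) t(1)] mult_ac)
        also have "r powr 1 * r powr (- n) * r powr (n + \<sigma>2) = ?y" unfolding powr_add[symmetric] by (rule arg_cong[where f="\<lambda>e. r powr e"]) simp
        also have "t powr (A - 1) * t powr (- \<beta> * (n + \<sigma>2)) = t powr (A - 1 - \<beta> * (n + \<sigma>2))" unfolding powr_add[symmetric] by (rule arg_cong[where f="\<lambda>e. t powr e"]) (simp add: A_def algebra_simps)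
        also have "?y * t powr (A - 1 - \<beta> * (n + \<sigma>2)) * M2 \<le> ?y * s (A - 1 - \<beta> * (n + \<sigma>2)) * M2"
          using M ts by (intro mult_right_mono mult_left_mono) auto
        finally show ?thesis by (simp add: c2_def mult_ac)
      qed
      have B3: "\<bar>u r t powr m - u 0 t powr m\<bar> / r \<le> c3 * ?y"
      proof -
        have "w 0 t powr a = 0" by (simp add: w_def)
        then have "\<bar>u r t powr m - u 0 t powr m\<bar> = t powr (\<alpha> * m) * \<bar>F (w r t powr a) powr m - F 0 powr m\<bar>"
          by (simp add: um f_def abs_mult flip: right_diff_distrib)
        also have "\<dots> \<le> t powr (\<alpha> * m) * (C3 * w r t powr a)" by (intro mult_left_mono C3(2)) auto
        also have "\<dots> = (t powr (\<alpha> * m) * t powr (- \<beta> * a)) * C3 * r powr a" by (simp add: wp[OF r(1) t(1)] mult_ac)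
        also have "t powr (\<alpha> * m) * t powr (- \<beta> * a) = t powr (\<alpha> * m - \<beta> * a)" unfolding powr_add[symmetric] by (rule arg_cong[where f="\<lambda>e. t powr e"]) (simp add: A_def algebra_simps)
        also have "r powr a = ?y * r" using r powr_add[of r "\<sigma>2 + 1" 1] by (simp add: a_def add.commute)
        also have "t powr (\<alpha> * m - \<beta> * a) * C3 * (?y * r) \<le> s (\<alpha> * m - \<beta> * a) * C3 * (?y * r)"
          using C3(1) ts r by (intro mult_right_mono) auto
        finally show ?thesis using r by (simp add: c3_def pos_divide_le_eq mult_ac)
      qed
      show "\<bar>r * P r t\<bar> \<le> (c1 + c2 + c3) * ?y \<and> \<bar>r * Q r t\<bar> \<le> (c1 + c2 + c3) * ?y \<and>
          \<bar>u r t powr m - u 0 t powr m\<bar> / r \<le> (c1 + c2 + c3) * ?y"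
        using up[OF B1] up[OF B2] up[OF B3] c by simp
    qed
  qed
  from R.weak_solution show ?thesis by (simp add: u_def f_def w_def)
qed

end

section \<open>Time units, and uniqueness among weak solutions\<close>

context exponent_range
begin

text \<open>A change of the time unit acts on the profile as the scaling with A = c^(-\<alpha>) and
  \<Lambda> = c^(\<beta> a). As \<alpha> (m - p) = \<beta> a, it preserves \<mu> = 1/a^2, which is
  why the coefficient at the origin is the same for every c.\<close>

lemma scaled_form:
  assumes Pr: "profile (\<beta> / a) (1 / a\<^sup>2) x0 F E" and n: "n = real CARD('n::finite)" and c: "0 < c"
  defines "u \<equiv> \<lambda>(x::real^'n) t. t powr \<alpha> * F ((norm x * t powr (- \<beta>)) powr a)"
  shows "\<exists>f. self_similar_solution m p \<sigma>1 \<sigma>2 c f u \<and> (\<exists>D>0. origin_behavior CARD('n) m p \<sigma>2 D f) \<and>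
    (\<exists>\<xi>0>0. compactly_supported_at m \<xi>0 f)"
proof -
  define f where "f \<xi> = c powr (- \<alpha>) * F ((c powr \<beta> * \<xi>) powr a)" for \<xi>
  have "c powr (- \<alpha> * (m - p)) * c powr (\<beta> * a) = 1"
    using c exponents(3) by (simp flip: powr_add)
  then have "1 / a\<^sup>2 * (c powr (- \<alpha>)) powr (m - p) * c powr (\<beta> * a) = 1 / a\<^sup>2"
    unfolding powr_powr mult.assoc by simp
  then obtain \<epsilon> E' where P': "profile \<epsilon> (1 / a\<^sup>2) (x0 / c powr (\<beta> * a)) (\<lambda>x. c powr (- \<alpha>) * F (c powr (\<beta> * a) * x)) E'"
    using profile_scale[OF Pr, of "c powr (- \<alpha>)" "c powr (\<beta> * a)"] c by auto
  have f: "f \<xi> = c powr (- \<alpha>) * F (c powr (\<beta> * a) * \<xi> powr a)" if "0 < \<xi>" for \<xi>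
    using that by (simp add: f_def powr_mult powr_powr)
  have "forward_form \<alpha> \<beta> c f u"
    unfolding forward_form_def
  proof (intro allI impI)
    fix x :: "real^'n" and t :: real assume t: "0 < t"
    have w: "c powr \<beta> * (norm x * (c * t) powr (- \<beta>)) = norm x * t powr (- \<beta>)"
      using c t by (simp add: powr_mult powr_minus)
    have "(c * t) powr \<alpha> * c powr (- \<alpha>) = t powr \<alpha>" using c t by (simp add: powr_mult powr_minus)
    then show "u x t = (c * t) powr \<alpha> * f (norm x * (c * t) powr (- \<beta>))"
      unfolding u_def f_def w by (metis mult.assoc)
  qed
  moreover have "weak_solution m p \<sigma>1 \<sigma>2 u" unfolding u_def by (rule profile_weak_solution[OF Pr n])
  ultimately show ?thesis
    unfolding self_similar_solution_def using profile_origin[OF P' f n] by (auto simp: \<alpha>_def \<beta>_def)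
qed

text \<open>In time unit 1 the profile g of v and the given F solve the normalised equations with
  the same coefficients, so \<open>profile_unique\<close> identifies them.\<close>

lemma self_similar_unique:
  fixes v :: "real^'n::finite \<Rightarrow> real \<Rightarrow> real"
  assumes Pr: "profile (\<beta> / a) (1 / a\<^sup>2) x0 F E" and n: "n = real CARD('n)" and c: "0 < c"
    and v: "self_similar_solution m p \<sigma>1 \<sigma>2 c f v" and D: "0 < D" "origin_behavior CARD('n) m p \<sigma>2 D f"
    and \<xi>0: "0 < \<xi>0" "compactly_supported_at m \<xi>0 f" and t: "0 < t"
  shows "v x t = t powr \<alpha> * F ((norm x * t powr (- \<beta>)) powr a)"
proof -
  define g where "g \<xi> = c powr \<alpha> * f (c powr (- \<beta>) * \<xi>)" for \<xi>
  interpret S: self_similar_weak m p \<sigma>1 \<sigma>2 \<alpha> \<beta> n v g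
  proof
    show "weak_solution m p \<sigma>1 \<sigma>2 v" using v by (simp add: self_similar_solution_def)
    show "v x t = t powr \<alpha> * g (norm x * t powr (- \<beta>))" if "0 < t" for x t
      using v that c unfolding self_similar_solution_def forward_form_def \<alpha>_def[symmetric] \<beta>_def[symmetric]
      by (simp add: g_def powr_mult mult_ac)
    show "\<alpha> * m - 2 * \<beta> = \<alpha> + \<beta> * \<sigma>1 - 1" "\<alpha> * p + \<beta> * \<sigma>2 = \<alpha> + \<beta> * \<sigma>1 - 1"
      using exponents(3,4) by (simp_all add: a_def algebra_simps)
  qed (use n m_gt p_ge n\<sigma>2 \<sigma>12 in auto)
  have cg: "continuous_on {0..} g" by (rule S.profile_continuous_nonneg(1))
  have inv: "c powr (- e) * (c powr e * y) = y" for e y using c by (simp add: powr_minus)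
  have "f = (\<lambda>\<xi>. c powr (- \<alpha>) * g (c powr \<beta> * \<xi>))" by (simp only: g_def inv)
  moreover have "continuous_on {0..} (\<lambda>\<xi>. c powr (- \<alpha>) * g (c powr \<beta> * \<xi>))"
    by (intro continuous_on_mult continuous_on_const continuous_on_compose2[OF cg]) (auto intro!: continuous_intros)
  ultimately have "continuous_on {0..} f" by simp
  then have g0: "0 < g 0" using origin_positive[OF D(2,1)] c by (simp add: g_def)
  have "compactly_supported_at m (c powr \<beta> * \<xi>0) g"
    unfolding compactly_supported_at_def
  proof (intro conjI allI impI)
    fix \<xi> assume "0 < \<xi> \<and> \<xi> < c powr \<beta> * \<xi>0"
    then have "0 < c powr (- \<beta>) * \<xi>" "c powr (- \<beta>) * \<xi> < \<xi>0" using c by (simp_all add: powr_minus field_simps)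
    then show "0 < g \<xi>" using \<xi>0(2) c by (simp add: g_def compactly_supported_at_def)
  next
    fix \<xi> assume "c powr \<beta> * \<xi>0 \<le> \<xi>"
    then have "\<xi>0 \<le> c powr (- \<beta>) * \<xi>" using c by (simp add: powr_minus field_simps)
    then show "g \<xi> = 0" using \<xi>0(2) by (simp add: g_def compactly_supported_at_def)
  next
    have "((\<lambda>\<xi>. f \<xi> powr m) has_real_derivative 0) (at (c powr (- \<beta>) * (c powr \<beta> * \<xi>0)))"
      unfolding inv using \<xi>0(2) by (simp add: compactly_supported_at_def)
    from DERIV_chain2[where g="\<lambda>\<xi>. c powr (- \<beta>) * \<xi>", OF this DERIV_cmult[OF DERIV_ident]]
    have "DERIV (\<lambda>\<xi>. f (c powr (- \<beta>) * \<xi>) powr m) (c powr \<beta> * \<xi>0) :> 0" by simp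
    from DERIV_cmult[OF this, of "(c powr \<alpha>) powr m"]
    have d: "DERIV (\<lambda>\<xi>. (c powr \<alpha>) powr m * f (c powr (- \<beta>) * \<xi>) powr m) (c powr \<beta> * \<xi>0) :> 0" by simp
    show "DERIV (\<lambda>\<xi>. g \<xi> powr m) (c powr \<beta> * \<xi>0) :> 0"
    proof (rule has_field_derivative_transform_within_open[OF d, of "{0<..}"])
      show "(c powr \<alpha>) powr m * f (c powr (- \<beta>) * \<xi>) powr m = g \<xi> powr m" if "\<xi> \<in> {0<..}" for \<xi>
      proof -
        have "0 \<le> f (c powr (- \<beta>) * \<xi>)"
          using S.profile_continuous_nonneg(2)[of \<xi>] that c by (simp add: g_def zero_le_mult_iff)
        then show ?thesis by (simp add: g_def powr_mult)
      qed
    qed (use c \<xi>0 in auto)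
  qed
  moreover have "0 < c powr \<beta> * \<xi>0" using c \<xi>0 by simp
  ultimately obtain x1 E1 where "profile (\<beta> / a) (1 / a\<^sup>2) x1 (\<lambda>x. g (x powr (1 / a))) E1"
    using self_similar_profile[OF S.self_similar_weak_axioms g0] by blast
  from profile_unique[OF this Pr] have eq: "g (x powr (1 / a)) = F x" if "0 \<le> x" for x
    using that exponents(2) a_pos by simp
  have "g \<xi> = F (\<xi> powr a)" if "0 \<le> \<xi>" for \<xi>
    using eq[of "\<xi> powr a"] that a_pos by (simp add: powr_powr)
  then show ?thesis using S.form[OF t] by simp
qed

end

theorem theorem5p1:
  fixes m p \<sigma>1 \<sigma>2 :: real
  assumes "m > 1"
    and "-2 < \<sigma>2" and "\<sigma>2 < \<sigma>1"
    and "1 \<le> p" and "p < p_crit m \<sigma>1 \<sigma>2"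
    and "CARD('n::finite) = 1 \<Longrightarrow> \<sigma>1 \<ge> 0 \<and> \<sigma>2 > -1"
  shows "\<exists>u :: real^'n \<Rightarrow> real \<Rightarrow> real.
    (\<forall>c\<in>{1, (theta \<sigma>1)\<^sup>2}. \<exists>f.
        self_similar_solution m p \<sigma>1 \<sigma>2 c f u \<and>
        (\<exists>D>0. origin_behavior CARD('n) m p \<sigma>2 D f) \<and>
        (\<exists>\<xi>0>0. compactly_supported_at m \<xi>0 f)) \<and>
    (\<forall>c\<in>{1, (theta \<sigma>1)\<^sup>2}. \<forall>v f.
        self_similar_solution m p \<sigma>1 \<sigma>2 c f v \<and>
        (\<exists>D>0. origin_behavior CARD('n) m p \<sigma>2 D f) \<and>
        (\<exists>\<xi>0>0. compactly_supported_at m \<xi>0 f) \<longrightarrow>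
        (\<forall>x. \<forall>t>0. v x t = u x t))"
proof -
  interpret X: exponent_range m p \<sigma>1 \<sigma>2 "real CARD('n)"
  proof
    \<comment> \<open>Local integrability of |x|^\<sigma>2: in dimension at least 2 it follows from
      \<sigma>2 > -2, in dimension 1 from \<sigma>2 > -1.\<close>
    show "- real CARD('n) < \<sigma>2"
    proof (cases "CARD('n) = 1")
      case False
      then have "2 \<le> CARD('n)" using zero_less_card_finite[where 'a='n] by linarith
      then have "2 \<le> real CARD('n)" by simp
      then show ?thesis using assms(2) by linarith
    qed (use assms(6) in simp)
  qed (use assms in auto)
  have pos: "0 < c" if "c \<in> {1, (theta \<sigma>1)\<^sup>2}" for c
    using that assms(2,3) by (auto simp: theta_def)
  \<comment> \<open>One profile with the coefficients of time unit 1 determines u; both time units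
    describe this same u.\<close>
  obtain x0 F E where P: "X.profile (X.\<beta> / X.a) (1 / X.a\<^sup>2) x0 F E"
    by (rule X.profile_exists[of "X.\<beta> / X.a" "1 / X.a\<^sup>2"]) (use X.exponents(2) X.a_pos in auto)
  show ?thesis
  proof (intro exI[of _ "\<lambda>x t. t powr X.\<alpha> * F ((norm x * t powr (- X.\<beta>)) powr X.a)"] conjI ballI allI impI)
    fix c assume "c \<in> {1, (theta \<sigma>1)\<^sup>2}"
    then show "\<exists>f. self_similar_solution m p \<sigma>1 \<sigma>2 c f (\<lambda>(x::real^'n) t. t powr X.\<alpha> * F ((norm x * t powr (- X.\<beta>)) powr X.a)) \<and>
        (\<exists>D>0. origin_behavior CARD('n) m p \<sigma>2 D f) \<and> (\<exists>\<xi>0>0. compactly_supported_at m \<xi>0 f)"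
      by (intro X.scaled_form[OF P refl] pos)
  next
    fix c f and t :: real and v :: "real^'n \<Rightarrow> real \<Rightarrow> real" and x
    assume c: "c \<in> {1, (theta \<sigma>1)\<^sup>2}" and t: "0 < t" and v: "self_similar_solution m p \<sigma>1 \<sigma>2 c f v \<and>
        (\<exists>D>0. origin_behavior CARD('n) m p \<sigma>2 D f) \<and> (\<exists>\<xi>0>0. compactly_supported_at m \<xi>0 f)"
    then show "v x t = t powr X.\<alpha> * F ((norm x * t powr (- X.\<beta>)) powr X.a)"
      using X.self_similar_unique[OF P refl pos[OF c] _ _ _ _ _ t] by blast
  qed
qed

end
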